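(* Let $V(t):=e^{-\mathrm itK_0}(S+S^* )e^{\mathrm itK_0}$. There exist $\epsilon_0>0$ and $\mathtt M\in\mathbb N$ such that for every $W\in C^\infty(\mathbb T,\mathcal A_0)$ with $W(t)$ selfadjoint for every $t$ and $\sup_t\wp^0_{\mathtt M}(W(t))\le\epsilon_0$, the potential $V+W$ is a transporter: for every $r>0$ there exist a solution $\psi(t)\in\mathcal H^r$ of $\mathrm i\partial_t\psi=\big(\frac{-\partial_x^2+x^2}2+V(t)+W(t)\big)\psi$ and constants $C,T>0$ with $\|\psi(t)\|_r\ge C\langle t\rangle^r$ for all $t\ge T$.
   Context: $\mathcal H=L^2(\mathbb R)$; $K_0:=\frac12(-\partial_x^2+x^2)$, Hermite functions $\{\mathbf e_n\}_{n\ge1}$ with $K_0\mathbf e_n=(n-\frac12)\mathbf e_n$; $\mathcal H^r=D(K_0^r)$, $\|\psi\|_r=\|K_0^r\psi\|_{L^2}$. Shift: $S\mathbf e_n=\mathbf e_{n+1}$, $S^*\mathbf e_1=0$, $S^*\mathbf e_n=\mathbf e_{n-1}$ ($n\ge2$). $S^\rho_{\rm har}$: $f\in C^\infty(\mathbb R^2)$ with $|\partial_x^\alpha\partial_\xi^\beta f|\le C_{\alpha\beta}(1+x^2+\xi^2)^{\rho-\frac{\alpha+\beta}2}$, with seminorms $\wp^\rho_j(f)=\sum_{\alpha+\beta\le j}\sup|\partial_x^\alpha\partial_\xi^\beta f|(1+x^2+\xi^2)^{-\rho+\frac{\alpha+\beta}2}$. $\mathcal A_\rho$: operators $f(x,D)+S'$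 with $f\in S^\rho_{\rm har}$ (Weyl quantization) and $S'$ smoothing, a Fréchet space with seminorms $\wp^\rho_j$ induced by the symbol seminorms. $C^\infty(\mathbb T,\mathcal A_0)$: smooth $2\pi$-periodic maps. Transporter: for every $r>0$ some solution in $\mathcal H^r$ has unbounded $\|\cdot\|_r$-norm as $t\to\infty$. $\langle t\rangle=\sqrt{1+t^2}$. *)

theory Defs
  imports "HOL-Analysis.Analysis"
begin

section \<open>Hermite functions (indexed from 0: hfun n corresponds to the paper's e_(n+1))\<close>

fun hermite_poly :: "nat \<Rightarrow> real \<Rightarrow> real" where
  "hermite_poly 0 x = 1"
| "hermite_poly (Suc 0) x = 2 * x"
| "hermite_poly (Suc (Suc n)) x =
     2 * x * hermite_poly (Suc n) x - 2 * real (Suc n) * hermite_poly n x"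

definition hfun :: "nat \<Rightarrow> real \<Rightarrow> real" where
  "hfun n x = hermite_poly n x * exp (- (x^2) / 2) / sqrt (2 ^ n * fact n * sqrt pi)"

text \<open>Eigenvalue of K_0 on hfun n (paper: K_0 e_(n+1) = (n + 1/2) e_(n+1)).\<close>
definition K0_eig :: "nat \<Rightarrow> real" where
  "K0_eig n = real n + 1/2"

definition is_L2 :: "(real \<Rightarrow> complex) \<Rightarrow> bool" where
  "is_L2 f \<longleftrightarrow> f \<in> borel_measurable lborel \<and> integrable lborel (\<lambda>x. (cmod (f x))^2)"

text \<open>Coefficient <e_n, f> in L^2 (Hermite functions are real).\<close>
definition hcoef :: "(real \<Rightarrow> complex) \<Rightarrow> nat \<Rightarrow> complex" where
  "hcoef f n = (LINT x|lborel. complex_of_real (hfun n x) * f x)"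

text \<open>Membership in H^r = D(K_0^r), defined spectrally.\<close>
definition in_Hr :: "real \<Rightarrow> (real \<Rightarrow> complex) \<Rightarrow> bool" where
  "in_Hr r f \<longleftrightarrow> is_L2 f \<and> summable (\<lambda>n. (K0_eig n powr r)^2 * (cmod (hcoef f n))^2)"

definition Hr_norm :: "real \<Rightarrow> (real \<Rightarrow> complex) \<Rightarrow> real" where
  "Hr_norm r f = sqrt (\<Sum>n. (K0_eig n powr r)^2 * (cmod (hcoef f n))^2)"

section \<open>The potential V(t) = exp(-itK_0)(S+S^* )exp(itK_0): matrix elements <e_m, V(t) e_n>\<close>

definition SSadj_mat :: "nat \<Rightarrow> nat \<Rightarrow> complex" where
  "SSadj_mat m n = (if m = Suc n \<or> n = Suc m then 1 else 0)"

definition V_mat :: "real \<Rightarrow> nat \<Rightarrow> nat \<Rightarrow> complex" where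
  "V_mat t m n = cis (- t * K0_eig m) * SSadj_mat m n * cis (t * K0_eig n)"

type_synonym tsymbol = "real \<Rightarrow> real \<Rightarrow> real \<Rightarrow> complex"

definition Dt :: "tsymbol \<Rightarrow> tsymbol" where
  "Dt f = (\<lambda>t x \<xi>. vector_derivative (\<lambda>s. f s x \<xi>) (at t))"
definition Dx :: "tsymbol \<Rightarrow> tsymbol" where
  "Dx f = (\<lambda>t x \<xi>. vector_derivative (\<lambda>y. f t y \<xi>) (at x))"
definition Dxi :: "tsymbol \<Rightarrow> tsymbol" where
  "Dxi f = (\<lambda>t x \<xi>. vector_derivative (\<lambda>\<eta>. f t x \<eta>) (at \<xi>))"

definition pd :: "nat \<Rightarrow> nat \<Rightarrow> nat \<Rightarrow> tsymbol \<Rightarrow> tsymbol" where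
  "pd k a b f = (Dt ^^ k) ((Dx ^^ a) ((Dxi ^^ b) f))"

definition smooth3 :: "tsymbol \<Rightarrow> bool" where
  "smooth3 f \<longleftrightarrow> (\<forall>k a b.
      continuous_on UNIV (\<lambda>(t, x, \<xi>). pd k a b f t x \<xi>) \<and>
      (\<forall>t x \<xi>.
         ((\<lambda>s. pd k a b f s x \<xi>) has_vector_derivative pd (Suc k) a b f t x \<xi>) (at t) \<and>
         ((\<lambda>y. pd k a b f t y \<xi>) has_vector_derivative pd k (Suc a) b f t x \<xi>) (at x) \<and>
         ((\<lambda>\<eta>. pd k a b f t x \<eta>) has_vector_derivative pd k a (Suc b) f t x \<xi>) (at \<xi>)))"

definition smooth_periodic_S0 :: "tsymbol \<Rightarrow> bool" where
  "smooth_periodic_S0 w \<longleftrightarrow> smooth3 w \<and>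
     (\<forall>t x \<xi>. w (t + 2 * pi) x \<xi> = w t x \<xi>) \<and>
     (\<forall>k a b. \<exists>C. \<forall>t x \<xi>.
        cmod (pd k a b w t x \<xi>) \<le> C * (1 + x^2 + \<xi>^2) powr (- real (a + b) / 2))"

definition wp0 :: "nat \<Rightarrow> tsymbol \<Rightarrow> real \<Rightarrow> real" where
  "wp0 j w t = (\<Sum>(a, b) \<in> {(a, b). a + b \<le> j}.
      (SUP z :: real \<times> real. cmod (pd 0 a b w t (fst z) (snd z)) *
           (1 + (fst z)^2 + (snd z)^2) powr (real (a + b) / 2)))"

section \<open>Weyl quantization: matrix elements <e_m, f^w(x,D) e_n>\<close>

text \<open>Cross-Wigner function; <v, f^w u> = integral of f times this over R^2.\<close>
definition wigner :: "nat \<Rightarrow> nat \<Rightarrow> real \<Rightarrow> real \<Rightarrow> complex" where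
  "wigner m n x \<xi> = (1 / (2 * pi)) *
     (LINT y|lborel. complex_of_real (hfun m (x + y / 2) * hfun n (x - y / 2)) * cis (y * \<xi>))"

definition weyl_mat :: "(real \<Rightarrow> real \<Rightarrow> complex) \<Rightarrow> nat \<Rightarrow> nat \<Rightarrow> complex" where
  "weyl_mat f m n = (LINT z|lborel. f (fst z) (snd z) * wigner m n (fst z) (snd z))"

definition selfadjoint_mat :: "(nat \<Rightarrow> nat \<Rightarrow> complex) \<Rightarrow> bool" where
  "selfadjoint_mat A \<longleftrightarrow> (\<forall>m n. A n m = cnj (A m n))"

text \<open>psi(t) in H^r for all t, psi continuous into L^2, and the equation holds tested
  against every Hermite function (weak formulation).\<close>
definition is_solution :: "tsymbol \<Rightarrow> real \<Rightarrow> (real \<Rightarrow> real \<Rightarrow> complex) \<Rightarrow> bool" where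
  "is_solution w r \<psi> \<longleftrightarrow>
     (\<forall>t. in_Hr r (\<psi> t)) \<and>
     (\<forall>t. ((\<lambda>s. LINT x|lborel. (cmod (\<psi> s x - \<psi> t x))^2) \<longlongrightarrow> 0) (at t)) \<and>
     (\<forall>n t. ((\<lambda>s. hcoef (\<psi> s) n) has_vector_derivative
        (- \<i>) * (complex_of_real (K0_eig n) * hcoef (\<psi> t) n +
                 (\<Sum>m. (V_mat t n m + weyl_mat (w t) n m) * hcoef (\<psi> t) m))) (at t))"

end

theory Submission
  imports Defs "HOL-Probability.Characteristic_Functions" "HOL-Probability.Sinc_Integral"
begin

text \<open>In the rotating frame \<open>\<phi>\<^sub>n = e\<^bsup>it(n+1/2)\<^esup> u\<^sub>n\<close> the equation becomes \<open>i\<phi>' = (H + A(t))\<phi>\<close>, where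
  \<open>H = S + S\<^sup>*\<close> is the hopping operator on the half line and \<open>A\<close> is small, \<open>2\<pi>\<close>-periodic and Hermitian.
  Let \<open>Y = -2 Im \<langle>\<phi>, \<Gamma>\<phi>\<rangle>\<close> for the weighted shift \<open>\<Gamma>\<close>. It grows at the rate \<open>Q = \<langle>\<phi>, (4 - H\<^sup>2)\<phi>\<rangle> \<ge> 0\<close>
  up to a small error, so growth can only stall while \<open>\<phi>\<close> sits near the spectral edges \<open>\<plusminus>2\<close>. There the phases
  \<open>e\<^bsup>\<mp>2it\<^esup>\<close> return after one period, which would make \<open>\<phi>(t + 2\<pi>) - \<phi>(t)\<close> small. But
  \<open>\<phi>(t + 2\<pi>) + \<phi>(t)\<close> is again a solution, hence of constant norm, and this norm is small for a wave packet
  of energy near \<open>1/2\<close>, since \<open>e\<^bsup>-2\<pi>i/2\<^esup> = -1\<close>. Thus \<open>Y\<close> increases by a fixed amount over each period;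
  combined with the ballistic upper bound on the second moment, interpolation gives growth of every \<open>r\<close>-norm.

  The matrix hypotheses on \<open>A\<close> come from the ladder relations of the cross-Wigner functions: multiplication of a
  Weyl matrix by \<open>m - n\<close> is the angular derivative of the symbol, and the weighted commutator with the shift is
  again a matrix of a symbol of order zero. Uniform boundedness of the matrix elements follows by comparing the
  Weyl quantization with its Gaussian smoothing.\<close>

text \<open>The obstacle is the spectral edges: \<open>4 - H\<^sup>2\<close> degenerates there, and
  an energy cutoff would not survive the evolution, since \<open>A\<close> depends on time and need
  not commute with functions of \<open>H\<close>. The conserved norm of
  \<open>\<phi>(t + 2\<pi>) + \<phi>(t)\<close> replaces such a cutoff and any spectral calculus: it
  has to be estimated over the first period only, by comparison with
  \<open>exp(-it/2) \<phi>(0)\<close>. \<open>\<Gamma>\<close> is unbounded, so small entries of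
  \<open>A\<close> do not suffice; its commutator with \<open>\<Gamma>\<close> must be small too.
  That commutator compares neighbouring entries of \<open>A\<close> with weights of the size of the
  index, which only the symbol controls: a derivative lowers the order by one and the weight raises
  it again. Rapidly decreasing sequences carry the argument because \<open>\<Gamma>\<close>,
  \<open>H\<close> and \<open>A\<close> preserve them; the initial packet has finite support and the
  Dyson series stays in the class. A lower bound on \<open>Y\<close> gives one on the first moment
  of \<open>|\<phi>\<^sub>n|\<^sup>2\<close>. Alone it could come from little mass very far out and
  say nothing for small \<open>r\<close>; the second moment excludes this.\<close>

declare of_nat_Suc [simp del]

section \<open>Rapidly decreasing sequences\<close>

text \<open>The index set makes the constants uniform: a compact time interval for paths, a
  singleton for one sequence. Each closure property is then proved once for both.\<close>

definition rapid_on :: "'a set \<Rightarrow> ('a \<Rightarrow> nat \<Rightarrow> complex) \<Rightarrow> bool" where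
  "rapid_on S f \<longleftrightarrow> (\<forall>p. \<exists>C. \<forall>x\<in>S. \<forall>n. cmod (f x n) \<le> C / real (Suc n) ^ p)"

definition rapid :: "(nat \<Rightarrow> complex) \<Rightarrow> bool" where
  "rapid u \<longleftrightarrow> (\<forall>p. \<exists>C. \<forall>n. cmod (u n) \<le> C / real (Suc n) ^ p)"

definition rapid_path :: "(real \<Rightarrow> nat \<Rightarrow> complex) \<Rightarrow> bool" where
  "rapid_path f \<longleftrightarrow> (\<forall>T. rapid_on {-T..T} f)"

definition ip :: "(nat \<Rightarrow> complex) \<Rightarrow> (nat \<Rightarrow> complex) \<Rightarrow> complex" where
  "ip u v = (\<Sum>n. cnj (u n) * v n)"

definition nsq :: "(nat \<Rightarrow> complex) \<Rightarrow> real" where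
  "nsq u = (\<Sum>n. (cmod (u n))\<^sup>2)"

definition nrm :: "(nat \<Rightarrow> complex) \<Rightarrow> real" where
  "nrm u = sqrt (nsq u)"

lemma rapid_onD: "rapid_on S f \<Longrightarrow> x \<in> S \<Longrightarrow> rapid (f x)"
  unfolding rapid_on_def rapid_def by blast

lemma rapid_pathD: "rapid_path f \<Longrightarrow> rapid (f t)"
  unfolding rapid_path_def by (rule rapid_onD[where S = "{-\<bar>t\<bar>..\<bar>t\<bar>}"]) auto

lemma rapid_on_const: "rapid u \<Longrightarrow> rapid_on S (\<lambda>_. u)"
  unfolding rapid_on_def rapid_def by blast

lemma rapid_path_const: "rapid u \<Longrightarrow> rapid_path (\<lambda>_. u)"
  unfolding rapid_path_def by (simp add: rapid_on_const)

lemma rapid_iff_rapid_on: "rapid u \<longleftrightarrow> rapid_on (UNIV :: unit set) (\<lambda>_. u)"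
  unfolding rapid_on_def rapid_def by simp

lemma rapid_on_bound:
  assumes "rapid_on S f"
  obtains C where "C > 0" "\<And>x n. x \<in> S \<Longrightarrow> cmod (f x n) \<le> C / real (Suc n) ^ p"
proof -
  obtain C where C: "\<forall>x\<in>S. \<forall>n. cmod (f x n) \<le> C / real (Suc n) ^ p"
    using assms unfolding rapid_on_def by blast
  show ?thesis
  proof (rule that[of "\<bar>C\<bar> + 1"])
    fix x n assume "x \<in> S"
    then have "cmod (f x n) \<le> C / real (Suc n) ^ p" using C by blast
    also have "\<dots> \<le> (\<bar>C\<bar> + 1) / real (Suc n) ^ p" by (rule divide_right_mono) auto
    finally show "cmod (f x n) \<le> (\<bar>C\<bar> + 1) / real (Suc n) ^ p" .
  qed auto
qed

text \<open>A weight of polynomial growth costs only \<open>j\<close> of the arbitrarily many powers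
  at hand.\<close>

lemma rapid_on_dominated:
  assumes f: "rapid_on S f"
    and g: "\<And>x n. x \<in> S \<Longrightarrow> cmod (g x n) \<le> K * real (Suc n) ^ j * cmod (f x n)" and K: "K \<ge> 0"
  shows "rapid_on S g"
  unfolding rapid_on_def
proof
  fix p
  obtain C where C: "C > 0" "\<And>x n. x \<in> S \<Longrightarrow> cmod (f x n) \<le> C / real (Suc n) ^ (p + j)"
    using rapid_on_bound[OF f] by blast
  show "\<exists>C. \<forall>x\<in>S. \<forall>n. cmod (g x n) \<le> C / real (Suc n) ^ p"
  proof (intro exI ballI allI)
    fix x n assume x: "x \<in> S"
    have "cmod (g x n) \<le> K * real (Suc n) ^ j * (C / real (Suc n) ^ (p + j))"
      using g[OF x, of n] C(2)[OF x, of n] K by (meson mult_left_mono mult_nonneg_nonneg of_nat_0_le_iff order_trans zero_le_power)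
    also have "\<dots> = K * C / real (Suc n) ^ p" by (simp add: power_add)
    finally show "cmod (g x n) \<le> K * C / real (Suc n) ^ p" .
  qed
qed

lemma rapid_on_add:
  assumes "rapid_on S f" "rapid_on S g"
  shows "rapid_on S (\<lambda>x n. f x n + g x n)"
  unfolding rapid_on_def
proof
  fix p
  obtain C where C: "C > 0" "\<And>x n. x \<in> S \<Longrightarrow> cmod (f x n) \<le> C / real (Suc n) ^ p"
    using rapid_on_bound[OF assms(1)] by blast
  obtain D where D: "D > 0" "\<And>x n. x \<in> S \<Longrightarrow> cmod (g x n) \<le> D / real (Suc n) ^ p"
    using rapid_on_bound[OF assms(2)] by blast
  show "\<exists>C. \<forall>x\<in>S. \<forall>n. cmod (f x n + g x n) \<le> C / real (Suc n) ^ p"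
    by (intro exI[of _ "C + D"] ballI allI)
       (auto simp: add_divide_distrib intro!: order_trans[OF norm_triangle_ineq] add_mono C(2) D(2))
qed

lemma rapid_on_scale:
  assumes "rapid_on S f" and "\<And>x. x \<in> S \<Longrightarrow> cmod (c x) \<le> K"
  shows "rapid_on S (\<lambda>x n. c x * f x n)"
  by (rule rapid_on_dominated[OF assms(1), where K = "\<bar>K\<bar>" and j = 0])
     (auto simp: norm_mult intro!: mult_right_mono dest: assms(2))

lemma rapid_on_Suc:
  assumes "rapid_on S f" shows "rapid_on S (\<lambda>x n. f x (Suc n))"
  unfolding rapid_on_def
proof
  fix p
  obtain C where C: "C > 0" "\<And>x n. x \<in> S \<Longrightarrow> cmod (f x n) \<le> C / real (Suc n) ^ p"
    using rapid_on_bound[OF assms(1)] by blast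
  show "\<exists>C. \<forall>x\<in>S. \<forall>n. cmod (f x (Suc n)) \<le> C / real (Suc n) ^ p"
  proof (intro exI[of _ C] ballI allI)
    fix x n assume "x \<in> S"
    then have "cmod (f x (Suc n)) \<le> C / real (Suc (Suc n)) ^ p" using C by blast
    also have "\<dots> \<le> C / real (Suc n) ^ p"
      using C(1) by (intro divide_left_mono power_mono) auto
    finally show "cmod (f x (Suc n)) \<le> C / real (Suc n) ^ p" .
  qed
qed

lemma rapid_on_pred:
  assumes "rapid_on S f" shows "rapid_on S (\<lambda>x n. if n = 0 then 0 else f x (n - 1))"
  unfolding rapid_on_def
proof
  fix p
  obtain C where C: "C > 0" "\<And>x n. x \<in> S \<Longrightarrow> cmod (f x n) \<le> C / real (Suc n) ^ p"
    using rapid_on_bound[OF assms(1)] by blast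
  show "\<exists>C. \<forall>x\<in>S. \<forall>n. cmod (if n = 0 then 0 else f x (n - 1)) \<le> C / real (Suc n) ^ p"
  proof (intro exI[of _ "C * 2 ^ p"] ballI allI)
    fix x n assume x: "x \<in> S"
    show "cmod (if n = 0 then 0 else f x (n - 1)) \<le> C * 2 ^ p / real (Suc n) ^ p"
    proof (cases n)
      case 0 then show ?thesis using C(1) by simp
    next
      case (Suc m)
      have "cmod (f x m) \<le> C / real (Suc m) ^ p" using C x by blast
      also have "\<dots> = C * 2 ^ p / (2 * real (Suc m)) ^ p" by (simp add: power_mult_distrib)
      also have "\<dots> \<le> C * 2 ^ p / real (Suc n) ^ p"
        using C(1) Suc by (intro divide_left_mono power_mono) (auto simp: of_nat_Suc)
      finally show ?thesis using Suc by simp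
    qed
  qed
qed

lemma rapid_add: "rapid u \<Longrightarrow> rapid v \<Longrightarrow> rapid (\<lambda>n. u n + v n)"
  unfolding rapid_iff_rapid_on by (rule rapid_on_add)

lemma rapid_scale: "rapid u \<Longrightarrow> rapid (\<lambda>n. c * u n)"
  unfolding rapid_iff_rapid_on by (rule rapid_on_scale[where K = "cmod c"]) auto

lemma rapid_diff: "rapid u \<Longrightarrow> rapid v \<Longrightarrow> rapid (\<lambda>n. u n - v n)"
  using rapid_add[of u "\<lambda>n. (-1) * v n"] rapid_scale[of v "-1"] by simp

lemma rapid_finite_support:
  assumes "\<And>n. n \<ge> L \<Longrightarrow> u n = 0" shows "rapid u"
  unfolding rapid_def
proof
  fix p
  show "\<exists>C. \<forall>n. cmod (u n) \<le> C / real (Suc n) ^ p"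
  proof (intro exI allI)
    fix n
    have "cmod (u n) * real (Suc n) ^ p \<le> (\<Sum>k<L. cmod (u k) * real (Suc k) ^ p)"
    proof (cases "n < L")
      case True
      then show ?thesis by (intro member_le_sum) auto
    next
      case False
      then show ?thesis using assms[of n] by (auto intro: sum_nonneg)
    qed
    then show "cmod (u n) \<le> (\<Sum>k<L. cmod (u k) * real (Suc k) ^ p) / real (Suc n) ^ p"
      by (subst pos_le_divide_eq) auto
  qed
qed

lemma rapid_path_add: "rapid_path f \<Longrightarrow> rapid_path g \<Longrightarrow> rapid_path (\<lambda>t n. f t n + g t n)"
  unfolding rapid_path_def by (simp add: rapid_on_add)

lemma rapid_path_scale:
  assumes "rapid_path f" "continuous_on UNIV c" shows "rapid_path (\<lambda>t n. c t * f t n)"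
  unfolding rapid_path_def
proof
  fix T :: real
  have "compact (c ` {-T..T})"
    by (intro compact_continuous_image) (auto intro: continuous_on_subset[OF assms(2)])
  then obtain K where "\<forall>y\<in>c ` {-T..T}. norm y \<le> K"
    using compact_imp_bounded bounded_iff by metis
  then show "rapid_on {- T..T} (\<lambda>t n. c t * f t n)"
    using assms(1) unfolding rapid_path_def by (intro rapid_on_scale[where K = K]) auto
qed

lemma rapid_path_cmult: "rapid_path f \<Longrightarrow> rapid_path (\<lambda>t n. c * f t n)"
  by (rule rapid_path_scale) auto

lemma rapid_path_diff: "rapid_path f \<Longrightarrow> rapid_path g \<Longrightarrow> rapid_path (\<lambda>t n. f t n - g t n)"
  using rapid_path_add[of f "\<lambda>t n. (-1) * g t n"] rapid_path_cmult[of g "-1"] by simp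

lemma rapid_path_shift:
  assumes "rapid_path f" shows "rapid_path (\<lambda>t. f (t + a))"
  unfolding rapid_path_def rapid_on_def
proof (intro allI)
  fix T :: real and p
  obtain C where C: "\<forall>x\<in>{-(\<bar>T\<bar>+\<bar>a\<bar>)..\<bar>T\<bar>+\<bar>a\<bar>}. \<forall>n. cmod (f x n) \<le> C / real (Suc n) ^ p"
    using assms unfolding rapid_path_def rapid_on_def by blast
  show "\<exists>C. \<forall>x\<in>{- T..T}. \<forall>n. cmod (f (x + a) n) \<le> C / real (Suc n) ^ p"
  proof (intro exI[of _ C] ballI allI)
    fix x n assume "x \<in> {-T..T}"
    then have "x + a \<in> {-(\<bar>T\<bar>+\<bar>a\<bar>)..\<bar>T\<bar>+\<bar>a\<bar>}" by auto
    then show "cmod (f (x + a) n) \<le> C / real (Suc n) ^ p" using C by blast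
  qed
qed

section \<open>Summability, inner product and norm\<close>

lemma summable_inverse_Suc_sq: "summable (\<lambda>n. C / real (Suc n) ^ 2)"
proof -
  have "summable (\<lambda>n. C * (1 / real (Suc n) ^ 2))"
    using inverse_squares_sums by (intro summable_mult) (auto simp: sums_iff)
  then show ?thesis by simp
qed

lemma rapid_on_product_bound:
  assumes f: "rapid_on S f" and g: "rapid_on S g"
  obtains M where "summable M" "\<And>x n. x \<in> S \<Longrightarrow> cmod (cnj (f x n) * g x n) \<le> M n"
proof -
  obtain C where C: "C > 0" "\<And>x n. x \<in> S \<Longrightarrow> cmod (f x n) \<le> C / real (Suc n) ^ 1"
    using rapid_on_bound[OF f] by blast
  obtain D where D: "D > 0" "\<And>x n. x \<in> S \<Longrightarrow> cmod (g x n) \<le> D / real (Suc n) ^ 1"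
    using rapid_on_bound[OF g] by blast
  show ?thesis
  proof (rule that[OF summable_inverse_Suc_sq[of "C * D"]])
    fix x n assume "x \<in> S"
    then have "cmod (f x n) * cmod (g x n) \<le> (C / real (Suc n) ^ 1) * (D / real (Suc n) ^ 1)"
      using C D by (intro mult_mono) auto
    then show "cmod (cnj (f x n) * g x n) \<le> C * D / real (Suc n) ^ 2"
      by (simp add: norm_mult power2_eq_square)
  qed
qed

lemma rapid_summable_norm:
  assumes "rapid u" shows "summable (\<lambda>n. cmod (u n))"
proof -
  obtain C where C: "\<And>n. cmod (u n) \<le> C / real (Suc n) ^ 2"
    using assms unfolding rapid_def by blast
  show ?thesis
    by (rule summable_comparison_test'[OF summable_inverse_Suc_sq[of C], of 0]) (use C in auto)
qed

lemma rapid_summable_ip_norm: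
  assumes "rapid u" "rapid v" shows "summable (\<lambda>n. cmod (cnj (u n) * v n))"
proof -
  obtain M where M: "summable M" "\<And>x n. x \<in> (UNIV :: unit set) \<Longrightarrow> cmod (cnj (u n) * v n) \<le> M n"
    using rapid_on_product_bound[of "UNIV :: unit set" "\<lambda>_. u" "\<lambda>_. v"] assms
    unfolding rapid_iff_rapid_on by blast
  show ?thesis by (rule summable_comparison_test'[OF M(1), of 0]) (use M(2) in simp)
qed

lemma rapid_summable_ip:
  assumes "rapid u" "rapid v" shows "summable (\<lambda>n. cnj (u n) * v n)"
  using rapid_summable_ip_norm[OF assms] by (rule summable_norm_cancel)

lemma rapid_summable_sq: "rapid u \<Longrightarrow> summable (\<lambda>n. (cmod (u n))\<^sup>2)"
  using rapid_summable_ip_norm[of u u] by (simp add: norm_mult power2_eq_square)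

lemma ip_sums: "rapid u \<Longrightarrow> rapid v \<Longrightarrow> (\<lambda>n. cnj (u n) * v n) sums ip u v"
  unfolding ip_def by (rule summable_sums[OF rapid_summable_ip])

lemma nsq_sums: "rapid u \<Longrightarrow> (\<lambda>n. (cmod (u n))\<^sup>2) sums nsq u"
  unfolding nsq_def by (rule summable_sums[OF rapid_summable_sq])

lemma ip_self:
  assumes "rapid u" shows "ip u u = complex_of_real (nsq u)"
proof -
  have "(\<lambda>n. complex_of_real ((cmod (u n))\<^sup>2)) sums complex_of_real (nsq u)"
    unfolding sums_of_real_iff by (rule nsq_sums[OF assms])
  moreover have "(\<lambda>n. complex_of_real ((cmod (u n))\<^sup>2)) = (\<lambda>n. cnj (u n) * u n)"
    by (rule ext) (metis complex_norm_square mult.commute)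
  ultimately show ?thesis using sums_unique2[OF ip_sums[OF assms assms]] by simp
qed

lemma ip_add_right:
  assumes "rapid u" "rapid v" "rapid w" shows "ip u (\<lambda>n. v n + w n) = ip u v + ip u w"
  using sums_add[OF ip_sums[OF assms(1,2)] ip_sums[OF assms(1,3)]]
  unfolding ip_def[of u "\<lambda>n. v n + w n"] distrib_left by (simp add: sums_iff)

lemma ip_diff_right:
  assumes "rapid u" "rapid v" "rapid w" shows "ip u (\<lambda>n. v n - w n) = ip u v - ip u w"
  using sums_diff[OF ip_sums[OF assms(1,2)] ip_sums[OF assms(1,3)]]
  unfolding ip_def[of u "\<lambda>n. v n - w n"] right_diff_distrib by (simp add: sums_iff)

lemma ip_cmult_right:
  assumes "rapid u" "rapid v" shows "ip u (\<lambda>n. c * v n) = c * ip u v"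
  using sums_mult[OF ip_sums[OF assms], of c]
  unfolding ip_def[of u "\<lambda>n. c * v n"] mult.left_commute[of c] by (simp add: sums_iff)

lemma ip_cnj:
  assumes "rapid u" "rapid v" shows "cnj (ip u v) = ip v u"
proof -
  have "(\<lambda>n. cnj (cnj (u n) * v n)) sums cnj (ip u v)"
    unfolding sums_cnj by (rule ip_sums[OF assms])
  then show ?thesis unfolding ip_def[of v u] by (simp add: sums_iff mult.commute)
qed

lemma ip_cmult_left:
  assumes "rapid u" "rapid v" shows "ip (\<lambda>n. c * u n) v = cnj c * ip u v"
  using sums_mult[OF ip_sums[OF assms], of "cnj c"]
  unfolding ip_def[of "\<lambda>n. c * u n" v] by (simp add: sums_iff mult.assoc)

lemma ip_add_left:
  assumes "rapid u" "rapid v" "rapid w" shows "ip (\<lambda>n. u n + v n) w = ip u w + ip v w"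
  using sums_add[OF ip_sums[OF assms(1,3)] ip_sums[OF assms(2,3)]]
  unfolding ip_def[of "\<lambda>n. u n + v n" w] by (simp add: sums_iff distrib_right)

lemma nsq_nonneg: "rapid u \<Longrightarrow> nsq u \<ge> 0"
  unfolding nsq_def by (intro suminf_nonneg rapid_summable_sq) auto

lemma nrm_nonneg: "rapid u \<Longrightarrow> nrm u \<ge> 0"
  unfolding nrm_def using nsq_nonneg by auto

lemma nrm_sq: "rapid u \<Longrightarrow> (nrm u)\<^sup>2 = nsq u"
  unfolding nrm_def using nsq_nonneg by auto

text \<open>Turns a family of weighted arithmetic-geometric estimates into a product bound. For
  positive \<open>a\<close>, \<open>b\<close> the best parameter balances the two terms; if one of
  them vanishes, letting \<open>s\<close> tend to 0 or infinity forces \<open>x\<close> to be at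
  most 0. Serves both Cauchy-Schwarz and the Schur test.\<close>

lemma optimise_weighted_sum:
  fixes a b c x :: real
  assumes H: "\<And>s. s > 0 \<Longrightarrow> x \<le> c * (s * a + b / s)" and "a \<ge> 0" "b \<ge> 0" "c \<ge> 0"
  shows "x \<le> 2 * c * (sqrt a * sqrt b)"
proof (cases "a > 0 \<and> b > 0")
  case True
  define s where "s = sqrt b / sqrt a"
  have s: "s > 0" using True by (simp add: s_def)
  obtain p q where pq: "a = p * p" "b = q * q" "p > 0" "q > 0"
    using that[of "sqrt a" "sqrt b"] True by simp
  have "s * a = sqrt a * sqrt b" "b / s = sqrt a * sqrt b"
    using pq by (simp_all add: s_def)
  with H[OF s] show ?thesis by simp
next
  case False
  have "x \<le> 0 + e" if e: "e > 0" for e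
  proof -
    consider "a = 0" | "b = 0" using False assms by force
    then show ?thesis
    proof cases
      case 1
      \<comment> \<open>With \<open>a = 0\<close> a large \<open>s\<close> is good: this choice
        makes the bound \<open>e\<close> times a number below 1. The other case uses a small
        \<open>s\<close> in the same way.\<close>
      have "x \<le> c * (b / ((c * b + 1) / e))" using H[of "(c * b + 1) / e"] 1 assms e
        by (simp add: add_nonneg_pos)
      also have "\<dots> = e * (c * b / (c * b + 1))" by simp
      also have "\<dots> \<le> e * 1" using assms e
        by (intro mult_left_mono) (auto simp: divide_le_eq_1 add_nonneg_pos)
      finally show ?thesis by simp
    next
      case 2
      have p: "e / (c * a + 1) > 0" using assms e by (simp add: add_nonneg_pos)
      have "x \<le> c * (e / (c * a + 1) * a)" using H[OF p] 2 by simp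
      also have "\<dots> = e * (c * a / (c * a + 1))" by simp
      also have "\<dots> \<le> e * 1" using assms e
        by (intro mult_left_mono) (auto simp: divide_le_eq_1 add_nonneg_pos)
      finally show ?thesis by simp
    qed
  qed
  then have "x \<le> 0" by (rule field_le_epsilon)
  then show ?thesis using assms by (smt (verit) mult_nonneg_nonneg real_sqrt_ge_zero)
qed

lemma ip_Cauchy_Schwarz:
  assumes u: "rapid u" and v: "rapid v" shows "cmod (ip u v) \<le> nrm u * nrm v"
proof -
  have "cmod (ip u v) \<le> (1/2) * (s * nsq u + nsq v / s)" if s: "s > 0" for s
  proof -
    have "cmod (ip u v) \<le> (\<Sum>n. cmod (cnj (u n) * v n))"
      unfolding ip_def by (rule summable_norm[OF rapid_summable_ip_norm[OF u v]])
    also have "\<dots> \<le> (\<Sum>n. (1/2) * (s * (cmod (u n))\<^sup>2 + (cmod (v n))\<^sup>2 / s))"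
    proof (rule suminf_le[OF _ rapid_summable_ip_norm[OF u v]])
      show "cmod (cnj (u n) * v n) \<le> (1/2) * (s * (cmod (u n))\<^sup>2 + (cmod (v n))\<^sup>2 / s)" for n
      proof -
        have "0 \<le> (s * cmod (u n) - cmod (v n))\<^sup>2 / s" using s by simp
        also have "\<dots> = s * (cmod (u n))\<^sup>2 + (cmod (v n))\<^sup>2 / s - 2 * cmod (u n) * cmod (v n)"
          using s by (simp add: field_simps power2_eq_square)
        finally show ?thesis by (simp add: norm_mult)
      qed
      show "summable (\<lambda>n. (1/2) * (s * (cmod (u n))\<^sup>2 + (cmod (v n))\<^sup>2 / s))"
        by (intro summable_mult summable_add summable_divide rapid_summable_sq u v)
    qed
    also have "\<dots> = (1/2) * (s * nsq u + nsq v / s)"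
      by (rule sums_unique[symmetric], intro sums_mult sums_add sums_divide nsq_sums u v)
    finally show ?thesis .
  qed
  from optimise_weighted_sum[OF this nsq_nonneg[OF u] nsq_nonneg[OF v]] show ?thesis
    by (simp add: nrm_def)
qed

lemma nrm_triangle:
  assumes u: "rapid u" and v: "rapid v" shows "nrm (\<lambda>n. u n + v n) \<le> nrm u + nrm v"
proof -
  let ?w = "\<lambda>n. u n + v n"
  have w: "rapid ?w" using u v by (rule rapid_add)
  have "complex_of_real (nsq ?w) = ip u u + ip u v + (ip v u + ip v v)"
    using ip_self[OF w] by (simp add: ip_add_left ip_add_right u v w)
  then have "nsq ?w = Re (ip u u + ip u v + (ip v u + ip v v))" by (metis Re_complex_of_real)
  also have "\<dots> = nsq u + nsq v + Re (ip u v) + Re (ip v u)"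
    using ip_self[OF u] ip_self[OF v] by simp
  also have "\<dots> \<le> nsq u + nsq v + nrm u * nrm v + nrm v * nrm u"
    using ip_Cauchy_Schwarz[OF u v] ip_Cauchy_Schwarz[OF v u] complex_Re_le_cmod[of "ip u v"]
      complex_Re_le_cmod[of "ip v u"] by linarith
  also have "\<dots> = (nrm u + nrm v)\<^sup>2" by (simp add: nrm_sq[OF u, symmetric] nrm_sq[OF v, symmetric] power2_eq_square algebra_simps)
  finally show ?thesis
    unfolding nrm_def[of ?w] using nrm_nonneg[OF u] nrm_nonneg[OF v] by (simp add: real_le_lsqrt)
qed

lemma nrm_cmult:
  assumes "rapid u" shows "nrm (\<lambda>n. c * u n) = cmod c * nrm u"
proof -
  have "nsq (\<lambda>n. c * u n) = (cmod c)\<^sup>2 * nsq u"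
    unfolding nsq_def[of "\<lambda>n. c * u n"] norm_mult power_mult_distrib
    by (rule sums_unique[symmetric], intro sums_mult nsq_sums assms)
  then show ?thesis unfolding nrm_def by (simp add: real_sqrt_mult)
qed

section \<open>Termwise differentiation\<close>

lemma has_vector_derivative_suminf:
  fixes f :: "nat \<Rightarrow> real \<Rightarrow> complex"
  assumes d: "\<And>n t. (f n has_vector_derivative f' n t) (at t)"
    and s: "\<And>t. summable (\<lambda>n. f n t)"
    and b: "\<And>T. \<exists>M. summable M \<and> (\<forall>n t. \<bar>t\<bar> \<le> T \<longrightarrow> cmod (f' n t) \<le> M n)"
  shows "((\<lambda>t. \<Sum>n. f n t) has_vector_derivative (\<Sum>n. f' n t)) (at t)"
proof -
  \<comment> \<open>Differentiability is local, so a majorant on one bounded open interval around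
    \<open>t\<close> is enough for uniform convergence of the derivatives.\<close>
  define S where "S = {-(\<bar>t\<bar> + 1)<..<\<bar>t\<bar> + 1}"
  have oS: "open S" "t \<in> S" "convex S" by (auto simp: S_def)
  obtain M where M: "summable M" "\<And>n x. x \<in> S \<Longrightarrow> cmod (f' n x) \<le> M n"
    using b[of "\<bar>t\<bar> + 1"] unfolding S_def by (auto simp: abs_le_iff)
  have ul: "uniform_limit S (\<lambda>n x. \<Sum>i<n. f' i x) (\<lambda>x. \<Sum>i. f' i x) sequentially"
    by (rule Weierstrass_m_test[OF M(2,1)])
  have "\<exists>g. \<forall>x\<in>S. (\<lambda>n. f n x) sums g x \<and> (g has_derivative (\<lambda>h. h *\<^sub>R (\<Sum>i. f' i x))) (at x within S)"
  proof (rule has_derivative_series[OF oS(3), where f' = "\<lambda>n x h. h *\<^sub>R f' n x"])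
    show "(f n has_derivative (\<lambda>h. h *\<^sub>R f' n x)) (at x within S)" for n x
      using d[of n x] unfolding has_vector_derivative_def by (rule has_derivative_at_withinI)
    show "\<forall>\<^sub>F n in sequentially. \<forall>x\<in>S. \<forall>h. norm ((\<Sum>i<n. h *\<^sub>R f' i x) - h *\<^sub>R (\<Sum>i. f' i x)) \<le> e * norm h"
      if e: "e > 0" for e
    proof -
      have "\<forall>\<^sub>F n in sequentially. \<forall>x\<in>S. dist (\<Sum>i<n. f' i x) (\<Sum>i. f' i x) < e"
        using ul e unfolding uniform_limit_iff by blast
      then show ?thesis
      proof eventually_elim
        case (elim n)
        show ?case
        proof (intro ballI allI)
          fix x h assume "x \<in> S"
          then have "norm ((\<Sum>i<n. f' i x) - (\<Sum>i. f' i x)) \<le> e"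
            using elim by (auto simp: dist_norm less_imp_le)
          moreover have "(\<Sum>i<n. h *\<^sub>R f' i x) - h *\<^sub>R (\<Sum>i. f' i x) = h *\<^sub>R ((\<Sum>i<n. f' i x) - (\<Sum>i. f' i x))"
            by (simp add: scaleR_sum_right scaleR_diff_right)
          ultimately have "norm ((\<Sum>i<n. h *\<^sub>R f' i x) - h *\<^sub>R (\<Sum>i. f' i x)) \<le> norm h * e"
            by (simp add: mult_left_mono)
          then show "norm ((\<Sum>i<n. h *\<^sub>R f' i x) - h *\<^sub>R (\<Sum>i. f' i x)) \<le> e * norm h"
            by (simp only: mult.commute)
        qed
      qed
    qed
    show "t \<in> S" by fact
    show "(\<lambda>n. f n t) sums (\<Sum>n. f n t)" using s by (rule summable_sums)
  qed
  then obtain g where g: "\<And>x. x \<in> S \<Longrightarrow> (\<lambda>n. f n x) sums g x"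
    "\<And>x. x \<in> S \<Longrightarrow> (g has_derivative (\<lambda>h. h *\<^sub>R (\<Sum>i. f' i x))) (at x within S)" by blast
  have "(g has_vector_derivative (\<Sum>i. f' i t)) (at t)"
    using g(2)[OF oS(2)] unfolding has_vector_derivative_def at_within_open[OF oS(2,1)] .
  then show ?thesis
    by (rule has_vector_derivative_transform_within_open[OF _ oS(1,2)]) (use g(1) in \<open>auto simp: sums_iff\<close>)
qed

lemma ip_has_vector_derivative:
  assumes df: "\<And>t n. ((\<lambda>s. f s n) has_vector_derivative f' t n) (at t)"
    and dg: "\<And>t n. ((\<lambda>s. g s n) has_vector_derivative g' t n) (at t)"
    and rf: "rapid_path f" "rapid_path f'" and rg: "rapid_path g" "rapid_path g'"
  shows "((\<lambda>s. ip (f s) (g s)) has_vector_derivative (ip (f' t) (g t) + ip (f t) (g' t))) (at t)"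
proof -
  note R = rapid_pathD[OF rf(1)] rapid_pathD[OF rf(2)] rapid_pathD[OF rg(1)] rapid_pathD[OF rg(2)]
  have "((\<lambda>s. \<Sum>n. cnj (f s n) * g s n) has_vector_derivative (\<Sum>n. cnj (f t n) * g' t n + cnj (f' t n) * g t n)) (at t)"
  proof (rule has_vector_derivative_suminf)
    show "((\<lambda>s. cnj (f s n) * g s n) has_vector_derivative (cnj (f t n) * g' t n + cnj (f' t n) * g t n)) (at t)" for n t
      by (intro has_vector_derivative_mult has_vector_derivative_cnj df dg)
    show "summable (\<lambda>n. cnj (f t n) * g t n)" for t
      by (intro rapid_summable_ip R)
    fix T :: real
    obtain M1 where M1: "summable M1" "\<And>x n. x \<in> {-T..T} \<Longrightarrow> cmod (cnj (f x n) * g' x n) \<le> M1 n"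
      using rapid_on_product_bound[of "{-T..T}" f g'] rf rg unfolding rapid_path_def by blast
    obtain M2 where M2: "summable M2" "\<And>x n. x \<in> {-T..T} \<Longrightarrow> cmod (cnj (f' x n) * g x n) \<le> M2 n"
      using rapid_on_product_bound[of "{-T..T}" f' g] rf rg unfolding rapid_path_def by blast
    show "\<exists>M. summable M \<and> (\<forall>n t. \<bar>t\<bar> \<le> T \<longrightarrow> cmod (cnj (f t n) * g' t n + cnj (f' t n) * g t n) \<le> M n)"
    proof (intro exI[of _ "\<lambda>n. M1 n + M2 n"] conjI summable_add M1(1) M2(1) allI impI)
      fix n and t :: real assume "\<bar>t\<bar> \<le> T"
      then have t: "t \<in> {-T..T}" by auto
      show "cmod (cnj (f t n) * g' t n + cnj (f' t n) * g t n) \<le> M1 n + M2 n"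
        using M1(2)[OF t, of n] M2(2)[OF t, of n] norm_triangle_ineq[of "cnj (f t n) * g' t n" "cnj (f' t n) * g t n"]
        by linarith
    qed
  qed
  moreover have "(\<lambda>n. cnj (f t n) * g' t n + cnj (f' t n) * g t n) sums (ip (f t) (g' t) + ip (f' t) (g t))"
    by (intro sums_add ip_sums R)
  ultimately show ?thesis by (simp add: ip_def[symmetric] sums_iff add.commute)
qed

section \<open>Matrices with off-diagonal decay\<close>

definition mop :: "(nat \<Rightarrow> nat \<Rightarrow> complex) \<Rightarrow> (nat \<Rightarrow> complex) \<Rightarrow> nat \<Rightarrow> complex" where
  "mop M u n = (\<Sum>m. M n m * u m)"

text \<open>Decay faster than any power of the distance to the diagonal, uniformly in time: the
  matrix counterpart of an order-zero symbol, and just what keeps rapidly decreasing sequences in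
  their class.\<close>

definition offdiag_decay :: "(real \<Rightarrow> nat \<Rightarrow> nat \<Rightarrow> complex) \<Rightarrow> bool" where
  "offdiag_decay M \<longleftrightarrow> (\<forall>K. \<exists>C. \<forall>t n m. cmod (M t n m) \<le> C / (1 + \<bar>real n - real m\<bar>) ^ K)"

lemma offdiag_decay_bound:
  assumes "offdiag_decay M"
  obtains C where "C > 0" "\<And>t n m. cmod (M t n m) \<le> C / (1 + \<bar>real n - real m\<bar>) ^ K"
proof -
  obtain C where C: "\<forall>t n m. cmod (M t n m) \<le> C / (1 + \<bar>real n - real m\<bar>) ^ K"
    using assms unfolding offdiag_decay_def by blast
  show ?thesis
  proof (rule that[of "\<bar>C\<bar> + 1"])
    fix t n m
    have "cmod (M t n m) \<le> C / (1 + \<bar>real n - real m\<bar>) ^ K" using C by blast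
    also have "\<dots> \<le> (\<bar>C\<bar> + 1) / (1 + \<bar>real n - real m\<bar>) ^ K" by (rule divide_right_mono) auto
    finally show "cmod (M t n m) \<le> (\<bar>C\<bar> + 1) / (1 + \<bar>real n - real m\<bar>) ^ K" .
  qed auto
qed

text \<open>The series has sum \<open>pi\<^sup>2 / 6\<close>; the crude \<open>pi < 4\<close>
  already gives a bound below 3.\<close>

lemma sum_inverse_sq_le: "finite A \<Longrightarrow> (\<Sum>k\<in>A. 1 / (1 + real k)\<^sup>2) \<le> 3"
proof -
  assume A: "finite A"
  have s: "(\<lambda>n. 1 / (1 + real n)\<^sup>2) sums (pi\<^sup>2 / 6)"
    using inverse_squares_sums by (simp add: of_nat_Suc add.commute)
  have "(\<Sum>k\<in>A. 1 / (1 + real k)\<^sup>2) \<le> (\<Sum>n. 1 / (1 + real n)\<^sup>2)"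
    using s A by (intro sum_le_suminf) (auto simp: sums_iff)
  also have "\<dots> = pi\<^sup>2 / 6" using s by (simp add: sums_iff)
  also have "\<dots> \<le> 4\<^sup>2 / 6" using pi_less_4 pi_gt_zero by (intro divide_right_mono power_mono) auto
  finally show ?thesis by simp
qed

text \<open>Each side of the diagonal contributes at most 3. The resulting 6 is the constant of all
  operator bounds below.\<close>

lemma sum_kernel_le: 
  assumes "finite A" shows "(\<Sum>m\<in>A. 1 / (1 + \<bar>real n - real m\<bar>)\<^sup>2) \<le> 6"
proof -
  let ?k = "\<lambda>m. 1 / (1 + \<bar>real n - real m\<bar>)\<^sup>2"
  have "(\<Sum>m\<in>A. ?k m) = (\<Sum>m\<in>{m\<in>A. m \<le> n}. ?k m) + (\<Sum>m\<in>{m\<in>A. \<not> m \<le> n}. ?k m)"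
    using sum.union_disjoint[of "{m\<in>A. m \<le> n}" "{m\<in>A. \<not> m \<le> n}" ?k] assms
    by (simp add: Collect_conj_eq[symmetric] Un_def conj_disj_distribL[symmetric] Int_def)
  moreover have "(\<Sum>m\<in>{m\<in>A. m \<le> n}. ?k m) = (\<Sum>j\<in>(\<lambda>m. n - m) ` {m\<in>A. m \<le> n}. 1 / (1 + real j)\<^sup>2)"
    by (subst sum.reindex) (auto simp: inj_on_def)
  moreover have "(\<Sum>m\<in>{m\<in>A. \<not> m \<le> n}. ?k m) = (\<Sum>j\<in>(\<lambda>m. m - n) ` {m\<in>A. \<not> m \<le> n}. 1 / (1 + real j)\<^sup>2)"
    by (subst sum.reindex) (auto simp: inj_on_def)
  ultimately show ?thesis
    using sum_inverse_sq_le[of "(\<lambda>m. n - m) ` {m\<in>A. m \<le> n}"] sum_inverse_sq_le[of "(\<lambda>m. m - n) ` {m\<in>A. \<not> m \<le> n}"] assms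
    by simp
qed

lemma summable_kernel: "summable (\<lambda>m. 1 / (1 + \<bar>real n - real m\<bar>)\<^sup>2)"
  by (rule summableI_nonneg_bounded[where x = 6]) (use sum_kernel_le in auto)

lemma suminf_kernel_le: "(\<Sum>m. 1 / (1 + \<bar>real n - real m\<bar>)\<^sup>2) \<le> 6"
  by (rule suminf_le_const[OF summable_kernel]) (use sum_kernel_le in auto)

lemma mop_summable_norm:
  assumes "\<And>m. cmod (M n m) \<le> C" "rapid u" shows "summable (\<lambda>m. cmod (M n m * u m))"
  by (rule summable_comparison_test'[OF summable_mult[OF rapid_summable_norm[OF assms(2)], of C], of 0])
     (auto simp: norm_mult intro!: mult_right_mono assms(1))

lemma mop_sums:
  assumes "\<And>m. cmod (M n m) \<le> C" "rapid u" shows "(\<lambda>m. M n m * u m) sums mop M u n"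
  unfolding mop_def
  by (rule summable_sums, rule summable_norm_cancel, rule mop_summable_norm[of M n C u]) (use assms in auto)

lemma offdiag_decay_bounded:
  assumes "offdiag_decay M" obtains C where "C > 0" "\<And>t n m. cmod (M t n m) \<le> C"
  using offdiag_decay_bound[OF assms, of 0] by auto

lemma weight_shift: "real (Suc n) \<le> real (Suc m) * (1 + \<bar>real n - real m\<bar>)"
proof -
  have "real (Suc n) \<le> 1 + real m + \<bar>real n - real m\<bar>" by (simp add: of_nat_Suc)
  also have "\<dots> \<le> real (Suc m) * (1 + \<bar>real n - real m\<bar>)" by (simp add: of_nat_Suc algebra_simps)
  finally show ?thesis .
qed

text \<open>Of the \<open>p + 2\<close> powers of off-diagonal decay, \<open>p\<close> carry the
  weight from the column index to the row index by \<open>weight_shift\<close>, and the last two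
  make the row summable.\<close>

lemma mop_weight_bound:
  assumes M: "\<And>m. cmod (M n m) \<le> C / (1 + \<bar>real n - real m\<bar>) ^ (p + 2)"
    and f: "\<And>m. cmod (f m) \<le> D / real (Suc m) ^ p" and C: "C \<ge> 0" and D: "D \<ge> 0"
  shows "summable (\<lambda>m. cmod (M n m * f m))" "cmod (mop M f n) \<le> 6 * C * D / real (Suc n) ^ p"
proof -
  let ?k = "\<lambda>m. 1 / (1 + \<bar>real n - real m\<bar>)\<^sup>2"
  have b: "cmod (M n m * f m) \<le> (C * D / real (Suc n) ^ p) * ?k m" for m
  proof -
    let ?d = "1 + \<bar>real n - real m\<bar>"
    have "cmod (M n m * f m) \<le> (C / ?d ^ (p + 2)) * (D / real (Suc m) ^ p)"
      unfolding norm_mult using C M f by (intro mult_mono) auto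
    also have "\<dots> = (C * D) / ((real (Suc m) * ?d) ^ p * ?d\<^sup>2)"
      by (simp add: power_add power_mult_distrib power2_eq_square)
    also have "\<dots> \<le> (C * D) / (real (Suc n) ^ p * ?d\<^sup>2)"
      using C D weight_shift[of n m]
      by (intro divide_left_mono mult_right_mono power_mono mult_pos_pos) auto
    also have "\<dots> = (C * D / real (Suc n) ^ p) * ?k m" by simp
    finally show ?thesis .
  qed
  show s: "summable (\<lambda>m. cmod (M n m * f m))"
    by (rule summable_comparison_test'[OF summable_mult[OF summable_kernel[of n]], of 0 _ "C * D / real (Suc n) ^ p"])
       (use b in auto)
  have "cmod (mop M f n) \<le> (\<Sum>m. cmod (M n m * f m))"
    unfolding mop_def by (rule summable_norm[OF s])
  also have "\<dots> \<le> (\<Sum>m. (C * D / real (Suc n) ^ p) * ?k m)"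
    by (rule suminf_le[OF b s summable_mult[OF summable_kernel]])
  also have "\<dots> = (C * D / real (Suc n) ^ p) * (\<Sum>m. ?k m)"
    by (rule suminf_mult[OF summable_kernel])
  also have "\<dots> \<le> (C * D / real (Suc n) ^ p) * 6"
    using C D by (intro mult_left_mono suminf_kernel_le) auto
  finally show "cmod (mop M f n) \<le> 6 * C * D / real (Suc n) ^ p" by (simp add: ac_simps)
qed

lemma rapid_on_mop:
  assumes M: "offdiag_decay M" and f: "rapid_on S f"
  shows "rapid_on S (\<lambda>t. mop (M t) (f t))"
  unfolding rapid_on_def
proof
  fix p
  obtain C where C: "C > 0" "\<And>t n m. cmod (M t n m) \<le> C / (1 + \<bar>real n - real m\<bar>) ^ (p + 2)"
    using offdiag_decay_bound[OF M] by blast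
  obtain D where D: "D > 0" "\<And>x n. x \<in> S \<Longrightarrow> cmod (f x n) \<le> D / real (Suc n) ^ p"
    using rapid_on_bound[OF f] by blast
  show "\<exists>C. \<forall>x\<in>S. \<forall>n. cmod (mop (M x) (f x) n) \<le> C / real (Suc n) ^ p"
    by (intro exI[of _ "6 * C * D"] ballI allI mop_weight_bound(2)[OF C(2) D(2)]) (use C D in auto)
qed

lemma rapid_path_mop:
  "offdiag_decay M \<Longrightarrow> rapid_path f \<Longrightarrow> rapid_path (\<lambda>t. mop (M t) (f t))"
  unfolding rapid_path_def by (simp add: rapid_on_mop)

lemma rapid_mop: "offdiag_decay M \<Longrightarrow> rapid u \<Longrightarrow> rapid (mop (M t) u)"
  using rapid_on_mop[of M "{t}" "\<lambda>_. u"] rapid_on_const[of u "{t}"] rapid_onD[of "{t}" "\<lambda>s. mop (M s) u" t]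
  by simp

section \<open>Schur test, exchange of sums, and the hopping operator as a matrix\<close>

lemma schur_bound:
  assumes b: "\<And>n m. cmod (M n m) \<le> e / (1 + \<bar>real n - real m\<bar>)\<^sup>2"
    and u: "rapid u" and v: "rapid v" and Mv: "rapid (mop M v)"
  shows "cmod (ip u (mop M v)) \<le> 6 * e * (nrm u * nrm v)"
proof -
  let ?k = "\<lambda>n m. 1 / (1 + \<bar>real n - real m\<bar>)\<^sup>2"
  have e: "e \<ge> 0" using order_trans[OF norm_ge_zero b[of 0 0]] by simp
  have kle: "?k n m \<le> 1" for n m by simp
  have be: "cmod (M n m) \<le> e" for n m
    using b[of n m] mult_left_mono[OF kle[of n m] e] by simp
  \<comment> \<open>Schur test with a free parameter: \<open>|u\<^sub>n| |v\<^sub>m|\<close> is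
    split by the weighted arithmetic-geometric mean, then row sums of the kernel act on
    \<open>u\<close> and column sums on \<open>v\<close>, each at most 6. Optimising in
    \<open>s\<close> at the end doubles 3 to 6.\<close>
  have "cmod (ip u (mop M v)) \<le> 3 * e * (s * nsq u + nsq v / s)" if s: "s > 0" for s
  proof -
    have sk: "summable (\<lambda>m. ?k n m * (cmod (v m))\<^sup>2)" for n
      by (rule summable_comparison_test'[OF rapid_summable_sq[OF v], of 0])
         (use mult_right_mono[OF kle] in auto)
    have row: "cmod (cnj (u n) * mop M v n) \<le> 3 * e * s * (cmod (u n))\<^sup>2 + e / (2 * s) * (\<Sum>m. ?k n m * (cmod (v m))\<^sup>2)" for n
    proof -
      have sn: "summable (\<lambda>m. cmod (M n m * v m))" by (rule mop_summable_norm[of M n e v]) (use be v in auto)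
      have "cmod (cnj (u n) * mop M v n) \<le> cmod (u n) * (\<Sum>m. cmod (M n m * v m))"
        unfolding mop_def norm_mult complex_mod_cnj
        by (intro mult_left_mono summable_norm[OF sn, unfolded norm_mult]) auto
      also have "\<dots> = (\<Sum>m. cmod (u n) * cmod (M n m * v m))"
        by (rule suminf_mult[OF sn, symmetric])
      also have "\<dots> \<le> (\<Sum>m. (e / 2 * s * (cmod (u n))\<^sup>2) * ?k n m + e / (2 * s) * (?k n m * (cmod (v m))\<^sup>2))"
      proof (rule suminf_le[OF _ summable_mult[OF sn] summable_add[OF summable_mult[OF summable_kernel] summable_mult[OF sk]]])
        fix m
        have "0 \<le> (s * cmod (u n) - cmod (v m))\<^sup>2 / s" using s by simp
        also have "\<dots> = s * (cmod (u n))\<^sup>2 + (cmod (v m))\<^sup>2 / s - 2 * cmod (u n) * cmod (v m)"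
          using s by (simp add: field_simps power2_eq_square)
        finally have am: "cmod (u n) * cmod (v m) \<le> (s * (cmod (u n))\<^sup>2 + (cmod (v m))\<^sup>2 / s) / 2" by simp
        have "cmod (u n) * cmod (M n m * v m) = cmod (M n m) * (cmod (u n) * cmod (v m))"
          by (simp add: norm_mult)
        also have "\<dots> \<le> (e * ?k n m) * ((s * (cmod (u n))\<^sup>2 + (cmod (v m))\<^sup>2 / s) / 2)"
          using b[of n m] e by (intro mult_mono am) auto
        also have "\<dots> = (e / 2 * s * (cmod (u n))\<^sup>2) * ?k n m + e / (2 * s) * (?k n m * (cmod (v m))\<^sup>2)"
          by (simp add: add_divide_distrib distrib_left ac_simps)
        finally show "cmod (u n) * cmod (M n m * v m) \<le> (e / 2 * s * (cmod (u n))\<^sup>2) * ?k n m + e / (2 * s) * (?k n m * (cmod (v m))\<^sup>2)" .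
      qed
      also have "\<dots> = (e / 2 * s * (cmod (u n))\<^sup>2) * (\<Sum>m. ?k n m) + e / (2 * s) * (\<Sum>m. ?k n m * (cmod (v m))\<^sup>2)"
        by (rule sums_unique[symmetric], intro sums_add sums_mult summable_sums[OF summable_kernel] summable_sums[OF sk])
      also have "(e / 2 * s * (cmod (u n))\<^sup>2) * (\<Sum>m. ?k n m) \<le> (e / 2 * s * (cmod (u n))\<^sup>2) * 6"
        using e s by (intro mult_left_mono suminf_kernel_le) auto
      finally show ?thesis by simp
    qed
    \<comment> \<open>With finitely many rows the column sums may be taken first without a Fubini
      argument; the limit in \<open>L\<close> is taken afterwards.\<close>
    have part: "cmod (\<Sum>n<L. cnj (u n) * mop M v n) \<le> 3 * e * (s * nsq u + nsq v / s)" for L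
    proof -
      have "cmod (\<Sum>n<L. cnj (u n) * mop M v n) \<le> (\<Sum>n<L. cmod (cnj (u n) * mop M v n))" by (rule norm_sum)
      also have "\<dots> \<le> (\<Sum>n<L. 3 * e * s * (cmod (u n))\<^sup>2 + e / (2 * s) * (\<Sum>m. ?k n m * (cmod (v m))\<^sup>2))"
        by (intro sum_mono row)
      also have "\<dots> = 3 * e * s * (\<Sum>n<L. (cmod (u n))\<^sup>2) + e / (2 * s) * (\<Sum>n<L. \<Sum>m. ?k n m * (cmod (v m))\<^sup>2)"
        by (simp only: sum.distrib sum_distrib_left)
      finally have "cmod (\<Sum>n<L. cnj (u n) * mop M v n) \<le> \<dots>" .
      moreover have "(\<Sum>n<L. \<Sum>m. ?k n m * (cmod (v m))\<^sup>2) \<le> 6 * nsq v"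
      proof -
        have "(\<Sum>n<L. \<Sum>m. ?k n m * (cmod (v m))\<^sup>2) = (\<Sum>m. \<Sum>n<L. ?k n m * (cmod (v m))\<^sup>2)"
          by (rule suminf_sum[symmetric]) (rule sk)
        also have "\<dots> \<le> (\<Sum>m. 6 * (cmod (v m))\<^sup>2)"
        proof (rule suminf_le)
          fix m
          have "(\<Sum>n<L. ?k n m * (cmod (v m))\<^sup>2) = (\<Sum>n<L. 1 / (1 + \<bar>real m - real n\<bar>)\<^sup>2) * (cmod (v m))\<^sup>2"
            by (simp only: sum_distrib_right abs_minus_commute)
          also have "\<dots> \<le> 6 * (cmod (v m))\<^sup>2" by (intro mult_right_mono sum_kernel_le) auto
          finally show "(\<Sum>n<L. ?k n m * (cmod (v m))\<^sup>2) \<le> 6 * (cmod (v m))\<^sup>2" .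
        qed (intro summable_sum sk summable_mult rapid_summable_sq v)+
        also have "\<dots> = 6 * nsq v" unfolding nsq_def by (rule suminf_mult[OF rapid_summable_sq[OF v]])
        finally show ?thesis .
      qed
      moreover have "(\<Sum>n<L. (cmod (u n))\<^sup>2) \<le> nsq u"
        unfolding nsq_def by (rule sum_le_suminf[OF rapid_summable_sq[OF u]]) auto
      moreover have "3 * e * s \<ge> 0" "e / (2 * s) \<ge> 0" using e s by auto
      ultimately have "cmod (\<Sum>n<L. cnj (u n) * mop M v n) \<le> 3 * e * s * nsq u + e / (2 * s) * (6 * nsq v)"
        by (meson add_mono mult_left_mono order_trans)
      also have "\<dots> = 3 * e * (s * nsq u + nsq v / s)" by (simp add: distrib_left)
      finally show ?thesis .
    qed
    have "(\<lambda>L. \<Sum>n<L. cnj (u n) * mop M v n) \<longlonglongrightarrow> ip u (mop M v)"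
      using ip_sums[OF u Mv] unfolding sums_def .
    then show ?thesis by (rule Lim_bounded[OF tendsto_norm]) (use part in auto)
  qed
  from optimise_weighted_sum[OF this nsq_nonneg[OF u] nsq_nonneg[OF v]] show ?thesis
    using e by (simp add: nrm_def)
qed

text \<open>The form bound tested with \<open>mop M v\<close> itself, followed by division by its
  norm.\<close>

lemma nrm_mop_le:
  assumes b: "\<And>n m. cmod (M n m) \<le> e / (1 + \<bar>real n - real m\<bar>)\<^sup>2" and v: "rapid v" and Mv: "rapid (mop M v)"
  shows "nrm (mop M v) \<le> 6 * e * nrm v"
proof (cases "nrm (mop M v) = 0")
  case True
  have "e \<ge> 0" using order_trans[OF norm_ge_zero b[of 0 0]] by simp
  then show ?thesis using True nrm_nonneg[OF v] by simp
next
  case False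
  then have p: "nrm (mop M v) > 0" using nrm_nonneg[OF Mv] by simp
  have "nrm (mop M v) * nrm (mop M v) = cmod (ip (mop M v) (mop M v))"
    using ip_self[OF Mv] nrm_sq[OF Mv] nsq_nonneg[OF Mv] by (simp add: power2_eq_square)
  also have "\<dots> \<le> 6 * e * (nrm (mop M v) * nrm v)" by (rule schur_bound[OF b Mv v Mv])
  finally have "nrm (mop M v) * nrm (mop M v) \<le> nrm (mop M v) * (6 * e * nrm v)" by (simp add: ac_simps)
  then show ?thesis using p by simp
qed

lemma infsum_nat_eq_suminf:
  fixes f :: "nat \<Rightarrow> complex"
  assumes "summable (\<lambda>n. cmod (f n))" shows "infsum f UNIV = suminf f"
  using norm_summable_imp_has_sum[OF assms summable_sums[OF summable_norm_cancel[OF assms]]]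
  by (rule infsumI)

text \<open>The product majorant makes the family absolutely summable over all pairs, where the
  unordered sums \<open>infsum\<close> can be swapped; they agree with \<open>suminf\<close> because
  every row, every column and both sequences of partial results are absolutely summable.\<close>

lemma suminf_swap_product_dominated:
  fixes f :: "nat \<Rightarrow> nat \<Rightarrow> complex"
  assumes f: "\<And>n m. cmod (f n m) \<le> a n * b m" and a: "summable a" and b: "summable b"
    and a0: "\<And>n. a n \<ge> 0" and b0: "\<And>m. b m \<ge> 0"
  shows "(\<Sum>n. \<Sum>m. f n m) = (\<Sum>m. \<Sum>n. f n m)"
proof -
  have s1: "summable (\<lambda>m. cmod (f n m))" for n
    by (rule summable_comparison_test'[OF summable_mult[OF b, of "a n"], of 0]) (use f in auto)
  have s2: "summable (\<lambda>n. cmod (f n m))" for m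
    by (rule summable_comparison_test'[OF summable_mult2[OF a, of "b m"], of 0]) (use f in auto)
  have n1: "cmod (\<Sum>m. f n m) \<le> a n * suminf b" for n
    by (rule order_trans[OF summable_norm[OF s1]], subst suminf_mult[OF b, symmetric])
       (rule suminf_le[OF f s1 summable_mult[OF b]])
  have n2: "cmod (\<Sum>n. f n m) \<le> suminf a * b m" for m
    by (rule order_trans[OF summable_norm[OF s2]], subst suminf_mult2[OF a])
       (rule suminf_le[OF f s2 summable_mult2[OF a]])
  have t1: "summable (\<lambda>n. cmod (\<Sum>m. f n m))"
    by (rule summable_comparison_test'[OF summable_mult2[OF a, of "suminf b"], of 0]) (use n1 in auto)
  have t2: "summable (\<lambda>m. cmod (\<Sum>n. f n m))"
    by (rule summable_comparison_test'[OF summable_mult[OF b, of "suminf a"], of 0]) (use n2 in auto)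
  have "(\<lambda>x. norm (case x of (n, m) \<Rightarrow> f n m)) summable_on (UNIV \<times> UNIV)"
    unfolding Infinite_Sum.abs_summable_on_Sigma_iff
  proof (intro conjI ballI)
    fix n
    show "(\<lambda>m. norm (case (n, m) of (n, m) \<Rightarrow> f n m)) summable_on UNIV"
      using s1[of n] by (simp add: summable_on_UNIV_nonneg_real_iff)
  next
    have eq: "infsum (\<lambda>m. cmod (f n m)) UNIV = (\<Sum>m. cmod (f n m))" for n
      by (rule infsumI, rule norm_summable_imp_has_sum) (use s1[of n] summable_sums in auto)
    have "summable (\<lambda>n. \<Sum>m. cmod (f n m))"
    proof (rule summable_comparison_test'[OF summable_mult2[OF a, of "suminf b"], of 0])
      fix n
      have "(\<Sum>m. cmod (f n m)) \<le> (\<Sum>m. a n * b m)" by (rule suminf_le[OF f s1 summable_mult[OF b]])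
      then show "norm (\<Sum>m. cmod (f n m)) \<le> a n * suminf b"
        using suminf_nonneg[OF s1[of n]] by (simp add: suminf_mult[OF b])
    qed
    then show "(\<lambda>n. norm (infsum (\<lambda>m. norm (case (n, m) of (n, m) \<Rightarrow> f n m)) UNIV)) summable_on UNIV"
      using suminf_nonneg[OF s1] by (simp add: eq summable_on_UNIV_nonneg_real_iff)
  qed
  then have "infsum (\<lambda>n. infsum (f n) UNIV) UNIV = infsum (\<lambda>m. infsum (\<lambda>n. f n m) UNIV) UNIV"
    by (rule infsum_swap_banach[OF Infinite_Sum.abs_summable_summable])
  then show ?thesis by (simp add: infsum_nat_eq_suminf s1 s2 t1 t2)
qed

lemma ip_mop_hermitian:
  assumes M: "offdiag_decay M" and h: "\<And>n m. M t m n = cnj (M t n m)" and u: "rapid u" and v: "rapid v"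
  shows "ip u (mop (M t) v) = ip (mop (M t) u) v"
proof -
  obtain B where B: "B > 0" "\<And>t n m. cmod (M t n m) \<le> B" using offdiag_decay_bounded[OF M] by blast
  have sv: "(\<lambda>m. M t n m * v m) sums mop (M t) v n" and su: "(\<lambda>m. M t n m * u m) sums mop (M t) u n" for n
    by (rule mop_sums[of "M t" n B]; use B u v in auto)+
  have "ip u (mop (M t) v) = (\<Sum>n. \<Sum>m. cnj (u n) * (M t n m * v m))"
    unfolding ip_def mop_def by (intro suminf_cong suminf_mult[symmetric] sums_summable[OF sv])
  also have "\<dots> = (\<Sum>m. \<Sum>n. cnj (u n) * (M t n m * v m))"
  proof (rule suminf_swap_product_dominated)
    show "cmod (cnj (u n) * (M t n m * v m)) \<le> (B * cmod (u n)) * cmod (v m)" for n m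
    proof -
      have "cmod (M t n m) * (cmod (u n) * cmod (v m)) \<le> B * (cmod (u n) * cmod (v m))"
        by (intro mult_right_mono B) auto
      then show ?thesis by (simp add: norm_mult ac_simps)
    qed
  qed (use B rapid_summable_norm[OF u] rapid_summable_norm[OF v] in \<open>auto intro: summable_mult\<close>)
  also have "\<dots> = (\<Sum>m. cnj (mop (M t) u m) * v m)"
  proof (rule suminf_cong)
    fix m
    have "(\<lambda>n. cnj (M t m n * u n)) sums cnj (mop (M t) u m)" using su[of m] unfolding sums_cnj .
    then have "(\<lambda>n. cnj (M t m n * u n) * v m) sums (cnj (mop (M t) u m) * v m)" by (rule sums_mult2)
    moreover have "(\<lambda>n. cnj (M t m n * u n) * v m) = (\<lambda>n. cnj (u n) * (M t n m * v m))"
    proof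
      fix n
      have "M t n m = cnj (M t m n)" by (rule h)
      then show "cnj (M t m n * u n) * v m = cnj (u n) * (M t n m * v m)" by simp
    qed
    ultimately show "(\<Sum>n. cnj (u n) * (M t n m * v m)) = cnj (mop (M t) u m) * v m"
      by (simp add: sums_iff)
  qed
  finally show ?thesis unfolding ip_def .
qed

lemma mop_add:
  assumes "offdiag_decay M" "rapid u" "rapid v"
  shows "mop (M t) (\<lambda>n. u n + v n) = (\<lambda>n. mop (M t) u n + mop (M t) v n)"
proof
  fix n
  obtain B where B: "B > 0" "\<And>t n m. cmod (M t n m) \<le> B" using offdiag_decay_bounded[OF assms(1)] by blast
  have "(\<lambda>m. M t n m * u m + M t n m * v m) sums (mop (M t) u n + mop (M t) v n)"
    using B assms by (intro sums_add mop_sums[of "M t" n B]) auto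
  then show "mop (M t) (\<lambda>n. u n + v n) n = mop (M t) u n + mop (M t) v n"
    unfolding mop_def[of "M t" "\<lambda>n. u n + v n"] distrib_left by (rule sums_unique[symmetric])
qed

lemma mop_cmult:
  assumes "offdiag_decay M" "rapid u"
  shows "mop (M t) (\<lambda>n. c * u n) = (\<lambda>n. c * mop (M t) u n)"
proof
  fix n
  obtain B where B: "B > 0" "\<And>t n m. cmod (M t n m) \<le> B" using offdiag_decay_bounded[OF assms(1)] by blast
  have "(\<lambda>m. c * (M t n m * u m)) sums (c * mop (M t) u n)"
    using B assms by (intro sums_mult mop_sums[of "M t" n B]) auto
  then show "mop (M t) (\<lambda>n. c * u n) n = c * mop (M t) u n"
    unfolding mop_def[of "M t" "\<lambda>n. c * u n"] mult.left_commute[of c] by (rule sums_unique[symmetric])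
qed

lemma offdiag_decay_add:
  assumes "offdiag_decay M" "offdiag_decay M'" shows "offdiag_decay (\<lambda>t n m. M t n m + M' t n m)"
  unfolding offdiag_decay_def
proof
  fix K
  obtain C where C: "C > 0" "\<And>t n m. cmod (M t n m) \<le> C / (1 + \<bar>real n - real m\<bar>) ^ K"
    using offdiag_decay_bound[OF assms(1)] by blast
  obtain D where D: "D > 0" "\<And>t n m. cmod (M' t n m) \<le> D / (1 + \<bar>real n - real m\<bar>) ^ K"
    using offdiag_decay_bound[OF assms(2)] by blast
  show "\<exists>C. \<forall>t n m. cmod (M t n m + M' t n m) \<le> C / (1 + \<bar>real n - real m\<bar>) ^ K"
    by (intro exI[of _ "C + D"] allI order_trans[OF norm_triangle_ineq])
       (simp add: add_divide_distrib add_mono C(2) D(2))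
qed

lemma offdiag_decay_hopping: "offdiag_decay (\<lambda>t. SSadj_mat)"
  unfolding offdiag_decay_def
proof (intro allI exI)
  fix K n m
  \<comment> \<open>The nonzero entries sit at distance one, where the weight is exactly
    \<open>2 ^ K\<close>.\<close>
  show "cmod (SSadj_mat n m) \<le> 2 ^ K / (1 + \<bar>real n - real m\<bar>) ^ K"
    unfolding SSadj_mat_def by (auto simp: of_nat_Suc)
qed

definition hop :: "(nat \<Rightarrow> complex) \<Rightarrow> nat \<Rightarrow> complex" where
  "hop u n = (if n = 0 then 0 else u (n - 1)) + u (Suc n)"

lemma mop_hopping: "mop SSadj_mat u = hop u"
proof
  fix n
  have "mop SSadj_mat u n = (\<Sum>m\<in>(if n = 0 then {} else {n - 1}) \<union> {Suc n}. SSadj_mat n m * u m)"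
    unfolding mop_def by (rule suminf_finite) (auto simp: SSadj_mat_def split: if_splits)
  then show "mop SSadj_mat u n = hop u n"
    by (cases n) (auto simp: SSadj_mat_def hop_def)
qed

lemma mop_hopping_plus:
  assumes A: "offdiag_decay A" and u: "rapid u"
  shows "mop (\<lambda>n m. SSadj_mat n m + A t n m) u n = hop u n + mop (A t) u n"
proof -
  obtain B where B: "B > 0" "\<And>t n m. cmod (A t n m) \<le> B" using offdiag_decay_bounded[OF A] by blast
  have D: "cmod (SSadj_mat n m) \<le> 1" for m by (simp add: SSadj_mat_def)
  have "(\<lambda>m. SSadj_mat n m * u m + A t n m * u m) sums (mop SSadj_mat u n + mop (A t) u n)"
    using B D u by (intro sums_add mop_sums[of SSadj_mat n 1] mop_sums[of "A t" n B]) auto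
  then show ?thesis
    unfolding mop_def[of "\<lambda>n m. SSadj_mat n m + A t n m"] distrib_right mop_hopping by (rule sums_unique[symmetric])
qed

section \<open>Growth for the perturbed hopping equation\<close>

text \<open>Formally the derivative of \<open>sqrt g\<close> is at most \<open>c\<close>. The
  function \<open>g\<close> may vanish, and does so at time 0 in \<open>almost_antiperiodic\<close>,
  so the argument runs on \<open>sqrt (g + \<delta>\<^sup>2)\<close> and lets
  \<open>\<delta>\<close> tend to 0.\<close>

lemma sqrt_growth:
  fixes g g' :: "real \<Rightarrow> real"
  assumes d: "\<And>t. (g has_real_derivative g' t) (at t)" and g0: "\<And>t. g t \<ge> 0"
    and b: "\<And>t. g' t \<le> 2 * c * sqrt (g t)" and c: "c \<ge> 0" and T: "T \<ge> 0"
  shows "sqrt (g T) \<le> sqrt (g 0) + c * T"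
proof (rule field_le_epsilon)
  fix \<delta> :: real assume \<delta>: "\<delta> > 0"
  let ?h = "\<lambda>t. sqrt (g t + \<delta>\<^sup>2) - c * t"
  have p: "g t + \<delta>\<^sup>2 > 0" for t using g0[of t] \<delta> by (simp add: add_nonneg_pos)
  have "?h T \<le> ?h 0"
  proof (rule DERIV_nonpos_imp_nonincreasing[OF T])
    fix t
    have sp: "sqrt (g t + \<delta>\<^sup>2) > 0" using p by simp
    have D: "(?h has_real_derivative (g' t * (inverse (sqrt (g t + \<delta>\<^sup>2)) / 2) - c)) (at t)"
      using p[of t] by (auto intro!: derivative_eq_intros d)
    have "g' t \<le> 2 * c * sqrt (g t + \<delta>\<^sup>2)"
      using b[of t] mult_left_mono[of "sqrt (g t)" "sqrt (g t + \<delta>\<^sup>2)" "2 * c"] c by simp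
    then have "g' t * (inverse (sqrt (g t + \<delta>\<^sup>2)) / 2) - c \<le> 0"
      using sp by (simp add: field_simps)
    then show "\<exists>y. (?h has_real_derivative y) (at t) \<and> y \<le> 0" using D by blast
  qed
  moreover have "sqrt (g T) \<le> sqrt (g T + \<delta>\<^sup>2)" by simp
  moreover have "sqrt (g 0 + \<delta>\<^sup>2) \<le> sqrt (g 0) + \<delta>"
    using sqrt_add_le_add_sqrt[of "g 0" "\<delta>\<^sup>2"] g0[of 0] \<delta> by simp
  ultimately show "sqrt (g T) \<le> sqrt (g 0) + c * T + \<delta>" by linarith
qed

lemma has_vector_derivative_translate:
  fixes f :: "real \<Rightarrow> 'a::real_normed_vector"
  assumes "(f has_vector_derivative f') (at (t + a))"
  shows "((\<lambda>s. f (s + a)) has_vector_derivative f') (at t)"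
proof -
  have "((\<lambda>s. s + a) has_vector_derivative 1) (at t)" by (auto intro!: derivative_eq_intros)
  from vector_diff_chain_at[OF this assms] show ?thesis by (simp add: o_def)
qed

lemma has_vector_derivative_cis_mult:
  "((\<lambda>s. cis (a * s)) has_vector_derivative \<i> * complex_of_real a * cis (a * s)) (at s)"
proof -
  have "((\<lambda>s. a * s) has_derivative (\<lambda>h. a * h)) (at s)" by (auto intro!: derivative_eq_intros)
  from has_derivative_cis[OF this] show ?thesis
    unfolding has_vector_derivative_def by (simp add: scaleR_conv_of_real ac_simps)
qed

lemma nrm_diff_le:
  assumes u: "rapid u" and v: "rapid v" shows "nrm (\<lambda>n. u n - v n) \<le> nrm u + nrm v"
  using nrm_triangle[OF u rapid_scale[OF v, of "-1"]] nrm_cmult[OF v, of "-1"] by simp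

text \<open>The operator \<open>\<Gamma>\<close> of the overview: the adjoint shift after
  \<open>K\<^sub>0\<close>, since \<open>real n + 3/2\<close> is
  \<open>K0_eig (Suc n)\<close>.\<close>

definition wshift :: "(nat \<Rightarrow> complex) \<Rightarrow> nat \<Rightarrow> complex" where
  "wshift u n = complex_of_real (real n + 3/2) * u (Suc n)"

text \<open>The matrix of the commutator of \<open>M\<close> with \<open>wshift\<close>. Column
  \<open>m\<close> of the product \<open>M \<Gamma>\<close> uses the weight of \<open>wshift\<close>
  at \<open>m - 1\<close>, which is \<open>real m + 1/2\<close>, and is empty for
  \<open>m = 0\<close>.\<close>

definition wshift_comm :: "(nat \<Rightarrow> nat \<Rightarrow> complex) \<Rightarrow> nat \<Rightarrow> nat \<Rightarrow> complex" where
  "wshift_comm M n m = (if m = 0 then 0 else M n (m - 1) * complex_of_real (real m + 1/2))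
     - complex_of_real (real n + 3/2) * M (Suc n) m"

lemma rapid_on_wshift:
  assumes "rapid_on S f" shows "rapid_on S (\<lambda>t. wshift (f t))"
proof (rule rapid_on_dominated[OF rapid_on_Suc[OF assms], where K = 2 and j = 1])
  fix x n
  have "cmod (complex_of_real (real n + 3/2)) \<le> 2 * real (Suc n) ^ 1"
    unfolding norm_of_real by (simp add: of_nat_Suc)
  then show "cmod (wshift (f x) n) \<le> 2 * real (Suc n) ^ 1 * cmod (f x (Suc n))"
    unfolding wshift_def norm_mult by (rule mult_right_mono) simp
qed simp

lemma rapid_on_hop: "rapid_on S f \<Longrightarrow> rapid_on S (\<lambda>t. hop (f t))"
  unfolding hop_def using rapid_on_add[OF rapid_on_pred rapid_on_Suc, of S f f] by simp

lemma rapid_path_wshift: "rapid_path f \<Longrightarrow> rapid_path (\<lambda>t. wshift (f t))"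
  unfolding rapid_path_def by (simp add: rapid_on_wshift)

lemma rapid_path_hop: "rapid_path f \<Longrightarrow> rapid_path (\<lambda>t. hop (f t))"
  unfolding rapid_path_def by (simp add: rapid_on_hop)

lemma rapid_wshift: "rapid u \<Longrightarrow> rapid (wshift u)"
  unfolding rapid_iff_rapid_on by (rule rapid_on_wshift)

lemma rapid_hop: "rapid u \<Longrightarrow> rapid (hop u)"
  unfolding rapid_iff_rapid_on by (rule rapid_on_hop)

lemma rapid_Suc: "rapid u \<Longrightarrow> rapid (\<lambda>n. u (Suc n))"
  unfolding rapid_iff_rapid_on by (rule rapid_on_Suc)

lemma rapid_pred: "rapid u \<Longrightarrow> rapid (\<lambda>n. if n = 0 then 0 else u (n - 1))"
  unfolding rapid_iff_rapid_on by (rule rapid_on_pred)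

lemma nsq_Suc: "rapid u \<Longrightarrow> nsq u = (cmod (u 0))\<^sup>2 + nsq (\<lambda>n. u (Suc n))"
  unfolding nsq_def using suminf_split_head[OF rapid_summable_sq] by fastforce

lemma nrm_hop_le:
  assumes "rapid u" shows "nrm (hop u) \<le> 2 * nrm u"
proof -
  let ?p = "\<lambda>n. if n = 0 then 0 else u (n - 1)"
  have "nrm (hop u) \<le> nrm ?p + nrm (\<lambda>n. u (Suc n))"
    using nrm_triangle[OF rapid_pred[OF assms] rapid_Suc[OF assms]] unfolding hop_def by simp
  moreover have "nsq ?p = nsq u" using nsq_Suc[OF rapid_pred[OF assms]] by simp
  moreover have "nsq (\<lambda>n. u (Suc n)) \<le> nsq u" using nsq_Suc[OF assms] by simp
  ultimately show ?thesis unfolding nrm_def by (smt (verit) real_sqrt_le_mono)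
qed

definition hop_defect :: "(nat \<Rightarrow> complex) \<Rightarrow> nat \<Rightarrow> complex" where
  "hop_defect u n = 4 * u n - hop (hop u) n"

lemma rapid_hop_defect: "rapid u \<Longrightarrow> rapid (hop_defect u)"
  unfolding hop_defect_def by (intro rapid_diff rapid_scale rapid_hop)

text \<open>In the bulk the weights cancel down to a second-neighbour difference. At the boundary
  the term coming from below is absent, whence 3/2; this extra has the favourable sign and makes the
  form below exactly that of \<open>4 - H\<^sup>2\<close>.\<close>

lemma hop_wshift:
  "hop (wshift u) n - wshift (hop u) n = u (Suc (Suc n)) - (if n = 0 then 3/2 else 1) * u n"
  by (cases n) (simp_all add: hop_def wshift_def of_nat_Suc field_simps)

text \<open>Up to a factor, \<open>4 - H\<^sup>2\<close> is the commutator of the hopping operator \<open>H\<close> with the generator of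
  dilations, and \<open>0 \<le> 4 - H\<^sup>2 \<le> 4\<close> lets its quadratic form control \<open>(4 - H\<^sup>2)u\<close> in norm.\<close>

lemma nsq_hop_defect_le:
  assumes u: "rapid u"
  shows "nsq (hop_defect u) \<le> 4 * (- 2 * Re (ip u (\<lambda>n. hop (wshift u) n - wshift (hop u) n)))"
proof -
  define d where "d = (\<lambda>n. u (Suc (Suc n)) - u n)"
  have rd: "rapid d" unfolding d_def by (intro rapid_diff rapid_Suc u)
  let ?c = "\<lambda>n. hop (wshift u) n - wshift (hop u) n"
  have rc: "rapid ?c" by (intro rapid_diff rapid_hop rapid_wshift u)
  have r2: "rapid (\<lambda>n. u (Suc (Suc n)))" by (intro rapid_Suc u)
  \<comment> \<open>Apart from the square of the difference \<open>d\<close>, the terms telescope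
    with step two and leave only boundary values.\<close>
  have t: "- 2 * Re (cnj (u n) * ?c n) = (cmod (d n))\<^sup>2 + (cmod (u n))\<^sup>2 - (cmod (u (Suc (Suc n))))\<^sup>2
      + (if n = 0 then (cmod (u 0))\<^sup>2 else 0)" for n
    unfolding hop_wshift d_def cmod_power2 by (cases n) (simp_all add: power2_eq_square field_simps)
  have "(\<lambda>n. - 2 * Re (cnj (u n) * ?c n)) sums (- 2 * Re (ip u ?c))"
    by (intro sums_mult sums_Re ip_sums u rc)
  moreover have "(\<lambda>n. - 2 * Re (cnj (u n) * ?c n)) sums (nsq d + nsq u - nsq (\<lambda>n. u (Suc (Suc n))) + (cmod (u 0))\<^sup>2)"
    unfolding t by (intro sums_add sums_diff nsq_sums rd u r2) (use sums_single[of 0 "\<lambda>_. (cmod (u 0))\<^sup>2"] in \<open>simp\<close>)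
  ultimately have Q: "- 2 * Re (ip u ?c) = nsq d + nsq u - nsq (\<lambda>n. u (Suc (Suc n))) + (cmod (u 0))\<^sup>2"
    by (rule sums_unique2)
  have un: "nsq u = (cmod (u 0))\<^sup>2 + (cmod (u 1))\<^sup>2 + nsq (\<lambda>n. u (Suc (Suc n)))"
    using nsq_Suc[OF u] nsq_Suc[OF rapid_Suc[OF u]] by simp
  have dn: "nsq d = (cmod (d 0))\<^sup>2 + (cmod (d 1))\<^sup>2 + nsq (\<lambda>n. d (Suc (Suc n)))"
    using nsq_Suc[OF rd] nsq_Suc[OF rapid_Suc[OF rd]] by simp
  let ?q = "hop_defect u"
  have rq: "rapid ?q" by (rule rapid_hop_defect[OF u])
  \<comment> \<open>\<open>4 - H\<^sup>2\<close> is minus a second difference with step two; its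
    first two rows see the boundary. Bounding each entry by
    \<open>2|a|\<^sup>2 + 2|b|\<^sup>2\<close> counts every entry of \<open>d\<close> at most twice,
    hence the factor 4.\<close>
  have q: "?q 0 = 2 * u 0 - d 0" "?q 1 = u 1 - d 1" "?q (Suc (Suc n)) = d n - d (Suc (Suc n))" for n
    by (simp_all add: hop_defect_def hop_def d_def)
  have sq: "(cmod (a - b))\<^sup>2 \<le> 2 * (cmod a)\<^sup>2 + 2 * (cmod b)\<^sup>2" for a b :: complex
  proof -
    have "(cmod (a - b))\<^sup>2 \<le> (cmod a + cmod b)\<^sup>2" by (intro power_mono norm_triangle_ineq4) auto
    also have "\<dots> \<le> 2 * (cmod a)\<^sup>2 + 2 * (cmod b)\<^sup>2"
      using sum_squares_bound[of "cmod a" "cmod b"] by (simp add: power2_eq_square algebra_simps)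
    finally show ?thesis .
  qed
  have "nsq (\<lambda>n. ?q (Suc (Suc n))) \<le> 2 * nsq d + 2 * nsq (\<lambda>n. d (Suc (Suc n)))"
  proof (rule sums_le)
    show "(\<lambda>n. (cmod (?q (Suc (Suc n))))\<^sup>2) sums nsq (\<lambda>n. ?q (Suc (Suc n)))"
      by (intro nsq_sums rapid_Suc rq)
    show "(\<lambda>n. 2 * (cmod (d n))\<^sup>2 + 2 * (cmod (d (Suc (Suc n))))\<^sup>2) sums (2 * nsq d + 2 * nsq (\<lambda>n. d (Suc (Suc n))))"
      by (intro sums_add sums_mult nsq_sums rd rapid_Suc)
    show "(cmod (?q (Suc (Suc n))))\<^sup>2 \<le> 2 * (cmod (d n))\<^sup>2 + 2 * (cmod (d (Suc (Suc n))))\<^sup>2" for n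
      unfolding q by (rule sq)
  qed
  moreover have "nsq ?q = (cmod (?q 0))\<^sup>2 + (cmod (?q 1))\<^sup>2 + nsq (\<lambda>n. ?q (Suc (Suc n)))"
    using nsq_Suc[OF rq] nsq_Suc[OF rapid_Suc[OF rq]] by simp
  moreover have "(cmod (?q 0))\<^sup>2 \<le> 8 * (cmod (u 0))\<^sup>2 + 2 * (cmod (d 0))\<^sup>2"
    unfolding q using sq[of "2 * u 0" "d 0"] by (simp add: norm_mult power_mult_distrib)
  moreover have "(cmod (?q 1))\<^sup>2 \<le> 2 * (cmod (u 1))\<^sup>2 + 2 * (cmod (d 1))\<^sup>2"
    unfolding q by (rule sq)
  moreover have "(cmod (u 1))\<^sup>2 \<ge> 0" by simp
  ultimately have "nsq ?q \<le> 8 * (cmod (u 0))\<^sup>2 + 4 * (cmod (u 1))\<^sup>2 + 4 * nsq d"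
    using dn by linarith
  then show ?thesis unfolding Q un by simp
qed

text \<open>One constant bounds both \<open>A\<close> and its commutator with \<open>wshift\<close>.
  The value 1/10000 keeps the error terms of \<open>almost_antiperiodic\<close> (6e per unit time)
  and of \<open>period_gain\<close> (72e per unit time) within the numerical margins used
  there.\<close>

locale hopping_perturbation =
  fixes A :: "real \<Rightarrow> nat \<Rightarrow> nat \<Rightarrow> complex" and e :: real
  assumes decay: "offdiag_decay A"
    and herm: "\<And>t n m. A t m n = cnj (A t n m)"
    and per: "\<And>t n m. A (t + 2 * pi) n m = A t n m"
    and small: "\<And>t n m. cmod (A t n m) \<le> e / (1 + \<bar>real n - real m\<bar>)\<^sup>2"
    and comm: "\<And>t n m. cmod (wshift_comm (A t) n m) \<le> e / (1 + \<bar>real n - real m\<bar>)\<^sup>2"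
    and e: "e \<le> 1 / 10000"
begin

definition B :: "real \<Rightarrow> nat \<Rightarrow> nat \<Rightarrow> complex" where
  "B t n m = SSadj_mat n m + A t n m"

definition solution :: "(real \<Rightarrow> nat \<Rightarrow> complex) \<Rightarrow> bool" where
  "solution \<phi> \<longleftrightarrow> rapid_path \<phi> \<and>
     (\<forall>t n. ((\<lambda>s. \<phi> s n) has_vector_derivative - \<i> * mop (B t) (\<phi> t) n) (at t))"

lemma e_nonneg: "e \<ge> 0"
  using order_trans[OF norm_ge_zero small[of 0 0 0]] by simp

lemma B_decay: "offdiag_decay B"
  unfolding B_def by (rule offdiag_decay_add[OF offdiag_decay_hopping decay])

lemma B_herm: "B t m n = cnj (B t n m)"
  unfolding B_def using herm[of t n m] by (simp add: SSadj_mat_def)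

lemma B_per: "B (t + 2 * pi) = B t"
  unfolding B_def using per by (intro ext) simp

lemma mop_B: "rapid u \<Longrightarrow> mop (B t) u n = hop u n + mop (A t) u n"
  unfolding B_def by (rule mop_hopping_plus[OF decay])

lemma rapid_B: "rapid u \<Longrightarrow> rapid (mop (B t) u)" by (rule rapid_mop[OF B_decay])
lemma rapid_A: "rapid u \<Longrightarrow> rapid (mop (A t) u)" by (rule rapid_mop[OF decay])

lemma nrm_A_le: "rapid u \<Longrightarrow> nrm (mop (A t) u) \<le> 6 * e * nrm u"
  by (rule nrm_mop_le[OF small _ rapid_A])

text \<open>The Hermitian generator drops out of the real part, so only the forcing \<open>f\<close>
  changes the norm. Used with \<open>f = 0\<close> for conservation, with the defect of an
  approximate solution, and with the commutator of the generator and a weight.\<close>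

lemma energy_derivative:
  assumes d: "rapid_path d" and f: "rapid_path f"
    and D: "\<And>t n. ((\<lambda>s. d s n) has_vector_derivative - \<i> * mop (B t) (d t) n + f t n) (at t)"
  shows "((\<lambda>t. nsq (d t)) has_real_derivative 2 * Re (ip (d t) (f t))) (at t)"
proof -
  note R = rapid_pathD[OF d] rapid_pathD[OF f]
  let ?d' = "\<lambda>t n. - \<i> * mop (B t) (d t) n + f t n"
  have r': "rapid_path ?d'"
    by (intro rapid_path_add rapid_path_cmult rapid_path_mop B_decay d f)
  have "((\<lambda>s. ip (d s) (d s)) has_vector_derivative (ip (?d' t) (d t) + ip (d t) (?d' t))) (at t)"
    by (rule ip_has_vector_derivative[OF D D d r' d r'])
  then have "((\<lambda>s. Re (ip (d s) (d s))) has_vector_derivative Re (ip (?d' t) (d t) + ip (d t) (?d' t))) (at t)"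
    by (rule bounded_linear.has_vector_derivative[OF bounded_linear_Re])
  moreover have "Re (ip (d s) (d s)) = nsq (d s)" for s using ip_self[OF R(1)] by simp
  moreover have "Re (ip (?d' t) (d t) + ip (d t) (?d' t)) = 2 * Re (ip (d t) (f t))"
  proof -
    have "ip (d t) (?d' t) = - \<i> * ip (d t) (mop (B t) (d t)) + ip (d t) (f t)"
      by (simp only: ip_add_right ip_cmult_right R rapid_B rapid_scale)
    moreover have "ip (?d' t) (d t) = cnj (ip (d t) (?d' t))"
      using ip_cnj[OF R(1) rapid_pathD[OF r']] by simp
    moreover have "cnj (ip (d t) (mop (B t) (d t))) = ip (d t) (mop (B t) (d t))"
      using ip_cnj[OF R(1) rapid_B[OF R(1)]] ip_mop_hermitian[OF B_decay B_herm R(1) R(1)] by simp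
    ultimately show ?thesis by (simp add: complex_eq_iff)
  qed
  ultimately show ?thesis by (simp add: has_real_derivative_iff_has_vector_derivative)
qed

lemma rapid_zero_path: "rapid_path (\<lambda>t n. 0)"
  by (rule rapid_path_const) (rule rapid_finite_support[of 0], simp)

lemma solution_nsq:
  assumes "solution \<phi>" shows "nsq (\<phi> t) = nsq (\<phi> 0)"
proof -
  have "((\<lambda>t. nsq (\<phi> t)) has_real_derivative 0) (at t)" for t
    using energy_derivative[of \<phi> "\<lambda>_ _. 0" t] assms rapid_zero_path unfolding solution_def
    by (simp add: ip_def)
  then show ?thesis by (intro DERIV_isconst_all) auto
qed

lemma solution_nrm: "solution \<phi> \<Longrightarrow> nrm (\<phi> t) = nrm (\<phi> 0)"
  unfolding nrm_def using solution_nsq by metis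

text \<open>Periodicity of the generator makes the time-shifted path a solution of the same
  equation, and linearity does the rest.\<close>

lemma solution_antiperiodic_part:
  assumes s: "solution \<phi>" shows "solution (\<lambda>t n. \<phi> (t + 2 * pi) n + \<phi> t n)"
  unfolding solution_def
proof (intro conjI allI)
  have r: "rapid_path \<phi>" and D: "\<And>t n. ((\<lambda>s. \<phi> s n) has_vector_derivative - \<i> * mop (B t) (\<phi> t) n) (at t)"
    using s unfolding solution_def by auto
  have r2: "rapid_path (\<lambda>t. \<phi> (t + 2 * pi))" by (rule rapid_path_shift[OF r])
  show "rapid_path (\<lambda>t n. \<phi> (t + 2 * pi) n + \<phi> t n)" by (rule rapid_path_add[OF r2 r])
  fix t n
  have "((\<lambda>s. \<phi> (s + 2 * pi) n) has_vector_derivative - \<i> * mop (B (t + 2 * pi)) (\<phi> (t + 2 * pi)) n) (at t)"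
    by (rule has_vector_derivative_translate[OF D])
  then have "((\<lambda>s. \<phi> (s + 2 * pi) n + \<phi> s n) has_vector_derivative
      - \<i> * mop (B t) (\<phi> (t + 2 * pi)) n + - \<i> * mop (B t) (\<phi> t) n) (at t)"
    unfolding B_per by (intro has_vector_derivative_add D)
  moreover have "mop (B t) (\<lambda>n. \<phi> (t + 2 * pi) n + \<phi> t n) n = mop (B t) (\<phi> (t + 2 * pi)) n + mop (B t) (\<phi> t) n"
    using mop_add[OF B_decay rapid_pathD[OF r2] rapid_pathD[OF r], of t t t] by simp
  ultimately show "((\<lambda>s. \<phi> (s + 2 * pi) n + \<phi> s n) has_vector_derivative
      - \<i> * mop (B t) (\<lambda>n. \<phi> (t + 2 * pi) n + \<phi> t n) n) (at t)"
    by (simp add: distrib_left)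
qed

section \<open>The increasing quantity and its gain per period\<close>

definition Q :: "(nat \<Rightarrow> complex) \<Rightarrow> real" where
  "Q u = - 2 * Re (ip u (\<lambda>n. hop (wshift u) n - wshift (hop u) n))"

definition Y :: "(nat \<Rightarrow> complex) \<Rightarrow> real" where
  "Y u = - 2 * Im (ip u (wshift u))"

lemma Q_ge: "rapid u \<Longrightarrow> (nrm (hop_defect u))\<^sup>2 \<le> 4 * Q u"
  unfolding Q_def using nsq_hop_defect_le nrm_sq[OF rapid_hop_defect] by simp

lemma Q_nonneg: "rapid u \<Longrightarrow> Q u \<ge> 0"
  using order_trans[OF zero_le_power2 Q_ge] by simp

lemma mop_wshift_comm:
  assumes u: "rapid u"
  shows "mop (wshift_comm (A t)) u n = mop (A t) (wshift u) n - wshift (mop (A t) u) n"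
proof -
  obtain C where C: "C > 0" "\<And>t n m. cmod (A t n m) \<le> C" using offdiag_decay_bounded[OF decay] by blast
  \<comment> \<open>\<open>wshift\<close> reads the next entry, so its row sum is one over
    \<open>u (Suc m)\<close>. A vanishing term at index 0 turns it into a sum over
    \<open>u m\<close>.\<close>
  define f where "f m = (if m = 0 then 0 else A t n (m - 1) * complex_of_real (real m + 1/2)) * u m" for m
  have "(\<lambda>m. A t n m * wshift u m) sums mop (A t) (wshift u) n"
    using C rapid_wshift[OF u] by (intro mop_sums[of "A t" n C]) auto
  moreover have "(\<lambda>m. A t n m * wshift u m) = (\<lambda>m. f (Suc m))"
    by (rule ext) (simp add: f_def wshift_def of_nat_Suc field_simps)
  moreover have "f 0 = 0" by (simp add: f_def)
  ultimately have "f sums mop (A t) (wshift u) n"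
    using sums_Suc_imp[of f] by simp
  moreover have "(\<lambda>m. complex_of_real (real n + 3/2) * (A t (Suc n) m * u m)) sums wshift (mop (A t) u) n"
    unfolding wshift_def using C u by (intro sums_mult mop_sums[of "A t" "Suc n" C]) auto
  ultimately have "(\<lambda>m. f m - complex_of_real (real n + 3/2) * (A t (Suc n) m * u m)) sums
      (mop (A t) (wshift u) n - wshift (mop (A t) u) n)" by (rule sums_diff)
  moreover have "f m - complex_of_real (real n + 3/2) * (A t (Suc n) m * u m) = wshift_comm (A t) n m * u m" for m
    by (simp only: f_def wshift_comm_def left_diff_distrib mult.assoc)
  ultimately show ?thesis unfolding mop_def[of "wshift_comm (A t)"] by (simp add: sums_iff)
qed

lemma rapid_wshift_comm: "rapid u \<Longrightarrow> rapid (mop (wshift_comm (A t)) u)"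
proof -
  assume u: "rapid u"
  have "mop (wshift_comm (A t)) u = (\<lambda>n. mop (A t) (wshift u) n - wshift (mop (A t) u) n)"
    by (rule ext) (rule mop_wshift_comm[OF u])
  then show ?thesis by (simp add: rapid_diff rapid_A rapid_wshift u)
qed

text \<open>The derivative of \<open>\<langle>\<phi>, \<Gamma>\<phi>\<rangle>\<close> is
  \<open>\<i>\<close> times the expectation of the commutator of generator and
  \<open>\<Gamma>\<close>. The hopping part of that commutator gives \<open>Q\<close>, the part of
  \<open>A\<close> the error.\<close>

lemma Y_derivative:
  assumes s: "solution \<phi>"
  shows "((\<lambda>t. Y (\<phi> t)) has_real_derivative
     (Q (\<phi> t) - 2 * Re (ip (\<phi> t) (mop (wshift_comm (A t)) (\<phi> t))))) (at t)"
proof -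
  have r: "rapid_path \<phi>" and D: "\<And>t n. ((\<lambda>s. \<phi> s n) has_vector_derivative - \<i> * mop (B t) (\<phi> t) n) (at t)"
    using s unfolding solution_def by auto
  let ?d = "\<lambda>t n. - \<i> * mop (B t) (\<phi> t) n"
  have rd: "rapid_path ?d" by (intro rapid_path_cmult rapid_path_mop B_decay r)
  have Dw: "((\<lambda>s. wshift (\<phi> s) n) has_vector_derivative wshift (?d t) n) (at t)" for t n
    unfolding wshift_def by (intro has_vector_derivative_mult_right D)
  note R = rapid_pathD[OF r, of t]
  let ?u = "\<phi> t" and ?b = "mop (B t) (\<phi> t)"
  let ?z = "ip ?u (\<lambda>n. (hop (wshift ?u) n - wshift (hop ?u) n) + mop (wshift_comm (A t)) ?u n)"
  have "ip (?d t) (wshift ?u) + ip ?u (wshift (?d t)) = \<i> * ?z"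
  proof -
    have "ip (?d t) (wshift ?u) = \<i> * ip ?b (wshift ?u)"
      using ip_cmult_left[OF rapid_B[OF R, of t] rapid_wshift[OF R], of "- \<i>"] by simp
    also have "ip ?b (wshift ?u) = ip ?u (mop (B t) (wshift ?u))"
      by (rule ip_mop_hermitian[OF B_decay B_herm R rapid_wshift[OF R], symmetric])
    finally have 1: "ip (?d t) (wshift ?u) = \<i> * ip ?u (mop (B t) (wshift ?u))" .
    have "wshift (?d t) = (\<lambda>n. - \<i> * wshift ?b n)" by (rule ext) (simp add: wshift_def)
    then have 2: "ip ?u (wshift (?d t)) = - \<i> * ip ?u (wshift ?b)"
      using ip_cmult_right[OF R rapid_wshift[OF rapid_B[OF R, of t]], of "- \<i>"] by simp
    have "ip ?u (mop (B t) (wshift ?u)) - ip ?u (wshift ?b) = ip ?u (\<lambda>n. mop (B t) (wshift ?u) n - wshift ?b n)"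
      by (rule ip_diff_right[symmetric]) (intro R rapid_B rapid_wshift)+
    also have "(\<lambda>n. mop (B t) (wshift ?u) n - wshift ?b n)
        = (\<lambda>n. (hop (wshift ?u) n - wshift (hop ?u) n) + mop (wshift_comm (A t)) ?u n)"
      by (rule ext) (simp add: mop_B[OF R] mop_B[OF rapid_wshift[OF R]] mop_wshift_comm[OF R] wshift_def algebra_simps)
    finally show ?thesis using 1 2 by (simp add: right_diff_distrib[symmetric])
  qed
  then have "((\<lambda>s. ip (\<phi> s) (wshift (\<phi> s))) has_vector_derivative (\<i> * ?z)) (at t)"
    using ip_has_vector_derivative[OF D Dw r rd rapid_path_wshift[OF r] rapid_path_wshift[OF rd], of t] by simp
  then have "((\<lambda>s. Im (ip (\<phi> s) (wshift (\<phi> s)))) has_vector_derivative Im (\<i> * ?z)) (at t)"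
    by (rule bounded_linear.has_vector_derivative[OF bounded_linear_Im])
  then have dY: "((\<lambda>s. - 2 * Im (ip (\<phi> s) (wshift (\<phi> s)))) has_vector_derivative (- 2 * Re ?z)) (at t)"
    using has_vector_derivative_mult_right[of _ "Im (\<i> * ?z)" "at t" "-2"] by simp
  have zeq: "?z = ip ?u (\<lambda>n. hop (wshift ?u) n - wshift (hop ?u) n) + ip ?u (mop (wshift_comm (A t)) ?u)"
    by (rule ip_add_right) (intro R rapid_diff rapid_hop rapid_wshift rapid_wshift_comm)+
  have "- 2 * Re ?z = Q ?u - 2 * Re (ip ?u (mop (wshift_comm (A t)) ?u))"
    unfolding zeq Q_def by simp
  with dY show ?thesis
    unfolding Y_def has_real_derivative_iff_has_vector_derivative by metis
qed

lemma comm_form_le: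
  assumes "rapid u" "nrm u = 1" shows "\<bar>2 * Re (ip u (mop (wshift_comm (A t)) u))\<bar> \<le> 12 * e"
  using schur_bound[OF comm assms(1) assms(1) rapid_wshift_comm[OF assms(1)], of t] assms(2)
    abs_Re_le_cmod[of "ip u (mop (wshift_comm (A t)) u)"] by simp

text \<open>\<open>H + 2\<sigma>\<close>, which annihilates the edge \<open>-2\<sigma>\<close> and
  so isolates the edge \<open>2\<sigma>\<close>. The difference between the two signs is four times
  the vector, so both edges together recover all of it.\<close>

definition chi :: "real \<Rightarrow> (nat \<Rightarrow> complex) \<Rightarrow> nat \<Rightarrow> complex" where
  "chi \<sigma> u n = hop u n + complex_of_real (2 * \<sigma>) * u n"

lemma rapid_chi: "rapid u \<Longrightarrow> rapid (chi \<sigma> u)"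
  unfolding chi_def by (intro rapid_add rapid_hop rapid_scale)

lemma rapid_path_chi: "rapid_path f \<Longrightarrow> rapid_path (\<lambda>t. chi \<sigma> (f t))"
  unfolding chi_def by (intro rapid_path_add rapid_path_hop rapid_path_cmult)

text \<open>At the spectral edges \<open>\<plusminus>2\<close> of the hopping operator the period \<open>2\<pi>\<close> is a full period of the
  phase, so \<open>cis (2\<sigma>t) \<chi>\<^sub>\<sigma>\<close> moves only through \<open>(4 - H\<^sup>2)\<phi>\<close> and the perturbation.\<close>

lemma chi_step:
  assumes s: "solution \<phi>" and n1: "nrm (\<phi> 0) = 1" and v: "rapid v" and \<sigma>: "\<sigma> * \<sigma> = 1"
  shows "cmod (ip v (chi \<sigma> (\<phi> (t + 2 * pi))) - ip v (chi \<sigma> (\<phi> t)))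
    \<le> nrm v * ((1/4 + 72 * e) * (2 * pi) + 4 * (Y (\<phi> (t + 2 * pi)) - Y (\<phi> t)))"
proof -
  define dd where "dd = (\<lambda>t n. - \<i> * mop (B t) (\<phi> t) n)"
  have r: "rapid_path \<phi>" and D: "\<And>t n. ((\<lambda>s. \<phi> s n) has_vector_derivative dd t n) (at t)"
    using s unfolding solution_def dd_def by auto
  note R = rapid_pathD[OF r]
  have nn: "nrm (\<phi> s) = 1" for s using solution_nrm[OF s] n1 by simp
  have rd: "rapid_path dd" unfolding dd_def by (intro rapid_path_cmult rapid_path_mop B_decay r)
  have Dc: "((\<lambda>s. chi \<sigma> (\<phi> s) n) has_vector_derivative chi \<sigma> (dd t) n) (at t)" for t n
  proof -
    have "((\<lambda>s. if n = 0 then 0 else \<phi> s (n - 1)) has_vector_derivative (if n = 0 then 0 else dd t (n - 1))) (at t)"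
      using D[of "n - 1" t] by (cases "n = 0") simp_all
    then show ?thesis
      unfolding chi_def hop_def by (intro has_vector_derivative_add has_vector_derivative_mult_right D)
  qed
  define F where "F s = cis (2 * \<sigma> * s) * ip v (chi \<sigma> (\<phi> s))" for s
  define E where "E s = (\<lambda>n. hop_defect (\<phi> s) n - (hop (mop (A s) (\<phi> s)) n + complex_of_real (2 * \<sigma>) * mop (A s) (\<phi> s) n))" for s
  have rE: "rapid (E s)" for s
    unfolding E_def by (intro rapid_diff rapid_add rapid_scale rapid_hop rapid_hop_defect rapid_A R)
  have DF: "(F has_vector_derivative (cis (2 * \<sigma> * s) * (\<i> * ip v (E s)))) (at s)" for s
  proof -
    have "((\<lambda>s. ip v (chi \<sigma> (\<phi> s))) has_vector_derivative (ip (\<lambda>n. 0) (chi \<sigma> (\<phi> s)) + ip v (chi \<sigma> (dd s)))) (at s)"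
      by (rule ip_has_vector_derivative[where f = "\<lambda>_. v" and f' = "\<lambda>_ _. 0", OF _ Dc])
         (auto intro!: rapid_path_const v rapid_zero_path rapid_path_chi r rd)
    then have d1: "((\<lambda>s. ip v (chi \<sigma> (\<phi> s))) has_vector_derivative (ip v (chi \<sigma> (dd s)))) (at s)"
      by (simp add: ip_def)
    have "(F has_vector_derivative (cis (2 * \<sigma> * s) * ip v (chi \<sigma> (dd s))
        + \<i> * complex_of_real (2 * \<sigma>) * cis (2 * \<sigma> * s) * ip v (chi \<sigma> (\<phi> s)))) (at s)"
      unfolding F_def by (intro has_vector_derivative_mult has_vector_derivative_cis_mult d1)
    moreover have "ip v (chi \<sigma> (dd s)) + \<i> * complex_of_real (2 * \<sigma>) * ip v (chi \<sigma> (\<phi> s)) = \<i> * ip v (E s)"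
    proof -
      have "ip v (chi \<sigma> (dd s)) + \<i> * complex_of_real (2 * \<sigma>) * ip v (chi \<sigma> (\<phi> s))
          = ip v (\<lambda>n. chi \<sigma> (dd s) n + \<i> * complex_of_real (2 * \<sigma>) * chi \<sigma> (\<phi> s) n)"
        using v by (subst ip_add_right) (auto intro!: rapid_chi rapid_scale R rapid_pathD[OF rd] simp: ip_cmult_right rapid_chi R)
      \<comment> \<open>The factorisation
        \<open>(2\<sigma> - H)(2\<sigma> + H) = 4 - H\<^sup>2\<close>, by
        \<open>\<sigma> * \<sigma> = 1\<close>; what remains is \<open>H + 2\<sigma>\<close> applied
        to the perturbation.\<close>
      also have "(\<lambda>n. chi \<sigma> (dd s) n + \<i> * complex_of_real (2 * \<sigma>) * chi \<sigma> (\<phi> s) n) = (\<lambda>n. \<i> * E s n)"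
      proof
        fix n
        have \<sigma>c: "complex_of_real \<sigma> * (complex_of_real \<sigma> * z) = z" for z
          using \<sigma> by (metis mult.assoc mult.left_neutral of_real_1 of_real_mult)
        show "chi \<sigma> (dd s) n + \<i> * complex_of_real (2 * \<sigma>) * chi \<sigma> (\<phi> s) n = \<i> * E s n"
          unfolding chi_def E_def hop_defect_def hop_def dd_def mop_B[OF R]
          by (cases n) (simp_all add: algebra_simps \<sigma>c)
      qed
      also have "ip v (\<lambda>n. \<i> * E s n) = \<i> * ip v (E s)" by (rule ip_cmult_right[OF v rE])
      finally show ?thesis .
    qed
    moreover have "cis (2 * \<sigma> * s) * ip v (chi \<sigma> (dd s))
        + \<i> * complex_of_real (2 * \<sigma>) * cis (2 * \<sigma> * s) * ip v (chi \<sigma> (\<phi> s))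
        = cis (2 * \<sigma> * s) * (ip v (chi \<sigma> (dd s)) + \<i> * complex_of_real (2 * \<sigma>) * ip v (chi \<sigma> (\<phi> s)))"
      by (simp add: algebra_simps)
    ultimately show ?thesis by (simp only:)
  qed
  define Y' where "Y' s = Q (\<phi> s) - 2 * Re (ip (\<phi> s) (mop (wshift_comm (A s)) (\<phi> s)))" for s
  have DY: "((\<lambda>s. Y (\<phi> s)) has_real_derivative Y' s) (at s)" for s
    unfolding Y'_def by (rule Y_derivative[OF s])
  have bnd: "cmod (cis (2 * \<sigma> * s) * (\<i> * ip v (E s))) \<le> nrm v * (1/4 + 72 * e + 4 * Y' s)" for s
  proof -
    let ?a = "mop (A s) (\<phi> s)"
    have \<sigma>1: "\<bar>\<sigma>\<bar> = 1" using \<sigma> by (metis abs_minus_cancel abs_one square_eq_1_iff)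
    have na: "nrm ?a \<le> 6 * e" using nrm_A_le[OF R, of s s] nn by simp
    have rn: "rapid (\<lambda>n. hop ?a n + complex_of_real (2 * \<sigma>) * ?a n)"
      by (intro rapid_add rapid_scale rapid_hop rapid_A R)
    have "nrm (\<lambda>n. hop ?a n + complex_of_real (2 * \<sigma>) * ?a n) \<le> nrm (hop ?a) + nrm (\<lambda>n. complex_of_real (2 * \<sigma>) * ?a n)"
      by (intro nrm_triangle rapid_scale rapid_hop rapid_A R)
    also have "\<dots> \<le> 2 * nrm ?a + 2 * nrm ?a"
      using nrm_hop_le[OF rapid_A[OF R], of s s] nrm_cmult[OF rapid_A[OF R], of "complex_of_real (2 * \<sigma>)" s s] \<sigma>1
      by (simp add: norm_mult)
    finally have n2: "nrm (\<lambda>n. hop ?a n + complex_of_real (2 * \<sigma>) * ?a n) \<le> 24 * e" using na by simp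
    have n3: "nrm (E s) \<le> nrm (hop_defect (\<phi> s)) + 24 * e"
      using nrm_diff_le[OF rapid_hop_defect[OF R] rn, of s] n2 unfolding E_def by linarith
    have "(nrm (hop_defect (\<phi> s)))\<^sup>2 \<le> 4 * Q (\<phi> s)" by (rule Q_ge[OF R])
    \<comment> \<open>\<open>x \<le> 1/4 + x\<^sup>2\<close> replaces the norm by its square and
      hence by \<open>Q\<close>, the rate of \<open>Y\<close>. The speed of \<open>chi\<close> thus
      becomes an exact derivative plus a constant, which can be integrated over a period.\<close>
    moreover have "0 \<le> (nrm (hop_defect (\<phi> s)) - 1/2)\<^sup>2" by simp
    ultimately have n4: "nrm (hop_defect (\<phi> s)) \<le> 1/4 + 4 * Q (\<phi> s)" 
      by (simp add: power2_eq_square algebra_simps)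
    \<comment> \<open>Replacing \<open>4 * Q\<close> by \<open>4 * Y'\<close> costs 48e, in addition
      to the 24e of the perturbation: together 72e.\<close>
    have "Q (\<phi> s) \<le> Y' s + 12 * e" using comm_form_le[OF R nn, of s s] unfolding Y'_def by simp
    then have "nrm (E s) \<le> 1/4 + 72 * e + 4 * Y' s" using n3 n4 by simp
    moreover have "cmod (ip v (E s)) \<le> nrm v * nrm (E s)" by (rule ip_Cauchy_Schwarz[OF v rE])
    ultimately show ?thesis
      using mult_left_mono[OF _ nrm_nonneg[OF v]] by (fastforce simp: norm_mult intro: order_trans)
  qed
  \<comment> \<open>A real primitive of the speed bound, so that the increment of \<open>F\<close>
    is at most the increment of \<open>G\<close>.\<close>
  define G where "G s = nrm v * ((1/4 + 72 * e) * s + 4 * Y (\<phi> s))" for s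
  have DG: "(G has_vector_derivative (nrm v * (1/4 + 72 * e + 4 * Y' s))) (at s)" for s
    unfolding G_def has_real_derivative_iff_has_vector_derivative[symmetric]
    by (auto intro!: derivative_eq_intros DY)
  have cF: "continuous_on S F" for S
    using DF by (meson continuous_at_imp_continuous_on has_vector_derivative_continuous)
  have cG: "continuous_on S G" for S
    using DG by (meson continuous_at_imp_continuous_on has_vector_derivative_continuous)
  have "norm (F (t + 2 * pi) - F t) \<le> G (t + 2 * pi) - G t"
    by (rule differentiable_bound_general[OF _ cF cG DF DG bnd]) simp
  \<comment> \<open>Over one period the edge phase turns by \<open>4 * pi\<close> up to sign, so the
    increment of \<open>F\<close> is that of \<open>chi\<close> itself.\<close>
  moreover have cc: "cis (2 * \<sigma> * (t + 2 * pi)) = cis (2 * \<sigma> * t)"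
  proof -
    have "\<sigma> = 1 \<or> \<sigma> = -1" using \<sigma> by (metis square_eq_1_iff)
    moreover have "cis (4 * pi) = 1" "cis (- (4 * pi)) = 1"
      using cis_multiple_2pi[of 2] cis_multiple_2pi[of "-2"] by (simp_all add: mult.commute)
    ultimately show ?thesis by (auto simp: distrib_left cis_mult[symmetric])
  qed
  moreover have "F (t + 2 * pi) - F t = cis (2 * \<sigma> * t) * (ip v (chi \<sigma> (\<phi> (t + 2 * pi))) - ip v (chi \<sigma> (\<phi> t)))"
    unfolding F_def cc by (simp only: right_diff_distrib)
  moreover have "G (t + 2 * pi) - G t = nrm v * ((1/4 + 72 * e) * (2 * pi) + 4 * (Y (\<phi> (t + 2 * pi)) - Y (\<phi> t)))"
    unfolding G_def by (simp add: algebra_simps)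
  ultimately show ?thesis by (simp only: norm_mult norm_cis mult_1_left)
qed

text \<open>The difference \<open>v\<close> of the states at the two ends of the period has norm
  almost 2, because their sum is small and each has norm 1. But \<open>4v\<close> is the difference
  of the increments of \<open>chi 1\<close> and \<open>chi (-1)\<close>, and \<open>chi_step\<close>
  with test vector \<open>v\<close> bounds these by the gain of \<open>Y\<close>: a small gain would
  keep \<open>v\<close> small.\<close>

lemma period_gain:
  assumes s: "solution \<phi>" and n1: "nrm (\<phi> 0) = 1"
    and ap: "nrm (\<lambda>n. \<phi> (2 * pi) n + \<phi> 0 n) \<le> 1/10"
  shows "Y (\<phi> (t + 2 * pi)) - Y (\<phi> t) \<ge> 2/5"
proof -
  have r: "rapid_path \<phi>" using s unfolding solution_def by auto
  note R = rapid_pathD[OF r]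
  define b where "b = t + 2 * pi"
  define v where "v = (\<lambda>n. \<phi> b n - \<phi> t n)"
  have v: "rapid v" unfolding v_def by (intro rapid_diff R)
  have nt: "nrm (\<phi> t) = 1" using solution_nrm[OF s] n1 by simp
  have "nrm (\<lambda>n. \<phi> b n + \<phi> t n) \<le> 1/10"
    using solution_nrm[OF solution_antiperiodic_part[OF s], of t] ap unfolding b_def by simp
  moreover have "nrm (\<lambda>n. 2 * \<phi> t n) \<le> nrm (\<lambda>n. \<phi> b n + \<phi> t n) + nrm v"
    using nrm_diff_le[OF rapid_add[OF R R] v, of b t] by (simp add: v_def)
  moreover have "nrm (\<lambda>n. 2 * \<phi> t n) = 2" using nrm_cmult[OF R, of 2 t] nt by simp
  ultimately have nv: "nrm v \<ge> 19/10" by simp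
  let ?K = "(1/4 + 72 * e) * (2 * pi) + 4 * (Y (\<phi> b) - Y (\<phi> t))"
  have c4: "ip v (chi 1 (\<phi> s)) - ip v (chi (-1) (\<phi> s)) = 4 * ip v (\<phi> s)" for s
  proof -
    have "ip v (chi 1 (\<phi> s)) - ip v (chi (-1) (\<phi> s)) = ip v (\<lambda>n. chi 1 (\<phi> s) n - chi (-1) (\<phi> s) n)"
      by (rule ip_diff_right[symmetric]) (intro v rapid_chi R)+
    also have "(\<lambda>n. chi 1 (\<phi> s) n - chi (-1) (\<phi> s) n) = (\<lambda>n. 4 * \<phi> s n)"
      by (rule ext) (simp add: chi_def)
    also have "ip v \<dots> = 4 * ip v (\<phi> s)" by (rule ip_cmult_right[OF v R])
    finally show ?thesis .
  qed
  have "complex_of_real (4 * nsq v) = 4 * (ip v (\<phi> b) - ip v (\<phi> t))"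
    using ip_diff_right[OF v R R, of b t] ip_self[OF v] unfolding v_def[symmetric] by simp
  also have "\<dots> = (ip v (chi 1 (\<phi> b)) - ip v (chi 1 (\<phi> t))) - (ip v (chi (-1) (\<phi> b)) - ip v (chi (-1) (\<phi> t)))"
    using c4[of b] c4[of t] by (simp add: algebra_simps)
  finally have eq: "complex_of_real (4 * nsq v) = \<dots>" .
  have "4 * nsq v = cmod (complex_of_real (4 * nsq v))" using nsq_nonneg[OF v] by simp
  also have "\<dots> \<le> cmod (ip v (chi 1 (\<phi> b)) - ip v (chi 1 (\<phi> t))) + cmod (ip v (chi (-1) (\<phi> b)) - ip v (chi (-1) (\<phi> t)))"
    unfolding eq by (rule norm_triangle_ineq4)
  also have "\<dots> \<le> nrm v * ?K + nrm v * ?K"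
    unfolding b_def by (intro add_mono chi_step[OF s n1 v]) auto
  finally have "nrm v * (2 * nrm v) \<le> nrm v * ?K"
    using nrm_sq[OF v] by (simp add: power2_eq_square)
  then have K: "2 * nrm v \<le> ?K" using nv by simp
  \<comment> \<open>\<open>2 * nrm v\<close> is at least 38/10 and \<open>P\<close> at most 21/10;
    the remaining 17/10 exceeds the 8/5 that four times the claimed gain requires.\<close>
  define P where "P = (1/4 + 72 * e) * (2 * pi)"
  have "P \<le> (1/4 + 72 / 10000) * (2 * 4)"
    unfolding P_def using e e_nonneg pi_less_4 by (intro mult_mono) auto
  also have "\<dots> \<le> 21/10" by simp
  finally have "P \<le> 21/10" .
  moreover define y where "y = Y (\<phi> b) - Y (\<phi> t)"
  ultimately have "2/5 \<le> y" using nv K[folded P_def y_def] by linarith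
  then show ?thesis unfolding y_def b_def .
qed

text \<open>A gain of 2/5 per period of length below 8 gives the slope 1/20. Inside a period
  \<open>Y\<close> can fall only through the commutator error, at rate at most 12e, and the constant
  2 absorbs this loss together with the incomplete last period.\<close>

lemma Y_lower_bound:
  assumes s: "solution \<phi>" and n1: "nrm (\<phi> 0) = 1"
    and ap: "nrm (\<lambda>n. \<phi> (2 * pi) n + \<phi> 0 n) \<le> 1/10" and t: "t \<ge> 0"
  shows "Y (\<phi> t) \<ge> Y (\<phi> 0) - 2 + t / 20"
proof -
  have R: "rapid (\<phi> s)" for s using s unfolding solution_def by (auto intro: rapid_pathD)
  have nn: "nrm (\<phi> s) = 1" for s using solution_nrm[OF s] n1 by simp
  define k where "k = nat \<lfloor>t / (2 * pi)\<rfloor>"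
  have k1: "real k \<le> t / (2 * pi)" using t unfolding k_def by (intro of_nat_floor) simp
  have k2: "t / (2 * pi) \<le> real k + 1" unfolding k_def by linarith
  from k1 k2 have k3: "real k * (2 * pi) \<le> t" "t - real k * (2 * pi) \<le> 2 * pi"
    using pi_gt_zero by (auto simp: field_simps)
  have Yk: "Y (\<phi> (real j * (2 * pi))) \<ge> Y (\<phi> 0) + (2/5) * real j" for j
  proof (induction j)
    case (Suc j)
    have eq: "real (Suc j) * (2 * pi) = real j * (2 * pi) + 2 * pi" by (simp add: of_nat_Suc algebra_simps)
    have "Y (\<phi> 0) + (2/5) * real (Suc j) = Y (\<phi> 0) + (2/5) * real j + 2/5" by (simp add: of_nat_Suc)
    then show ?case using Suc period_gain[OF s n1 ap, of "real j * (2 * pi)"] unfolding eq by linarith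
  qed simp
  have "Y (\<phi> (real k * (2 * pi))) + 12 * e * (real k * (2 * pi)) \<le> Y (\<phi> t) + 12 * e * t"
  proof (rule DERIV_nonneg_imp_nondecreasing[OF k3(1)])
    fix x
    have "((\<lambda>t. Y (\<phi> t) + 12 * e * t) has_real_derivative
        (Q (\<phi> x) - 2 * Re (ip (\<phi> x) (mop (wshift_comm (A x)) (\<phi> x))) + 12 * e)) (at x)"
      by (auto intro!: derivative_eq_intros Y_derivative[OF s])
    moreover have "Q (\<phi> x) - 2 * Re (ip (\<phi> x) (mop (wshift_comm (A x)) (\<phi> x))) + 12 * e \<ge> 0"
      using Q_nonneg[OF R[of x]] comm_form_le[OF R[of x] nn[of x], of x] by linarith
    ultimately show "\<exists>y. ((\<lambda>t. Y (\<phi> t) + 12 * e * t) has_real_derivative y) (at x) \<and> 0 \<le> y" by blast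
  qed
  then have "Y (\<phi> t) \<ge> Y (\<phi> (real k * (2 * pi))) - 12 * e * (t - real k * (2 * pi))"
    by (simp add: algebra_simps)
  moreover have "12 * e * (t - real k * (2 * pi)) \<le> 12 * (1/10000) * (2 * 4)"
    using e e_nonneg k3 pi_less_4 by (intro mult_mono) auto
  moreover have "real k \<ge> t / 8 - 1"
  proof -
    have "t / 8 \<le> t / (2 * pi)" using t pi_less_4 pi_gt_zero by (intro divide_left_mono) auto
    then show ?thesis using k2 by simp
  qed
  ultimately show ?thesis using Yk[of k] by simp
qed

text \<open>The initial vector is nearly an eigenvector of \<open>H\<close> with eigenvalue 1/2, so
  \<open>cis (- t / 2)\<close> times it solves the equation up to a forcing of norm at most 1/100 +
  6e. The difference starts at 0 and stays below 1/10 for time \<open>2 * pi\<close>, when the phase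
  has become -1.\<close>

lemma almost_antiperiodic:
  assumes s: "solution \<phi>" and n1: "nrm (\<phi> 0) = 1"
    and q: "nrm (\<lambda>n. hop (\<phi> 0) n - 1/2 * \<phi> 0 n) \<le> 1/100"
  shows "nrm (\<lambda>n. \<phi> (2 * pi) n + \<phi> 0 n) \<le> 1/10"
proof -
  have r: "rapid_path \<phi>" and D: "\<And>t n. ((\<lambda>s. \<phi> s n) has_vector_derivative - \<i> * mop (B t) (\<phi> t) n) (at t)"
    using s unfolding solution_def by auto
  note R = rapid_pathD[OF r]
  let ?u = "\<phi> 0"
  define c where "c t = cis ((-1/2) * t)" for t
  have cc: "continuous_on UNIV c" unfolding c_def by (intro continuous_intros)
  define d where "d t n = \<phi> t n - c t * ?u n" for t n
  define f where "f t n = - \<i> * c t * (mop (B t) ?u n - 1/2 * ?u n)" for t n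
  have rc: "rapid_path (\<lambda>t n. c t * ?u n)" by (intro rapid_path_scale rapid_path_const R cc)
  have rd: "rapid_path d" unfolding d_def by (intro rapid_path_diff r rc)
  have rb: "rapid_path (\<lambda>t n. mop (B t) ?u n - 1/2 * ?u n)"
    by (intro rapid_path_diff rapid_path_mop[OF B_decay] rapid_path_const rapid_path_cmult R)
  have rf: "rapid_path f" unfolding f_def by (rule rapid_path_scale[OF rb]) (intro continuous_intros cc)
  have Dd: "((\<lambda>s. d s n) has_vector_derivative - \<i> * mop (B t) (d t) n + f t n) (at t)" for t n
  proof -
    have "((\<lambda>s. d s n) has_vector_derivative - \<i> * mop (B t) (\<phi> t) n - (\<i> * complex_of_real (-1/2) * c t) * ?u n) (at t)"
      unfolding d_def c_def by (intro has_vector_derivative_diff D has_vector_derivative_mult_left has_vector_derivative_cis_mult)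
    moreover have "mop (B t) (d t) n = mop (B t) (\<phi> t) n - c t * mop (B t) ?u n"
    proof -
      have "mop (B t) (\<lambda>n. d t n + c t * ?u n) = (\<lambda>n. mop (B t) (d t) n + mop (B t) (\<lambda>n. c t * ?u n) n)"
        by (rule mop_add[OF B_decay rapid_pathD[OF rd] rapid_pathD[OF rc]])
      then show ?thesis using mop_cmult[OF B_decay R, of t "c t" 0] by (simp add: d_def fun_eq_iff)
    qed
    moreover have "- \<i> * mop (B t) (\<phi> t) n - (\<i> * complex_of_real (-1/2) * c t) * ?u n
        = - \<i> * (mop (B t) (\<phi> t) n - c t * mop (B t) ?u n) + f t n"
      by (simp add: f_def algebra_simps)
    ultimately show ?thesis by (simp only:)
  qed
  have nf: "nrm (f t) \<le> 1/100 + 6 * e" for t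
  proof -
    have "nrm (f t) = nrm (\<lambda>n. mop (B t) ?u n - 1/2 * ?u n)"
      unfolding f_def using nrm_cmult[OF rapid_pathD[OF rb], of "- \<i> * c t" t] by (simp add: norm_mult c_def)
    also have "(\<lambda>n. mop (B t) ?u n - 1/2 * ?u n) = (\<lambda>n. (hop ?u n - 1/2 * ?u n) + mop (A t) ?u n)"
      by (rule ext) (simp add: mop_B[OF R])
    also have "nrm \<dots> \<le> nrm (\<lambda>n. hop ?u n - 1/2 * ?u n) + nrm (mop (A t) ?u)"
      by (intro nrm_triangle rapid_diff rapid_scale rapid_hop rapid_A R)
    also have "\<dots> \<le> 1/100 + 6 * e" using q nrm_A_le[OF R, of t 0] n1 by simp
    finally show ?thesis .
  qed
  have "sqrt (nsq (d (2 * pi))) \<le> sqrt (nsq (d 0)) + (1/100 + 6 * e) * (2 * pi)"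
  proof (rule sqrt_growth)
    show "((\<lambda>t. nsq (d t)) has_real_derivative 2 * Re (ip (d t) (f t))) (at t)" for t
      by (rule energy_derivative[OF rd rf Dd])
    show "nsq (d t) \<ge> 0" for t by (rule nsq_nonneg[OF rapid_pathD[OF rd]])
    show "2 * Re (ip (d t) (f t)) \<le> 2 * (1/100 + 6 * e) * sqrt (nsq (d t))" for t
    proof -
      have "Re (ip (d t) (f t)) \<le> nrm (d t) * nrm (f t)"
        using ip_Cauchy_Schwarz[OF rapid_pathD[OF rd] rapid_pathD[OF rf], of t t] complex_Re_le_cmod order_trans by blast
      also have "\<dots> \<le> nrm (d t) * (1/100 + 6 * e)"
        by (intro mult_left_mono nf nrm_nonneg rapid_pathD[OF rd])
      finally show ?thesis unfolding nrm_def by (simp add: algebra_simps)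
    qed
  qed (use e_nonneg in auto)
  moreover have "d 0 = (\<lambda>n. 0)" by (rule ext) (simp add: d_def c_def)
  moreover have "d (2 * pi) = (\<lambda>n. \<phi> (2 * pi) n + \<phi> 0 n)"
  proof -
    have "cis (- pi) = -1" by (simp add: complex_eq_iff)
    then show ?thesis by (intro ext) (simp add: d_def c_def)
  qed
  moreover have "(1/100 + 6 * e) * (2 * pi) \<le> (1/100 + 6 * (1/10000)) * (2 * 4)"
    using e e_nonneg pi_less_4 by (intro mult_mono) auto
  ultimately show ?thesis by (simp add: nrm_def nsq_def)
qed

text \<open>\<open>wshift\<close> has the size of one power of \<open>K0_eig\<close>, so growth of
  \<open>Y\<close> forces growth of the first moment.\<close>

lemma Y_le_first_moment:
  assumes u: "rapid u" shows "summable (\<lambda>n. K0_eig n * (cmod (u n))\<^sup>2)" "Y u \<le> 4 * (\<Sum>n. K0_eig n * (cmod (u n))\<^sup>2)"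
proof -
  have r1: "rapid (\<lambda>n. complex_of_real (K0_eig n) * u n)"
    unfolding rapid_iff_rapid_on
    by (rule rapid_on_dominated[OF u[unfolded rapid_iff_rapid_on], where K = 1 and j = 1])
       (auto simp: norm_mult K0_eig_def of_nat_Suc simp del: of_real_add intro!: mult_right_mono)
  have "summable (\<lambda>n. cmod (cnj (u n) * (complex_of_real (K0_eig n) * u n)))"
    by (rule rapid_summable_ip_norm[OF u r1])
  moreover have "(\<lambda>n. cmod (cnj (u n) * (complex_of_real (K0_eig n) * u n))) = (\<lambda>n. K0_eig n * (cmod (u n))\<^sup>2)"
    by (rule ext) (simp add: norm_mult power2_eq_square K0_eig_def del: of_real_add)
  ultimately show S: "summable (\<lambda>n. K0_eig n * (cmod (u n))\<^sup>2)" by simp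
  let ?X = "\<Sum>n. K0_eig n * (cmod (u n))\<^sup>2"
  have S1: "summable (\<lambda>n. K0_eig (Suc n) * (cmod (u (Suc n)))\<^sup>2)" using S by (subst summable_Suc_iff)
  have "Y u \<le> 2 * cmod (ip u (wshift u))" unfolding Y_def using abs_Im_le_cmod[of "ip u (wshift u)"] by linarith
  also have "cmod (ip u (wshift u)) \<le> (\<Sum>n. cmod (cnj (u n) * wshift u n))"
    unfolding ip_def by (rule summable_norm[OF rapid_summable_ip_norm[OF u rapid_wshift[OF u]]])
  also have "\<dots> \<le> (\<Sum>n. (3/2) * (K0_eig n * (cmod (u n))\<^sup>2) + (1/2) * (K0_eig (Suc n) * (cmod (u (Suc n)))\<^sup>2))"
  proof (rule suminf_le[OF _ rapid_summable_ip_norm[OF u rapid_wshift[OF u]] summable_add[OF summable_mult[OF S] summable_mult[OF S1]]])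
    fix n
    have w: "cmod (complex_of_real (real n + 3/2)) = real n + 3/2" unfolding norm_of_real by simp
    have "cmod (cnj (u n) * wshift u n) = (real n + 3/2) * (cmod (u n) * cmod (u (Suc n)))"
      unfolding wshift_def norm_mult w by simp
    also have "\<dots> \<le> (real n + 3/2) * (((cmod (u n))\<^sup>2 + (cmod (u (Suc n)))\<^sup>2) / 2)"
      using sum_squares_bound[of "cmod (u n)" "cmod (u (Suc n))"] by (intro mult_left_mono) auto
    also have "\<dots> = (1/2) * ((real n + 3/2) * (cmod (u n))\<^sup>2) + (1/2) * (K0_eig (Suc n) * (cmod (u (Suc n)))\<^sup>2)"
      by (simp add: K0_eig_def of_nat_Suc field_simps)
    \<comment> \<open>Since \<open>n + 3/2 \<le> 3 (n + 1/2)\<close>, with equality at 0.\<close>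
    also have "(real n + 3/2) * (cmod (u n))\<^sup>2 \<le> 3 * (K0_eig n * (cmod (u n))\<^sup>2)"
      unfolding mult.assoc[symmetric] by (intro mult_right_mono) (auto simp: K0_eig_def)
    finally show "cmod (cnj (u n) * wshift u n) \<le> (3/2) * (K0_eig n * (cmod (u n))\<^sup>2) + (1/2) * (K0_eig (Suc n) * (cmod (u (Suc n)))\<^sup>2)"
      by simp
  qed
  also have "\<dots> = (3/2) * ?X + (1/2) * (\<Sum>n. K0_eig (Suc n) * (cmod (u (Suc n)))\<^sup>2)"
    by (rule sums_unique[symmetric], intro sums_add sums_mult summable_sums S S1)
  also have "(\<Sum>n. K0_eig (Suc n) * (cmod (u (Suc n)))\<^sup>2) \<le> ?X"
    using suminf_split_head[OF S] by (simp add: K0_eig_def)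
  finally show "Y u \<le> 4 * ?X" by simp
qed

text \<open>Ballistic upper bound: commuting the position weight past the generator leaves the
  matrix \<open>(n - m) B\<close>, still bounded by the Schur test, so the weighted norm grows at
  most linearly.\<close>

lemma second_moment_bound:
  assumes s: "solution \<phi>" and n1: "nrm (\<phi> 0) = 1"
  shows "\<exists>C>0. \<forall>t\<ge>1. nrm (\<lambda>n. complex_of_real (real (Suc n)) * \<phi> t n) \<le> C * t"
proof -
  have r: "rapid_path \<phi>" and D: "\<And>t n. ((\<lambda>s. \<phi> s n) has_vector_derivative - \<i> * mop (B t) (\<phi> t) n) (at t)"
    using s unfolding solution_def by auto
  note R = rapid_pathD[OF r]
  have nn: "nrm (\<phi> s) = 1" for s using solution_nrm[OF s] n1 by simp
  \<comment> \<open>Three powers of decay: one pays for the factor \<open>n - m\<close>, two for the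
    Schur test.\<close>
  obtain C where C: "C > 0" "\<And>t n m. cmod (B t n m) \<le> C / (1 + \<bar>real n - real m\<bar>) ^ 3"
    using offdiag_decay_bound[OF B_decay] by blast
  obtain C1 where C1: "C1 > 0" "\<And>t n m. cmod (B t n m) \<le> C1" using offdiag_decay_bounded[OF B_decay] by blast
  define d where "d t n = complex_of_real (real (Suc n)) * \<phi> t n" for t n
  define K where "K t n m = complex_of_real (real n - real m) * B t n m" for t n m
  define f where "f t n = - \<i> * mop (K t) (\<phi> t) n" for t n
  have rd: "rapid_path d"
    unfolding rapid_path_def
  proof
    fix T
    show "rapid_on {-T..T} d"
    proof (rule rapid_on_dominated[where f = \<phi> and K = 1 and j = 1])
      show "rapid_on {-T..T} \<phi>" using r unfolding rapid_path_def by blast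
      show "cmod (d x n) \<le> 1 * real (Suc n) ^ 1 * cmod (\<phi> x n)" for x n
        unfolding d_def norm_mult norm_of_real by simp
    qed simp
  qed
  have Kd: "offdiag_decay K"
    unfolding offdiag_decay_def
  proof
    fix p
    obtain C where C: "C > 0" "\<And>t n m. cmod (B t n m) \<le> C / (1 + \<bar>real n - real m\<bar>) ^ Suc p"
      using offdiag_decay_bound[OF B_decay] by blast
    show "\<exists>C. \<forall>t n m. cmod (K t n m) \<le> C / (1 + \<bar>real n - real m\<bar>) ^ p"
    proof (intro exI allI)
      fix t n m
      have "cmod (K t n m) \<le> (1 + \<bar>real n - real m\<bar>) * (C / (1 + \<bar>real n - real m\<bar>) ^ Suc p)"
        unfolding K_def norm_mult norm_of_real using C by (intro mult_mono) auto
      also have "\<dots> = C / (1 + \<bar>real n - real m\<bar>) ^ p" by (simp add: add_nonneg_eq_0_iff)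
      finally show "cmod (K t n m) \<le> C / (1 + \<bar>real n - real m\<bar>) ^ p" .
    qed
  qed
  have Kb: "cmod (K t n m) \<le> C / (1 + \<bar>real n - real m\<bar>)\<^sup>2" for t n m
  proof -
    have "cmod (K t n m) \<le> (1 + \<bar>real n - real m\<bar>) * (C / (1 + \<bar>real n - real m\<bar>) ^ 3)"
      unfolding K_def norm_mult norm_of_real using C by (intro mult_mono) auto
    also have "\<dots> = C / (1 + \<bar>real n - real m\<bar>)\<^sup>2" by (simp add: power2_eq_square power3_eq_cube add_nonneg_eq_0_iff)
    finally show ?thesis .
  qed
  have rf: "rapid_path f" unfolding f_def by (intro rapid_path_cmult rapid_path_mop Kd r)
  have Dd: "((\<lambda>s. d s n) has_vector_derivative - \<i> * mop (B t) (d t) n + f t n) (at t)" for t n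
  proof -
    have "((\<lambda>s. d s n) has_vector_derivative complex_of_real (real (Suc n)) * (- \<i> * mop (B t) (\<phi> t) n)) (at t)"
      unfolding d_def by (intro has_vector_derivative_mult_right D)
    moreover have keq: "complex_of_real (real (Suc n)) * mop (B t) (\<phi> t) n = mop (B t) (d t) n + mop (K t) (\<phi> t) n"
    proof -
      obtain C2 where C2: "C2 > 0" "\<And>t n m. cmod (K t n m) \<le> C2" using offdiag_decay_bounded[OF Kd] by blast
      have "(\<lambda>m. B t n m * d t m + K t n m * \<phi> t m) sums (mop (B t) (d t) n + mop (K t) (\<phi> t) n)"
        using C1 C2 R rapid_pathD[OF rd] by (intro sums_add mop_sums[of "B t" n C1] mop_sums[of "K t" n C2]) auto
      moreover have "B t n m * d t m + K t n m * \<phi> t m = complex_of_real (real (Suc n)) * (B t n m * \<phi> t m)" for m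
        by (simp add: d_def K_def of_nat_Suc algebra_simps)
      moreover have "(\<lambda>m. complex_of_real (real (Suc n)) * (B t n m * \<phi> t m)) sums (complex_of_real (real (Suc n)) * mop (B t) (\<phi> t) n)"
        using C1 R by (intro sums_mult mop_sums[of "B t" n C1]) auto
      ultimately show ?thesis using sums_unique2 by simp
    qed
    moreover have "complex_of_real (real (Suc n)) * (- \<i> * mop (B t) (\<phi> t) n) = - \<i> * mop (B t) (d t) n + f t n"
      unfolding mult.left_commute[of _ "- \<i>"] keq f_def by (rule distrib_left)
    ultimately show ?thesis by (simp only:)
  qed
  have nf: "nrm (f t) \<le> 6 * C" for t
    using nrm_cmult[OF rapid_mop[OF Kd R], of "- \<i>" t t] nrm_mop_le[OF Kb R rapid_mop[OF Kd R], of t t] nn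
    unfolding f_def by simp
  have g: "nrm (d t) \<le> nrm (d 0) + 6 * C * t" if "t \<ge> 0" for t
    unfolding nrm_def
  proof (rule sqrt_growth[OF _ _ _ _ that])
    show "((\<lambda>t. nsq (d t)) has_real_derivative 2 * Re (ip (d t) (f t))) (at t)" for t
      by (rule energy_derivative[OF rd rf Dd])
    show "nsq (d t) \<ge> 0" for t by (rule nsq_nonneg[OF rapid_pathD[OF rd]])
    show "2 * Re (ip (d t) (f t)) \<le> 2 * (6 * C) * sqrt (nsq (d t))" for t
    proof -
      have "Re (ip (d t) (f t)) \<le> nrm (d t) * nrm (f t)"
        using ip_Cauchy_Schwarz[OF rapid_pathD[OF rd] rapid_pathD[OF rf], of t t] complex_Re_le_cmod order_trans by blast
      also have "\<dots> \<le> nrm (d t) * (6 * C)"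
        by (intro mult_left_mono nf nrm_nonneg rapid_pathD[OF rd])
      finally show ?thesis unfolding nrm_def by (simp add: algebra_simps)
    qed
  qed (use C in auto)
  show ?thesis
  proof (intro exI[of _ "nrm (d 0) + 6 * C"] conjI allI impI)
    have d0: "nrm (d 0) \<ge> 0" by (rule nrm_nonneg[OF rapid_pathD[OF rd]])
    then show "nrm (d 0) + 6 * C > 0" using C by simp
    fix t :: real assume t: "t \<ge> 1"
    have "nrm (d t) \<le> nrm (d 0) + 6 * C * t" using g t by simp
    also have "\<dots> \<le> (nrm (d 0) + 6 * C) * t" using mult_left_mono[OF t d0] by (simp add: algebra_simps)
    finally show "nrm (\<lambda>n. complex_of_real (real (Suc n)) * \<phi> t n) \<le> (nrm (d 0) + 6 * C) * t"
      unfolding d_def .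
  qed
qed

end

section \<open>From moments to the growth of every \<open>r\<close>-norm\<close>

lemma rapid_weighted:
  assumes u: "rapid u" and r: "r > 0" shows "rapid (\<lambda>n. complex_of_real (K0_eig n powr r) * u n)"
  unfolding rapid_iff_rapid_on
proof (rule rapid_on_dominated[where f = "\<lambda>_. u" and K = 1 and j = "nat \<lceil>r\<rceil>"])
  show "rapid_on (UNIV :: unit set) (\<lambda>_. u)" using u unfolding rapid_iff_rapid_on .
  fix n
  have "K0_eig n powr r \<le> real (Suc n) powr r"
    using r by (intro powr_mono2) (auto simp: K0_eig_def of_nat_Suc)
  also have "\<dots> \<le> real (Suc n) powr real (nat \<lceil>r\<rceil>)"
    by (intro powr_mono real_nat_ceiling_ge) (simp add: of_nat_Suc)
  also have "\<dots> = real (Suc n) ^ nat \<lceil>r\<rceil>" by (rule powr_realpow) simp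
  finally have "K0_eig n powr r \<le> real (Suc n) ^ nat \<lceil>r\<rceil>" .
  then show "cmod (complex_of_real (K0_eig n powr r) * u n) \<le> 1 * real (Suc n) ^ nat \<lceil>r\<rceil> * cmod (u n)"
    unfolding norm_mult norm_of_real by (intro mult_right_mono) auto
qed simp

lemma summable_weighted:
  assumes u: "rapid u" and r: "r > 0" shows "summable (\<lambda>n. (K0_eig n powr r)\<^sup>2 * (cmod (u n))\<^sup>2)"
  using rapid_summable_sq[OF rapid_weighted[OF u r]] by (simp add: norm_mult power_mult_distrib)

text \<open>If the first moment is of size \<open>t\<close> and the second at most of size
  \<open>t\<^sup>2\<close>, a fixed part of the first comes from the window where
  \<open>lam n\<close> is comparable with \<open>t\<close>. There \<open>lam\<close> is bounded by a
  multiple of \<open>t powr (1 - 2*r)\<close> times its \<open>2r\<close>-th power. The maximum in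
  the constant covers both signs of \<open>1 - 2*r\<close>.\<close>

lemma moment_interpolation:
  fixes lam p :: "nat \<Rightarrow> real"
  assumes lam: "\<And>n. lam n > 0" and p: "\<And>n. p n \<ge> 0" and p1: "p sums 1"
    and m1: "(\<lambda>n. lam n * p n) sums X1" and m2: "(\<lambda>n. (lam n)\<^sup>2 * p n) sums X2"
    and mr: "(\<lambda>n. (lam n powr r)\<^sup>2 * p n) sums S"
    and c: "c > 0" and C: "C > 0" and t: "t > 0" and X1: "X1 \<ge> c * t" and X2: "X2 \<le> C * t\<^sup>2"
  shows "S \<ge> c / (2 * max ((c/4) powr (1 - 2*r)) ((4*C/c) powr (1 - 2*r))) * t powr (2*r)"
proof -
  \<comment> \<open>Below \<open>a * t\<close> the first moment collects at most
    \<open>c * t / 4\<close>, and above \<open>R * t\<close> the second moment limits it to the same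
    amount; half of \<open>c * t\<close> is left for the window.\<close>
  define a R K where "a = c / 4" and "R = 4 * C / c" and "K = max (a powr (1 - 2*r)) (R powr (1 - 2*r))"
  have a: "a > 0" and R: "R > 0" using c C by (auto simp: a_def R_def)
  have K: "K > 0" using a by (simp add: K_def less_max_iff_disj)
  have pw: "lam n \<le> a * t + (lam n)\<^sup>2 / (R * t) + K * t powr (1 - 2*r) * (lam n powr r)\<^sup>2" for n
  proof -
    let ?l = "lam n"
    have nn: "a * t \<ge> 0" "?l\<^sup>2 / (R * t) \<ge> 0" "K * t powr (1 - 2*r) * (?l powr r)\<^sup>2 \<ge> 0"
      using a R K t by auto
    consider "?l \<le> a * t" | "?l \<ge> R * t" | "a * t < ?l" "?l < R * t" by linarith
    then show ?thesis
    proof cases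
      case 1 then show ?thesis using nn by linarith
    next
      case 2
      have "?l * (R * t) \<le> ?l * ?l" using 2 lam[of n] by (intro mult_left_mono) auto
      then have "?l \<le> ?l\<^sup>2 / (R * t)" using R t by (simp add: power2_eq_square pos_le_divide_eq)
      then show ?thesis using nn by linarith
    next
      case 3
      have q: "a \<le> ?l / t" "?l / t \<le> R" using 3 t by (auto simp: field_simps)
      have "(?l / t) powr (1 - 2*r) \<le> K"
      proof (cases "1 - 2*r \<ge> 0")
        case True
        then have "(?l / t) powr (1 - 2*r) \<le> R powr (1 - 2*r)"
          using q a by (intro powr_mono2) auto
        then show ?thesis by (simp add: K_def)
      next
        case False
        then have "(?l / t) powr (1 - 2*r) \<le> a powr (1 - 2*r)"
          using q a by (intro powr_mono2') auto
        then show ?thesis by (simp add: K_def)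
      qed
      then have "(?l powr (2*r)) * (t powr (1 - 2*r) * (?l / t) powr (1 - 2*r)) \<le> (?l powr (2*r)) * (t powr (1 - 2*r) * K)"
        by (intro mult_left_mono) auto
      moreover have "t powr (1 - 2*r) * (?l / t) powr (1 - 2*r) = ?l powr (1 - 2*r)"
        using t lam[of n] by (subst powr_mult[symmetric]) auto
      moreover have "?l powr (2*r) * ?l powr (1 - 2*r) = ?l"
        using lam[of n] by (subst powr_add[symmetric]) simp
      moreover have "(?l powr r)\<^sup>2 = ?l powr (2*r)"
        by (simp add: power2_eq_square powr_add[symmetric])
      ultimately have "?l \<le> K * t powr (1 - 2*r) * (?l powr r)\<^sup>2" by (simp add: ac_simps)
      then show ?thesis using nn by linarith
    qed
  qed
  have "X1 \<le> a * t * 1 + 1 / (R * t) * X2 + K * t powr (1 - 2*r) * S"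
  proof (rule sums_le[OF _ m1 sums_add[OF sums_add[OF sums_mult[OF p1] sums_mult[OF m2]] sums_mult[OF mr]]])
    fix n
    have "lam n * p n \<le> (a * t + (lam n)\<^sup>2 / (R * t) + K * t powr (1 - 2*r) * (lam n powr r)\<^sup>2) * p n"
      by (rule mult_right_mono[OF pw p])
    then show "lam n * p n \<le> a * t * p n + 1 / (R * t) * ((lam n)\<^sup>2 * p n) + K * t powr (1 - 2*r) * ((lam n powr r)\<^sup>2 * p n)"
      by (simp add: algebra_simps)
  qed
  moreover have "1 / (R * t) * X2 \<le> 1 / (R * t) * (C * t\<^sup>2)" using X2 R t by (intro mult_left_mono) auto
  moreover have "1 / (R * t) * (C * t\<^sup>2) = c * t / 4" using c C t by (simp add: R_def power2_eq_square)
  ultimately have "c * t / 2 \<le> K * t powr (1 - 2*r) * S" using X1 by (simp add: a_def)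
  then have "c * t / 2 * t powr (2*r - 1) \<le> K * t powr (1 - 2*r) * S * t powr (2*r - 1)"
    by (intro mult_right_mono) auto
  also have "\<dots> = K * S * (t powr (1 - 2*r) * t powr (2*r - 1))" by simp
  also have "t powr (1 - 2*r) * t powr (2*r - 1) = 1" using t by (subst powr_add[symmetric]) simp
  also have "c * t / 2 * t powr (2*r - 1) = c / 2 * t powr (2*r)"
    using t powr_add[of t 1 "2*r - 1"] by simp
  finally have "c / (2 * K) * t powr (2*r) \<le> S" using K by (simp add: field_simps)
  then show ?thesis unfolding K_def a_def R_def .
qed

lemma (in hopping_perturbation) solution_growth:
  assumes s: "solution \<phi>" and n1: "nrm (\<phi> 0) = 1"
    and q: "nrm (\<lambda>n. hop (\<phi> 0) n - 1/2 * \<phi> 0 n) \<le> 1/100" and r: "r > 0"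
  shows "\<exists>c>0. \<exists>T\<ge>1. \<forall>t\<ge>T. c * t powr (2*r) \<le> (\<Sum>n. (K0_eig n powr r)\<^sup>2 * (cmod (\<phi> t n))\<^sup>2)"
proof -
  have R: "rapid (\<phi> s)" for s using s unfolding solution_def by (auto intro: rapid_pathD)
  have nn: "nrm (\<phi> s) = 1" for s using solution_nrm[OF s] n1 by simp
  obtain C where C: "C > 0" "\<And>t. t \<ge> 1 \<Longrightarrow> nrm (\<lambda>n. complex_of_real (real (Suc n)) * \<phi> t n) \<le> C * t"
    using second_moment_bound[OF s n1] by blast
  \<comment> \<open>From this time on \<open>t / 40\<close> absorbs the initial deficit, so
    \<open>Y\<close> is at least \<open>t / 40\<close> and the first moment at least
    \<open>t / 160\<close>.\<close>
  define T where "T = 40 * (2 + \<bar>Y (\<phi> 0)\<bar>)"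
  define c where "c = (1 / 160) / (2 * max ((1/160/4) powr (1 - 2*r)) ((4*C\<^sup>2/(1/160)) powr (1 - 2*r)))"
  have "T \<ge> 1" unfolding T_def by simp
  moreover have "c > 0" unfolding c_def by (simp add: less_max_iff_disj)
  moreover have "c * t powr (2*r) \<le> (\<Sum>n. (K0_eig n powr r)\<^sup>2 * (cmod (\<phi> t n))\<^sup>2)" if t: "t \<ge> T" for t
    unfolding c_def
  proof (rule moment_interpolation)
    have t1: "t \<ge> 1" using t \<open>T \<ge> 1\<close> by simp
    show "K0_eig n > 0" for n by (simp add: K0_eig_def add_nonneg_pos)
    show "(\<lambda>n. (cmod (\<phi> t n))\<^sup>2) sums 1" using nsq_sums[OF R, of t] nrm_sq[OF R, of t] nn by simp
    show m1: "(\<lambda>n. K0_eig n * (cmod (\<phi> t n))\<^sup>2) sums (\<Sum>n. K0_eig n * (cmod (\<phi> t n))\<^sup>2)"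
      by (rule summable_sums[OF Y_le_first_moment(1)[OF R]])
    have "summable (\<lambda>n. (K0_eig n powr 1)\<^sup>2 * (cmod (\<phi> t n))\<^sup>2)" by (rule summable_weighted[OF R]) simp
    then show m2: "(\<lambda>n. (K0_eig n)\<^sup>2 * (cmod (\<phi> t n))\<^sup>2) sums (\<Sum>n. (K0_eig n)\<^sup>2 * (cmod (\<phi> t n))\<^sup>2)"
      by (simp add: K0_eig_def summable_sums)
    show "(\<lambda>n. (K0_eig n powr r)\<^sup>2 * (cmod (\<phi> t n))\<^sup>2) sums (\<Sum>n. (K0_eig n powr r)\<^sup>2 * (cmod (\<phi> t n))\<^sup>2)"
      by (rule summable_sums[OF summable_weighted[OF R r]])
    show "t > 0" using t1 by simp
    show "(\<Sum>n. K0_eig n * (cmod (\<phi> t n))\<^sup>2) \<ge> 1/160 * t"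
      using Y_lower_bound[OF s n1 almost_antiperiodic[OF s n1 q], of t] Y_le_first_moment(2)[OF R, of t] t t1
      unfolding T_def by simp
    have rs: "rapid (\<lambda>n. complex_of_real (real (Suc n)) * \<phi> t n)"
      unfolding rapid_iff_rapid_on
    proof (rule rapid_on_dominated[where f = "\<lambda>_. \<phi> t" and K = 1 and j = 1])
      show "rapid_on (UNIV :: unit set) (\<lambda>_. \<phi> t)" using R[of t] unfolding rapid_iff_rapid_on .
    qed (unfold norm_mult norm_of_real, simp_all)
    have "(\<Sum>n. (K0_eig n)\<^sup>2 * (cmod (\<phi> t n))\<^sup>2) \<le> nsq (\<lambda>n. complex_of_real (real (Suc n)) * \<phi> t n)"
    proof (rule sums_le[OF _ m2 nsq_sums[OF rs]])
      fix n
      have "(K0_eig n)\<^sup>2 \<le> (real (Suc n))\<^sup>2" by (intro power_mono) (auto simp: K0_eig_def of_nat_Suc)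
      then show "(K0_eig n)\<^sup>2 * (cmod (\<phi> t n))\<^sup>2 \<le> (cmod (complex_of_real (real (Suc n)) * \<phi> t n))\<^sup>2"
        unfolding norm_mult norm_of_real power_mult_distrib by (intro mult_right_mono) auto
    qed
    also have "\<dots> = (nrm (\<lambda>n. complex_of_real (real (Suc n)) * \<phi> t n))\<^sup>2" by (rule nrm_sq[OF rs, symmetric])
    also have "\<dots> \<le> (C * t)\<^sup>2" by (intro power_mono C(2) nrm_nonneg rs t1)
    finally show "(\<Sum>n. (K0_eig n)\<^sup>2 * (cmod (\<phi> t n))\<^sup>2) \<le> C\<^sup>2 * t\<^sup>2" by (simp add: power_mult_distrib)
  qed (use C in auto)
  ultimately show ?thesis by blast
qed

text \<open>A plane wave of frequency \<open>\<theta>\<close> with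
  \<open>2 cos \<theta> = 1/2\<close>, cut off to \<open>L\<close> sites, solves the eigenvalue
  equation except at the sites 0, \<open>L - 1\<close> and \<open>L\<close>.\<close>

lemma exists_wave_packet:
  "\<exists>u. rapid u \<and> nrm u = 1 \<and> nrm (\<lambda>n. hop u n - 1/2 * u n) \<le> 1/100"
proof -
  \<comment> \<open>Each of the three defective sites contributes at most \<open>9 / L\<close>, and
    \<open>27 / L\<close> has to be at most \<open>(1/100)\<^sup>2\<close>.\<close>
  obtain L :: nat where L: "real L \<ge> 270000" using real_arch_simple by blast
  have L3: "L \<ge> 3" using L by linarith
  have Lp: "real L > 0" using L by linarith
  define \<theta> where "\<theta> = arccos (1/4)"
  have ct: "cos \<theta> = 1/4" unfolding \<theta>_def by (rule cos_arccos) auto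
  define u where "u n = (if n < L then cis (\<theta> * real n) / complex_of_real (sqrt (real L)) else 0)" for n
  have u: "rapid u" by (rule rapid_finite_support[of L]) (simp add: u_def)
  have nu: "cmod (u n) \<le> 1 / sqrt (real L)" for n by (simp add: u_def norm_divide)
  have "nsq u = (\<Sum>n<L. (cmod (u n))\<^sup>2)" unfolding nsq_def by (rule suminf_finite) (auto simp: u_def)
  also have "\<dots> = (\<Sum>n<L. 1 / real L)" by (rule sum.cong) (auto simp: u_def norm_divide power_divide)
  also have "\<dots> = 1" using Lp by simp
  finally have n1: "nrm u = 1" by (simp add: nrm_def)
  define w where "w n = hop u n - 1/2 * u n" for n
  have mid: "w n = 0" if "n \<notin> {0, L - 1, L}" for n
  proof (cases "n < L")
    case False
    then have "\<not> n - 1 < L" "\<not> Suc n < L" using that by auto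
    then show ?thesis using False by (simp add: w_def hop_def u_def)
  next
    case True
    then have i: "n \<noteq> 0" "n - 1 < L" "Suc n < L" using that by auto
    have e1: "\<theta> * real (n - 1) = \<theta> * real n - \<theta>" "\<theta> * real (Suc n) = \<theta> * real n + \<theta>"
      using i by (simp_all add: of_nat_Suc algebra_simps)
    have "cis (\<theta> * real (n - 1)) + cis (\<theta> * real (Suc n)) = 2 * complex_of_real (cos \<theta>) * cis (\<theta> * real n)"
      unfolding e1 by (simp add: complex_eq_iff cos_add cos_diff sin_add sin_diff)
    then have "cis (\<theta> * real (n - 1)) + cis (\<theta> * real (Suc n)) = 1/2 * cis (\<theta> * real n)"
      unfolding ct by simp
    moreover have "w n = (cis (\<theta> * real (n - 1)) + cis (\<theta> * real (Suc n)) - 1/2 * cis (\<theta> * real n)) / complex_of_real (sqrt (real L))"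
      using i True by (simp add: w_def hop_def u_def add_divide_distrib diff_divide_distrib del: of_nat_diff)
    ultimately show ?thesis by (simp only: diff_self div_0)
  qed
  have bw: "cmod (w n) \<le> 3 / sqrt (real L)" for n
  proof -
    have "cmod (w n) \<le> cmod (hop u n) + 1/2 * cmod (u n)"
      unfolding w_def by (rule order_trans[OF norm_triangle_ineq4]) (simp add: norm_mult)
    moreover have "cmod (hop u n) \<le> 1 / sqrt (real L) + 1 / sqrt (real L)"
      unfolding hop_def by (intro order_trans[OF norm_triangle_ineq] add_mono nu) (use nu[of "n - 1"] in auto)
    moreover have "1/2 * cmod (u n) \<le> 1 / sqrt (real L)" using nu[of n] norm_ge_zero[of "u n"] by linarith
    ultimately show ?thesis by simp
  qed
  have "nsq w = (\<Sum>n\<in>{0, L - 1, L}. (cmod (w n))\<^sup>2)"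
    unfolding nsq_def by (rule suminf_finite) (use mid in auto)
  also have "\<dots> \<le> (\<Sum>n\<in>{0, L - 1, L}. 9 / real L)"
  proof (rule sum_mono)
    fix n
    have "(cmod (w n))\<^sup>2 \<le> (3 / sqrt (real L))\<^sup>2" by (intro power_mono bw) auto
    then show "(cmod (w n))\<^sup>2 \<le> 9 / real L" by (simp add: power_divide)
  qed
  also have "\<dots> \<le> 27 / real L" using L3 by (simp add: card_insert_if)
  also have "\<dots> \<le> (1/100)\<^sup>2" using L Lp by (simp add: field_simps power2_eq_square)
  finally have "nrm w \<le> 1/100" unfolding nrm_def by (intro real_le_lsqrt) auto
  with u n1 show ?thesis unfolding w_def by blast
qed

section \<open>Existence of rapidly decreasing solutions\<close>

text \<open>A two-sided antiderivative normalised at 0: choosing it on the whole line treats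
  negative times together with positive ones.\<close>

definition primitive :: "(real \<Rightarrow> complex) \<Rightarrow> real \<Rightarrow> complex" where
  "primitive f t = (let F = (SOME F. \<forall>x. (F has_vector_derivative f x) (at x)) in F t - F 0)"

lemma primitive_0: "primitive f 0 = 0"
  by (simp add: primitive_def Let_def)

lemma primitive_has_vector_derivative:
  assumes "continuous_on UNIV f" shows "(primitive f has_vector_derivative f t) (at t)"
proof -
  have "\<exists>F. \<forall>x::real. -\<infinity> < ereal x \<longrightarrow> ereal x < \<infinity> \<longrightarrow> (F has_vector_derivative f x) (at x)"
    by (rule einterval_antiderivative) (use assms in \<open>auto simp: continuous_on_eq_continuous_at\<close>)
  then have "\<exists>F. \<forall>x. (F has_vector_derivative f x) (at x)" by simp
  from someI_ex[OF this]
  have "((\<lambda>t. (SOME F. \<forall>x. (F has_vector_derivative f x) (at x)) t - (SOME F. \<forall>x. (F has_vector_derivative f x) (at x)) 0)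
      has_vector_derivative f t - 0) (at t)"
    by (intro has_vector_derivative_diff has_vector_derivative_const) blast
  then show ?thesis unfolding primitive_def[abs_def] Let_def by simp
qed

text \<open>One step of the factorial gain in the Dyson series. Negative times reduce to positive
  ones by reflection.\<close>

lemma primitive_power_bound:
  assumes f: "continuous_on UNIV f" and b: "\<And>s. cmod (f s) \<le> K * \<bar>s\<bar> ^ k / fact k"
  shows "cmod (primitive f t) \<le> K * \<bar>t\<bar> ^ Suc k / fact (Suc k)"
proof -
  have dp: "((\<lambda>s. K * s ^ Suc k / fact (Suc k)) has_vector_derivative K * s ^ k / fact k) (at s)" for s :: real
    unfolding has_real_derivative_iff_has_vector_derivative[symmetric]
    by (rule derivative_eq_intros refl | simp add: of_nat_Suc)+
  have pos: "cmod (g t) \<le> K * t ^ Suc k / fact (Suc k)"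
    if g: "\<And>s. (g has_vector_derivative g' s) (at s)" "g 0 = 0" "\<And>s. cmod (g' s) \<le> K * \<bar>s\<bar> ^ k / fact k" and t: "t > 0"
    for g g' and t :: real
  proof -
    have "norm (g t - g 0) \<le> K * t ^ Suc k / fact (Suc k) - K * 0 ^ Suc k / fact (Suc k)"
    proof (rule differentiable_bound_general[OF t _ _ g(1) dp])
      show "continuous_on {0..t} g"
        using g(1) by (meson continuous_at_imp_continuous_on has_vector_derivative_continuous)
      show "continuous_on {0..t} (\<lambda>s. K * s ^ Suc k / fact (Suc k))" by (intro continuous_intros) auto
      show "norm (g' x) \<le> K * x ^ k / fact k" if "0 < x" for x using g(3)[of x] that by simp
    qed
    then show ?thesis using g(2) by simp
  qed
  note d = primitive_has_vector_derivative[OF f]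
  consider "t = 0" | "t > 0" | "t < 0" by linarith
  then show ?thesis
  proof cases
    case 1 then show ?thesis by (simp add: primitive_0)
  next
    case 2 then show ?thesis using pos[OF d primitive_0 b] by simp
  next
    case 3
    have "((\<lambda>s. primitive f (- s)) has_vector_derivative - f (- s)) (at s)" for s
    proof -
      have "(uminus has_vector_derivative -1) (at s)" by (auto intro!: derivative_eq_intros)
      from vector_diff_chain_at[OF this d[of "- s"]] show ?thesis by (simp add: o_def)
    qed
    from pos[OF this, of "- t"] 3 b show ?thesis by (simp add: primitive_0) (metis abs_minus_cancel)
  qed
qed

lemma continuous_on_mop:
  assumes B: "offdiag_decay B" and cB: "\<And>n m. continuous_on UNIV (\<lambda>t. B t n m)"
    and f: "rapid_path f" and cf: "\<And>n. continuous_on UNIV (\<lambda>t. f t n)"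
  shows "continuous_on UNIV (\<lambda>t. mop (B t) (f t) n)"
proof -
  obtain C where C: "C > 0" "\<And>t n m. cmod (B t n m) \<le> C" using offdiag_decay_bounded[OF B] by blast
  have "continuous (at t) (\<lambda>t. mop (B t) (f t) n)" for t
  proof -
    define S where "S = {-(\<bar>t\<bar> + 1)..\<bar>t\<bar> + 1}"
    obtain D where D: "D > 0" "\<And>x n. x \<in> S \<Longrightarrow> cmod (f x n) \<le> D / real (Suc n) ^ 2"
      using rapid_on_bound[of S f] f unfolding rapid_path_def S_def by blast
    have "uniform_limit S (\<lambda>N x. \<Sum>m<N. B x n m * f x m) (\<lambda>x. \<Sum>m. B x n m * f x m) sequentially"
    proof (rule Weierstrass_m_test[OF _ summable_inverse_Suc_sq[of "C * D"]])
      fix m x assume "x \<in> S"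
      then have "cmod (B x n m * f x m) \<le> C * (D / real (Suc m) ^ 2)"
        unfolding norm_mult using C D by (intro mult_mono) auto
      then show "cmod (B x n m * f x m) \<le> C * D / real (Suc m) ^ 2" by simp
    qed
    then have "continuous_on S (\<lambda>x. \<Sum>m. B x n m * f x m)"
      by (rule uniform_limit_theorem[rotated])
         (auto intro!: always_eventually continuous_intros continuous_on_subset[OF cB] continuous_on_subset[OF cf])
    moreover have "t \<in> interior S" unfolding S_def by (auto simp: abs_if)
    ultimately show ?thesis unfolding mop_def by (rule continuous_on_interior)
  qed
  then show ?thesis by (simp add: continuous_on_eq_continuous_at)
qed

text \<open>Not the Picard iterates but their successive differences, that is the terms of the Dyson
  series; the solution is their sum.\<close>

fun picard :: "(real \<Rightarrow> nat \<Rightarrow> nat \<Rightarrow> complex) \<Rightarrow> (nat \<Rightarrow> complex) \<Rightarrow> nat \<Rightarrow> real \<Rightarrow> nat \<Rightarrow> complex" where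
  "picard B u 0 t n = u n"
| "picard B u (Suc k) t n = primitive (\<lambda>s. - \<i> * mop (B s) (picard B u k s) n) t"

text \<open>The Dyson series is run in all polynomially weighted sup norms at once: by
  \<open>mop_weight_bound\<close> the generator is bounded in each, with its own constant
  \<open>L p\<close>, so the \<open>k\<close>-th term is at most
  \<open>D p (L p |t|) ^ k / k!\<close> there and the sum is rapidly decreasing.\<close>

lemma solution_exists:
  assumes B: "offdiag_decay B" and cB: "\<And>n m. continuous_on UNIV (\<lambda>t. B t n m)" and u: "rapid u"
  shows "\<exists>\<phi>. rapid_path \<phi> \<and> \<phi> 0 = u \<and>
     (\<forall>t n. ((\<lambda>s. \<phi> s n) has_vector_derivative - \<i> * mop (B t) (\<phi> t) n) (at t))"
proof -
  \<comment> \<open>The division by 6 anticipates the factor 6 of \<open>mop_weight_bound\<close>,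
    so that \<open>L p\<close> is the operator bound itself.\<close>
  have "\<forall>p. \<exists>L D. L > 0 \<and> D > 0 \<and> (\<forall>t n m. cmod (B t n m) \<le> (L/6) / (1 + \<bar>real n - real m\<bar>) ^ (p + 2))
      \<and> (\<forall>n. cmod (u n) \<le> D / real (Suc n) ^ p)"
  proof
    fix p
    obtain C where C: "C > 0" "\<And>t n m. cmod (B t n m) \<le> C / (1 + \<bar>real n - real m\<bar>) ^ (p + 2)"
      using offdiag_decay_bound[OF B] by blast
    obtain D where D: "D > 0" "\<And>x n. x \<in> (UNIV :: unit set) \<Longrightarrow> cmod (u n) \<le> D / real (Suc n) ^ p"
      using rapid_on_bound[of "UNIV :: unit set" "\<lambda>_. u"] u unfolding rapid_iff_rapid_on by blast
    show "\<exists>L D. L > 0 \<and> D > 0 \<and> (\<forall>t n m. cmod (B t n m) \<le> (L/6) / (1 + \<bar>real n - real m\<bar>) ^ (p + 2))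
      \<and> (\<forall>n. cmod (u n) \<le> D / real (Suc n) ^ p)"
      by (rule exI[of _ "6 * C"], rule exI[of _ D]) (use C D in simp)
  qed
  then obtain L D where L: "\<And>p. L p > 0" and D: "\<And>p. D p > 0"
    and BL: "\<And>p t n m. cmod (B t n m) \<le> (L p/6) / (1 + \<bar>real n - real m\<bar>) ^ (p + 2)"
    and uD: "\<And>p n. cmod (u n) \<le> D p / real (Suc n) ^ p" by metis
  define v where "v = picard B u"
  define c where "c p k t = D p * (L p * \<bar>t\<bar>) ^ k / fact k" for p k and t :: real
  have c0: "c p k t \<ge> 0" for p k t using L[of p] D[of p] by (simp add: c_def)
  have rp: "rapid_path f" if "\<And>p t n. cmod (f t n) \<le> c p k t / real (Suc n) ^ p" for f k
    unfolding rapid_path_def rapid_on_def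
  proof (intro allI)
    fix T :: real and p
    show "\<exists>C. \<forall>x\<in>{-T..T}. \<forall>n. cmod (f x n) \<le> C / real (Suc n) ^ p"
    proof (intro exI ballI allI)
      fix x n assume x: "x \<in> {-T..T}"
      have "cmod (f x n) \<le> c p k x / real (Suc n) ^ p" by (rule that)
      also have "\<dots> \<le> c p k T / real (Suc n) ^ p"
        unfolding c_def using x L[of p] D[of p] by (intro divide_right_mono mult_left_mono power_mono) auto
      finally show "cmod (f x n) \<le> c p k T / real (Suc n) ^ p" .
    qed
  qed
  have mb: "cmod (- \<i> * mop (B s) (v k s) n) \<le> (L p ^ Suc k * D p / real (Suc n) ^ p) * \<bar>s\<bar> ^ k / fact k"
    if "\<And>n. cmod (v k s n) \<le> c p k s / real (Suc n) ^ p" for k s n p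
  proof -
    have "cmod (mop (B s) (v k s) n) \<le> 6 * (L p / 6) * c p k s / real (Suc n) ^ p"
      by (rule mop_weight_bound(2)[OF BL that]) (use c0 L[of p] in auto)
    then show ?thesis by (simp add: norm_mult c_def power_mult_distrib ac_simps)
  qed
  have main: "(\<forall>p t n. cmod (v k t n) \<le> c p k t / real (Suc n) ^ p) \<and> (\<forall>n. continuous_on UNIV (\<lambda>t. v k t n))" for k
  proof (induction k)
    case 0
    show ?case unfolding v_def c_def using uD by simp
  next
    case (Suc k)
    then have IH: "\<And>p t n. cmod (v k t n) \<le> c p k t / real (Suc n) ^ p" and cv: "\<And>n. continuous_on UNIV (\<lambda>t. v k t n)"
      by auto
    have cm: "continuous_on UNIV (\<lambda>s. - \<i> * mop (B s) (v k s) n)" for n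
      by (intro continuous_intros continuous_on_mop[OF B cB rp[OF IH] cv])
    have "cmod (v (Suc k) t n) \<le> c p (Suc k) t / real (Suc n) ^ p" for p t n
    proof -
      have "cmod (v (Suc k) t n) \<le> (L p ^ Suc k * D p / real (Suc n) ^ p) * \<bar>t\<bar> ^ Suc k / fact (Suc k)"
        unfolding v_def picard.simps
        by (rule primitive_power_bound[OF cm[unfolded v_def] mb[OF IH, unfolded v_def]])
      also have "\<dots> = c p (Suc k) t / real (Suc n) ^ p"
        unfolding c_def power_mult_distrib by (simp add: ac_simps)
      finally show ?thesis .
    qed
    moreover have "continuous_on UNIV (\<lambda>t. v (Suc k) t n)" for n
      unfolding v_def picard.simps
      using primitive_has_vector_derivative[OF cm[unfolded v_def]]
      by (meson continuous_at_imp_continuous_on has_vector_derivative_continuous)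
    ultimately show ?case by blast
  qed
  have vb: "cmod (v k t n) \<le> c p k t / real (Suc n) ^ p" and cv: "continuous_on UNIV (\<lambda>t. v k t n)" for p k t n
    using main by auto
  have dv: "((\<lambda>t. v (Suc k) t n) has_vector_derivative - \<i> * mop (B t) (v k t) n) (at t)" for k t n
    unfolding v_def picard.simps
    by (rule primitive_has_vector_derivative)
       (intro continuous_intros continuous_on_mop[OF B cB] rp[OF vb, unfolded v_def] cv[unfolded v_def])
  have cs: "(\<lambda>k. c p k t) sums (D p * exp (L p * \<bar>t\<bar>))" for p t
    unfolding c_def using sums_mult[OF exp_converges[of "L p * \<bar>t\<bar>"], of "D p"]
    by (simp add: divide_inverse ac_simps)
  have vs: "summable (\<lambda>k. cmod (v k t n))" for t n
    by (rule summable_comparison_test'[OF sums_summable[OF cs[of 0 t]], of 0]) (use vb[of _ t n 0] in auto)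
  define \<phi> where "\<phi> t n = (\<Sum>k. v k t n)" for t n
  have "rapid_path \<phi>"
    unfolding rapid_path_def rapid_on_def
  proof (intro allI)
    fix T :: real and p
    show "\<exists>C. \<forall>x\<in>{-T..T}. \<forall>n. cmod (\<phi> x n) \<le> C / real (Suc n) ^ p"
    proof (intro exI ballI allI)
      fix x n assume x: "x \<in> {-T..T}"
      have "cmod (\<phi> x n) \<le> (\<Sum>k. cmod (v k x n))" unfolding \<phi>_def by (rule summable_norm[OF vs])
      also have "\<dots> \<le> (\<Sum>k. c p k x / real (Suc n) ^ p)"
        by (rule suminf_le[OF vb vs summable_divide[OF sums_summable[OF cs]]])
      also have "\<dots> = D p * exp (L p * \<bar>x\<bar>) / real (Suc n) ^ p"
        by (rule sums_unique[symmetric], intro sums_divide cs)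
      also have "\<dots> \<le> D p * exp (L p * \<bar>T\<bar>) / real (Suc n) ^ p"
        using x L[of p] D[of p] by (intro divide_right_mono mult_left_mono) (auto simp: mult_le_cancel_left)
      finally show "cmod (\<phi> x n) \<le> D p * exp (L p * \<bar>T\<bar>) / real (Suc n) ^ p" .
    qed
  qed
  moreover have "\<phi> 0 = u"
  proof
    fix n
    have "\<phi> 0 n = (\<Sum>k\<in>{0}. v k 0 n)"
      unfolding \<phi>_def
    proof (rule suminf_finite)
      fix k :: nat assume "k \<notin> {0}"
      then show "v k 0 n = 0" by (cases k) (simp_all add: v_def primitive_0)
    qed simp
    then show "\<phi> 0 n = u n" by (simp add: v_def)
  qed
  moreover have "((\<lambda>s. \<phi> s n) has_vector_derivative - \<i> * mop (B t) (\<phi> t) n) (at t)" for t n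
  proof -
    \<comment> \<open>The zeroth term is constant in time, so the differentiated series is the
      original one under the generator, shifted by one.\<close>
    define f' where "f' k t = (case k of 0 \<Rightarrow> 0 | Suc j \<Rightarrow> - \<i> * mop (B t) (v j t) n)" for k t
    have "((\<lambda>s. \<Sum>k. v k s n) has_vector_derivative (\<Sum>k. f' k t)) (at t)"
    proof (rule has_vector_derivative_suminf)
      show "((\<lambda>s. v k s n) has_vector_derivative f' k t) (at t)" for k t
      proof (cases k)
        case 0 then show ?thesis by (simp add: f'_def v_def)
      next
        case (Suc j) then show ?thesis using dv by (simp add: f'_def)
      qed
      show "summable (\<lambda>k. v k t n)" for t by (rule summable_norm_cancel[OF vs])
      fix T :: real
      define M where "M k = (case k of 0 \<Rightarrow> 0 | Suc j \<Rightarrow> L 0 * c 0 j T)" for k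
      have "summable (\<lambda>k. M (Suc k))" unfolding M_def using summable_mult[OF sums_summable[OF cs]] by simp
      then have "summable M" by (simp add: summable_Suc_iff)
      moreover have "cmod (f' k t) \<le> M k" if t: "\<bar>t\<bar> \<le> T" for k t
      proof (cases k)
        case 0 then show ?thesis by (simp add: f'_def M_def)
      next
        case (Suc j)
        have "cmod (f' k t) \<le> (L 0 ^ Suc j * D 0 / real (Suc n) ^ 0) * \<bar>t\<bar> ^ j / fact j"
          unfolding f'_def Suc using mb[OF vb, where k = j and p = 0] by simp
        also have "\<dots> = L 0 * c 0 j t" by (simp add: c_def power_mult_distrib)
        also have "\<dots> \<le> L 0 * c 0 j T"
          unfolding c_def using t L[of 0] D[of 0] by (intro mult_left_mono divide_right_mono power_mono) auto
        finally show ?thesis by (simp add: M_def Suc)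
      qed
      ultimately show "\<exists>M. summable M \<and> (\<forall>k t. \<bar>t\<bar> \<le> T \<longrightarrow> cmod (f' k t) \<le> M k)" by blast
    qed
    moreover have "(\<Sum>k. f' k t) = - \<i> * mop (B t) (\<phi> t) n"
    proof -
      have Bb: "cmod (B t n m) \<le> L 0 / 6" for m
      proof -
        have "(L 0 / 6) / (1 + \<bar>real n - real m\<bar>) ^ (0 + 2) \<le> (L 0 / 6) / 1"
          using L[of 0] by (intro divide_left_mono one_le_power) auto
        then show ?thesis using BL[of t n m 0] by linarith
      qed
      \<comment> \<open>The weight of order 2 supplies summability in \<open>m\<close>, the
        factorial summability in \<open>k\<close>.\<close>
      have sw: "(\<Sum>k. \<Sum>m. B t n m * v k t m) = (\<Sum>m. \<Sum>k. B t n m * v k t m)"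
      proof (rule suminf_swap_product_dominated)
        show "cmod (B t n m * v k t m) \<le> (L 0 / 6 * c 2 k t) * (1 / real (Suc m) ^ 2)" for k m
        proof -
          have "cmod (B t n m * v k t m) \<le> L 0 / 6 * (c 2 k t / real (Suc m) ^ 2)"
            unfolding norm_mult using L[of 0] by (intro mult_mono Bb vb) auto
          then show ?thesis by simp
        qed
        show "summable (\<lambda>k. L 0 / 6 * c 2 k t)" by (rule summable_mult[OF sums_summable[OF cs]])
        show "summable (\<lambda>m. 1 / real (Suc m) ^ 2)" by (rule summable_inverse_Suc_sq)
        show "L 0 / 6 * c 2 k t \<ge> 0" for k using c0 L[of 0] by auto
      qed simp
      have "mop (B t) (\<phi> t) n = (\<Sum>m. \<Sum>k. B t n m * v k t m)"
        unfolding mop_def \<phi>_def by (intro suminf_cong suminf_mult[symmetric] summable_norm_cancel[OF vs])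
      also have "\<dots> = (\<Sum>k. mop (B t) (v k t) n)" unfolding sw[symmetric] mop_def ..
      finally have 1: "mop (B t) (\<phi> t) n = (\<Sum>k. mop (B t) (v k t) n)" .
      have ms: "summable (\<lambda>k. mop (B t) (v k t) n)"
      proof (rule summable_comparison_test'[OF summable_mult[OF sums_summable[OF cs[of 0 t]], of "L 0"], of 0])
        fix k
        show "norm (mop (B t) (v k t) n) \<le> L 0 * c 0 k t"
        proof -
          have "norm (mop (B t) (v k t) n) \<le> 6 * (L 0 / 6) * c 0 k t / real (Suc n) ^ 0"
            by (rule mop_weight_bound(2)[OF BL vb]) (use c0 L[of 0] in auto)
          then show ?thesis by simp
        qed
      qed
      have "summable f'0" if "f'0 = (\<lambda>k. f' (Suc k) t)" for f'0
        unfolding that f'_def using summable_mult[OF ms, of "- \<i>"] by simp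
      then have "summable (\<lambda>k. f' k t)" using summable_Suc_iff[of "\<lambda>k. f' k t"] by simp
      moreover have "f' 0 t = 0" by (simp add: f'_def)
      ultimately have "(\<Sum>k. f' k t) = (\<Sum>k. f' (Suc k) t)" using suminf_split_head[of "\<lambda>k. f' k t"] by simp
      also have "\<dots> = (\<Sum>k. - \<i> * mop (B t) (v k t) n)" by (simp add: f'_def)
      also have "\<dots> = - \<i> * (\<Sum>k. mop (B t) (v k t) n)" by (rule suminf_mult[OF ms])
      finally show ?thesis unfolding 1 .
    qed
    ultimately show ?thesis unfolding \<phi>_def by simp
  qed
  ultimately show ?thesis by blast
qed

section \<open>Gaussian integrals\<close>

lemma gauss_integral:
  fixes a b :: real assumes a: "a > 0"
  shows integrable_gauss: "integrable lborel (\<lambda>x. exp (- a * (x - b)\<^sup>2))"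
    and integral_gauss: "(LINT x|lborel. exp (- a * (x - b)\<^sup>2)) = sqrt (pi / a)"
proof -
  define \<sigma> where "\<sigma> = 1 / sqrt (2 * a)"
  have \<sigma>: "\<sigma> > 0" "2 * \<sigma>\<^sup>2 = 1 / a" using a by (simp_all add: \<sigma>_def power_divide)
  have c: "2 * pi * \<sigma>\<^sup>2 = pi / a" using \<sigma>(2) by (metis mult.assoc mult.commute times_divide_eq_right mult_1_right)
  have eq: "exp (- a * (x - b)\<^sup>2) = sqrt (pi / a) * normal_density b \<sigma> x" for x
    using a unfolding normal_density_def c \<sigma>(2) by simp
  show "integrable lborel (\<lambda>x. exp (- a * (x - b)\<^sup>2))"
    unfolding eq by (intro integrable_mult_right integrable_normal_density \<sigma>)
  show "(LINT x|lborel. exp (- a * (x - b)\<^sup>2)) = sqrt (pi / a)"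
    unfolding eq using integral_normal_density[OF \<sigma>(1)] by simp
qed

lemma integrable_gauss_dominated:
  fixes f :: "real \<Rightarrow> 'a::{banach, second_countable_topology}"
  assumes "a > 0" "f \<in> borel_measurable borel" "\<And>x. norm (f x) \<le> C * exp (- a * (x - b)\<^sup>2)"
  shows "integrable lborel f"
proof (rule Bochner_Integration.integrable_bound)
  show "integrable lborel (\<lambda>x. C * exp (- a * (x - b)\<^sup>2))"
    using integrable_gauss[OF assms(1)] by (rule integrable_mult_right)
  show "AE x in lborel. norm (f x) \<le> norm (C * exp (- a * (x - b)\<^sup>2))"
    by (intro AE_I2 order_trans[OF assms(3)]) simp
qed (use assms in simp)

lemma tendsto_gauss_0:
  fixes f :: "real \<Rightarrow> 'a::real_normed_vector"
  assumes a: "a > 0" and b: "\<And>x. norm (f x) \<le> C * exp (- a * (x - c)\<^sup>2)"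
  shows "(f \<longlongrightarrow> 0) at_top" "(f \<longlongrightarrow> 0) at_bot"
proof -
  have C: "C \<ge> 0" using order_trans[OF norm_ge_zero b[of c]] by simp
  have l: "((\<lambda>x. C * exp (- a * (x - c)\<^sup>2)) \<longlongrightarrow> 0) at_top" "((\<lambda>x. C * exp (- a * (x - c)\<^sup>2)) \<longlongrightarrow> 0) at_bot"
    using a by real_asymp+
  show "(f \<longlongrightarrow> 0) at_top" by (rule Lim_null_comparison[OF always_eventually l(1)]) (use b in auto)
  show "(f \<longlongrightarrow> 0) at_bot" by (rule Lim_null_comparison[OF always_eventually l(2)]) (use b in auto)
qed

text \<open>The fundamental theorem of calculus on the whole line; the Gaussian bound on
  \<open>f\<close> removes both boundary terms. Every integration by parts below rests on
  it.\<close>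

lemma integral_derivative_eq_0:
  fixes f f' :: "real \<Rightarrow> complex"
  assumes d: "\<And>x. (f has_vector_derivative f' x) (at x)" and c: "continuous_on UNIV f'"
    and a: "a > 0" and b: "\<And>x. cmod (f x) \<le> C * exp (- a * (x - k)\<^sup>2)" and b': "integrable lborel f'"
  shows "(LINT x|lborel. f' x) = 0"
proof -
  have "(LBINT x=-\<infinity>..\<infinity>. f' x) = 0 - 0"
  proof (rule interval_integral_FTC_integrable[where F = f])
    show "set_integrable lborel (einterval (-\<infinity>) \<infinity>) f'" using b' by (simp add: set_integrable_def)
    show "((f \<circ> real_of_ereal) \<longlongrightarrow> 0) (at_right (-\<infinity>))" "((f \<circ> real_of_ereal) \<longlongrightarrow> 0) (at_left \<infinity>)"
      unfolding ereal_tendsto_simps using tendsto_gauss_0[of a f C k, OF a b] by auto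
  qed (use d c in \<open>auto simp: continuous_on_eq_continuous_at\<close>)
  then show ?thesis by (simp add: interval_lebesgue_integral_def set_lebesgue_integral_def)
qed

text \<open>The characteristic function of the standard normal law after the scaling
  \<open>y = sqrt 2 * x\<close>.\<close>

lemma fourier_gauss:
  "(LINT y|lborel. complex_of_real (exp (- (y\<^sup>2) / 4)) * cis (y * \<xi>)) = complex_of_real (2 * sqrt pi * exp (- (\<xi>\<^sup>2)))"
proof -
  have "complex_of_real (exp (- ((sqrt 2 * \<xi>)\<^sup>2) / 2)) = char std_normal_distribution (sqrt 2 * \<xi>)"
    by (simp add: char_std_normal_distribution)
  also have "\<dots> = (LINT x|lborel. std_normal_density x *\<^sub>R iexp (sqrt 2 * \<xi> * x))"
    unfolding char_def by (subst integral_density) (auto simp: normal_density_nonneg)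
  finally have 1: "(LINT x|lborel. std_normal_density x *\<^sub>R iexp (sqrt 2 * \<xi> * x)) = complex_of_real (exp (- (\<xi>\<^sup>2)))"
    by (simp add: power_mult_distrib)
  have "(LINT y|lborel. complex_of_real (exp (- (y\<^sup>2) / 4)) * cis (y * \<xi>))
      = \<bar>sqrt 2\<bar> *\<^sub>R (LINT x|lborel. complex_of_real (exp (- ((0 + sqrt 2 * x)\<^sup>2) / 4)) * cis ((0 + sqrt 2 * x) * \<xi>))"
    by (rule lborel_integral_real_affine) simp
  also have "(\<lambda>x. complex_of_real (exp (- ((0 + sqrt 2 * x)\<^sup>2) / 4)) * cis ((0 + sqrt 2 * x) * \<xi>))
      = (\<lambda>x. complex_of_real (sqrt (2 * pi)) * (std_normal_density x *\<^sub>R iexp (sqrt 2 * \<xi> * x)))"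
    by (rule ext) (simp add: std_normal_density_def power_mult_distrib cis_conv_exp scaleR_conv_of_real ac_simps)
  finally show ?thesis
  proof -
    have "complex_of_real (sqrt 2) * complex_of_real (sqrt 2) = 2" by (simp flip: of_real_mult)
    moreover assume "(LINT y|lborel. complex_of_real (exp (- (y\<^sup>2) / 4)) * cis (y * \<xi>))
      = \<bar>sqrt 2\<bar> *\<^sub>R (LINT x|lborel. complex_of_real (sqrt (2 * pi)) * (std_normal_density x *\<^sub>R iexp (sqrt 2 * \<xi> * x)))"
    ultimately show ?thesis unfolding integral_mult_right_zero 1
      by (simp add: scaleR_conv_of_real real_sqrt_mult mult.assoc[symmetric])
  qed
qed

section \<open>Hermite functions\<close>

lemma hermite_poly_derivative:
  "(hermite_poly n has_real_derivative 2 * real n * hermite_poly (n - 1) x) (at x)"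
proof (induction n rule: less_induct)
  case (less n)
  consider "n = 0" | "n = 1" | k where "n = Suc (Suc k)" by (metis One_nat_def not0_implies_Suc)
  then show ?case
  proof cases
    case 1
    then show ?thesis by (simp add: hermite_poly.simps(1)[abs_def])
  next
    case 2
    have "((\<lambda>x. 2 * x) has_real_derivative 2) (at x)" by (auto intro!: derivative_eq_intros)
    then show ?thesis using 2 by (simp add: hermite_poly.simps(2)[abs_def] of_nat_Suc)
  next
    case 3
    have d1: "(hermite_poly (Suc k) has_real_derivative 2 * real (Suc k) * hermite_poly k x) (at x)"
      using less.IH[of "Suc k"] 3 by simp
    have d2: "(hermite_poly k has_real_derivative 2 * real k * hermite_poly (k - 1) x) (at x)"
      using less.IH[of k] 3 by simp
    have "((\<lambda>x. 2 * x * hermite_poly (Suc k) x - 2 * real (Suc k) * hermite_poly k x) has_real_derivative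
        (2 * hermite_poly (Suc k) x + 2 * x * (2 * real (Suc k) * hermite_poly k x)
          - 2 * real (Suc k) * (2 * real k * hermite_poly (k - 1) x))) (at x)"
      by (rule derivative_eq_intros d1 d2 refl | simp)+
    moreover have "2 * x * hermite_poly k x - 2 * real k * hermite_poly (k - 1) x = hermite_poly (Suc k) x"
      by (cases k) simp_all
    then have "2 * real (Suc k) * (2 * x * hermite_poly k x - 2 * real k * hermite_poly (k - 1) x) = 2 * real (Suc k) * hermite_poly (Suc k) x"
      by simp
    then have "2 * hermite_poly (Suc k) x + 2 * x * (2 * real (Suc k) * hermite_poly k x)
          - 2 * real (Suc k) * (2 * real k * hermite_poly (k - 1) x) = 2 * real n * hermite_poly (Suc k) x"
      unfolding 3 by (simp add: algebra_simps of_nat_Suc)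
    ultimately show ?thesis using 3 by (simp add: hermite_poly.simps(3)[abs_def])
  qed
qed

text \<open>For \<open>n = 0\<close> the index \<open>n - 1\<close> is truncated, but its
  coefficient vanishes. All ladder relations below are stated in this way, without a separate case
  for 0.\<close>

lemma hermite_poly_rec: "2 * x * hermite_poly n x = hermite_poly (Suc n) x + 2 * real n * hermite_poly (n - 1) x"
  by (cases n) simp_all

definition hnorm :: "nat \<Rightarrow> real" where "hnorm n = sqrt (2 ^ n * fact n * sqrt pi)"

lemma hnorm_pos: "hnorm n > 0" by (simp add: hnorm_def)

lemma hnorm_Suc: "hnorm (Suc n) = sqrt (2 * real (Suc n)) * hnorm n"
  unfolding hnorm_def real_sqrt_mult[symmetric] by (simp add: ac_simps)

lemma hfun_eq: "hfun n x = hermite_poly n x * exp (- (x\<^sup>2) / 2) / hnorm n"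
  by (simp add: hfun_def hnorm_def)

lemma hfun_lower: "2 * real n * (hermite_poly (n - 1) x * exp (- (x\<^sup>2) / 2) / hnorm n) = sqrt (2 * real n) * hfun (n - 1) x"
proof (cases n)
  case (Suc k)
  define s where "s = sqrt (2 * real n)"
  have s: "2 * real n = s * s" "s > 0" using Suc by (simp_all add: s_def)
  have "hnorm n = s * hnorm k" using hnorm_Suc[of k] Suc by (simp add: s_def)
  then show ?thesis unfolding s_def[symmetric] s(1) using s(2) Suc hnorm_pos[of k] by (simp add: hfun_eq)
qed simp

lemma hfun_raise: "hermite_poly (Suc n) x * exp (- (x\<^sup>2) / 2) / hnorm n = sqrt (2 * real (Suc n)) * hfun (Suc n) x"
  using hnorm_pos[of n] by (simp add: hfun_eq hnorm_Suc)

lemma hfun_mult: "2 * x * hfun n x = sqrt (2 * real n) * hfun (n - 1) x + sqrt (2 * real (Suc n)) * hfun (Suc n) x"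
proof -
  have "2 * x * hfun n x = (2 * x * hermite_poly n x) * exp (- (x\<^sup>2) / 2) / hnorm n" by (simp add: hfun_eq)
  also have "\<dots> = hermite_poly (Suc n) x * exp (- (x\<^sup>2) / 2) / hnorm n
      + 2 * real n * (hermite_poly (n - 1) x * exp (- (x\<^sup>2) / 2) / hnorm n)"
    unfolding hermite_poly_rec by (simp add: distrib_right add_divide_distrib)
  finally show ?thesis unfolding hfun_lower hfun_raise by simp
qed

text \<open>The derivative in ladder form: half the difference of the two terms whose sum is
  \<open>2 * x * hfun n x\<close>.\<close>

definition hfun' :: "nat \<Rightarrow> real \<Rightarrow> real" where
  "hfun' n x = (sqrt (2 * real n) * hfun (n - 1) x - sqrt (2 * real (Suc n)) * hfun (Suc n) x) / 2"

lemma hfun_derivative: "(hfun n has_real_derivative hfun' n x) (at x)"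
proof -
  have "((\<lambda>x. hermite_poly n x * exp (- (x\<^sup>2) / 2) / hnorm n) has_real_derivative
      ((2 * real n * hermite_poly (n - 1) x) * exp (- (x\<^sup>2) / 2) + hermite_poly n x * (exp (- (x\<^sup>2) / 2) * (- x))) / hnorm n) (at x)"
    by (rule derivative_eq_intros hermite_poly_derivative refl | simp add: hnorm_pos less_imp_neq[symmetric])+
  moreover have "((2 * real n * hermite_poly (n - 1) x) * exp (- (x\<^sup>2) / 2) + hermite_poly n x * (exp (- (x\<^sup>2) / 2) * (- x))) / hnorm n
      = sqrt (2 * real n) * hfun (n - 1) x - x * hfun n x"
    unfolding hfun_lower[symmetric] by (simp add: hfun_eq diff_divide_distrib ac_simps)
  moreover have "\<dots> = hfun' n x"
  proof -
    have "2 * (x * hfun n x) = sqrt (2 * real n) * hfun (n - 1) x + sqrt (2 * real (Suc n)) * hfun (Suc n) x"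
      using hfun_mult[of x n] by (simp only: mult.assoc)
    moreover have "2 * c = a + b \<Longrightarrow> a - c = (a - b) / 2" for a b c :: real by (simp add: field_simps)
    ultimately show ?thesis unfolding hfun'_def by blast
  qed
  ultimately show ?thesis by (simp add: hfun_eq[abs_def])
qed

section \<open>Gaussian bounds and orthonormality of the Hermite functions\<close>

lemma continuous_on_hfun: "continuous_on A (hfun n)"
  using hfun_derivative by (meson DERIV_isCont continuous_at_imp_continuous_on)

lemma continuous_on_hfun'[continuous_intros]: "continuous_on A g \<Longrightarrow> continuous_on A (\<lambda>x. hfun n (g x))"
  using continuous_on_compose2[OF continuous_on_hfun[of UNIV]] by auto

text \<open>Half of the Gaussian is spent on the polynomial: \<open>1 + |x| \<le> exp |x|\<close>,
  and completing the square gives \<open>k |x| \<le> k\<^sup>2 + x\<^sup>2 / 4\<close>.\<close>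

lemma poly_gauss_le:
  fixes x :: real shows "(1 + \<bar>x\<bar>) ^ k * exp (- (x\<^sup>2) / 2) \<le> exp (real k ^ 2) * exp (- (x\<^sup>2) / 4)"
proof -
  have "(1 + \<bar>x\<bar>) ^ k \<le> exp \<bar>x\<bar> ^ k" by (intro power_mono exp_ge_add_one_self) auto
  also have "\<dots> = exp (real k * \<bar>x\<bar>)" by (simp add: exp_of_nat_mult)
  also have "\<dots> \<le> exp (real k ^ 2 + x\<^sup>2 / 4)"
  proof -
    have "0 \<le> (real k - \<bar>x\<bar> / 2)\<^sup>2" by simp
    also have "\<dots> = real k ^ 2 + x\<^sup>2 / 4 - real k * \<bar>x\<bar>" by (simp add: power2_eq_square algebra_simps)
    finally show ?thesis by simp
  qed
  finally have "(1 + \<bar>x\<bar>) ^ k * exp (- (x\<^sup>2) / 2) \<le> exp (real k ^ 2 + x\<^sup>2 / 4) * exp (- (x\<^sup>2) / 2)"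
    by (intro mult_right_mono) auto
  also have "\<dots> = exp (real k ^ 2) * exp (- (x\<^sup>2) / 4)" by (simp add: exp_add[symmetric])
  finally show ?thesis .
qed

text \<open>All weights are carried through the induction, because each step of the recurrence
  multiplies by \<open>x\<close>. In this way the Gaussian rate is reduced once, in the base case,
  and not at every step.\<close>

lemma hfun_weighted_bound: "\<exists>C. \<forall>x. (1 + \<bar>x\<bar>) ^ k * \<bar>hfun n x\<bar> \<le> C * exp (- (x\<^sup>2) / 4)"
proof (induction n arbitrary: k rule: less_induct)
  case (less n)
  show ?case
  proof (cases n)
    case 0
    show ?thesis
    proof (intro exI allI)
      fix x
      have "(1 + \<bar>x\<bar>) ^ k * \<bar>hfun n x\<bar> = ((1 + \<bar>x\<bar>) ^ k * exp (- (x\<^sup>2) / 2)) / hnorm 0"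
        using hnorm_pos[of 0] by (simp add: 0 hfun_eq abs_mult)
      also have "\<dots> \<le> (exp (real k ^ 2) * exp (- (x\<^sup>2) / 4)) / hnorm 0"
        using hnorm_pos[of 0] by (intro divide_right_mono poly_gauss_le) auto
      finally show "(1 + \<bar>x\<bar>) ^ k * \<bar>hfun n x\<bar> \<le> (exp (real k ^ 2) / hnorm 0) * exp (- (x\<^sup>2) / 4)" by simp
    qed
  next
    case (Suc j)
    obtain C where C: "\<And>x. (1 + \<bar>x\<bar>) ^ Suc k * \<bar>hfun j x\<bar> \<le> C * exp (- (x\<^sup>2) / 4)" using less.IH[of j "Suc k"] Suc by auto
    obtain D where D: "\<And>x. (1 + \<bar>x\<bar>) ^ k * \<bar>hfun (j - 1) x\<bar> \<le> D * exp (- (x\<^sup>2) / 4)" 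
    proof -
      have "j - 1 < n" using Suc by simp
      from less.IH[OF this, of k] that show ?thesis by blast
    qed
    have s1: "sqrt (2 * real n) \<ge> 1" using Suc by (simp add: of_nat_Suc)
    show ?thesis
    proof (intro exI allI)
      fix x
      have "\<bar>hfun n x\<bar> \<le> sqrt (2 * real n) * \<bar>hfun n x\<bar>" using mult_right_mono[OF s1, of "\<bar>hfun n x\<bar>"] by simp
      also have "\<dots> = \<bar>sqrt (2 * real n) * hfun n x\<bar>" by (simp add: abs_mult)
      also have "sqrt (2 * real n) * hfun n x = 2 * x * hfun j x - sqrt (2 * real j) * hfun (j - 1) x"
        using hfun_mult[of x j] Suc by simp
      also have "\<bar>\<dots>\<bar> \<le> \<bar>2 * x * hfun j x\<bar> + \<bar>sqrt (2 * real j) * hfun (j - 1) x\<bar>" by (rule abs_triangle_ineq4)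
      also have "\<dots> = 2 * (\<bar>x\<bar> * \<bar>hfun j x\<bar>) + sqrt (2 * real j) * \<bar>hfun (j - 1) x\<bar>" by (simp add: abs_mult)
      also have "\<bar>x\<bar> * \<bar>hfun j x\<bar> \<le> (1 + \<bar>x\<bar>) * \<bar>hfun j x\<bar>" by (intro mult_right_mono) auto
      finally have h: "\<bar>hfun n x\<bar> \<le> 2 * ((1 + \<bar>x\<bar>) * \<bar>hfun j x\<bar>) + sqrt (2 * real j) * \<bar>hfun (j - 1) x\<bar>" by simp
      have "(1 + \<bar>x\<bar>) ^ k * \<bar>hfun n x\<bar> \<le> (1 + \<bar>x\<bar>) ^ k * (2 * ((1 + \<bar>x\<bar>) * \<bar>hfun j x\<bar>) + sqrt (2 * real j) * \<bar>hfun (j - 1) x\<bar>)"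
        by (intro mult_left_mono h) auto
      also have "\<dots> = 2 * ((1 + \<bar>x\<bar>) ^ Suc k * \<bar>hfun j x\<bar>) + sqrt (2 * real j) * ((1 + \<bar>x\<bar>) ^ k * \<bar>hfun (j - 1) x\<bar>)"
        by (simp add: algebra_simps)
      also have "\<dots> \<le> 2 * (C * exp (- (x\<^sup>2) / 4)) + sqrt (2 * real j) * (D * exp (- (x\<^sup>2) / 4))"
        by (intro add_mono mult_left_mono C D) auto
      also have "\<dots> = (2 * C + sqrt (2 * real j) * D) * exp (- (x\<^sup>2) / 4)" by (simp add: algebra_simps)
      finally show "(1 + \<bar>x\<bar>) ^ k * \<bar>hfun n x\<bar> \<le> (2 * C + sqrt (2 * real j) * D) * exp (- (x\<^sup>2) / 4)" .
    qed
  qed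
qed

lemma hfun_bound:
  obtains C where "C > 0" "\<And>x. \<bar>hfun n x\<bar> \<le> C * exp (- (x\<^sup>2) / 4)"
proof -
  obtain C where C: "\<And>x. (1 + \<bar>x\<bar>) ^ 0 * \<bar>hfun n x\<bar> \<le> C * exp (- (x\<^sup>2) / 4)" using hfun_weighted_bound[of 0 n] by blast
  show ?thesis
  proof (rule that[of "\<bar>C\<bar> + 1"])
    fix x
    have "\<bar>hfun n x\<bar> \<le> C * exp (- (x\<^sup>2) / 4)" using C[of x] by simp
    also have "\<dots> \<le> (\<bar>C\<bar> + 1) * exp (- (x\<^sup>2) / 4)" by (intro mult_right_mono) auto
    finally show "\<bar>hfun n x\<bar> \<le> (\<bar>C\<bar> + 1) * exp (- (x\<^sup>2) / 4)" .
  qed simp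
qed

lemma hfun_measurable [measurable]: "hfun n \<in> borel_measurable borel"
  by (intro borel_measurable_continuous_onI continuous_on_hfun)

lemma hfun_product_bound:
  obtains C where "C > 0" "\<And>x. \<bar>hfun m x * hfun n x\<bar> \<le> C * exp (- (1/2) * (x - 0)\<^sup>2)"
proof -
  obtain C where C: "C > 0" "\<And>x. \<bar>hfun m x\<bar> \<le> C * exp (- (x\<^sup>2) / 4)" using hfun_bound by blast
  obtain D where D: "D > 0" "\<And>x. \<bar>hfun n x\<bar> \<le> D * exp (- (x\<^sup>2) / 4)" using hfun_bound by blast
  show ?thesis
  proof (rule that[of "C * D"])
    fix x
    have "\<bar>hfun m x * hfun n x\<bar> \<le> (C * exp (- (x\<^sup>2) / 4)) * (D * exp (- (x\<^sup>2) / 4))"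
      unfolding abs_mult using C D by (intro mult_mono) auto
    also have "\<dots> = (C * D) * (exp (- (x\<^sup>2) / 4) * exp (- (x\<^sup>2) / 4))" by simp
    also have "exp (- (x\<^sup>2) / 4) * exp (- (x\<^sup>2) / 4) = exp (- (1/2) * (x - 0)\<^sup>2)" by (simp add: exp_add[symmetric])
    finally show "\<bar>hfun m x * hfun n x\<bar> \<le> C * D * exp (- (1/2) * (x - 0)\<^sup>2)" .
  qed (use C D in simp)
qed

lemma integrable_hfun_product: "integrable lborel (\<lambda>x. hfun m x * hfun n x)"
proof -
  obtain C where "C > 0" "\<And>x. \<bar>hfun m x * hfun n x\<bar> \<le> C * exp (- (1/2) * (x - 0)\<^sup>2)"
    using hfun_product_bound by blast
  then show ?thesis by (intro integrable_gauss_dominated[where a = "1/2" and b = 0 and C = C]) auto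
qed

text \<open>Raising and lowering operators are adjoint. Integrating the derivative of the product to
  zero gives one relation, symmetry of multiplication by \<open>x\<close> another; in their
  combination the unwanted terms cancel.\<close>

lemma hfun_ladder_integral:
  "sqrt (2 * real m) * (LINT x|lborel. hfun (m - 1) x * hfun n x) = sqrt (2 * real (Suc n)) * (LINT x|lborel. hfun m x * hfun (Suc n) x)"
proof -
  let ?I = "\<lambda>m n. LINT x|lborel. hfun m x * hfun n x"
  obtain C where C: "C > 0" "\<And>x. \<bar>hfun m x * hfun n x\<bar> \<le> C * exp (- (1/2) * (x - 0)\<^sup>2)"
    using hfun_product_bound by blast
  note i = integrable_hfun_product
  let ?s = "\<lambda>k. sqrt (2 * real k)"
  have e1: "hfun' m x * hfun n x + hfun m x * hfun' n x = (?s m * (hfun (m-1) x * hfun n x) - ?s (Suc m) * (hfun (Suc m) x * hfun n x)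
      + (?s n * (hfun m x * hfun (n-1) x) - ?s (Suc n) * (hfun m x * hfun (Suc n) x))) / 2" for x
    by (simp add: hfun'_def field_simps)
  have "(LINT x|lborel. complex_of_real (hfun' m x * hfun n x + hfun m x * hfun' n x)) = 0"
  proof (rule integral_derivative_eq_0[where f = "\<lambda>x. complex_of_real (hfun m x * hfun n x)" and a = "1/2" and C = C and k = 0])
    show "((\<lambda>x. complex_of_real (hfun m x * hfun n x)) has_vector_derivative complex_of_real (hfun' m x * hfun n x + hfun m x * hfun' n x)) (at x)" for x
      by (rule bounded_linear.has_vector_derivative[OF bounded_linear_of_real],
          unfold has_real_derivative_iff_has_vector_derivative[symmetric],
          rule DERIV_cong[OF DERIV_mult[OF hfun_derivative hfun_derivative]]) simp
    show "continuous_on UNIV (\<lambda>x. complex_of_real (hfun' m x * hfun n x + hfun m x * hfun' n x))"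
      unfolding hfun'_def by (intro continuous_intros) auto
    show "cmod (complex_of_real (hfun m x * hfun n x)) \<le> C * exp (- (1/2) * (x - 0)\<^sup>2)" for x
      using C(2)[of x] unfolding norm_of_real .
    show "integrable lborel (\<lambda>x. complex_of_real (hfun' m x * hfun n x + hfun m x * hfun' n x))"
      unfolding e1 by (intro integrable_of_real integrable_divide_zero Bochner_Integration.integrable_add
          Bochner_Integration.integrable_diff integrable_mult_right i)
  qed simp
  then have "(LINT x|lborel. hfun' m x * hfun n x + hfun m x * hfun' n x) = 0"
    unfolding integral_complex_of_real by (simp only: of_real_eq_0_iff)
  then have E1: "?s m * ?I (m-1) n - ?s (Suc m) * ?I (Suc m) n + (?s n * ?I m (n-1) - ?s (Suc n) * ?I m (Suc n)) = 0"
    unfolding e1 by (simp add: i Bochner_Integration.integral_add Bochner_Integration.integral_diff)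
  have "(\<lambda>x. ?s m * (hfun (m-1) x * hfun n x) + ?s (Suc m) * (hfun (Suc m) x * hfun n x))
     = (\<lambda>x. ?s n * (hfun m x * hfun (n-1) x) + ?s (Suc n) * (hfun m x * hfun (Suc n) x))"
  proof
    fix x
    have "(2 * x * hfun m x) * hfun n x = hfun m x * (2 * x * hfun n x)" by simp
    then show "?s m * (hfun (m-1) x * hfun n x) + ?s (Suc m) * (hfun (Suc m) x * hfun n x)
      = ?s n * (hfun m x * hfun (n-1) x) + ?s (Suc n) * (hfun m x * hfun (Suc n) x)"
      unfolding hfun_mult by (simp add: algebra_simps)
  qed
  then have "(LINT x|lborel. ?s m * (hfun (m-1) x * hfun n x) + ?s (Suc m) * (hfun (Suc m) x * hfun n x))
     = (LINT x|lborel. ?s n * (hfun m x * hfun (n-1) x) + ?s (Suc n) * (hfun m x * hfun (Suc n) x))" by (rule arg_cong)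
  then have E2: "?s m * ?I (m-1) n + ?s (Suc m) * ?I (Suc m) n = ?s n * ?I m (n-1) + ?s (Suc n) * ?I m (Suc n)"
    by (simp add: i Bochner_Integration.integral_add)
  have "a - b + (c - d) = 0 \<Longrightarrow> a + b = c + d \<Longrightarrow> a = d" for a b c d :: real by linarith
  from this[OF E1 E2] show ?thesis .
qed

text \<open>The adjoint ladder relation lowers both indices together until the right one is 0, where
  the lowering operator or the Gaussian integral decides.\<close>

lemma hfun_orthonormal: "(LINT x|lborel. hfun m x * hfun n x) = (if m = n then 1 else 0)"
proof (induction n arbitrary: m)
  case 0
  show ?case
  proof (cases m)
    case 0
    have "hfun 0 x * hfun 0 x = (1 / sqrt pi) * exp (- 1 * (x - 0)\<^sup>2)" for x
      by (simp add: hfun_def power2_eq_square exp_add[symmetric] real_sqrt_mult_self)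
    then show ?thesis using integral_gauss[of 1 0] 0 by simp
  next
    case (Suc k)
    have "sqrt (2 * real (Suc k)) * (LINT x|lborel. hfun 0 x * hfun (Suc k) x) = 0"
      using hfun_ladder_integral[of 0 k] by simp
    then show ?thesis using Suc by (simp add: mult.commute)
  qed
next
  case (Suc n)
  have "sqrt (2 * real (Suc n)) * (LINT x|lborel. hfun m x * hfun (Suc n) x) = sqrt (2 * real m) * (if m - 1 = n then 1 else 0)"
    using hfun_ladder_integral[of m n] Suc.IH[of "m - 1"] by simp
  then show ?case by (cases m) auto
qed

section \<open>Cross-Wigner functions of Hermite functions\<close>

text \<open>The factor 2 under the root appears because the ladder operators are taken as
  \<open>x\<close> plus or minus the derivative, without normalisation by
  \<open>sqrt 2\<close>.\<close>

abbreviation rt :: "nat \<Rightarrow> complex" where "rt k \<equiv> complex_of_real (sqrt (2 * real k))"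

definition wkernel :: "nat \<Rightarrow> nat \<Rightarrow> real \<Rightarrow> real \<Rightarrow> real" where
  "wkernel m n x y = hfun m (x + y / 2) * hfun n (x - y / 2)"

text \<open>The squares of \<open>x + y/2\<close> and \<open>x - y/2\<close> add up to
  \<open>2x\<^sup>2 + y\<^sup>2 / 2\<close>: the mixed term cancels, so the decay in
  \<open>y\<close> is uniform in \<open>x\<close>.\<close>

lemma wkernel_bound:
  obtains C where "C > 0" "\<And>x y. \<bar>wkernel m n x y\<bar> \<le> C * exp (- (1/8) * (y - 0)\<^sup>2)"
proof -
  obtain C where C: "C > 0" "\<And>x. \<bar>hfun m x\<bar> \<le> C * exp (- (x\<^sup>2) / 4)" using hfun_bound by blast
  obtain D where D: "D > 0" "\<And>x. \<bar>hfun n x\<bar> \<le> D * exp (- (x\<^sup>2) / 4)" using hfun_bound by blast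
  show ?thesis
  proof (rule that[of "C * D"])
    fix x y :: real
    have "\<bar>wkernel m n x y\<bar> \<le> (C * exp (- ((x + y/2)\<^sup>2) / 4)) * (D * exp (- ((x - y/2)\<^sup>2) / 4))"
      unfolding wkernel_def abs_mult using C D by (intro mult_mono) auto
    also have "\<dots> = (C * D) * exp (- ((x + y/2)\<^sup>2) / 4 + - ((x - y/2)\<^sup>2) / 4)" unfolding exp_add by simp
    also have "\<dots> \<le> (C * D) * exp (- (1/8) * (y - 0)\<^sup>2)"
    proof -
      have "- ((x + y/2)\<^sup>2) / 4 + - ((x - y/2)\<^sup>2) / 4 = - (1/8) * (y - 0)\<^sup>2 - x\<^sup>2 / 2"
        by (simp add: power2_eq_square field_simps)
      then show ?thesis using C D by (intro mult_left_mono) auto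
    qed
    finally show "\<bar>wkernel m n x y\<bar> \<le> C * D * exp (- (1/8) * (y - 0)\<^sup>2)" .
  qed (use C D in simp)
qed

lemma wkernel_measurable [measurable]: "wkernel m n x \<in> borel_measurable borel"
  unfolding wkernel_def[abs_def] by measurable

lemma integrable_wkernel: "integrable lborel (\<lambda>y. complex_of_real (wkernel m n x y) * cis (y * \<xi>))"
proof -
  obtain C where C: "C > 0" "\<And>x y. \<bar>wkernel m n x y\<bar> \<le> C * exp (- (1/8) * (y - 0)\<^sup>2)"
    using wkernel_bound by blast
  have m: "(\<lambda>y. cis (y * \<xi>)) \<in> borel_measurable borel"
    by (intro borel_measurable_continuous_onI continuous_intros)
  show ?thesis
  proof (rule integrable_gauss_dominated[where a = "1/8" and b = 0 and C = C])
    show "(\<lambda>y. complex_of_real (wkernel m n x y) * cis (y * \<xi>)) \<in> borel_measurable borel"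
      using m by measurable
    show "cmod (complex_of_real (wkernel m n x y) * cis (y * \<xi>)) \<le> C * exp (- (1/8) * (y - 0)\<^sup>2)" for y
      using C(2)[of x y] unfolding norm_mult norm_of_real norm_cis by simp
  qed simp
qed

lemma wigner_eq: "wigner m n x \<xi> = (1 / (2 * pi)) * (LINT y|lborel. complex_of_real (wkernel m n x y) * cis (y * \<xi>))"
  unfolding wigner_def wkernel_def by simp

lemma wkernel_mult:
  "complex_of_real (4 * x) * complex_of_real (wkernel m n x y) = rt m * complex_of_real (wkernel (m - 1) n x y)
    + rt (Suc m) * complex_of_real (wkernel (Suc m) n x y) + rt n * complex_of_real (wkernel m (n - 1) x y)
    + rt (Suc n) * complex_of_real (wkernel m (Suc n) x y)"
proof -
  let ?u = "x + y / 2" and ?v = "x - y / 2"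
  have "4 * x * (hfun m ?u * hfun n ?v) = (2 * ?u * hfun m ?u) * hfun n ?v + hfun m ?u * (2 * ?v * hfun n ?v)"
    by (simp add: algebra_simps)
  also have "\<dots> = sqrt (2 * real m) * (hfun (m - 1) ?u * hfun n ?v) + sqrt (2 * real (Suc m)) * (hfun (Suc m) ?u * hfun n ?v)
      + sqrt (2 * real n) * (hfun m ?u * hfun (n - 1) ?v) + sqrt (2 * real (Suc n)) * (hfun m ?u * hfun (Suc n) ?v)"
    unfolding hfun_mult by (simp add: algebra_simps)
  finally show ?thesis unfolding wkernel_def of_real_mult[symmetric] of_real_add[symmetric] of_real_eq_iff .
qed

definition wkernel' :: "nat \<Rightarrow> nat \<Rightarrow> real \<Rightarrow> real \<Rightarrow> complex" where
  "wkernel' m n x y = (rt m * complex_of_real (wkernel (m - 1) n x y) - rt (Suc m) * complex_of_real (wkernel (Suc m) n x y)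
    - rt n * complex_of_real (wkernel m (n - 1) x y) + rt (Suc n) * complex_of_real (wkernel m (Suc n) x y)) / 4"

lemma wkernel_derivative:
  "((\<lambda>y. complex_of_real (wkernel m n x y)) has_vector_derivative wkernel' m n x y) (at y)"
proof -
  have 1: "((\<lambda>y. hfun m (x + y/2)) has_real_derivative hfun' m (x + y/2) * (1/2)) (at y)"
    by (rule DERIV_chain2[OF hfun_derivative]) (auto intro!: derivative_eq_intros)
  have 2: "((\<lambda>y. hfun n (x - y/2)) has_real_derivative hfun' n (x - y/2) * (- 1/2)) (at y)"
    by (rule DERIV_chain2[OF hfun_derivative]) (auto intro!: derivative_eq_intros)
  have "((\<lambda>y. wkernel m n x y) has_real_derivative
      (hfun' m (x + y/2) * (1/2) * hfun n (x - y/2) + hfun' n (x - y/2) * (- 1/2) * hfun m (x + y/2))) (at y)"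
    unfolding wkernel_def by (rule DERIV_mult[OF 1 2])
  then have "((\<lambda>y. complex_of_real (wkernel m n x y)) has_vector_derivative
      complex_of_real (hfun' m (x + y/2) * (1/2) * hfun n (x - y/2) + hfun' n (x - y/2) * (- 1/2) * hfun m (x + y/2))) (at y)"
    unfolding has_real_derivative_iff_has_vector_derivative
    by (rule bounded_linear.has_vector_derivative[OF bounded_linear_of_real])
  moreover have "complex_of_real (hfun' m (x + y/2) * (1/2) * hfun n (x - y/2) + hfun' n (x - y/2) * (- 1/2) * hfun m (x + y/2)) = wkernel' m n x y"
    unfolding wkernel'_def wkernel_def hfun'_def by (simp add: field_simps)
  ultimately show ?thesis by simp
qed

text \<open>Multiplication by \<open>x\<close> acts on the kernel through the three-term recurrence
  in both indices, multiplication by \<open>\<xi>\<close> through integration by parts in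
  \<open>y\<close>. In \<open>x \<plusminus> \<i>\<xi>\<close> two of the four ladder terms cancel,
  one for each index remaining.\<close>

lemma wigner_z_zbar:
  shows wigner_z: "2 * Complex x \<xi> * wigner m n x \<xi> = rt n * wigner m (n - 1) x \<xi> + rt (Suc m) * wigner (Suc m) n x \<xi>"
    and wigner_zbar: "2 * cnj (Complex x \<xi>) * wigner m n x \<xi> = rt m * wigner (m - 1) n x \<xi> + rt (Suc n) * wigner m (Suc n) x \<xi>"
proof -
  define J where "J m n = (LINT y|lborel. complex_of_real (wkernel m n x y) * cis (y * \<xi>))" for m n
  note i = integrable_wkernel
  have hJ: "has_bochner_integral lborel (\<lambda>y. complex_of_real (wkernel m n x y) * cis (y * \<xi>)) (J m n)" for m n
    unfolding J_def using i by (simp add: has_bochner_integral_iff)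
  have h1: "has_bochner_integral lborel (\<lambda>y. complex_of_real (4 * x) * (complex_of_real (wkernel m n x y) * cis (y * \<xi>)))
     (complex_of_real (4 * x) * J m n)"
    by (intro has_bochner_integral_mult_right hJ)
  have h2: "has_bochner_integral lborel (\<lambda>y. rt m * (complex_of_real (wkernel (m - 1) n x y) * cis (y * \<xi>)) + rt (Suc m) * (complex_of_real (wkernel (Suc m) n x y) * cis (y * \<xi>))
       + rt n * (complex_of_real (wkernel m (n - 1) x y) * cis (y * \<xi>)) + rt (Suc n) * (complex_of_real (wkernel m (Suc n) x y) * cis (y * \<xi>)))
    (rt m * J (m - 1) n + rt (Suc m) * J (Suc m) n + rt n * J m (n - 1) + rt (Suc n) * J m (Suc n))"
    by (intro has_bochner_integral_add has_bochner_integral_mult_right hJ)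
  have heq: "(\<lambda>y. complex_of_real (4 * x) * (complex_of_real (wkernel m n x y) * cis (y * \<xi>)))
     = (\<lambda>y. rt m * (complex_of_real (wkernel (m - 1) n x y) * cis (y * \<xi>)) + rt (Suc m) * (complex_of_real (wkernel (Suc m) n x y) * cis (y * \<xi>))
       + rt n * (complex_of_real (wkernel m (n - 1) x y) * cis (y * \<xi>)) + rt (Suc n) * (complex_of_real (wkernel m (Suc n) x y) * cis (y * \<xi>)))"
    unfolding mult.assoc[symmetric] wkernel_mult distrib_right ..
  have E1: "complex_of_real (4 * x) * J m n = rt m * J (m - 1) n + rt (Suc m) * J (Suc m) n + rt n * J m (n - 1) + rt (Suc n) * J m (Suc n)"
    by (rule has_bochner_integral_eq[OF h1[unfolded heq] h2])
  obtain C where C: "C > 0" "\<And>x y. \<bar>wkernel m n x y\<bar> \<le> C * exp (- (1/8) * (y - 0)\<^sup>2)"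
    using wkernel_bound by blast
  let ?d = "\<lambda>y. complex_of_real (wkernel m n x y) * (\<i> * complex_of_real \<xi> * cis (\<xi> * y)) + wkernel' m n x y * cis (\<xi> * y)"
  have dd: "?d = (\<lambda>y. \<i> * complex_of_real \<xi> * (complex_of_real (wkernel m n x y) * cis (y * \<xi>))
      + (rt m * (complex_of_real (wkernel (m - 1) n x y) * cis (y * \<xi>)) - rt (Suc m) * (complex_of_real (wkernel (Suc m) n x y) * cis (y * \<xi>))
       - rt n * (complex_of_real (wkernel m (n - 1) x y) * cis (y * \<xi>)) + rt (Suc n) * (complex_of_real (wkernel m (Suc n) x y) * cis (y * \<xi>))) / 4)"
    unfolding wkernel'_def by (rule ext) (simp add: field_simps)
  have hd: "has_bochner_integral lborel ?d (\<i> * complex_of_real \<xi> * J m n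
      + (rt m * J (m - 1) n - rt (Suc m) * J (Suc m) n - rt n * J m (n - 1) + rt (Suc n) * J m (Suc n)) / 4)"
    unfolding dd by (intro has_bochner_integral_add has_bochner_integral_diff has_bochner_integral_divide_zero has_bochner_integral_mult_right hJ)
  have cw: "continuous_on UNIV (\<lambda>y. wkernel m n x y)" for m n
    unfolding wkernel_def by (intro continuous_intros) auto
  have "(LINT y|lborel. ?d y) = 0"
  proof (rule integral_derivative_eq_0[where f = "\<lambda>y. complex_of_real (wkernel m n x y) * cis (\<xi> * y)" and a = "1/8" and C = C and k = 0])
    show "((\<lambda>y. complex_of_real (wkernel m n x y) * cis (\<xi> * y)) has_vector_derivative ?d y) (at y)" for y
    proof -
      have "((\<lambda>y. \<xi> * y) has_derivative (\<lambda>h. \<xi> * h)) (at y)" by (auto intro!: derivative_eq_intros)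
      from has_derivative_cis[OF this] have "((\<lambda>y. cis (\<xi> * y)) has_vector_derivative \<i> * complex_of_real \<xi> * cis (\<xi> * y)) (at y)"
        unfolding has_vector_derivative_def by (simp add: scaleR_conv_of_real ac_simps)
      then show ?thesis by (intro has_vector_derivative_mult wkernel_derivative)
    qed
    show "continuous_on UNIV ?d"
      unfolding wkernel'_def divide_inverse
      by (intro continuous_on_add continuous_on_diff continuous_on_mult continuous_on_of_real continuous_on_const
          continuous_on_cis continuous_on_id cw)
    show "cmod (complex_of_real (wkernel m n x y) * cis (\<xi> * y)) \<le> C * exp (- (1/8) * (y - 0)\<^sup>2)" for y
      using C(2)[of x y] unfolding norm_mult norm_of_real norm_cis by simp
    show "integrable lborel ?d" using hd by (rule integrable.intros)
  qed simp
  then have E2: "\<i> * complex_of_real \<xi> * J m n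
      + (rt m * J (m - 1) n - rt (Suc m) * J (Suc m) n - rt n * J m (n - 1) + rt (Suc n) * J m (Suc n)) / 4 = 0"
    using has_bochner_integral_integral_eq[OF hd] by simp
  have z: "Complex x \<xi> = complex_of_real x + \<i> * complex_of_real \<xi>" "cnj (Complex x \<xi>) = complex_of_real x - \<i> * complex_of_real \<xi>"
    by (simp_all add: complex_eq_iff)
  have J1: "2 * Complex x \<xi> * J m n = rt n * J m (n - 1) + rt (Suc m) * J (Suc m) n"
  proof -
    have "4 * X = a + b + c + d \<Longrightarrow> Y + (a - b - c + d) / 4 = 0 \<Longrightarrow> 2 * (X + Y) = c + b" for X Y a b c d :: complex
      by (simp add: field_simps) (algebra)
    from this[of "complex_of_real x * J m n", OF _ E2] E1 show ?thesis unfolding z by (simp add: algebra_simps)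
  qed
  have J2: "2 * cnj (Complex x \<xi>) * J m n = rt m * J (m - 1) n + rt (Suc n) * J m (Suc n)"
  proof -
    have "4 * X = a + b + c + d \<Longrightarrow> Y + (a - b - c + d) / 4 = 0 \<Longrightarrow> 2 * (X - Y) = a + d" for X Y a b c d :: complex
      by (simp add: field_simps) (algebra)
    from this[of "complex_of_real x * J m n", OF _ E2] E1 show ?thesis unfolding z by (simp add: algebra_simps)
  qed
  let ?c = "complex_of_real (1 / (2 * pi))"
  have w: "wigner m n x \<xi> = ?c * J m n" for m n unfolding wigner_eq J_def by simp
  show "2 * Complex x \<xi> * wigner m n x \<xi> = rt n * wigner m (n - 1) x \<xi> + rt (Suc m) * wigner (Suc m) n x \<xi>"
    using arg_cong[OF J1, of "\<lambda>u. ?c * u"] unfolding w by (simp add: algebra_simps)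
  show "2 * cnj (Complex x \<xi>) * wigner m n x \<xi> = rt m * wigner (m - 1) n x \<xi> + rt (Suc n) * wigner m (Suc n) x \<xi>"
    using arg_cong[OF J2, of "\<lambda>u. ?c * u"] unfolding w by (simp add: algebra_simps)
qed

lemma wigner_00: "wigner 0 0 x \<xi> = complex_of_real (exp (- (x\<^sup>2 + \<xi>\<^sup>2)) / pi)"
proof -
  have "wkernel 0 0 x y = (exp (- (x\<^sup>2)) / sqrt pi) * exp (- (y\<^sup>2) / 4)" for y
  proof -
    have "- (x + y / 2)\<^sup>2 / 2 + - (x - y / 2)\<^sup>2 / 2 = - (x\<^sup>2) + - (y\<^sup>2) / 4" by (simp add: power2_eq_square field_simps)
    then have "exp (- (x + y / 2)\<^sup>2 / 2) * exp (- (x - y / 2)\<^sup>2 / 2) = exp (- (x\<^sup>2)) * exp (- (y\<^sup>2) / 4)"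
      unfolding exp_add[symmetric] by simp
    then show ?thesis by (simp add: wkernel_def hfun_def)
  qed
  then have "(LINT y|lborel. complex_of_real (wkernel 0 0 x y) * cis (y * \<xi>))
     = (LINT y|lborel. complex_of_real (exp (- (x\<^sup>2)) / sqrt pi) * (complex_of_real (exp (- (y\<^sup>2) / 4)) * cis (y * \<xi>)))"
    by (simp only: of_real_mult mult.assoc)
  also have "\<dots> = complex_of_real (exp (- (x\<^sup>2)) / sqrt pi) * complex_of_real (2 * sqrt pi * exp (- (\<xi>\<^sup>2)))"
    unfolding integral_mult_right_zero fourier_gauss ..
  also have "\<dots> = complex_of_real (2 * exp (- (x\<^sup>2 + \<xi>\<^sup>2)))"
  proof -
    have "exp (- (x\<^sup>2 + \<xi>\<^sup>2)) = exp (- (x\<^sup>2)) * exp (- (\<xi>\<^sup>2))" unfolding exp_add[symmetric] by simp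
    then show ?thesis unfolding of_real_mult[symmetric] by simp
  qed
  finally show ?thesis unfolding wigner_eq by simp
qed

lemma rt_Suc_nonzero: "rt (Suc k) \<noteq> 0" by simp

lemma wigner_Suc_left:
  "wigner (Suc m) n x \<xi> = (2 / rt (Suc m)) * Complex x \<xi> * wigner m n x \<xi> + (- rt n / rt (Suc m)) * wigner m (n - 1) x \<xi>"
  using wigner_z[of x \<xi> m n] rt_Suc_nonzero[of m] by (simp add: field_simps)

lemma wigner_Suc_right_0:
  "wigner 0 (Suc n) x \<xi> = (2 / rt (Suc n)) * cnj (Complex x \<xi>) * wigner 0 n x \<xi>"
  using wigner_zbar[of x \<xi> 0 n] rt_Suc_nonzero[of n] by (simp add: field_simps)

text \<open>Multiplication by \<open>Complex x \<xi>\<close> raises the left index, its conjugate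
  the right one when the left is 0, so the Gaussian \<open>wigner 0 0\<close> generates the whole
  family.\<close>

lemma wigner_induct:
  assumes P0: "P (wigner 0 0)"
    and Pz: "\<And>f g a b. P f \<Longrightarrow> P g \<Longrightarrow> P (\<lambda>x \<xi>. a * Complex x \<xi> * f x \<xi> + b * g x \<xi>)"
    and Pc: "\<And>f a. P f \<Longrightarrow> P (\<lambda>x \<xi>. a * cnj (Complex x \<xi>) * f x \<xi>)"
  shows "P (wigner m n)"
proof (induction m arbitrary: n)
  case 0
  show ?case
  proof (induction n)
    case (Suc n)
    have "wigner 0 (Suc n) = (\<lambda>x \<xi>. (2 / rt (Suc n)) * cnj (Complex x \<xi>) * wigner 0 n x \<xi>)"
      by (intro ext) (rule wigner_Suc_right_0)
    then show ?case using Pc[OF Suc, of "2 / rt (Suc n)"] by (simp only:)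
  qed (rule P0)
next
  case (Suc m)
  have "wigner (Suc m) n = (\<lambda>x \<xi>. (2 / rt (Suc m)) * Complex x \<xi> * wigner m n x \<xi> + (- rt n / rt (Suc m)) * wigner m (n - 1) x \<xi>)"
    by (intro ext) (rule wigner_Suc_left)
  then show ?case using Pz[OF Suc Suc, of "2 / rt (Suc m)" n "- rt n / rt (Suc m)" "n - 1"] by (simp only:)
qed

section \<open>Integration by parts in the phase plane\<close>

abbreviation cplane :: "(real \<Rightarrow> real \<Rightarrow> complex) \<Rightarrow> bool" where
  "cplane f \<equiv> continuous_on UNIV (\<lambda>z :: real \<times> real. f (fst z) (snd z))"

definition pint :: "(real \<Rightarrow> real \<Rightarrow> complex) \<Rightarrow> complex" where
  "pint f = (LINT z|lborel. f (fst z) (snd z))"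

definition poly_bdd :: "(real \<Rightarrow> real \<Rightarrow> complex) \<Rightarrow> bool" where
  "poly_bdd f \<longleftrightarrow> cplane f \<and> (\<exists>C k. \<forall>x \<xi>. cmod (f x \<xi>) \<le> C * (1 + x\<^sup>2 + \<xi>\<^sup>2) ^ k)"

text \<open>The rate 1/2 is that of the slowest Gaussian that occurs, in the Poisson weights; the
  Wigner functions decay at rate 1 up to polynomials. The free polynomial factor makes the class
  stable under multiplication by symbols and coordinates.\<close>

definition gauss_poly :: "(real \<Rightarrow> real \<Rightarrow> complex) \<Rightarrow> bool" where
  "gauss_poly f \<longleftrightarrow> cplane f \<and> (\<exists>C k. \<forall>x \<xi>. cmod (f x \<xi>) \<le> C * (1 + x\<^sup>2 + \<xi>\<^sup>2) ^ k * exp (- (x\<^sup>2 + \<xi>\<^sup>2) / 2))"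

lemma one_le_weight: "1 \<le> 1 + x\<^sup>2 + (\<xi>::real)\<^sup>2" by simp

lemma poly_bdd_mult: assumes "poly_bdd f" "poly_bdd g" shows "poly_bdd (\<lambda>x \<xi>. f x \<xi> * g x \<xi>)"
proof -
  obtain C k where C: "\<And>x \<xi>. cmod (f x \<xi>) \<le> C * (1 + x\<^sup>2 + \<xi>\<^sup>2) ^ k" using assms unfolding poly_bdd_def by blast
  obtain D j where D: "\<And>x \<xi>. cmod (g x \<xi>) \<le> D * (1 + x\<^sup>2 + \<xi>\<^sup>2) ^ j" using assms unfolding poly_bdd_def by blast
  have "cmod (f x \<xi> * g x \<xi>) \<le> (C * D) * (1 + x\<^sup>2 + \<xi>\<^sup>2) ^ (k + j)" for x \<xi>
  proof -
    have "cmod (f x \<xi> * g x \<xi>) \<le> (C * (1 + x\<^sup>2 + \<xi>\<^sup>2) ^ k) * (D * (1 + x\<^sup>2 + \<xi>\<^sup>2) ^ j)"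
      unfolding norm_mult by (intro mult_mono C D order_trans[OF norm_ge_zero C]) auto
    then show ?thesis by (simp add: power_add ac_simps)
  qed
  then show ?thesis using assms unfolding poly_bdd_def by (auto intro!: continuous_on_mult)
qed

lemma gauss_poly_mult: assumes "poly_bdd f" "gauss_poly g" shows "gauss_poly (\<lambda>x \<xi>. f x \<xi> * g x \<xi>)"
proof -
  obtain C k where C: "\<And>x \<xi>. cmod (f x \<xi>) \<le> C * (1 + x\<^sup>2 + \<xi>\<^sup>2) ^ k" using assms unfolding poly_bdd_def by blast
  obtain D j where D: "\<And>x \<xi>. cmod (g x \<xi>) \<le> D * (1 + x\<^sup>2 + \<xi>\<^sup>2) ^ j * exp (- (x\<^sup>2 + \<xi>\<^sup>2) / 2)" using assms unfolding gauss_poly_def by blast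
  have "cmod (f x \<xi> * g x \<xi>) \<le> (C * D) * (1 + x\<^sup>2 + \<xi>\<^sup>2) ^ (k + j) * exp (- (x\<^sup>2 + \<xi>\<^sup>2) / 2)" for x \<xi>
  proof -
    have "cmod (f x \<xi> * g x \<xi>) \<le> (C * (1 + x\<^sup>2 + \<xi>\<^sup>2) ^ k) * (D * (1 + x\<^sup>2 + \<xi>\<^sup>2) ^ j * exp (- (x\<^sup>2 + \<xi>\<^sup>2) / 2))"
      unfolding norm_mult by (intro mult_mono C D order_trans[OF norm_ge_zero C]) auto
    then show ?thesis by (simp add: power_add ac_simps)
  qed
  then show ?thesis using assms unfolding poly_bdd_def gauss_poly_def by (auto intro!: continuous_on_mult)
qed

lemma weight_power_mono:
  fixes x \<xi> :: real assumes "k \<le> j" shows "\<bar>C\<bar> * (1 + x\<^sup>2 + \<xi>\<^sup>2) ^ k \<le> \<bar>C\<bar> * (1 + x\<^sup>2 + \<xi>\<^sup>2) ^ j"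
  by (intro mult_left_mono power_increasing assms one_le_weight) auto

lemma poly_bdd_add: assumes "poly_bdd f" "poly_bdd g" shows "poly_bdd (\<lambda>x \<xi>. f x \<xi> + g x \<xi>)"
proof -
  obtain C k where C: "\<And>x \<xi>. cmod (f x \<xi>) \<le> C * (1 + x\<^sup>2 + \<xi>\<^sup>2) ^ k" using assms unfolding poly_bdd_def by blast
  obtain D j where D: "\<And>x \<xi>. cmod (g x \<xi>) \<le> D * (1 + x\<^sup>2 + \<xi>\<^sup>2) ^ j" using assms unfolding poly_bdd_def by blast
  have "cmod (f x \<xi> + g x \<xi>) \<le> (\<bar>C\<bar> + \<bar>D\<bar>) * (1 + x\<^sup>2 + \<xi>\<^sup>2) ^ (k + j)" for x \<xi>
  proof -
    have "cmod (f x \<xi>) \<le> \<bar>C\<bar> * (1 + x\<^sup>2 + \<xi>\<^sup>2) ^ k" by (rule order_trans[OF C]) (intro mult_right_mono, auto)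
    also have "\<dots> \<le> \<bar>C\<bar> * (1 + x\<^sup>2 + \<xi>\<^sup>2) ^ (k + j)" by (rule weight_power_mono) simp
    finally have 1: "cmod (f x \<xi>) \<le> \<bar>C\<bar> * (1 + x\<^sup>2 + \<xi>\<^sup>2) ^ (k + j)" .
    have "cmod (g x \<xi>) \<le> \<bar>D\<bar> * (1 + x\<^sup>2 + \<xi>\<^sup>2) ^ j" by (rule order_trans[OF D]) (intro mult_right_mono, auto)
    also have "\<dots> \<le> \<bar>D\<bar> * (1 + x\<^sup>2 + \<xi>\<^sup>2) ^ (k + j)" by (rule weight_power_mono) simp
    finally have 2: "cmod (g x \<xi>) \<le> \<bar>D\<bar> * (1 + x\<^sup>2 + \<xi>\<^sup>2) ^ (k + j)" .
    show ?thesis unfolding distrib_right by (rule order_trans[OF norm_triangle_ineq add_mono[OF 1 2]])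
  qed
  then show ?thesis using assms unfolding poly_bdd_def by (auto intro!: continuous_on_add)
qed

text \<open>Sums are reduced to the polynomial case by dividing out the Gaussian.\<close>

lemma gauss_poly_iff_poly_bdd: "gauss_poly f \<longleftrightarrow> poly_bdd (\<lambda>x \<xi>. complex_of_real (exp ((x\<^sup>2 + \<xi>\<^sup>2) / 2)) * f x \<xi>)"
proof -
  have c: "cplane f \<longleftrightarrow> cplane (\<lambda>x \<xi>. complex_of_real (exp ((x\<^sup>2 + \<xi>\<^sup>2) / 2)) * f x \<xi>)"
  proof
    assume "cplane f"
    then show "cplane (\<lambda>x \<xi>. complex_of_real (exp ((x\<^sup>2 + \<xi>\<^sup>2) / 2)) * f x \<xi>)"
      by (rule continuous_on_mult[rotated]) (intro continuous_intros, simp)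
  next
    assume "cplane (\<lambda>x \<xi>. complex_of_real (exp ((x\<^sup>2 + \<xi>\<^sup>2) / 2)) * f x \<xi>)"
    then have "cplane (\<lambda>x \<xi>. complex_of_real (exp (- (x\<^sup>2 + \<xi>\<^sup>2) / 2)) * (complex_of_real (exp ((x\<^sup>2 + \<xi>\<^sup>2) / 2)) * f x \<xi>))"
      by (rule continuous_on_mult[rotated]) (intro continuous_intros, simp)
    moreover have "complex_of_real (exp (- (x\<^sup>2 + \<xi>\<^sup>2) / 2)) * (complex_of_real (exp ((x\<^sup>2 + \<xi>\<^sup>2) / 2)) * f x \<xi>) = f x \<xi>" for x \<xi> :: real
    proof -
      have "exp (- (x\<^sup>2 + \<xi>\<^sup>2) / 2) * exp ((x\<^sup>2 + \<xi>\<^sup>2) / 2) = 1"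
        unfolding exp_add[symmetric] add_divide_distrib[symmetric] by simp
      then show ?thesis unfolding mult.assoc[symmetric] of_real_mult[symmetric] by simp
    qed
    ultimately show "cplane f" by (simp only:)
  qed
  have b: "cmod (f x \<xi>) \<le> K * exp (- (x\<^sup>2 + \<xi>\<^sup>2) / 2) \<longleftrightarrow> cmod (complex_of_real (exp ((x\<^sup>2 + \<xi>\<^sup>2) / 2)) * f x \<xi>) \<le> K" for x \<xi> K :: real
  proof -
    have "exp (- (x\<^sup>2 + \<xi>\<^sup>2) / 2) = 1 / exp ((x\<^sup>2 + \<xi>\<^sup>2) / 2)" by (simp only: minus_divide_left[symmetric] exp_minus inverse_eq_divide)
    moreover have "exp ((x\<^sup>2 + \<xi>\<^sup>2) / 2) > 0" by simp
    ultimately show ?thesis unfolding norm_mult norm_of_real by (simp only: abs_of_pos) (simp add: field_simps)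
  qed
  show ?thesis unfolding gauss_poly_def poly_bdd_def b c ..
qed

lemma gauss_poly_add: "gauss_poly f \<Longrightarrow> gauss_poly g \<Longrightarrow> gauss_poly (\<lambda>x \<xi>. f x \<xi> + g x \<xi>)"
  unfolding gauss_poly_iff_poly_bdd distrib_left by (rule poly_bdd_add)

lemma poly_bdd_const: "poly_bdd (\<lambda>x \<xi>. c)"
  unfolding poly_bdd_def by (intro conjI exI[of _ "cmod c"] exI[of _ 0]) auto

lemma poly_bdd_cmult: "poly_bdd f \<Longrightarrow> poly_bdd (\<lambda>x \<xi>. c * f x \<xi>)" by (rule poly_bdd_mult[OF poly_bdd_const])
lemma gauss_poly_cmult: "gauss_poly f \<Longrightarrow> gauss_poly (\<lambda>x \<xi>. c * f x \<xi>)" by (rule gauss_poly_mult[OF poly_bdd_const])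

lemma gauss_poly_diff: "gauss_poly f \<Longrightarrow> gauss_poly g \<Longrightarrow> gauss_poly (\<lambda>x \<xi>. f x \<xi> - g x \<xi>)"
  using gauss_poly_add[of f "\<lambda>x \<xi>. (-1) * g x \<xi>"] gauss_poly_cmult[of g "-1"] by simp

lemma poly_bdd_diff: "poly_bdd f \<Longrightarrow> poly_bdd g \<Longrightarrow> poly_bdd (\<lambda>x \<xi>. f x \<xi> - g x \<xi>)"
  using poly_bdd_add[of f "\<lambda>x \<xi>. (-1) * g x \<xi>"] poly_bdd_cmult[of g "-1"] by simp

lemma poly_bdd_cnj: "poly_bdd f \<Longrightarrow> poly_bdd (\<lambda>x \<xi>. cnj (f x \<xi>))"
  unfolding poly_bdd_def by (auto intro!: continuous_intros)

lemma poly_bdd_fst: "poly_bdd (\<lambda>x \<xi>. complex_of_real x)"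
proof -
  have "\<bar>x\<bar> \<le> 1 + x\<^sup>2 + \<xi>\<^sup>2" for x \<xi> :: real
  proof -
    have "2 * \<bar>x\<bar> \<le> x\<^sup>2 + 1" using sum_squares_bound[of "\<bar>x\<bar>" 1] by simp
    then show ?thesis using abs_ge_zero[of x] zero_le_power2[of \<xi>] by linarith
  qed
  then show ?thesis unfolding poly_bdd_def by (intro conjI exI[of _ 1] exI[of _ 1]) (auto intro!: continuous_intros)
qed

lemma poly_bdd_snd: "poly_bdd (\<lambda>x \<xi>. complex_of_real \<xi>)"
proof -
  have "\<bar>\<xi>\<bar> \<le> 1 + x\<^sup>2 + \<xi>\<^sup>2" for x \<xi> :: real
  proof -
    have "2 * \<bar>\<xi>\<bar> \<le> \<xi>\<^sup>2 + 1" using sum_squares_bound[of "\<bar>\<xi>\<bar>" 1] by simp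
    then show ?thesis using abs_ge_zero[of \<xi>] zero_le_power2[of x] by linarith
  qed
  then show ?thesis unfolding poly_bdd_def by (intro conjI exI[of _ 1] exI[of _ 1]) (auto intro!: continuous_intros)
qed

lemma poly_bdd_Complex: "poly_bdd Complex"
proof -
  have "poly_bdd (\<lambda>x \<xi>. complex_of_real x + \<i> * complex_of_real \<xi>)" by (intro poly_bdd_add poly_bdd_cmult poly_bdd_fst poly_bdd_snd)
  moreover have "(\<lambda>x \<xi>. complex_of_real x + \<i> * complex_of_real \<xi>) = Complex" by (intro ext) (simp add: complex_eq_iff)
  ultimately show ?thesis by simp
qed

lemma gauss_poly_gauss: assumes "a \<ge> 1/2" shows "gauss_poly (\<lambda>x \<xi>. complex_of_real (exp (- a * (x\<^sup>2 + \<xi>\<^sup>2))))"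
proof -
  have "- a * (x\<^sup>2 + \<xi>\<^sup>2) \<le> - (x\<^sup>2 + \<xi>\<^sup>2) / 2" for x \<xi> :: real
    using mult_right_mono[OF assms, of "x\<^sup>2 + \<xi>\<^sup>2"] by simp
  then show ?thesis unfolding gauss_poly_def
    by (intro conjI exI[of _ 1] exI[of _ 0]) (auto intro!: continuous_intros)
qed

lemma gauss_poly_imp_poly_bdd: assumes "gauss_poly f" shows "poly_bdd f"
proof -
  obtain D j where D: "\<And>x \<xi>. cmod (f x \<xi>) \<le> D * (1 + x\<^sup>2 + \<xi>\<^sup>2) ^ j * exp (- (x\<^sup>2 + \<xi>\<^sup>2) / 2)" using assms unfolding gauss_poly_def by blast
  have "cmod (f x \<xi>) \<le> \<bar>D\<bar> * (1 + x\<^sup>2 + \<xi>\<^sup>2) ^ j" for x \<xi>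
  proof -
    have "cmod (f x \<xi>) \<le> \<bar>D\<bar> * (1 + x\<^sup>2 + \<xi>\<^sup>2) ^ j * 1"
      by (rule order_trans[OF D]) (intro mult_mono, auto)
    then show ?thesis by simp
  qed
  then show ?thesis using assms unfolding gauss_poly_def poly_bdd_def by blast
qed

text \<open>Half of the exponent absorbs the polynomial: with \<open>k = 4j + 1\<close> one has
  \<open>(1 + r) ^ j \<le> k ^ j * exp (j r / k)\<close> and \<open>j / k \<le> 1/4\<close>. The
  product form of the bound is what Fubini needs.\<close>

lemma gauss_poly_gauss_bound:
  assumes "gauss_poly f"
  obtains C where "C > 0" "\<And>x \<xi>. cmod (f x \<xi>) \<le> C * (exp (- (1/4) * (x - 0)\<^sup>2) * exp (- (1/4) * (\<xi> - 0)\<^sup>2))"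
proof -
  obtain D j where D: "\<And>x \<xi>. cmod (f x \<xi>) \<le> D * (1 + x\<^sup>2 + \<xi>\<^sup>2) ^ j * exp (- (x\<^sup>2 + \<xi>\<^sup>2) / 2)" using assms unfolding gauss_poly_def by blast
  let ?k = "4 * real j + 1"
  show ?thesis
  proof (rule that[of "(\<bar>D\<bar> + 1) * ?k ^ j"])
    fix x \<xi> :: real
    define r where "r = x\<^sup>2 + \<xi>\<^sup>2"
    have r: "r \<ge> 0" by (simp add: r_def)
    have "(1 + r) ^ j \<le> (?k * (1 + r / ?k)) ^ j" using r by (intro power_mono) (auto simp: field_simps)
    also have "\<dots> = ?k ^ j * (1 + r / ?k) ^ j" by (rule power_mult_distrib)
    also have "\<dots> \<le> ?k ^ j * exp (r / ?k) ^ j" using r by (intro mult_left_mono power_mono exp_ge_add_one_self) auto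
    also have "exp (r / ?k) ^ j = exp (real j * (r / ?k))" by (rule exp_of_nat_mult[symmetric])
    also have "\<dots> \<le> exp (r / 4)"
    proof -
      have "real j * (r / ?k) = r * (real j / ?k)" by simp
      also have "\<dots> \<le> r * (1/4)" using r by (intro mult_left_mono) (auto simp: field_simps)
      finally show ?thesis by simp
    qed
    finally have p: "(1 + r) ^ j \<le> ?k ^ j * exp (r / 4)" by simp
    have "cmod (f x \<xi>) \<le> D * (1 + r) ^ j * exp (- r / 2)" using D[of x \<xi>] by (simp add: r_def add.assoc)
    also have "\<dots> \<le> (\<bar>D\<bar> + 1) * (?k ^ j * exp (r / 4)) * exp (- r / 2)"
      using r by (intro mult_right_mono mult_mono p) auto
    also have "\<dots> = ((\<bar>D\<bar> + 1) * ?k ^ j) * (exp (r / 4) * exp (- r / 2))" by simp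
    also have "exp (r / 4) * exp (- r / 2) = exp (- (1/4) * (x - 0)\<^sup>2) * exp (- (1/4) * (\<xi> - 0)\<^sup>2)"
      unfolding exp_add[symmetric] by (simp add: r_def field_simps)
    finally show "cmod (f x \<xi>) \<le> (\<bar>D\<bar> + 1) * ?k ^ j * (exp (- (1/4) * (x - 0)\<^sup>2) * exp (- (1/4) * (\<xi> - 0)\<^sup>2))" .
  qed simp
qed

section \<open>Plane integrals and integration by parts\<close>

lemma integrable_lborel_product:
  fixes f g :: "real \<Rightarrow> real"
  assumes "integrable lborel f" "integrable lborel g"
  shows "integrable lborel (\<lambda>z :: real \<times> real. f (fst z) * g (snd z))"
    and "(LINT z|lborel. f (fst z) * g (snd z)) = (LINT x|lborel. f x) * (LINT y|lborel. g y)"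
proof -
  have [measurable]: "f \<in> borel_measurable borel" "g \<in> borel_measurable borel" using assms by auto
  have i: "integrable (lborel \<Otimes>\<^sub>M lborel) (\<lambda>(x, y). f x * g y)"
  proof (rule lborel_pair.Fubini_integrable)
    show "(\<lambda>(x, y). f x * g y) \<in> borel_measurable (lborel \<Otimes>\<^sub>M lborel)" by measurable
    have "(LINT y|lborel. norm (case (x, y) of (x, y) \<Rightarrow> f x * g y)) = norm (f x) * (LINT y|lborel. norm (g y))" for x
      by (simp add: abs_mult)
    then show "integrable lborel (\<lambda>x. LINT y|lborel. norm (case (x, y) of (x, y) \<Rightarrow> f x * g y))"
      using assms by simp
    show "AE x in lborel. integrable lborel (\<lambda>y. case (x, y) of (x, y) \<Rightarrow> f x * g y)" using assms by simp
  qed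
  show "integrable lborel (\<lambda>z :: real \<times> real. f (fst z) * g (snd z))"
    using i by (simp add: lborel_prod case_prod_unfold)
  have "(LINT z|lborel. f (fst z) * g (snd z)) = (LINT x|lborel. LINT y|lborel. f x * g y)"
    using lborel_pair.integral_fst[OF i] by (simp add: lborel_prod case_prod_unfold)
  then show "(LINT z|lborel. f (fst z) * g (snd z)) = (LINT x|lborel. f x) * (LINT y|lborel. g y)" by simp
qed

lemma cplane_measurable: "cplane f \<Longrightarrow> (\<lambda>z. f (fst z) (snd z)) \<in> borel_measurable borel"
  by (rule borel_measurable_continuous_onI)

lemma gauss_poly_integrable: assumes "gauss_poly f" shows "integrable lborel (\<lambda>z. f (fst z) (snd z))"
proof -
  obtain C where C: "C > 0" "\<And>x \<xi>. cmod (f x \<xi>) \<le> C * (exp (- (1/4) * (x - 0)\<^sup>2) * exp (- (1/4) * (\<xi> - 0)\<^sup>2))"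
    using gauss_poly_gauss_bound[OF assms] by blast
  have "integrable lborel (\<lambda>z :: real \<times> real. exp (- (1/4) * (fst z - 0)\<^sup>2) * exp (- (1/4) * (snd z - 0)\<^sup>2))"
    using integrable_lborel_product(1)[OF integrable_gauss integrable_gauss, of "1/4" "1/4" 0 0] by simp
  then have "integrable lborel (\<lambda>z :: real \<times> real. C * (exp (- (1/4) * (fst z - 0)\<^sup>2) * exp (- (1/4) * (snd z - 0)\<^sup>2)))"
    by (rule integrable_mult_right)
  then show ?thesis
  proof (rule Bochner_Integration.integrable_bound)
    show "(\<lambda>z. f (fst z) (snd z)) \<in> borel_measurable lborel" using assms cplane_measurable unfolding gauss_poly_def by simp
    show "AE z in lborel. cmod (f (fst z) (snd z)) \<le> norm (C * (exp (- (1/4) * (fst z - 0)\<^sup>2) * exp (- (1/4) * (snd z - 0)\<^sup>2)))"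
      by (intro AE_I2 order_trans[OF C(2)]) simp
  qed
qed

lemma pint_add: "gauss_poly f \<Longrightarrow> gauss_poly g \<Longrightarrow> pint (\<lambda>x \<xi>. f x \<xi> + g x \<xi>) = pint f + pint g"
  unfolding pint_def by (intro Bochner_Integration.integral_add gauss_poly_integrable)

lemma pint_diff: "gauss_poly f \<Longrightarrow> gauss_poly g \<Longrightarrow> pint (\<lambda>x \<xi>. f x \<xi> - g x \<xi>) = pint f - pint g"
  unfolding pint_def by (intro Bochner_Integration.integral_diff gauss_poly_integrable)

lemma pint_cmult: "pint (\<lambda>x \<xi>. c * f x \<xi>) = c * pint f"
  unfolding pint_def by simp

lemma pint_dx:
  assumes d: "\<And>x \<xi>. ((\<lambda>y. h y \<xi>) has_vector_derivative hx x \<xi>) (at x)" and h: "gauss_poly h" and hx: "gauss_poly hx"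
  shows "pint hx = 0"
proof -
  obtain C where C: "C > 0" "\<And>x \<xi>. cmod (h x \<xi>) \<le> C * (exp (- (1/4) * (x - 0)\<^sup>2) * exp (- (1/4) * (\<xi> - 0)\<^sup>2))"
    using gauss_poly_gauss_bound[OF h] by blast
  obtain D where D: "D > 0" "\<And>x \<xi>. cmod (hx x \<xi>) \<le> D * (exp (- (1/4) * (x - 0)\<^sup>2) * exp (- (1/4) * (\<xi> - 0)\<^sup>2))"
    using gauss_poly_gauss_bound[OF hx] by blast
  have le: "K * (exp (- (1/4) * (x - 0)\<^sup>2) * exp (- (1/4) * (\<xi> - 0)\<^sup>2)) \<le> K * exp (- (1/4) * (x - 0)\<^sup>2)" if "K > 0" for K x \<xi> :: real
    using that by simp
  have z: "(LINT x|lborel. hx x \<xi>) = 0" for \<xi>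
  proof (rule integral_derivative_eq_0[where f = "\<lambda>x. h x \<xi>" and a = "1/4" and C = C and k = 0])
    have c: "cplane hx" using hx unfolding gauss_poly_def by simp
    show cx: "continuous_on UNIV (\<lambda>x. hx x \<xi>)"
      using continuous_on_compose2[OF c, of UNIV "\<lambda>x. (x, \<xi>)"] by (simp add: continuous_intros)
    show "cmod (h x \<xi>) \<le> C * exp (- (1/4) * (x - 0)\<^sup>2)" for x by (rule order_trans[OF C(2) le[OF C(1)]])
    show "integrable lborel (\<lambda>x. hx x \<xi>)"
      by (rule integrable_gauss_dominated[where a = "1/4" and b = 0 and C = D])
         (use cx order_trans[OF D(2) le[OF D(1)]] in \<open>auto intro!: borel_measurable_continuous_onI\<close>)
  qed (use d in auto)
  have "integrable (lborel \<Otimes>\<^sub>M lborel) (case_prod hx)"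
    using gauss_poly_integrable[OF hx] by (simp add: lborel_prod case_prod_unfold)
  from lborel_pair.integral_snd[OF this] show ?thesis
    unfolding pint_def by (simp add: z lborel_prod case_prod_unfold)
qed

lemma pint_dxi:
  assumes d: "\<And>x \<xi>. ((\<lambda>\<eta>. h x \<eta>) has_vector_derivative hx x \<xi>) (at \<xi>)" and h: "gauss_poly h" and hx: "gauss_poly hx"
  shows "pint hx = 0"
proof -
  obtain C where C: "C > 0" "\<And>x \<xi>. cmod (h x \<xi>) \<le> C * (exp (- (1/4) * (x - 0)\<^sup>2) * exp (- (1/4) * (\<xi> - 0)\<^sup>2))"
    using gauss_poly_gauss_bound[OF h] by blast
  obtain D where D: "D > 0" "\<And>x \<xi>. cmod (hx x \<xi>) \<le> D * (exp (- (1/4) * (x - 0)\<^sup>2) * exp (- (1/4) * (\<xi> - 0)\<^sup>2))"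
    using gauss_poly_gauss_bound[OF hx] by blast
  have le: "K * (exp (- (1/4) * (x - 0)\<^sup>2) * exp (- (1/4) * (\<xi> - 0)\<^sup>2)) \<le> K * exp (- (1/4) * (\<xi> - 0)\<^sup>2)" if "K > 0" for K x \<xi> :: real
    using that by simp
  have z: "(LINT \<xi>|lborel. hx x \<xi>) = 0" for x
  proof (rule integral_derivative_eq_0[where f = "\<lambda>\<xi>. h x \<xi>" and a = "1/4" and C = C and k = 0])
    have c: "cplane hx" using hx unfolding gauss_poly_def by simp
    show cx: "continuous_on UNIV (\<lambda>\<xi>. hx x \<xi>)"
      using continuous_on_compose2[OF c, of UNIV "\<lambda>\<xi>. (x, \<xi>)"] by (simp add: continuous_intros)
    show "cmod (h x \<xi>) \<le> C * exp (- (1/4) * (\<xi> - 0)\<^sup>2)" for \<xi> by (rule order_trans[OF C(2) le[OF C(1)]])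
    show "integrable lborel (\<lambda>\<xi>. hx x \<xi>)"
      by (rule integrable_gauss_dominated[where a = "1/4" and b = 0 and C = D])
         (use cx order_trans[OF D(2) le[OF D(1)]] in \<open>auto intro!: borel_measurable_continuous_onI\<close>)
  qed (use d in auto)
  have "integrable (lborel \<Otimes>\<^sub>M lborel) (case_prod hx)"
    using gauss_poly_integrable[OF hx] by (simp add: lborel_prod case_prod_unfold)
  from lborel_pair.integral_fst[OF this] show ?thesis
    unfolding pint_def by (simp add: z lborel_prod case_prod_unfold)
qed

text \<open>\<open>wirt f \<alpha> \<beta>\<close> records \<open>\<alpha> = (\<partial>\<^sub>x + \<i>\<partial>\<^sub>\<xi>)f\<close> and \<open>\<beta> = (\<partial>\<^sub>x - \<i>\<partial>\<^sub>\<xi>)f\<close>.\<close>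

definition wirt :: "(real \<Rightarrow> real \<Rightarrow> complex) \<Rightarrow> (real \<Rightarrow> real \<Rightarrow> complex) \<Rightarrow> (real \<Rightarrow> real \<Rightarrow> complex) \<Rightarrow> bool" where
  "wirt f \<alpha> \<beta> \<longleftrightarrow> (\<forall>x \<xi>. ((\<lambda>y. f y \<xi>) has_vector_derivative (\<alpha> x \<xi> + \<beta> x \<xi>) / 2) (at x)
     \<and> ((\<lambda>\<eta>. f x \<eta>) has_vector_derivative (\<alpha> x \<xi> - \<beta> x \<xi>) / (2 * \<i>)) (at \<xi>))"

lemma wirt_mult:
  assumes "wirt f \<alpha> \<beta>" "wirt g \<alpha>' \<beta>'"
  shows "wirt (\<lambda>x \<xi>. f x \<xi> * g x \<xi>) (\<lambda>x \<xi>. f x \<xi> * \<alpha>' x \<xi> + \<alpha> x \<xi> * g x \<xi>) (\<lambda>x \<xi>. f x \<xi> * \<beta>' x \<xi> + \<beta> x \<xi> * g x \<xi>)"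
  unfolding wirt_def
proof (intro allI conjI)
  fix x \<xi>
  have "((\<lambda>y. f y \<xi> * g y \<xi>) has_vector_derivative f x \<xi> * ((\<alpha>' x \<xi> + \<beta>' x \<xi>) / 2) + ((\<alpha> x \<xi> + \<beta> x \<xi>) / 2) * g x \<xi>) (at x)"
    using assms unfolding wirt_def by (intro has_vector_derivative_mult) auto
  moreover have "f x \<xi> * ((\<alpha>' x \<xi> + \<beta>' x \<xi>) / 2) + ((\<alpha> x \<xi> + \<beta> x \<xi>) / 2) * g x \<xi>
      = (f x \<xi> * \<alpha>' x \<xi> + \<alpha> x \<xi> * g x \<xi> + (f x \<xi> * \<beta>' x \<xi> + \<beta> x \<xi> * g x \<xi>)) / 2" by (simp add: field_simps)
  ultimately show "((\<lambda>y. f y \<xi> * g y \<xi>) has_vector_derivative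
      (f x \<xi> * \<alpha>' x \<xi> + \<alpha> x \<xi> * g x \<xi> + (f x \<xi> * \<beta>' x \<xi> + \<beta> x \<xi> * g x \<xi>)) / 2) (at x)" by (simp only:)
  have "((\<lambda>\<eta>. f x \<eta> * g x \<eta>) has_vector_derivative f x \<xi> * ((\<alpha>' x \<xi> - \<beta>' x \<xi>) / (2 * \<i>)) + ((\<alpha> x \<xi> - \<beta> x \<xi>) / (2 * \<i>)) * g x \<xi>) (at \<xi>)"
    using assms unfolding wirt_def by (intro has_vector_derivative_mult) auto
  moreover have "f x \<xi> * ((\<alpha>' x \<xi> - \<beta>' x \<xi>) / (2 * \<i>)) + ((\<alpha> x \<xi> - \<beta> x \<xi>) / (2 * \<i>)) * g x \<xi>
      = (f x \<xi> * \<alpha>' x \<xi> + \<alpha> x \<xi> * g x \<xi> - (f x \<xi> * \<beta>' x \<xi> + \<beta> x \<xi> * g x \<xi>)) / (2 * \<i>)" by (simp add: field_simps)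
  ultimately show "((\<lambda>\<eta>. f x \<eta> * g x \<eta>) has_vector_derivative
      (f x \<xi> * \<alpha>' x \<xi> + \<alpha> x \<xi> * g x \<xi> - (f x \<xi> * \<beta>' x \<xi> + \<beta> x \<xi> * g x \<xi>)) / (2 * \<i>)) (at \<xi>)" by (simp only:)
qed

lemma pint_wirt:
  assumes w: "wirt h \<alpha> \<beta>" and h: "gauss_poly h" and \<alpha>: "gauss_poly \<alpha>" and \<beta>: "gauss_poly \<beta>"
  shows "pint \<alpha> = 0" "pint \<beta> = 0"
proof -
  have "pint (\<lambda>x \<xi>. (1/2) * (\<alpha> x \<xi> + \<beta> x \<xi>)) = 0"
    by (rule pint_dx[OF _ h gauss_poly_cmult[OF gauss_poly_add[OF \<alpha> \<beta>]]])
       (use w in \<open>simp only: wirt_def times_divide_eq_left mult_1_left\<close>)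
  then have 1: "pint \<alpha> + pint \<beta> = 0" unfolding pint_cmult pint_add[OF \<alpha> \<beta>] by simp
  have "pint (\<lambda>x \<xi>. (1/(2*\<i>)) * (\<alpha> x \<xi> - \<beta> x \<xi>)) = 0"
    by (rule pint_dxi[OF _ h gauss_poly_cmult[OF gauss_poly_diff[OF \<alpha> \<beta>]]])
       (use w in \<open>simp only: wirt_def times_divide_eq_left mult_1_left\<close>)
  then have 2: "pint \<alpha> - pint \<beta> = 0" unfolding pint_cmult pint_diff[OF \<alpha> \<beta>] by simp
  have "2 * pint \<alpha> = (pint \<alpha> + pint \<beta>) + (pint \<alpha> - pint \<beta>)" by simp
  then show "pint \<alpha> = 0" using 1 2 by simp
  then show "pint \<beta> = 0" using 1 by simp
qed

text \<open>The symbol \<open>f\<close> may grow polynomially; the Gaussian decay of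
  \<open>g\<close> alone makes the boundary terms vanish.\<close>

lemma pint_by_parts:
  assumes f: "wirt f \<alpha> \<beta>" "poly_bdd f" "poly_bdd \<alpha>" "poly_bdd \<beta>" and g: "wirt g \<alpha>' \<beta>'" "gauss_poly g" "gauss_poly \<alpha>'" "gauss_poly \<beta>'"
  shows "pint (\<lambda>x \<xi>. f x \<xi> * \<alpha>' x \<xi>) = - pint (\<lambda>x \<xi>. \<alpha> x \<xi> * g x \<xi>)"
    and "pint (\<lambda>x \<xi>. f x \<xi> * \<beta>' x \<xi>) = - pint (\<lambda>x \<xi>. \<beta> x \<xi> * g x \<xi>)"
proof -
  note w = wirt_mult[OF f(1) g(1)]
  note z = pint_wirt[OF w gauss_poly_mult[OF f(2) g(2)] gauss_poly_add[OF gauss_poly_mult[OF f(2) g(3)] gauss_poly_mult[OF f(3) g(2)]]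
      gauss_poly_add[OF gauss_poly_mult[OF f(2) g(4)] gauss_poly_mult[OF f(4) g(2)]]]
  show "pint (\<lambda>x \<xi>. f x \<xi> * \<alpha>' x \<xi>) = - pint (\<lambda>x \<xi>. \<alpha> x \<xi> * g x \<xi>)"
    using z(1) unfolding pint_add[OF gauss_poly_mult[OF f(2) g(3)] gauss_poly_mult[OF f(3) g(2)]] by (simp add: eq_neg_iff_add_eq_0)
  show "pint (\<lambda>x \<xi>. f x \<xi> * \<beta>' x \<xi>) = - pint (\<lambda>x \<xi>. \<beta> x \<xi> * g x \<xi>)"
    using z(2) unfolding pint_add[OF gauss_poly_mult[OF f(2) g(4)] gauss_poly_mult[OF f(4) g(2)]] by (simp add: eq_neg_iff_add_eq_0)
qed

section \<open>Ladder relations and norms of the Wigner functions\<close>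

lemma wirt_add:
  assumes "wirt f \<alpha> \<beta>" "wirt g \<alpha>' \<beta>'"
  shows "wirt (\<lambda>x \<xi>. f x \<xi> + g x \<xi>) (\<lambda>x \<xi>. \<alpha> x \<xi> + \<alpha>' x \<xi>) (\<lambda>x \<xi>. \<beta> x \<xi> + \<beta>' x \<xi>)"
  unfolding wirt_def
proof (intro allI conjI)
  fix x \<xi>
  have "((\<lambda>y. f y \<xi> + g y \<xi>) has_vector_derivative (\<alpha> x \<xi> + \<beta> x \<xi>) / 2 + (\<alpha>' x \<xi> + \<beta>' x \<xi>) / 2) (at x)"
    using assms unfolding wirt_def by (intro has_vector_derivative_add) auto
  moreover have "(\<alpha> x \<xi> + \<beta> x \<xi>) / 2 + (\<alpha>' x \<xi> + \<beta>' x \<xi>) / 2 = (\<alpha> x \<xi> + \<alpha>' x \<xi> + (\<beta> x \<xi> + \<beta>' x \<xi>)) / 2"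
    by (simp add: field_simps)
  ultimately show "((\<lambda>y. f y \<xi> + g y \<xi>) has_vector_derivative (\<alpha> x \<xi> + \<alpha>' x \<xi> + (\<beta> x \<xi> + \<beta>' x \<xi>)) / 2) (at x)" by (simp only:)
  have "((\<lambda>\<eta>. f x \<eta> + g x \<eta>) has_vector_derivative (\<alpha> x \<xi> - \<beta> x \<xi>) / (2 * \<i>) + (\<alpha>' x \<xi> - \<beta>' x \<xi>) / (2 * \<i>)) (at \<xi>)"
    using assms unfolding wirt_def by (intro has_vector_derivative_add) auto
  moreover have "(\<alpha> x \<xi> - \<beta> x \<xi>) / (2 * \<i>) + (\<alpha>' x \<xi> - \<beta>' x \<xi>) / (2 * \<i>) = (\<alpha> x \<xi> + \<alpha>' x \<xi> - (\<beta> x \<xi> + \<beta>' x \<xi>)) / (2 * \<i>)"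
    by (simp add: field_simps)
  ultimately show "((\<lambda>\<eta>. f x \<eta> + g x \<eta>) has_vector_derivative (\<alpha> x \<xi> + \<alpha>' x \<xi> - (\<beta> x \<xi> + \<beta>' x \<xi>)) / (2 * \<i>)) (at \<xi>)" by (simp only:)
qed

lemma wirt_const: "wirt (\<lambda>x \<xi>. c) (\<lambda>x \<xi>. 0) (\<lambda>x \<xi>. 0)"
  unfolding wirt_def by simp

lemma wirt_cmult: "wirt f \<alpha> \<beta> \<Longrightarrow> wirt (\<lambda>x \<xi>. c * f x \<xi>) (\<lambda>x \<xi>. c * \<alpha> x \<xi>) (\<lambda>x \<xi>. c * \<beta> x \<xi>)"
  using wirt_mult[OF wirt_const[of c]] by simp

lemma wirt_cnj:
  assumes "wirt f \<alpha> \<beta>" shows "wirt (\<lambda>x \<xi>. cnj (f x \<xi>)) (\<lambda>x \<xi>. cnj (\<beta> x \<xi>)) (\<lambda>x \<xi>. cnj (\<alpha> x \<xi>))"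
  unfolding wirt_def
proof (intro allI conjI)
  fix x \<xi>
  have "((\<lambda>y. cnj (f y \<xi>)) has_vector_derivative cnj ((\<alpha> x \<xi> + \<beta> x \<xi>) / 2)) (at x)"
    using assms unfolding wirt_def by (intro has_vector_derivative_cnj) auto
  then show "((\<lambda>y. cnj (f y \<xi>)) has_vector_derivative (cnj (\<beta> x \<xi>) + cnj (\<alpha> x \<xi>)) / 2) (at x)"
    by (simp add: add.commute)
  have "((\<lambda>\<eta>. cnj (f x \<eta>)) has_vector_derivative cnj ((\<alpha> x \<xi> - \<beta> x \<xi>) / (2 * \<i>))) (at \<xi>)"
    using assms unfolding wirt_def by (intro has_vector_derivative_cnj) auto
  moreover have "cnj ((\<alpha> x \<xi> - \<beta> x \<xi>) / (2 * \<i>)) = (cnj (\<beta> x \<xi>) - cnj (\<alpha> x \<xi>)) / (2 * \<i>)"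
    by (simp add: field_simps)
  ultimately show "((\<lambda>\<eta>. cnj (f x \<eta>)) has_vector_derivative (cnj (\<beta> x \<xi>) - cnj (\<alpha> x \<xi>)) / (2 * \<i>)) (at \<xi>)" by (simp only:)
qed

lemma wirt_Complex: "wirt Complex (\<lambda>x \<xi>. 0) (\<lambda>x \<xi>. 2)"
proof -
  have e: "Complex x \<xi> = complex_of_real x + \<i> * complex_of_real \<xi>" for x \<xi> by (simp add: complex_eq_iff)
  have d: "(complex_of_real has_vector_derivative 1) (at x)" for x
  proof -
    have "((\<lambda>x. x) has_vector_derivative (1::real)) (at x)" by (auto intro!: derivative_eq_intros)
    from bounded_linear.has_vector_derivative[OF bounded_linear_of_real this] show ?thesis by simp
  qed
  show ?thesis unfolding wirt_def e
  proof (intro allI conjI)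
    fix x \<xi>
    have "((\<lambda>y. complex_of_real y + \<i> * complex_of_real \<xi>) has_vector_derivative 1 + 0) (at x)"
      by (intro has_vector_derivative_add d has_vector_derivative_const)
    then show "((\<lambda>y. complex_of_real y + \<i> * complex_of_real \<xi>) has_vector_derivative (0 + 2) / 2) (at x)" by simp
    have "((\<lambda>\<eta>. complex_of_real x + \<i> * complex_of_real \<eta>) has_vector_derivative 0 + \<i> * 1) (at \<xi>)"
      by (intro has_vector_derivative_add has_vector_derivative_mult_right d has_vector_derivative_const)
    then show "((\<lambda>\<eta>. complex_of_real x + \<i> * complex_of_real \<eta>) has_vector_derivative (0 - 2) / (2 * \<i>)) (at \<xi>)" by simp
  qed
qed

lemma wirt_cnj_Complex: "wirt (\<lambda>x \<xi>. cnj (Complex x \<xi>)) (\<lambda>x \<xi>. 2) (\<lambda>x \<xi>. 0)"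
  using wirt_cnj[OF wirt_Complex] by simp

lemma wirt_gauss:
  "wirt (\<lambda>x \<xi>. complex_of_real (exp (- ((x - a)\<^sup>2 + (\<xi> - b)\<^sup>2))))
     (\<lambda>x \<xi>. - 2 * (Complex x \<xi> - Complex a b) * complex_of_real (exp (- ((x - a)\<^sup>2 + (\<xi> - b)\<^sup>2))))
     (\<lambda>x \<xi>. - 2 * cnj (Complex x \<xi> - Complex a b) * complex_of_real (exp (- ((x - a)\<^sup>2 + (\<xi> - b)\<^sup>2))))"
  unfolding wirt_def
proof (intro allI conjI)
  fix x \<xi> :: real
  let ?e = "exp (- ((x - a)\<^sup>2 + (\<xi> - b)\<^sup>2))"
  have "((\<lambda>y. exp (- ((y - a)\<^sup>2 + (\<xi> - b)\<^sup>2))) has_real_derivative - 2 * (x - a) * ?e) (at x)"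
    by (auto intro!: derivative_eq_intros)
  then have "((\<lambda>y. complex_of_real (exp (- ((y - a)\<^sup>2 + (\<xi> - b)\<^sup>2)))) has_vector_derivative complex_of_real (- 2 * (x - a) * ?e)) (at x)"
    unfolding has_real_derivative_iff_has_vector_derivative by (rule bounded_linear.has_vector_derivative[OF bounded_linear_of_real])
  moreover have "complex_of_real (- 2 * (x - a) * ?e) = (- 2 * (Complex x \<xi> - Complex a b) * complex_of_real ?e + - 2 * cnj (Complex x \<xi> - Complex a b) * complex_of_real ?e) / 2"
    by (simp add: complex_eq_iff algebra_simps)
  ultimately show "((\<lambda>y. complex_of_real (exp (- ((y - a)\<^sup>2 + (\<xi> - b)\<^sup>2)))) has_vector_derivative
    (- 2 * (Complex x \<xi> - Complex a b) * complex_of_real ?e + - 2 * cnj (Complex x \<xi> - Complex a b) * complex_of_real ?e) / 2) (at x)" by (simp only:)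
  have "((\<lambda>\<eta>. exp (- ((x - a)\<^sup>2 + (\<eta> - b)\<^sup>2))) has_real_derivative - 2 * (\<xi> - b) * ?e) (at \<xi>)"
    by (auto intro!: derivative_eq_intros)
  then have "((\<lambda>\<eta>. complex_of_real (exp (- ((x - a)\<^sup>2 + (\<eta> - b)\<^sup>2)))) has_vector_derivative complex_of_real (- 2 * (\<xi> - b) * ?e)) (at \<xi>)"
    unfolding has_real_derivative_iff_has_vector_derivative by (rule bounded_linear.has_vector_derivative[OF bounded_linear_of_real])
  moreover have "complex_of_real (- 2 * (\<xi> - b) * ?e) = (- 2 * (Complex x \<xi> - Complex a b) * complex_of_real ?e - - 2 * cnj (Complex x \<xi> - Complex a b) * complex_of_real ?e) / (2 * \<i>)"
  proof -
    have D: "Complex x \<xi> - Complex a b - cnj (Complex x \<xi> - Complex a b) = 2 * \<i> * complex_of_real (\<xi> - b)"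
      by (simp add: complex_eq_iff)
    have "(- 2 * complex_of_real ?e) * (Complex x \<xi> - Complex a b - cnj (Complex x \<xi> - Complex a b))
        = (2 * \<i>) * complex_of_real (- 2 * (\<xi> - b) * ?e)" unfolding D by (simp add: algebra_simps)
    moreover have "- 2 * D * E - - 2 * D' * E = (- 2 * E) * (D - D')" for D D' E :: complex by (simp add: algebra_simps)
    ultimately show ?thesis by (simp only:) simp
  qed
  ultimately show "((\<lambda>\<eta>. complex_of_real (exp (- ((x - a)\<^sup>2 + (\<eta> - b)\<^sup>2)))) has_vector_derivative
    (- 2 * (Complex x \<xi> - Complex a b) * complex_of_real ?e - - 2 * cnj (Complex x \<xi> - Complex a b) * complex_of_real ?e) / (2 * \<i>)) (at \<xi>)" by (simp only:)
qed

lemma poly_bdd_cnj_Complex: "poly_bdd (\<lambda>x \<xi>. cnj (Complex x \<xi>))"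
  by (rule poly_bdd_cnj[OF poly_bdd_Complex])

lemma wigner_00_fun: "wigner 0 0 = (\<lambda>x \<xi>. complex_of_real (1 / pi) * complex_of_real (exp (- 1 * (x\<^sup>2 + \<xi>\<^sup>2))))"
  by (intro ext) (simp add: wigner_00)

lemma gauss_poly_wigner: "gauss_poly (wigner m n)"
proof (rule wigner_induct)
  show "gauss_poly (wigner 0 0)" unfolding wigner_00_fun by (intro gauss_poly_cmult gauss_poly_gauss) simp
  show "gauss_poly (\<lambda>x \<xi>. a * Complex x \<xi> * f x \<xi> + b * g x \<xi>)" if "gauss_poly f" "gauss_poly g" for f g a b
    unfolding mult.assoc by (intro gauss_poly_add gauss_poly_cmult gauss_poly_mult[OF poly_bdd_Complex] that)
  show "gauss_poly (\<lambda>x \<xi>. a * cnj (Complex x \<xi>) * f x \<xi>)" if "gauss_poly f" for f a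
    unfolding mult.assoc by (intro gauss_poly_cmult gauss_poly_mult[OF poly_bdd_cnj_Complex] that)
qed

text \<open>The derivative in ladder form: multiplication by \<open>2 * Complex x \<xi>\<close> adds
  the same two terms that are subtracted here. \<open>wig\<beta>\<close> stands in the same relation
  to the conjugate.\<close>

definition wig\<alpha> :: "nat \<Rightarrow> nat \<Rightarrow> real \<Rightarrow> real \<Rightarrow> complex" where
  "wig\<alpha> m n x \<xi> = rt n * wigner m (n - 1) x \<xi> - rt (Suc m) * wigner (Suc m) n x \<xi>"

definition wig\<beta> :: "nat \<Rightarrow> nat \<Rightarrow> real \<Rightarrow> real \<Rightarrow> complex" where
  "wig\<beta> m n x \<xi> = rt m * wigner (m - 1) n x \<xi> - rt (Suc n) * wigner m (Suc n) x \<xi>"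

lemma gauss_poly_wig\<alpha>: "gauss_poly (wig\<alpha> m n)"
  unfolding wig\<alpha>_def[abs_def] by (intro gauss_poly_diff gauss_poly_cmult gauss_poly_wigner)

lemma gauss_poly_wig\<beta>: "gauss_poly (wig\<beta> m n)"
  unfolding wig\<beta>_def[abs_def] by (intro gauss_poly_diff gauss_poly_cmult gauss_poly_wigner)

lemma rt_sq: "rt k * rt k = 2 * of_nat k"
  unfolding of_real_mult[symmetric] by simp

text \<open>Induction along the recurrences that build the Wigner functions. Differentiating the
  coordinate factor gives 2 and the recurrence another 2; this 4 is just what shifts the squared
  ladder coefficients \<open>rt k * rt k = 2k\<close> to those of the next index.\<close>

lemma wirt_wigner: "wirt (wigner m n) (wig\<alpha> m n) (wig\<beta> m n)"
proof (induction m arbitrary: n)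
  case 0
  show ?case
  proof (induction n)
    case 0
    have "wirt (\<lambda>x \<xi>. complex_of_real (1 / pi) * complex_of_real (exp (- ((x - 0)\<^sup>2 + (\<xi> - 0)\<^sup>2))))
      (\<lambda>x \<xi>. complex_of_real (1 / pi) * (- 2 * (Complex x \<xi> - Complex 0 0) * complex_of_real (exp (- ((x - 0)\<^sup>2 + (\<xi> - 0)\<^sup>2)))))
      (\<lambda>x \<xi>. complex_of_real (1 / pi) * (- 2 * cnj (Complex x \<xi> - Complex 0 0) * complex_of_real (exp (- ((x - 0)\<^sup>2 + (\<xi> - 0)\<^sup>2)))))"
      by (intro wirt_cmult wirt_gauss)
    moreover have "(\<lambda>x \<xi>. complex_of_real (1 / pi) * complex_of_real (exp (- ((x - 0)\<^sup>2 + (\<xi> - 0)\<^sup>2)))) = wigner 0 0"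
      unfolding wigner_00_fun by simp
    moreover have "(\<lambda>x \<xi>. complex_of_real (1 / pi) * (- 2 * (Complex x \<xi> - Complex 0 0) * complex_of_real (exp (- ((x - 0)\<^sup>2 + (\<xi> - 0)\<^sup>2))))) = wig\<alpha> 0 0"
    proof (intro ext)
      fix x \<xi> :: real
      have "wig\<alpha> 0 0 x \<xi> = - (2 * Complex x \<xi> * wigner 0 0 x \<xi>)" unfolding wig\<alpha>_def wigner_z by simp
      moreover have "Complex x \<xi> - Complex 0 0 = Complex x \<xi>" by (simp add: complex_eq_iff)
      ultimately show "complex_of_real (1 / pi) * (- 2 * (Complex x \<xi> - Complex 0 0) * complex_of_real (exp (- ((x - 0)\<^sup>2 + (\<xi> - 0)\<^sup>2)))) = wig\<alpha> 0 0 x \<xi>"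
        by (simp add: wigner_00)
    qed
    moreover have "(\<lambda>x \<xi>. complex_of_real (1 / pi) * (- 2 * cnj (Complex x \<xi> - Complex 0 0) * complex_of_real (exp (- ((x - 0)\<^sup>2 + (\<xi> - 0)\<^sup>2))))) = wig\<beta> 0 0"
    proof (intro ext)
      fix x \<xi> :: real
      have "wig\<beta> 0 0 x \<xi> = - (2 * cnj (Complex x \<xi>) * wigner 0 0 x \<xi>)" unfolding wig\<beta>_def wigner_zbar by simp
      moreover have "Complex x \<xi> - Complex 0 0 = Complex x \<xi>" by (simp add: complex_eq_iff)
      ultimately show "complex_of_real (1 / pi) * (- 2 * cnj (Complex x \<xi> - Complex 0 0) * complex_of_real (exp (- ((x - 0)\<^sup>2 + (\<xi> - 0)\<^sup>2)))) = wig\<beta> 0 0 x \<xi>"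
        by (simp add: wigner_00)
    qed
    ultimately show ?case by (simp only:)
  next
    case (Suc n)
    let ?W = "wigner" and ?r = "rt (Suc n)"
    have r0: "?r \<noteq> 0" by (rule rt_Suc_nonzero)
    have "wirt (\<lambda>x \<xi>. (2 / ?r) * (cnj (Complex x \<xi>) * ?W 0 n x \<xi>))
       (\<lambda>x \<xi>. (2 / ?r) * (cnj (Complex x \<xi>) * wig\<alpha> 0 n x \<xi> + 2 * ?W 0 n x \<xi>))
       (\<lambda>x \<xi>. (2 / ?r) * (cnj (Complex x \<xi>) * wig\<beta> 0 n x \<xi> + 0 * ?W 0 n x \<xi>))"
      by (intro wirt_cmult wirt_mult wirt_cnj_Complex Suc)
    moreover have "(\<lambda>x \<xi>. (2 / ?r) * (cnj (Complex x \<xi>) * ?W 0 n x \<xi>)) = ?W 0 (Suc n)"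
      by (intro ext) (simp only: wigner_Suc_right_0 mult.assoc)
    moreover have "(\<lambda>x \<xi>. (2 / ?r) * (cnj (Complex x \<xi>) * wig\<alpha> 0 n x \<xi> + 2 * ?W 0 n x \<xi>)) = wig\<alpha> 0 (Suc n)"
    proof (intro ext)
      fix x \<xi>
      define c where "c = cnj (Complex x \<xi>)"
      have 1: "rt n * (2 * c * ?W 0 (n - 1) x \<xi>) = rt n * (rt n * ?W 0 n x \<xi>)"
        using wigner_zbar[of x \<xi> 0 "n - 1"] unfolding c_def by (cases n) simp_all
      have 2: "2 * c * ?W (Suc 0) n x \<xi> = rt (Suc 0) * ?W 0 n x \<xi> + ?r * ?W (Suc 0) (Suc n) x \<xi>"
        using wigner_zbar[of x \<xi> "Suc 0" n] unfolding c_def by simp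
      have "2 * (c * wig\<alpha> 0 n x \<xi> + 2 * ?W 0 n x \<xi>) = rt n * (2 * c * ?W 0 (n - 1) x \<xi>) - rt (Suc 0) * (2 * c * ?W (Suc 0) n x \<xi>) + 4 * ?W 0 n x \<xi>"
        unfolding wig\<alpha>_def by (simp add: algebra_simps)
      also have "\<dots> = (rt n * rt n - rt (Suc 0) * rt (Suc 0) + 4) * ?W 0 n x \<xi> - rt (Suc 0) * ?r * ?W (Suc 0) (Suc n) x \<xi>"
        unfolding 1 2 by (simp add: algebra_simps)
      also have "rt n * rt n - rt (Suc 0) * rt (Suc 0) + 4 = ?r * ?r" unfolding rt_sq by (simp add: of_nat_Suc algebra_simps)
      also have "?r * ?r * ?W 0 n x \<xi> - rt (Suc 0) * ?r * ?W (Suc 0) (Suc n) x \<xi> = ?r * wig\<alpha> 0 (Suc n) x \<xi>"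
        unfolding wig\<alpha>_def by (simp add: algebra_simps)
      finally show "(2 / ?r) * (cnj (Complex x \<xi>) * wig\<alpha> 0 n x \<xi> + 2 * ?W 0 n x \<xi>) = wig\<alpha> 0 (Suc n) x \<xi>"
        using r0 unfolding c_def[symmetric] by (simp add: field_simps)
    qed
    moreover have "(\<lambda>x \<xi>. (2 / ?r) * (cnj (Complex x \<xi>) * wig\<beta> 0 n x \<xi> + 0 * ?W 0 n x \<xi>)) = wig\<beta> 0 (Suc n)"
    proof (intro ext)
      fix x \<xi>
      have "wig\<beta> 0 n x \<xi> = - (?r * ?W 0 (Suc n) x \<xi>)" by (simp add: wig\<beta>_def)
      then have "(2 / ?r) * (cnj (Complex x \<xi>) * wig\<beta> 0 n x \<xi> + 0 * ?W 0 n x \<xi>) = - (2 * cnj (Complex x \<xi>) * ?W 0 (Suc n) x \<xi>)"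
        using r0 by simp
      also have "\<dots> = wig\<beta> 0 (Suc n) x \<xi>" unfolding wigner_zbar wig\<beta>_def by simp
      finally show "(2 / ?r) * (cnj (Complex x \<xi>) * wig\<beta> 0 n x \<xi> + 0 * ?W 0 n x \<xi>) = wig\<beta> 0 (Suc n) x \<xi>" .
    qed
    ultimately show ?case by (simp only:)
  qed
next
  case (Suc m)
  let ?W = "wigner" and ?r = "rt (Suc m)"
  have r0: "?r \<noteq> 0" by (rule rt_Suc_nonzero)
  have "wirt (\<lambda>x \<xi>. (2 / ?r) * (Complex x \<xi> * ?W m n x \<xi>) + (- rt n / ?r) * ?W m (n - 1) x \<xi>)
     (\<lambda>x \<xi>. (2 / ?r) * (Complex x \<xi> * wig\<alpha> m n x \<xi> + 0 * ?W m n x \<xi>) + (- rt n / ?r) * wig\<alpha> m (n - 1) x \<xi>)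
     (\<lambda>x \<xi>. (2 / ?r) * (Complex x \<xi> * wig\<beta> m n x \<xi> + 2 * ?W m n x \<xi>) + (- rt n / ?r) * wig\<beta> m (n - 1) x \<xi>)"
    by (intro wirt_add wirt_cmult wirt_mult wirt_Complex Suc)
  moreover have "(\<lambda>x \<xi>. (2 / ?r) * (Complex x \<xi> * ?W m n x \<xi>) + (- rt n / ?r) * ?W m (n - 1) x \<xi>) = ?W (Suc m) n"
    by (intro ext) (simp only: wigner_Suc_left mult.assoc)
  moreover have "(\<lambda>x \<xi>. (2 / ?r) * (Complex x \<xi> * wig\<alpha> m n x \<xi> + 0 * ?W m n x \<xi>) + (- rt n / ?r) * wig\<alpha> m (n - 1) x \<xi>) = wig\<alpha> (Suc m) n"
  proof (intro ext)
    fix x \<xi>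
    define c where "c = Complex x \<xi>"
    have 1: "2 * c * ?W m (n - 1) x \<xi> = rt (n - 1) * ?W m (n - 1 - 1) x \<xi> + ?r * ?W (Suc m) (n - 1) x \<xi>"
      unfolding c_def by (rule wigner_z)
    have 2: "2 * c * ?W (Suc m) n x \<xi> = rt n * ?W (Suc m) (n - 1) x \<xi> + rt (Suc (Suc m)) * ?W (Suc (Suc m)) n x \<xi>"
      unfolding c_def by (rule wigner_z)
    have "2 * (c * wig\<alpha> m n x \<xi>) - rt n * wig\<alpha> m (n - 1) x \<xi> = rt n * (2 * c * ?W m (n - 1) x \<xi>) - ?r * (2 * c * ?W (Suc m) n x \<xi>)
       - rt n * (rt (n - 1) * ?W m (n - 1 - 1) x \<xi> - ?r * ?W (Suc m) (n - 1) x \<xi>)"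
      unfolding wig\<alpha>_def by (simp add: algebra_simps)
    also have "\<dots> = ?r * wig\<alpha> (Suc m) n x \<xi>" unfolding 1 2 wig\<alpha>_def by (simp add: algebra_simps)
    finally show "(2 / ?r) * (Complex x \<xi> * wig\<alpha> m n x \<xi> + 0 * ?W m n x \<xi>) + (- rt n / ?r) * wig\<alpha> m (n - 1) x \<xi> = wig\<alpha> (Suc m) n x \<xi>"
      using r0 unfolding c_def[symmetric] by (simp add: field_simps)
  qed
  moreover have "(\<lambda>x \<xi>. (2 / ?r) * (Complex x \<xi> * wig\<beta> m n x \<xi> + 2 * ?W m n x \<xi>) + (- rt n / ?r) * wig\<beta> m (n - 1) x \<xi>) = wig\<beta> (Suc m) n"
  proof (intro ext)
    fix x \<xi>
    define c where "c = Complex x \<xi>"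
    have 1: "rt m * (2 * c * ?W (m - 1) n x \<xi>) = rt m * (rt n * ?W (m - 1) (n - 1) x \<xi> + rt m * ?W m n x \<xi>)"
      using wigner_z[of x \<xi> "m - 1" n] unfolding c_def by (cases m) simp_all
    have 2: "2 * c * ?W m (Suc n) x \<xi> = rt (Suc n) * ?W m n x \<xi> + ?r * ?W (Suc m) (Suc n) x \<xi>"
      using wigner_z[of x \<xi> m "Suc n"] unfolding c_def by simp
    have 3: "rt n * wig\<beta> m (n - 1) x \<xi> = rt n * (rt m * ?W (m - 1) (n - 1) x \<xi> - rt n * ?W m n x \<xi>)"
      unfolding wig\<beta>_def by (cases n) simp_all
    have "2 * (c * wig\<beta> m n x \<xi> + 2 * ?W m n x \<xi>) - rt n * wig\<beta> m (n - 1) x \<xi>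
       = rt m * (2 * c * ?W (m - 1) n x \<xi>) - rt (Suc n) * (2 * c * ?W m (Suc n) x \<xi>) + 4 * ?W m n x \<xi> - rt n * wig\<beta> m (n - 1) x \<xi>"
      unfolding wig\<beta>_def[of m n] by (simp add: algebra_simps)
    also have "\<dots> = (rt m * rt m - rt (Suc n) * rt (Suc n) + 4 + rt n * rt n) * ?W m n x \<xi> - rt (Suc n) * ?r * ?W (Suc m) (Suc n) x \<xi>"
      unfolding 1 2 3 by (simp add: algebra_simps)
    also have "rt m * rt m - rt (Suc n) * rt (Suc n) + 4 + rt n * rt n = ?r * ?r" unfolding rt_sq by (simp add: of_nat_Suc algebra_simps)
    also have "?r * ?r * ?W m n x \<xi> - rt (Suc n) * ?r * ?W (Suc m) (Suc n) x \<xi> = ?r * wig\<beta> (Suc m) n x \<xi>"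
      unfolding wig\<beta>_def by (simp add: algebra_simps)
    finally show "(2 / ?r) * (Complex x \<xi> * wig\<beta> m n x \<xi> + 2 * ?W m n x \<xi>) + (- rt n / ?r) * wig\<beta> m (n - 1) x \<xi> = wig\<beta> (Suc m) n x \<xi>"
      using r0 unfolding c_def[symmetric] by (simp add: field_simps)
  qed
  ultimately show ?case by (simp only:)
qed

lemma wigner_cnj: "wigner n m x \<xi> = cnj (wigner m n x \<xi>)"
proof -
  have k: "wkernel m n x (- y) = wkernel n m x y" for y by (simp add: wkernel_def mult.commute)
  have "cnj (LINT y|lborel. complex_of_real (wkernel m n x y) * cis (y * \<xi>))
      = (LINT y|lborel. complex_of_real (wkernel m n x y) * cis (- (y * \<xi>)))"
    unfolding Bochner_Integration.integral_cnj[symmetric] by (simp add: cis_cnj)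
  also have "\<dots> = \<bar>-1\<bar> *\<^sub>R (LINT y|lborel. complex_of_real (wkernel m n x (0 + (-1) * y)) * cis (- ((0 + (-1) * y) * \<xi>)))"
    by (rule lborel_integral_real_affine) simp
  also have "\<dots> = (LINT y|lborel. complex_of_real (wkernel n m x y) * cis (y * \<xi>))" by (simp add: k)
  finally show ?thesis unfolding wigner_eq by simp
qed

lemma wigner_raise: "rt (Suc m) * wigner (Suc m) n x \<xi> = Complex x \<xi> * wigner m n x \<xi> - 1/2 * wig\<alpha> m n x \<xi>"
proof -
  have "2 * (Complex x \<xi> * wigner m n x \<xi>) = rt n * wigner m (n - 1) x \<xi> + rt (Suc m) * wigner (Suc m) n x \<xi>"
    using wigner_z[of x \<xi> m n] by (simp only: mult.assoc)
  then have "2 * (Complex x \<xi> * wigner m n x \<xi>) - wig\<alpha> m n x \<xi> = 2 * (rt (Suc m) * wigner (Suc m) n x \<xi>)"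
    unfolding wig\<alpha>_def by (simp only:) simp
  then show ?thesis by (simp add: field_simps)
qed

lemma wigner_lower: "rt (Suc m) * wigner m n x \<xi> = cnj (Complex x \<xi>) * wigner (Suc m) n x \<xi> + 1/2 * wig\<beta> (Suc m) n x \<xi>"
proof -
  have "2 * (cnj (Complex x \<xi>) * wigner (Suc m) n x \<xi>) = rt (Suc m) * wigner m n x \<xi> + rt (Suc n) * wigner (Suc m) (Suc n) x \<xi>"
    using wigner_zbar[of x \<xi> "Suc m" n] by (simp only: mult.assoc diff_Suc_1)
  then have "2 * (cnj (Complex x \<xi>) * wigner (Suc m) n x \<xi>) + wig\<beta> (Suc m) n x \<xi> = 2 * (rt (Suc m) * wigner m n x \<xi>)"
    unfolding wig\<beta>_def by (simp only:) simp
  then show ?thesis by (simp add: field_simps)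
qed

text \<open>The raising operator in the left index is the first-order differential operator of
  \<open>wigner_raise\<close>; integration by parts moves it onto the symbol.\<close>

lemma pint_raise:
  assumes f: "wirt f \<alpha> \<beta>" "poly_bdd f" "poly_bdd \<alpha>" "poly_bdd \<beta>"
  shows "rt (Suc m) * pint (\<lambda>x \<xi>. f x \<xi> * wigner (Suc m) n x \<xi>)
    = pint (\<lambda>x \<xi>. (Complex x \<xi> * f x \<xi> + 1/2 * \<alpha> x \<xi>) * wigner m n x \<xi>)"
proof -
  let ?W = "wigner m n"
  note g = gauss_poly_wigner gauss_poly_wig\<alpha> gauss_poly_wig\<beta>
  have "rt (Suc m) * pint (\<lambda>x \<xi>. f x \<xi> * wigner (Suc m) n x \<xi>) = pint (\<lambda>x \<xi>. f x \<xi> * (rt (Suc m) * wigner (Suc m) n x \<xi>))"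
    unfolding pint_cmult[symmetric] by (simp only: mult.left_commute)
  also have "\<dots> = pint (\<lambda>x \<xi>. (Complex x \<xi> * f x \<xi>) * ?W x \<xi> - 1/2 * (f x \<xi> * wig\<alpha> m n x \<xi>))"
    unfolding wigner_raise by (simp add: algebra_simps)
  also have "\<dots> = pint (\<lambda>x \<xi>. (Complex x \<xi> * f x \<xi>) * ?W x \<xi>) - 1/2 * pint (\<lambda>x \<xi>. f x \<xi> * wig\<alpha> m n x \<xi>)"
    unfolding pint_cmult[symmetric]
    by (intro pint_diff gauss_poly_cmult gauss_poly_mult poly_bdd_mult poly_bdd_Complex f g)
  also have "\<dots> = pint (\<lambda>x \<xi>. (Complex x \<xi> * f x \<xi>) * ?W x \<xi>) + 1/2 * pint (\<lambda>x \<xi>. \<alpha> x \<xi> * ?W x \<xi>)"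
    unfolding pint_by_parts(1)[OF f wirt_wigner g] by simp
  also have "\<dots> = pint (\<lambda>x \<xi>. (Complex x \<xi> * f x \<xi>) * ?W x \<xi> + 1/2 * (\<alpha> x \<xi> * ?W x \<xi>))"
    unfolding pint_cmult[symmetric]
    by (intro pint_add[symmetric] gauss_poly_cmult gauss_poly_mult poly_bdd_mult poly_bdd_Complex f g)
  finally show ?thesis by (simp add: distrib_right)
qed

lemma integral_gauss_plane:
  assumes a: "a > 0"
  shows "pint (\<lambda>x \<xi>. complex_of_real (exp (- a * ((x - b)\<^sup>2 + (\<xi> - c)\<^sup>2)))) = complex_of_real (pi / a)"
proof -
  have e: "exp (- a * ((x - b)\<^sup>2 + (\<xi> - c)\<^sup>2)) = exp (- a * (x - b)\<^sup>2) * exp (- a * (\<xi> - c)\<^sup>2)" for x \<xi>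
    unfolding exp_add[symmetric] distrib_left ..
  have "pint (\<lambda>x \<xi>. complex_of_real (exp (- a * ((x - b)\<^sup>2 + (\<xi> - c)\<^sup>2)))) = complex_of_real (LINT z|lborel. exp (- a * (fst z - b)\<^sup>2) * exp (- a * (snd z - c)\<^sup>2))"
    unfolding pint_def e by (rule integral_complex_of_real)
  also have "(LINT z|lborel. exp (- a * (fst z - b)\<^sup>2) * exp (- a * (snd z - c)\<^sup>2)) = sqrt (pi / a) * sqrt (pi / a)"
    by (subst integrable_lborel_product(2)[OF integrable_gauss[OF a] integrable_gauss[OF a]]) (simp only: integral_gauss[OF a])
  also have "\<dots> = pi / a" using a by simp
  finally show ?thesis .
qed

text \<open>One factor is lowered by \<open>pint_raise\<close>, which turns the conjugate factor
  into the conjugate of \<open>wigner_lower\<close>; both index shifts carry the same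
  coefficient.\<close>

lemma wigner_L2_Suc: "pint (\<lambda>x \<xi>. cnj (wigner (Suc m) n x \<xi>) * wigner (Suc m) n x \<xi>) = pint (\<lambda>x \<xi>. cnj (wigner m n x \<xi>) * wigner m n x \<xi>)"
proof -
  have "rt (Suc m) * pint (\<lambda>x \<xi>. cnj (wigner (Suc m) n x \<xi>) * wigner (Suc m) n x \<xi>)
      = pint (\<lambda>x \<xi>. (Complex x \<xi> * cnj (wigner (Suc m) n x \<xi>) + 1/2 * cnj (wig\<beta> (Suc m) n x \<xi>)) * wigner m n x \<xi>)"
    by (rule pint_raise[OF wirt_cnj[OF wirt_wigner]])
       (intro poly_bdd_cnj gauss_poly_imp_poly_bdd gauss_poly_wigner gauss_poly_wig\<alpha> gauss_poly_wig\<beta>)+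
  also have "(\<lambda>x \<xi>. (Complex x \<xi> * cnj (wigner (Suc m) n x \<xi>) + 1/2 * cnj (wig\<beta> (Suc m) n x \<xi>)) * wigner m n x \<xi>)
      = (\<lambda>x \<xi>. rt (Suc m) * (cnj (wigner m n x \<xi>) * wigner m n x \<xi>))"
  proof (intro ext)
    fix x \<xi>
    have "Complex x \<xi> * cnj (wigner (Suc m) n x \<xi>) + 1/2 * cnj (wig\<beta> (Suc m) n x \<xi>) = cnj (rt (Suc m) * wigner m n x \<xi>)"
      unfolding wigner_lower by simp
    then show "(Complex x \<xi> * cnj (wigner (Suc m) n x \<xi>) + 1/2 * cnj (wig\<beta> (Suc m) n x \<xi>)) * wigner m n x \<xi>
      = rt (Suc m) * (cnj (wigner m n x \<xi>) * wigner m n x \<xi>)" by simp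
  qed
  finally show ?thesis unfolding pint_cmult using rt_Suc_nonzero[of m] by simp
qed

lemma wigner_L2: "(LINT z|lborel. (cmod (wigner m n (fst z) (snd z)))\<^sup>2) = 1 / (2 * pi)"
proof -
  let ?N = "\<lambda>m n. pint (\<lambda>x \<xi>. cnj (wigner m n x \<xi>) * wigner m n x \<xi>)"
  have s: "?N m n = ?N 0 n" for m n by (induction m) (simp_all add: wigner_L2_Suc)
  have "?N m n = ?N n 0"
    \<comment> \<open>Only the left index can be lowered; conjugation exchanges the indices, and
      lowering again reaches the Gaussian.\<close>
    unfolding s[of m n] wigner_cnj[of n 0] by (simp add: mult.commute)
  also have "\<dots> = ?N 0 0" by (rule s)
  also have "\<dots> = complex_of_real (1 / (2 * pi))"
  proof -
    have "(\<lambda>x \<xi>. cnj (wigner 0 0 x \<xi>) * wigner 0 0 x \<xi>) = (\<lambda>x \<xi>. complex_of_real (1 / pi\<^sup>2) * complex_of_real (exp (- 2 * ((x - 0)\<^sup>2 + (\<xi> - 0)\<^sup>2))))"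
    proof (intro ext)
      fix x \<xi> :: real
      have "exp (- (x\<^sup>2 + \<xi>\<^sup>2)) * exp (- (x\<^sup>2 + \<xi>\<^sup>2)) = exp (- 2 * ((x - 0)\<^sup>2 + (\<xi> - 0)\<^sup>2))"
        unfolding exp_add[symmetric] by simp
      then show "cnj (wigner 0 0 x \<xi>) * wigner 0 0 x \<xi> = complex_of_real (1 / pi\<^sup>2) * complex_of_real (exp (- 2 * ((x - 0)\<^sup>2 + (\<xi> - 0)\<^sup>2)))"
        unfolding wigner_00 complex_cnj_complex_of_real of_real_mult[symmetric] by (simp add: power2_eq_square)
    qed
    then have "?N 0 0 = complex_of_real (1 / pi\<^sup>2) * complex_of_real (pi / 2)"
      using integral_gauss_plane[of 2 0 0] by (simp only: pint_cmult)
    also have "\<dots> = complex_of_real (1 / (2 * pi))" unfolding of_real_mult[symmetric] by (simp add: power2_eq_square)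
    finally show ?thesis .
  qed
  finally have "?N m n = complex_of_real (1 / (2 * pi))" .
  moreover have "?N m n = complex_of_real (LINT z|lborel. (cmod (wigner m n (fst z) (snd z)))\<^sup>2)"
  proof -
    have "cnj z * z = complex_of_real ((cmod z)\<^sup>2)" for z by (metis complex_norm_square mult.commute)
    then show ?thesis unfolding pint_def integral_complex_of_real[symmetric] by simp
  qed
  ultimately show ?thesis by (metis of_real_eq_iff)
qed

text \<open>The Husimi transform of the Wigner functions: smoothing by a Gaussian turns the Weyl symbol
  calculus into the (positive) anti-Wick calculus.\<close>

definition husimi :: "nat \<Rightarrow> nat \<Rightarrow> real \<Rightarrow> real \<Rightarrow> complex" where
  "husimi m n a b = pint (\<lambda>x \<xi>. complex_of_real (exp (- ((x - a)\<^sup>2 + (\<xi> - b)\<^sup>2))) * wigner m n x \<xi>) / complex_of_real pi"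

lemma poly_bdd_gauss: "poly_bdd (\<lambda>x \<xi>. complex_of_real (exp (- ((x - a)\<^sup>2 + (\<xi> - b)\<^sup>2))))"
  unfolding poly_bdd_def
  by (intro conjI exI[of _ 1] exI[of _ 0] continuous_intros) auto

text \<open>The raising operator differentiates the Gaussian. The resulting
  \<open>-(z - z\<^sub>0)\<close>, with centre \<open>z\<^sub>0 = Complex a b\<close>, cancels the
  multiplication by \<open>z\<close> and leaves the number \<open>z\<^sub>0\<close>.\<close>

lemma husimi_Suc: "rt (Suc m) * husimi (Suc m) n a b = Complex a b * husimi m n a b"
proof -
  let ?G = "\<lambda>x \<xi>. complex_of_real (exp (- ((x - a)\<^sup>2 + (\<xi> - b)\<^sup>2)))"
  have pc: "poly_bdd (\<lambda>x \<xi>. Complex x \<xi> - Complex a b)" by (intro poly_bdd_diff poly_bdd_Complex poly_bdd_const)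
  have "rt (Suc m) * pint (\<lambda>x \<xi>. ?G x \<xi> * wigner (Suc m) n x \<xi>)
     = pint (\<lambda>x \<xi>. (Complex x \<xi> * ?G x \<xi> + 1/2 * (- 2 * (Complex x \<xi> - Complex a b) * ?G x \<xi>)) * wigner m n x \<xi>)"
    by (rule pint_raise[OF wirt_gauss poly_bdd_gauss poly_bdd_mult[OF poly_bdd_cmult[OF pc] poly_bdd_gauss]
          poly_bdd_mult[OF poly_bdd_cmult[OF poly_bdd_cnj[OF pc]] poly_bdd_gauss]])
  also have "\<dots> = Complex a b * pint (\<lambda>x \<xi>. ?G x \<xi> * wigner m n x \<xi>)"
    unfolding pint_cmult[symmetric] by (simp add: algebra_simps)
  finally show ?thesis unfolding husimi_def by simp
qed

lemma husimi_cnj: "husimi n m a b = cnj (husimi m n a b)"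
  unfolding husimi_def pint_def wigner_cnj[of n m] by (simp flip: Bochner_Integration.integral_cnj)

lemma husimi_00: "husimi 0 0 a b = complex_of_real (exp (- (a\<^sup>2 + b\<^sup>2) / 2) / (2 * pi))"
proof -
  have "(\<lambda>x \<xi>. complex_of_real (exp (- ((x - a)\<^sup>2 + (\<xi> - b)\<^sup>2))) * wigner 0 0 x \<xi>)
     = (\<lambda>x \<xi>. complex_of_real (exp (- (a\<^sup>2 + b\<^sup>2) / 2) / pi) * complex_of_real (exp (- 2 * ((x - a/2)\<^sup>2 + (\<xi> - b/2)\<^sup>2))))"
  proof (intro ext)
    fix x \<xi>
    have "- ((x - a)\<^sup>2 + (\<xi> - b)\<^sup>2) + - (x\<^sup>2 + \<xi>\<^sup>2) = - (a\<^sup>2 + b\<^sup>2) / 2 + - 2 * ((x - a/2)\<^sup>2 + (\<xi> - b/2)\<^sup>2)"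
      by (simp add: power2_eq_square field_simps)
    then have "exp (- ((x - a)\<^sup>2 + (\<xi> - b)\<^sup>2)) * exp (- (x\<^sup>2 + \<xi>\<^sup>2)) = exp (- (a\<^sup>2 + b\<^sup>2) / 2) * exp (- 2 * ((x - a/2)\<^sup>2 + (\<xi> - b/2)\<^sup>2))"
      unfolding exp_add[symmetric] by (simp only:)
    then show "complex_of_real (exp (- ((x - a)\<^sup>2 + (\<xi> - b)\<^sup>2))) * wigner 0 0 x \<xi>
      = complex_of_real (exp (- (a\<^sup>2 + b\<^sup>2) / 2) / pi) * complex_of_real (exp (- 2 * ((x - a/2)\<^sup>2 + (\<xi> - b/2)\<^sup>2)))"
      unfolding wigner_00 of_real_mult[symmetric] by (simp only: times_divide_eq_left times_divide_eq_right)
  qed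
  then show ?thesis unfolding husimi_def using integral_gauss_plane[of 2 "a/2" "b/2"]
    by (simp only: pint_cmult) simp
qed

text \<open>For fixed \<open>(a, b)\<close> a Poisson law in \<open>m\<close> with mean
  \<open>(a\<^sup>2 + b\<^sup>2) / 2\<close>, divided by \<open>2 * pi\<close>: the squared
  coefficients of a coherent state, normalised to integral one over the plane.\<close>

definition poisson_weight :: "nat \<Rightarrow> real \<Rightarrow> real \<Rightarrow> real" where
  "poisson_weight m a b = ((a\<^sup>2 + b\<^sup>2) / 2) ^ m / fact m * exp (- (a\<^sup>2 + b\<^sup>2) / 2) / (2 * pi)"

lemma poisson_weight_nonneg: "poisson_weight m a b \<ge> 0"
  by (simp add: poisson_weight_def)

text \<open>The Husimi function is a product of coherent-state coefficients, one for each index; by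
  \<open>husimi_Suc\<close> both sides obey the same recurrence.\<close>

lemma husimi_norm_sq: "(cmod (husimi m n a b))\<^sup>2 = poisson_weight m a b * poisson_weight n a b"
proof -
  have step: "(cmod (husimi (Suc m) n a b))\<^sup>2 = (a\<^sup>2 + b\<^sup>2) / (2 * real (Suc m)) * (cmod (husimi m n a b))\<^sup>2" for m n
  proof -
    have "(cmod (rt (Suc m) * husimi (Suc m) n a b))\<^sup>2 = (cmod (Complex a b * husimi m n a b))\<^sup>2" unfolding husimi_Suc ..
    then have "2 * real (Suc m) * (cmod (husimi (Suc m) n a b))\<^sup>2 = (a\<^sup>2 + b\<^sup>2) * (cmod (husimi m n a b))\<^sup>2"
      unfolding norm_mult power_mult_distrib norm_of_real by (simp add: cmod_power2)
    then show ?thesis by (simp add: field_simps)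
  qed
  have pw: "poisson_weight (Suc m) a b = (a\<^sup>2 + b\<^sup>2) / (2 * real (Suc m)) * poisson_weight m a b" for m
    by (simp add: poisson_weight_def)
  have base: "(cmod (husimi 0 0 a b))\<^sup>2 = poisson_weight 0 a b * poisson_weight 0 a b"
    unfolding husimi_00 norm_of_real by (simp add: poisson_weight_def power2_eq_square)
  have m0: "(cmod (husimi m 0 a b))\<^sup>2 = poisson_weight m a b * poisson_weight 0 a b" for m
    by (induction m) (simp_all only: base step pw mult.assoc)
  have n0: "(cmod (husimi 0 n a b))\<^sup>2 = poisson_weight 0 a b * poisson_weight n a b"
    unfolding husimi_cnj[of 0 n] complex_mod_cnj m0 by (rule mult.commute)
  show ?thesis by (induction m) (simp_all only: n0 step pw mult.assoc)
qed

lemma husimi_norm_le: "cmod (husimi m n a b) \<le> (poisson_weight m a b + poisson_weight n a b) / 2"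
proof -
  have "cmod (husimi m n a b) = sqrt (poisson_weight m a b * poisson_weight n a b)"
    unfolding husimi_norm_sq[symmetric] by simp
  also have "\<dots> \<le> (poisson_weight m a b + poisson_weight n a b) / 2"
    by (rule arith_geo_mean_sqrt[OF poisson_weight_nonneg poisson_weight_nonneg])
  finally show ?thesis .
qed

section \<open>Uniform bounds for Weyl matrix elements\<close>

lemma poly_bdd_power: "poly_bdd f \<Longrightarrow> poly_bdd (\<lambda>x \<xi>. f x \<xi> ^ k)"
  by (induction k) (auto intro: poly_bdd_const poly_bdd_mult)

lemma poly_bdd_radius: "poly_bdd (\<lambda>x \<xi>. complex_of_real (x\<^sup>2 + \<xi>\<^sup>2))"
  unfolding of_real_add power2_eq_square of_real_mult by (intro poly_bdd_add poly_bdd_mult poly_bdd_fst poly_bdd_snd)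

lemma gauss_poly_radial: "gauss_poly (\<lambda>x \<xi>. complex_of_real ((x\<^sup>2 + \<xi>\<^sup>2) ^ k * exp (- (1/2) * (x\<^sup>2 + \<xi>\<^sup>2))))"
proof -
  have "gauss_poly (\<lambda>x \<xi>. complex_of_real (x\<^sup>2 + \<xi>\<^sup>2) ^ k * complex_of_real (exp (- (1/2) * (x\<^sup>2 + \<xi>\<^sup>2))))"
    by (rule gauss_poly_mult[OF poly_bdd_power[OF poly_bdd_radius] gauss_poly_gauss]) simp
  then show ?thesis by (simp only: of_real_mult of_real_power)
qed

text \<open>The divergence theorem for the radial field with density
  \<open>r ^ (2m) exp (- r\<^sup>2 / 2)\<close>.\<close>

lemma radial_moment_Suc:
  "pint (\<lambda>x \<xi>. complex_of_real ((x\<^sup>2 + \<xi>\<^sup>2) ^ Suc m * exp (- (1/2) * (x\<^sup>2 + \<xi>\<^sup>2))))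
    = (2 + 2 * of_nat m) * pint (\<lambda>x \<xi>. complex_of_real ((x\<^sup>2 + \<xi>\<^sup>2) ^ m * exp (- (1/2) * (x\<^sup>2 + \<xi>\<^sup>2))))"
proof -
  define R where "R k x \<xi> = complex_of_real ((x\<^sup>2 + \<xi>\<^sup>2) ^ k * exp (- (1/2) * (x\<^sup>2 + \<xi>\<^sup>2)))" for k x \<xi>
  have gR: "gauss_poly (R k)" for k unfolding R_def by (rule gauss_poly_radial)
  define D where "D t x \<xi> = R m x \<xi> + complex_of_real (t * t) * (2 * of_nat m * R (m - 1) x \<xi> - R m x \<xi>)" for t x \<xi> :: real
  have dx: "((\<lambda>y. complex_of_real y * R m y \<xi>) has_vector_derivative D x x \<xi>) (at x)" for x \<xi>
  proof -
    let ?r = "x\<^sup>2 + \<xi>\<^sup>2"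
    have "((\<lambda>y. y * ((y\<^sup>2 + \<xi>\<^sup>2) ^ m * exp (- (1/2) * (y\<^sup>2 + \<xi>\<^sup>2)))) has_real_derivative
        (?r ^ m * exp (- (1/2) * ?r) + x * x * (2 * real m * (?r ^ (m - 1) * exp (- (1/2) * ?r)) - ?r ^ m * exp (- (1/2) * ?r)))) (at x)"
      by (rule derivative_eq_intros refl | simp)+ (simp add: algebra_simps)
    then have "((\<lambda>y. complex_of_real (y * ((y\<^sup>2 + \<xi>\<^sup>2) ^ m * exp (- (1/2) * (y\<^sup>2 + \<xi>\<^sup>2))))) has_vector_derivative
        complex_of_real (?r ^ m * exp (- (1/2) * ?r) + x * x * (2 * real m * (?r ^ (m - 1) * exp (- (1/2) * ?r)) - ?r ^ m * exp (- (1/2) * ?r)))) (at x)"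
      unfolding has_real_derivative_iff_has_vector_derivative by (rule bounded_linear.has_vector_derivative[OF bounded_linear_of_real])
    then show ?thesis unfolding R_def D_def
      by (simp only: of_real_mult of_real_add of_real_diff of_real_numeral of_real_of_nat_eq mult.assoc)
  qed
  have sym: "R k x \<xi> = R k \<xi> x" for k x \<xi> by (simp add: R_def add.commute)
  have dxi: "((\<lambda>\<eta>. complex_of_real \<eta> * R m x \<eta>) has_vector_derivative D \<xi> x \<xi>) (at \<xi>)" for x \<xi>
  proof -
    have "(\<lambda>\<eta>. complex_of_real \<eta> * R m x \<eta>) = (\<lambda>\<eta>. complex_of_real \<eta> * R m \<eta> x)"
      by (rule ext) (rule arg_cong[OF sym])
    moreover have "D \<xi> x \<xi> = D \<xi> \<xi> x" unfolding D_def by (metis sym)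
    ultimately show ?thesis using dx[of x \<xi>] by (simp only:)
  qed
  have gD1: "gauss_poly (\<lambda>x \<xi>. D x x \<xi>)"
    unfolding D_def of_real_mult
    by (rule gauss_poly_add[OF gR gauss_poly_mult[OF poly_bdd_mult[OF poly_bdd_fst poly_bdd_fst]
          gauss_poly_diff[OF gauss_poly_cmult[OF gR] gR]]])
  have gD2: "gauss_poly (\<lambda>x \<xi>. D \<xi> x \<xi>)"
    unfolding D_def of_real_mult
    by (rule gauss_poly_add[OF gR gauss_poly_mult[OF poly_bdd_mult[OF poly_bdd_snd poly_bdd_snd]
          gauss_poly_diff[OF gauss_poly_cmult[OF gR] gR]]])
  have "pint (\<lambda>x \<xi>. D x x \<xi>) = 0" by (rule pint_dx[OF dx _ gD1]) (rule gauss_poly_mult[OF poly_bdd_fst gR])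
  moreover have "pint (\<lambda>x \<xi>. D \<xi> x \<xi>) = 0" by (rule pint_dxi[OF dxi _ gD2]) (rule gauss_poly_mult[OF poly_bdd_snd gR])
  ultimately have "pint (\<lambda>x \<xi>. D x x \<xi> + D \<xi> x \<xi>) = 0" using pint_add[OF gD1 gD2] by simp
  moreover have "(\<lambda>x \<xi>. D x x \<xi> + D \<xi> x \<xi>) = (\<lambda>x \<xi>. (2 + 2 * of_nat m) * R m x \<xi> - R (Suc m) x \<xi>)"
  proof (intro ext)
    fix x \<xi> :: real
    let ?r = "complex_of_real (x * x + \<xi> * \<xi>)"
    have r1: "?r * R m x \<xi> = R (Suc m) x \<xi>" by (simp add: R_def power2_eq_square)
    have r2: "of_nat m * (?r * R (m - 1) x \<xi>) = of_nat m * R m x \<xi>" by (cases m) (simp_all add: R_def power2_eq_square)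
    have "D x x \<xi> + D \<xi> x \<xi> = 2 * R m x \<xi> + 2 * (of_nat m * (?r * R (m - 1) x \<xi>)) - ?r * R m x \<xi>"
      unfolding D_def by (simp add: algebra_simps)
    then show "D x x \<xi> + D \<xi> x \<xi> = (2 + 2 * of_nat m) * R m x \<xi> - R (Suc m) x \<xi>"
      unfolding r1 r2 by (simp add: algebra_simps)
  qed
  moreover have "pint (\<lambda>x \<xi>. (2 + 2 * of_nat m) * R m x \<xi> - R (Suc m) x \<xi>) = (2 + 2 * of_nat m) * pint (R m) - pint (R (Suc m))"
    unfolding pint_cmult[symmetric] by (rule pint_diff[OF gauss_poly_cmult[OF gR] gR])
  ultimately show ?thesis unfolding R_def[symmetric] by simp
qed

lemma poisson_weight_integral:
  shows "integrable lborel (\<lambda>z. poisson_weight m (fst z) (snd z))" "(LINT z|lborel. poisson_weight m (fst z) (snd z)) = 1"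
proof -
  define c where "c m = 1 / (2 ^ m * fact m * (2 * pi))" for m :: nat
  let ?R = "\<lambda>m (x::real) (\<xi>::real). (x\<^sup>2 + \<xi>\<^sup>2) ^ m * exp (- (1/2) * (x\<^sup>2 + \<xi>\<^sup>2))"
  have eq: "poisson_weight m x \<xi> = c m * ?R m x \<xi>" for m x \<xi>
  proof -
    have "exp (- (1/2) * r) = exp (- r / 2)" for r :: real by simp
    then show ?thesis unfolding poisson_weight_def c_def power_divide by (simp only:) simp
  qed
  have i: "integrable lborel (\<lambda>z. ?R m (fst z) (snd z))" for m
    using integrable_Re[OF gauss_poly_integrable[OF gauss_poly_radial[of m]]] by simp
  show "integrable lborel (\<lambda>z. poisson_weight m (fst z) (snd z))" unfolding eq by (intro integrable_mult_right i)
  have I: "pint (\<lambda>x \<xi>. complex_of_real (?R m x \<xi>)) = complex_of_real (2 ^ m * fact m * (2 * pi))" for m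
  proof (induction m)
    case 0
    show ?case using integral_gauss_plane[of "1/2" 0 0] by simp
  next
    case (Suc m)
    show ?case unfolding radial_moment_Suc Suc.IH by (simp add: of_nat_Suc algebra_simps)
  qed
  have "complex_of_real (LINT z|lborel. ?R m (fst z) (snd z)) = complex_of_real (2 ^ m * fact m * (2 * pi))"
    unfolding I[symmetric] pint_def by (rule integral_complex_of_real[symmetric])
  then have "(LINT z|lborel. ?R m (fst z) (snd z)) = 2 ^ m * fact m * (2 * pi)" by (simp only: of_real_eq_iff)
  then show "(LINT z|lborel. poisson_weight m (fst z) (snd z)) = 1" unfolding eq by (simp add: c_def)
qed

text \<open>Both partial derivatives together with continuity of one of them give total
  differentiability, and the chain rule follows.\<close>

lemma line_derivative:
  fixes f fx fy :: "real \<Rightarrow> real \<Rightarrow> complex"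
  assumes dx: "\<And>x y. ((\<lambda>t. f t y) has_vector_derivative fx x y) (at x)"
    and dy: "\<And>x y. ((\<lambda>t. f x t) has_vector_derivative fy x y) (at y)"
    and c: "cplane fy"
  shows "((\<lambda>s. f (x + s * u) (y + s * v)) has_vector_derivative
     (complex_of_real u * fx (x + s * u) (y + s * v) + complex_of_real v * fy (x + s * u) (y + s * v))) (at s)"
proof -
  let ?p = "(x + s * u, y + s * v)"
  have D: "((\<lambda>(x, y). f x y) has_derivative (\<lambda>(tx, ty). tx *\<^sub>R fx (fst ?p) (snd ?p) + blinfun_apply (blinfun_scaleR_left (fy (fst ?p) (snd ?p))) ty)) (at (fst ?p, snd ?p) within UNIV \<times> UNIV)"
  proof (rule has_derivative_partialsI)
    show "((\<lambda>x. f x (snd ?p)) has_derivative (\<lambda>tx. tx *\<^sub>R fx (fst ?p) (snd ?p))) (at (fst ?p) within UNIV)"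
      using dx unfolding has_vector_derivative_def by simp
    show "((\<lambda>y. f x y) has_derivative blinfun_apply (blinfun_scaleR_left (fy x y))) (at y within UNIV)" for x y
      using dy[of x y] unfolding has_vector_derivative_def by simp
    have "continuous_on UNIV (\<lambda>z. blinfun_scaleR_left (fy (fst z) (snd z)))"
      by (rule bounded_linear.continuous_on[OF bounded_linear_blinfun_scaleR_left c])
    then show "continuous (at (fst ?p, snd ?p) within UNIV \<times> UNIV) (\<lambda>(x, y). blinfun_scaleR_left (fy x y))"
      by (simp add: case_prod_unfold continuous_on_eq_continuous_within)
  qed auto
  have L: "((\<lambda>s. (x + s * u, y + s * v)) has_derivative (\<lambda>h. (h * u, h * v))) (at s)"
    by (auto intro!: derivative_eq_intros)
  have "((\<lambda>(x, y). f x y) \<circ> (\<lambda>s. (x + s * u, y + s * v)) has_derivative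
     (\<lambda>(tx, ty). tx *\<^sub>R fx (fst ?p) (snd ?p) + blinfun_apply (blinfun_scaleR_left (fy (fst ?p) (snd ?p))) ty) \<circ> (\<lambda>h. (h * u, h * v))) (at s)"
    by (rule diff_chain_at[OF L]) (use D in simp)
  then show ?thesis
    unfolding has_vector_derivative_def o_def by (simp add: scaleR_conv_of_real algebra_simps)
qed

text \<open>The mean value inequality twice: first for the derivative between \<open>-s\<close> and
  \<open>s\<close>, giving \<open>2 K s\<close>, then for the even part of \<open>g\<close>,
  compared with \<open>K * s\<^sup>2\<close>.\<close>

lemma second_difference_bound:
  fixes g :: "real \<Rightarrow> complex"
  assumes g: "\<And>s. (g has_vector_derivative g1 s) (at s)" and g1: "\<And>s. (g1 has_vector_derivative g2 s) (at s)"
    and b: "\<And>s. \<bar>s\<bar> \<le> 1 \<Longrightarrow> cmod (g2 s) \<le> K"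
  shows "cmod (2 * g 0 - g 1 - g (-1)) \<le> K"
proof -
  have cg1: "continuous_on S g1" for S using g1 by (meson continuous_at_imp_continuous_on has_vector_derivative_continuous)
  have k1: "cmod (g1 s - g1 (- s)) \<le> K * (2 * s)" if "0 < s" "s < 1" for s
  proof -
    have "norm (g1 s - g1 (- s)) \<le> K * s - K * (- s)"
    proof (rule differentiable_bound_general[where f' = g2 and \<phi> = "\<lambda>s. K * s" and \<phi>' = "\<lambda>_. K"])
      show "((\<lambda>s. K * s) has_vector_derivative K) (at x)" for x
        unfolding has_real_derivative_iff_has_vector_derivative[symmetric] by (auto intro!: derivative_eq_intros)
      show "norm (g2 x) \<le> K" if "- s < x" "x < s" for x using b[of x] that \<open>s < 1\<close> by auto
    qed (use that g1 cg1 in \<open>auto intro!: continuous_intros\<close>)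
    then show ?thesis by simp
  qed
  have dm: "((\<lambda>s. g (- s)) has_vector_derivative - g1 (- s)) (at s)" for s
  proof -
    have "(uminus has_vector_derivative -1) (at s)" by (auto intro!: derivative_eq_intros)
    from vector_diff_chain_at[OF this g[of "- s"]] show ?thesis by (simp add: o_def)
  qed
  have dk: "((\<lambda>s. g s + g (- s)) has_vector_derivative (g1 s + - g1 (- s))) (at s)" for s
    by (intro has_vector_derivative_add g dm)
  have "norm ((g 1 + g (- 1)) - (g 0 + g (- 0))) \<le> K * 1\<^sup>2 - K * 0\<^sup>2"
  proof (rule differentiable_bound_general[where f = "\<lambda>s. g s + g (- s)" and f' = "\<lambda>s. g1 s + - g1 (- s)" and \<phi> = "\<lambda>s. K * s\<^sup>2" and \<phi>' = "\<lambda>s. K * (2 * s)"])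
    show "continuous_on {0..1} (\<lambda>s. g s + g (- s))"
      using dk by (meson continuous_at_imp_continuous_on has_vector_derivative_continuous)
    show "((\<lambda>s. K * s\<^sup>2) has_vector_derivative K * (2 * x)) (at x)" for x
      unfolding has_real_derivative_iff_has_vector_derivative[symmetric] by (auto intro!: derivative_eq_intros)
    show "norm (g1 x + - g1 (- x)) \<le> K * (2 * x)" if "0 < x" "x < 1" for x using k1[OF that] by simp
  qed (use dk in \<open>auto intro!: continuous_intros\<close>)
  moreover have "(g 1 + g (- 1)) - (g 0 + g (- 0)) = - (2 * g 0 - g 1 - g (-1))" by simp
  ultimately show ?thesis by (simp only: norm_minus_cancel) simp
qed

text \<open>Peetre's inequality, by which decay at a displaced point becomes decay at
  \<open>(x, y)\<close>, at the price of a polynomial in the displacement that the Gaussian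
  absorbs.\<close>

lemma peetre:
  fixes x y u v s :: real assumes "\<bar>s\<bar> \<le> 1"
  shows "1 + x\<^sup>2 + y\<^sup>2 \<le> 2 * (1 + u\<^sup>2 + v\<^sup>2) * (1 + (x + s * u)\<^sup>2 + (y + s * v)\<^sup>2)"
proof -
  have q: "a\<^sup>2 \<le> 2 * (a + s * b)\<^sup>2 + 2 * b\<^sup>2" for a b :: real
  proof -
    have "0 \<le> (a + 2 * (s * b))\<^sup>2" by simp
    then have "a\<^sup>2 \<le> 2 * (a + s * b)\<^sup>2 + 2 * (s * b)\<^sup>2" by (simp add: power2_eq_square algebra_simps)
    moreover have "(s * b)\<^sup>2 \<le> b\<^sup>2"
      using assms mult_right_mono[of "s\<^sup>2" 1 "b\<^sup>2"] by (simp add: power_mult_distrib abs_square_le_1)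
    ultimately show ?thesis by linarith
  qed
  let ?P = "u\<^sup>2 + v\<^sup>2" and ?Q = "(x + s * u)\<^sup>2 + (y + s * v)\<^sup>2"
  have "1 + x\<^sup>2 + y\<^sup>2 \<le> 1 + 2 * ?Q + 2 * ?P" using q[of x u] q[of y v] by simp
  also have "\<dots> \<le> 2 * (1 + ?P) * (1 + ?Q)"
  proof -
    have "?P * ?Q \<ge> 0" by simp
    then show ?thesis by (simp add: algebra_simps)
  qed
  finally show ?thesis by (simp add: add.assoc)
qed

section \<open>Comparison of a symbol with its Gaussian smoothing\<close>

lemma weyl_mat_eq_pint: "weyl_mat f m n = pint (\<lambda>x \<xi>. f x \<xi> * wigner m n x \<xi>)"
  unfolding weyl_mat_def pint_def ..

lemma integrable_inverse_weight_sq: "integrable lborel (\<lambda>z :: real \<times> real. 1 / (1 + (fst z)\<^sup>2 + (snd z)\<^sup>2)\<^sup>2)"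
proof -
  have "integrable lborel (\<lambda>x :: real. inverse (1 + x\<^sup>2))"
    using integrable_inverse_1_plus_square by (simp add: set_integrable_def)
  then have i: "integrable lborel (\<lambda>z :: real \<times> real. inverse (1 + (fst z)\<^sup>2) * inverse (1 + (snd z)\<^sup>2))"
    using integrable_lborel_product(1) by blast
  show ?thesis
  proof (rule Bochner_Integration.integrable_bound[OF i])
    show "(\<lambda>z :: real \<times> real. 1 / (1 + (fst z)\<^sup>2 + (snd z)\<^sup>2)\<^sup>2) \<in> borel_measurable lborel"
    proof -
      have "1 + (fst z)\<^sup>2 + (snd z)\<^sup>2 \<noteq> 0" for z :: "real \<times> real"
        using zero_le_power2[of "fst z"] zero_le_power2[of "snd z"] by linarith
      then have "continuous_on UNIV (\<lambda>z :: real \<times> real. 1 / (1 + (fst z)\<^sup>2 + (snd z)\<^sup>2)\<^sup>2)"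
        by (intro continuous_intros) auto
      then show ?thesis using borel_measurable_continuous_onI by simp
    qed
    show "AE z :: real \<times> real in lborel. norm (1 / (1 + (fst z)\<^sup>2 + (snd z)\<^sup>2)\<^sup>2) \<le> norm (inverse (1 + (fst z)\<^sup>2) * inverse (1 + (snd z)\<^sup>2))"
    proof (rule AE_I2)
      fix z :: "real \<times> real"
      define p q where "p = (fst z)\<^sup>2" and "q = (snd z)\<^sup>2"
      have pq: "p \<ge> 0" "q \<ge> 0" by (simp_all add: p_def q_def)
      have "(1 + p) * (1 + q) \<le> (1 + p + q) * (1 + p + q)" using pq by (intro mult_mono) auto
      then have "1 / (1 + p + q)\<^sup>2 \<le> 1 / ((1 + p) * (1 + q))"
        using pq by (intro divide_left_mono) (auto simp: power2_eq_square add_nonneg_pos intro!: mult_pos_pos)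
      then show "norm (1 / (1 + (fst z)\<^sup>2 + (snd z)\<^sup>2)\<^sup>2) \<le> norm (inverse (1 + (fst z)\<^sup>2) * inverse (1 + (snd z)\<^sup>2))"
        unfolding p_def[symmetric] q_def[symmetric] using pq by (simp add: inverse_eq_divide)
    qed
  qed
qed

lemma lborel_integral_translate:
  fixes h :: "'a::euclidean_space \<Rightarrow> complex" assumes "h \<in> borel_measurable borel"
  shows "(LINT u|lborel. h (c + u)) = (LINT u|lborel. h u)"
proof -
  have "(LINT u|lborel. h u) = (LINT u|distr lborel borel ((+) c). h u)" unfolding lborel_distr_plus ..
  also have "\<dots> = (LINT u|lborel. h (c + u))" using assms by (subst integral_distr) auto
  finally show ?thesis ..
qed

lemma lborel_integral_reflect:
  fixes h :: "'a::euclidean_space \<Rightarrow> complex" assumes "h \<in> borel_measurable borel"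
  shows "(LINT u|lborel. h (- u)) = (LINT u|lborel. h u)"
proof -
  have "lborel = distr lborel borel (uminus :: 'a \<Rightarrow> 'a)"
    using lborel_affine[of "-1" "0::'a"] by (simp add: density_1)
  then have "(LINT u|lborel. h u) = (LINT u|distr lborel borel uminus. h u)" by simp
  also have "\<dots> = (LINT u|lborel. h (- u))" using assms by (subst integral_distr) auto
  finally show ?thesis ..
qed

definition smoothing_const :: real where
  "smoothing_const = (LINT u|lborel. 4 * ((fst u)\<^sup>2 + (snd u)\<^sup>2) * (1 + (fst u)\<^sup>2 + (snd u)\<^sup>2) * exp (- ((fst u)\<^sup>2 + (snd u)\<^sup>2)))"

lemma smoothing_integrable:
  "integrable lborel (\<lambda>u :: real \<times> real. 4 * ((fst u)\<^sup>2 + (snd u)\<^sup>2) * (1 + (fst u)\<^sup>2 + (snd u)\<^sup>2) * exp (- ((fst u)\<^sup>2 + (snd u)\<^sup>2)))"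
proof -
  have "gauss_poly (\<lambda>x \<xi>. (4 * complex_of_real (x\<^sup>2 + \<xi>\<^sup>2) * (1 + complex_of_real (x\<^sup>2 + \<xi>\<^sup>2))) * complex_of_real (exp (- 1 * (x\<^sup>2 + \<xi>\<^sup>2))))"
    by (rule gauss_poly_mult[OF poly_bdd_mult[OF poly_bdd_cmult[OF poly_bdd_radius] poly_bdd_add[OF poly_bdd_const poly_bdd_radius]] gauss_poly_gauss]) simp
  from integrable_Re[OF gauss_poly_integrable[OF this]] show ?thesis by (simp add: algebra_simps)
qed

text \<open>The 1 is the Husimi part. The remainder pairs the smoothing defect with the Wigner
  function: the integrals are the two squared norms in that pairing, and the factor collects 1/2
  from symmetrisation, 1/2 from the arithmetic-geometric mean and \<open>1 / pi\<close> from the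
  mass of the Gaussian.\<close>

definition weyl_const :: real where
  "weyl_const = 1 + smoothing_const / (4 * pi) * (1 / (2 * pi) + (LINT z|lborel. 1 / (1 + (fst z)\<^sup>2 + (snd z)\<^sup>2)\<^sup>2))"

lemma second_difference_symbol:
  fixes f :: "real \<Rightarrow> real \<Rightarrow> complex"
  assumes cont: "cplane fy" "cplane fxy" "cplane fyy"
    and d: "\<And>x y. ((\<lambda>t. f t y) has_vector_derivative fx x y) (at x)" "\<And>x y. ((\<lambda>t. f x t) has_vector_derivative fy x y) (at y)"
    and dfx: "\<And>x y. ((\<lambda>t. fx t y) has_vector_derivative fxx x y) (at x)" "\<And>x y. ((\<lambda>t. fx x t) has_vector_derivative fxy x y) (at y)"
    and dfy: "\<And>x y. ((\<lambda>t. fy t y) has_vector_derivative fyx x y) (at x)" "\<And>x y. ((\<lambda>t. fy x t) has_vector_derivative fyy x y) (at y)"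
    and b2: "\<And>x y. cmod (fxx x y) \<le> C / (1 + x\<^sup>2 + y\<^sup>2)" "\<And>x y. cmod (fxy x y) \<le> C / (1 + x\<^sup>2 + y\<^sup>2)"
      "\<And>x y. cmod (fyx x y) \<le> C / (1 + x\<^sup>2 + y\<^sup>2)" "\<And>x y. cmod (fyy x y) \<le> C / (1 + x\<^sup>2 + y\<^sup>2)"
  shows "cmod (2 * f x y - f (x + u) (y + v) - f (x - u) (y - v)) \<le> C * (4 * (u\<^sup>2 + v\<^sup>2) * (1 + u\<^sup>2 + v\<^sup>2)) / (1 + x\<^sup>2 + y\<^sup>2)"
proof -
  have C: "C \<ge> 0" using order_trans[OF norm_ge_zero b2(1)[of 0 0]] by simp
  define g where "g s = f (x + s * u) (y + s * v)" for s
  define g1 where "g1 s = complex_of_real u * fx (x + s * u) (y + s * v) + complex_of_real v * fy (x + s * u) (y + s * v)" for s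
  define g2 where "g2 s = complex_of_real u * (complex_of_real u * fxx (x + s * u) (y + s * v) + complex_of_real v * fxy (x + s * u) (y + s * v))
     + complex_of_real v * (complex_of_real u * fyx (x + s * u) (y + s * v) + complex_of_real v * fyy (x + s * u) (y + s * v))" for s
  have "cmod (2 * g 0 - g 1 - g (-1)) \<le> C * (4 * (u\<^sup>2 + v\<^sup>2) * (1 + u\<^sup>2 + v\<^sup>2)) / (1 + x\<^sup>2 + y\<^sup>2)"
  proof (rule second_difference_bound[of g g1 g2])
    show "(g has_vector_derivative g1 s) (at s)" for s unfolding g_def g1_def by (rule line_derivative[OF d cont(1)])
    show "(g1 has_vector_derivative g2 s) (at s)" for s unfolding g1_def g2_def
      by (intro has_vector_derivative_add has_vector_derivative_mult_right line_derivative[OF dfx cont(2)] line_derivative[OF dfy cont(3)])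
    fix s :: real assume s: "\<bar>s\<bar> \<le> 1"
    define w where "w = 1 + (x + s * u)\<^sup>2 + (y + s * v)\<^sup>2"
    have w: "w > 0" unfolding w_def by (simp add: add_pos_nonneg)
    have p: "cmod (complex_of_real u * A + complex_of_real v * B) \<le> \<bar>u\<bar> * c + \<bar>v\<bar> * d" if "cmod A \<le> c" "cmod B \<le> d" for A B c d
    proof -
      have "cmod (complex_of_real u * A + complex_of_real v * B) \<le> \<bar>u\<bar> * cmod A + \<bar>v\<bar> * cmod B"
        by (rule order_trans[OF norm_triangle_ineq]) (simp add: norm_mult)
      also have "\<dots> \<le> \<bar>u\<bar> * c + \<bar>v\<bar> * d" using that by (intro add_mono mult_left_mono) auto
      finally show ?thesis .
    qed
    have "cmod (g2 s) \<le> \<bar>u\<bar> * (\<bar>u\<bar> * (C / w) + \<bar>v\<bar> * (C / w)) + \<bar>v\<bar> * (\<bar>u\<bar> * (C / w) + \<bar>v\<bar> * (C / w))"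
      unfolding g2_def by (intro p b2[of "x + s * u" "y + s * v", folded w_def])
    also have "\<dots> = (\<bar>u\<bar> + \<bar>v\<bar>)\<^sup>2 * (C / w)" by (simp add: power2_eq_square algebra_simps)
    also have "\<dots> \<le> (2 * (u\<^sup>2 + v\<^sup>2)) * (C / w)"
    proof (rule mult_right_mono)
      show "(\<bar>u\<bar> + \<bar>v\<bar>)\<^sup>2 \<le> 2 * (u\<^sup>2 + v\<^sup>2)" using sum_squares_bound[of "\<bar>u\<bar>" "\<bar>v\<bar>"] by (simp add: power2_sum)
    qed (use C w in simp)
    also have "\<dots> = (2 * C * (u\<^sup>2 + v\<^sup>2)) * (1 / w)" by simp
    also have "\<dots> \<le> (2 * C * (u\<^sup>2 + v\<^sup>2)) * (2 * (1 + u\<^sup>2 + v\<^sup>2) / (1 + x\<^sup>2 + y\<^sup>2))"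
    proof (rule mult_left_mono)
      have "1 + x\<^sup>2 + y\<^sup>2 > 0" by (simp add: add_pos_nonneg)
      then show "1 / w \<le> 2 * (1 + u\<^sup>2 + v\<^sup>2) / (1 + x\<^sup>2 + y\<^sup>2)"
        using peetre[OF s, of x y u v] w unfolding w_def[symmetric] by (simp add: divide_le_eq le_divide_eq pos_le_divide_eq pos_divide_le_eq mult.commute)
    qed (use C in simp)
    also have "\<dots> = C * (4 * (u\<^sup>2 + v\<^sup>2) * (1 + u\<^sup>2 + v\<^sup>2)) / (1 + x\<^sup>2 + y\<^sup>2)" by (simp add: algebra_simps)
    finally show "cmod (g2 s) \<le> C * (4 * (u\<^sup>2 + v\<^sup>2) * (1 + u\<^sup>2 + v\<^sup>2)) / (1 + x\<^sup>2 + y\<^sup>2)" .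
  qed
  then show ?thesis by (simp add: g_def)
qed

text \<open>Averaging over \<open>u\<close> and \<open>-u\<close> with the even Gaussian leaves only
  second differences, hence a defect with a full power of the weight in the denominator. A first
  difference would gain half a power, whose square is not integrable over the plane.\<close>

lemma gauss_smoothing_defect:
  fixes f :: "real \<Rightarrow> real \<Rightarrow> complex"
  assumes cf: "cplane f" and b: "\<And>x y. cmod (f x y) \<le> C"
    and sd: "\<And>x y u v. cmod (2 * f x y - f (x + u) (y + v) - f (x - u) (y - v)) \<le> C * (4 * (u\<^sup>2 + v\<^sup>2) * (1 + u\<^sup>2 + v\<^sup>2)) / (1 + x\<^sup>2 + y\<^sup>2)"
  shows "cmod (complex_of_real pi * f x y - pint (\<lambda>a c. f a c * complex_of_real (exp (- ((a - x)\<^sup>2 + (c - y)\<^sup>2)))))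
     \<le> C * smoothing_const / 2 / (1 + x\<^sup>2 + y\<^sup>2)"
proof -
  have C: "C \<ge> 0" using order_trans[OF norm_ge_zero b] .
  define E where "E u = complex_of_real (exp (- ((fst u)\<^sup>2 + (snd u)\<^sup>2)))" for u :: "real \<times> real"
  define F where "F u = f (fst u) (snd u)" for u
  have mF: "F \<in> borel_measurable borel" unfolding F_def[abs_def] by (rule cplane_measurable[OF cf])
  have mE: "E \<in> borel_measurable borel" unfolding E_def[abs_def] by (intro borel_measurable_continuous_onI continuous_intros)
  have gE: "gauss_poly (\<lambda>x \<xi>. complex_of_real (exp (- 1 * (x\<^sup>2 + \<xi>\<^sup>2))))" by (rule gauss_poly_gauss) simp
  have iE: "integrable lborel E" using gauss_poly_integrable[OF gE] by (simp add: E_def[abs_def])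
  have intE: "(LINT u|lborel. E u) = complex_of_real pi"
    using integral_gauss_plane[of 1 0 0] by (simp add: pint_def E_def)
  have iH: "integrable lborel (\<lambda>u. H u * E u)" if "H \<in> borel_measurable borel" "\<And>u. cmod (H u) \<le> C" for H
  proof (rule Bochner_Integration.integrable_bound[OF integrable_mult_right[OF iE, of "complex_of_real C"]])
    show "(\<lambda>u. H u * E u) \<in> borel_measurable lborel" using that(1) mE by measurable
    show "AE u in lborel. norm (H u * E u) \<le> norm (complex_of_real C * E u)"
      using that(2) C by (intro AE_I2) (simp add: norm_mult mult_right_mono)
  qed
  let ?z = "(x, y)"
  have m1: "(\<lambda>u. F (?z + u)) \<in> borel_measurable borel" and m2: "(\<lambda>u. F (?z - u)) \<in> borel_measurable borel"
    using mF by measurable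
  have bF: "cmod (F u) \<le> C" for u unfolding F_def by (rule b)
  have Em: "E (- u) = E u" for u by (simp add: E_def)
  define S where "S = (LINT u|lborel. F (?z + u) * E u)"
  have S1: "pint (\<lambda>a c. f a c * complex_of_real (exp (- ((a - x)\<^sup>2 + (c - y)\<^sup>2)))) = S"
  proof -
    have "pint (\<lambda>a c. f a c * complex_of_real (exp (- ((a - x)\<^sup>2 + (c - y)\<^sup>2)))) = (LINT u|lborel. F u * E (u - ?z))"
      unfolding pint_def F_def E_def by simp
    also have "\<dots> = (LINT u|lborel. F (?z + u) * E (?z + u - ?z))"
      by (rule lborel_integral_translate[symmetric, where h = "\<lambda>u. F u * E (u - ?z)"]) (use mF mE in measurable)
    finally show ?thesis unfolding S_def by simp
  qed
  have S2: "(LINT u|lborel. F (?z - u) * E u) = S"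
  proof -
    have "(LINT u|lborel. F (?z + (- u)) * E (- u)) = (LINT u|lborel. F (?z + u) * E u)"
      by (rule lborel_integral_reflect[where h = "\<lambda>u. F (?z + u) * E u"]) (use m1 mE in measurable)
    then show ?thesis unfolding S_def by (simp add: Em)
  qed
  have "2 * (complex_of_real pi * F ?z - S) = (LINT u|lborel. (2 * F ?z) * E u - F (?z + u) * E u - F (?z - u) * E u)"
  proof -
    have "(LINT u|lborel. (2 * F ?z) * E u - F (?z + u) * E u - F (?z - u) * E u)
      = (2 * F ?z) * (LINT u|lborel. E u) - (LINT u|lborel. F (?z + u) * E u) - (LINT u|lborel. F (?z - u) * E u)"
      by (subst Bochner_Integration.integral_diff Bochner_Integration.integral_diff,
          (intro Bochner_Integration.integrable_diff integrable_mult_right iE iH m1 m2 bF)+)+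
         (simp add: Bochner_Integration.integral_diff iE iH m1 bF)
    then show ?thesis unfolding intE S2 S_def[symmetric] by (simp add: algebra_simps)
  qed
  also have "cmod \<dots> \<le> (LINT u|lborel. norm ((2 * F ?z) * E u - F (?z + u) * E u - F (?z - u) * E u))"
    by (rule Bochner_Integration.integral_norm_bound)
  also have "\<dots> \<le> (LINT u|lborel. C / (1 + x\<^sup>2 + y\<^sup>2) * (4 * ((fst u)\<^sup>2 + (snd u)\<^sup>2) * (1 + (fst u)\<^sup>2 + (snd u)\<^sup>2) * exp (- ((fst u)\<^sup>2 + (snd u)\<^sup>2))))"
  proof (rule integral_mono)
    show "integrable lborel (\<lambda>u. norm ((2 * F ?z) * E u - F (?z + u) * E u - F (?z - u) * E u))"
      by (intro integrable_norm Bochner_Integration.integrable_diff integrable_mult_right iE iH m1 m2 bF)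
    show "integrable lborel (\<lambda>u :: real \<times> real. C / (1 + x\<^sup>2 + y\<^sup>2) * (4 * ((fst u)\<^sup>2 + (snd u)\<^sup>2) * (1 + (fst u)\<^sup>2 + (snd u)\<^sup>2) * exp (- ((fst u)\<^sup>2 + (snd u)\<^sup>2))))"
      by (rule integrable_mult_right[OF smoothing_integrable])
    fix u :: "real \<times> real"
    have "(2 * F ?z) * E u - F (?z + u) * E u - F (?z - u) * E u = (2 * f x y - f (x + fst u) (y + snd u) - f (x - fst u) (y - snd u)) * E u"
      by (simp add: F_def algebra_simps)
    then have "norm ((2 * F ?z) * E u - F (?z + u) * E u - F (?z - u) * E u)
       = cmod (2 * f x y - f (x + fst u) (y + snd u) - f (x - fst u) (y - snd u)) * exp (- ((fst u)\<^sup>2 + (snd u)\<^sup>2))"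
      by (simp only: norm_mult E_def norm_of_real abs_exp_cancel)
    also have "\<dots> \<le> C * (4 * ((fst u)\<^sup>2 + (snd u)\<^sup>2) * (1 + (fst u)\<^sup>2 + (snd u)\<^sup>2)) / (1 + x\<^sup>2 + y\<^sup>2) * exp (- ((fst u)\<^sup>2 + (snd u)\<^sup>2))"
      by (intro mult_right_mono sd) simp
    finally show "norm ((2 * F ?z) * E u - F (?z + u) * E u - F (?z - u) * E u)
       \<le> C / (1 + x\<^sup>2 + y\<^sup>2) * (4 * ((fst u)\<^sup>2 + (snd u)\<^sup>2) * (1 + (fst u)\<^sup>2 + (snd u)\<^sup>2) * exp (- ((fst u)\<^sup>2 + (snd u)\<^sup>2)))" by simp
  qed
  also have "\<dots> = C / (1 + x\<^sup>2 + y\<^sup>2) * smoothing_const" unfolding smoothing_const_def by simp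
  finally have "cmod (2 * (complex_of_real pi * F ?z - S)) \<le> C / (1 + x\<^sup>2 + y\<^sup>2) * smoothing_const" .
  then have "2 * cmod (complex_of_real pi * F ?z - S) \<le> C / (1 + x\<^sup>2 + y\<^sup>2) * smoothing_const" by (simp only: norm_mult) simp
  moreover have "C / (1 + x\<^sup>2 + y\<^sup>2) * smoothing_const = 2 * (C * smoothing_const / 2 / (1 + x\<^sup>2 + y\<^sup>2))"
  proof -
    have "C / w * t = 2 * (C * t / 2 / w)" for w t :: real by simp
    then show ?thesis .
  qed
  ultimately have "cmod (complex_of_real pi * F ?z - S) \<le> C * smoothing_const / 2 / (1 + x\<^sup>2 + y\<^sup>2)" by linarith
  then show ?thesis unfolding S1 F_def by simp
qed

text \<open>The Gaussian smoothing of \<open>f\<close> pairs with the Wigner function through the Husimi function, whose \<open>L\<^sup>1\<close> norm is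
  at most one; the remainder is \<open>O((1 + x\<^sup>2 + \<xi>\<^sup>2)\<^bsup>-1\<^esup>)\<close>, hence in \<open>L\<^sup>2\<close> like the Wigner function itself.\<close>

lemma weyl_mat_bound:
  fixes f :: "real \<Rightarrow> real \<Rightarrow> complex"
  assumes cf: "cplane f" and b: "\<And>x y. cmod (f x y) \<le> C"
    and sd: "\<And>x y u v. cmod (2 * f x y - f (x + u) (y + v) - f (x - u) (y - v)) \<le> C * (4 * (u\<^sup>2 + v\<^sup>2) * (1 + u\<^sup>2 + v\<^sup>2)) / (1 + x\<^sup>2 + y\<^sup>2)"
  shows "cmod (weyl_mat f m n) \<le> weyl_const * C"
proof -
  have C: "C \<ge> 0" using order_trans[OF norm_ge_zero b] .
  have sc0: "smoothing_const \<ge> 0" unfolding smoothing_const_def by (intro integral_nonneg_AE AE_I2) auto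
  define W where "W z = wigner m n (fst z) (snd z)" for z
  define F where "F z = f (fst z) (snd z)" for z
  define G where "G z a = complex_of_real (exp (- ((fst z - fst a)\<^sup>2 + (snd z - snd a)\<^sup>2)))" for z a :: "real \<times> real"
  have iW: "integrable lborel W" unfolding W_def[abs_def] by (rule gauss_poly_integrable[OF gauss_poly_wigner])
  have [measurable]: "W \<in> borel_measurable borel" using iW by auto
  have [measurable]: "F \<in> borel_measurable borel" unfolding F_def[abs_def] by (rule cplane_measurable[OF cf])
  have bF: "cmod (F u) \<le> C" for u unfolding F_def by (rule b)
  have mG: "(\<lambda>z. G (fst z) (snd z)) \<in> borel_measurable borel"
    unfolding G_def by (intro borel_measurable_continuous_onI continuous_intros)
  have [measurable]: "(\<lambda>z. G (fst z) (snd z)) \<in> borel_measurable (lborel \<Otimes>\<^sub>M lborel)" using mG by (simp add: lborel_prod)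
  have Gs: "G z a = G a z" for z a by (simp add: G_def power2_commute)
  have gi: "pint (\<lambda>x \<xi>. complex_of_real (exp (- ((x - b)\<^sup>2 + (\<xi> - c)\<^sup>2)))) = complex_of_real pi" for b c
    using integral_gauss_plane[of 1 b c] by simp
  have iG: "integrable lborel (\<lambda>a. G z a)" for z
  \<comment> \<open>The integral of a non-integrable function is 0 by convention, whereas this one
    is known to be \<open>pi\<close>.\<close>
  proof (rule ccontr)
    assume "\<not> integrable lborel (\<lambda>a. G z a)"
    then have "(LINT a|lborel. G a z) = 0" unfolding Gs[of _ z] by (rule not_integrable_integral_eq)
    then show False using gi[of "fst z" "snd z"] unfolding pint_def G_def by simp
  qed
  have intG: "(LINT a|lborel. exp (- ((fst z - fst a)\<^sup>2 + (snd z - snd a)\<^sup>2))) = pi" for z :: "real \<times> real"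
  proof -
    have "complex_of_real (LINT a|lborel. exp (- ((fst z - fst a)\<^sup>2 + (snd z - snd a)\<^sup>2))) = complex_of_real pi"
      using gi[of "fst z" "snd z"] unfolding pint_def integral_complex_of_real[symmetric] by (simp add: power2_commute)
    then show ?thesis by (simp only: of_real_eq_iff)
  qed
  have nG: "cmod (G z a) = exp (- ((fst z - fst a)\<^sup>2 + (snd z - snd a)\<^sup>2))" for z a by (simp add: G_def)
  have iP: "integrable (lborel \<Otimes>\<^sub>M lborel) (\<lambda>(z, a). W z * (G z a * F a))"
  proof (rule Bochner_Integration.integrable_bound)
    show "integrable (lborel \<Otimes>\<^sub>M lborel) (\<lambda>(z, a). complex_of_real C * (W z * G z a))"
    proof (rule lborel_pair.Fubini_integrable)
      show "(\<lambda>(z, a). complex_of_real C * (W z * G z a)) \<in> borel_measurable (lborel \<Otimes>\<^sub>M lborel)"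
        by (simp add: case_prod_unfold) measurable
      have "(LINT a|lborel. norm (case (z, a) of (z, a) \<Rightarrow> complex_of_real C * (W z * G z a))) = C * pi * cmod (W z)" for z
        using C intG[of z] by (simp add: norm_mult nG mult.assoc)
      then show "integrable lborel (\<lambda>z. LINT a|lborel. norm (case (z, a) of (z, a) \<Rightarrow> complex_of_real C * (W z * G z a)))"
        using iW by simp
      show "AE z in lborel. integrable lborel (\<lambda>a. case (z, a) of (z, a) \<Rightarrow> complex_of_real C * (W z * G z a))"
        using iG by simp
    qed
    show "(\<lambda>(z, a). W z * (G z a * F a)) \<in> borel_measurable (lborel \<Otimes>\<^sub>M lborel)"
      by (simp add: case_prod_unfold) measurable
    show "AE p in lborel \<Otimes>\<^sub>M lborel. norm (case p of (z, a) \<Rightarrow> W z * (G z a * F a)) \<le> norm (case p of (z, a) \<Rightarrow> complex_of_real C * (W z * G z a))"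
    proof (rule AE_I2)
      fix p :: "(real \<times> real) \<times> (real \<times> real)"
      obtain z a where p: "p = (z, a)" by (cases p)
      have "cmod (F a) * (cmod (W z) * cmod (G z a)) \<le> C * (cmod (W z) * cmod (G z a))"
        by (intro mult_right_mono bF) auto
      then show "norm (case p of (z, a) \<Rightarrow> W z * (G z a * F a)) \<le> norm (case p of (z, a) \<Rightarrow> complex_of_real C * (W z * G z a))"
        unfolding p using C by (simp add: norm_mult ac_simps)
    qed
  qed
  define S where "S z = (LINT a|lborel. G z a * F a)" for z
  have "(LINT a|lborel. LINT z|lborel. W z * (G z a * F a)) = (LINT z|lborel. LINT a|lborel. W z * (G z a * F a))"
    by (rule lborel_pair.Fubini_integral[OF iP])
  moreover have "(LINT z|lborel. W z * (G z a * F a)) = complex_of_real pi * (F a * husimi m n (fst a) (snd a))" for a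
  proof -
    have "(LINT z|lborel. W z * (G z a * F a)) = (LINT z|lborel. F a * (G z a * W z))" by (simp add: ac_simps)
    also have "\<dots> = F a * (complex_of_real pi * husimi m n (fst a) (snd a))"
      unfolding husimi_def pint_def W_def G_def by simp
    finally show ?thesis by simp
  qed
  ultimately have swap: "complex_of_real pi * (LINT a|lborel. F a * husimi m n (fst a) (snd a)) = (LINT z|lborel. W z * S z)"
    unfolding S_def by simp
  have iWS: "integrable lborel (\<lambda>z. W z * S z)"
    using lborel_pair.integrable_fst[OF iP] unfolding S_def by simp
  have iWF: "integrable lborel (\<lambda>z. W z * (complex_of_real pi * F z))"
  proof (rule Bochner_Integration.integrable_bound[OF integrable_mult_right[OF iW, of "complex_of_real (C * pi)"]])
    show "AE z in lborel. norm (W z * (complex_of_real pi * F z)) \<le> norm (complex_of_real (C * pi) * W z)"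
    proof (rule AE_I2)
      fix z
      have "cmod (F z) * (pi * cmod (W z)) \<le> C * (pi * cmod (W z))" by (intro mult_right_mono bF) auto
      then show "norm (W z * (complex_of_real pi * F z)) \<le> norm (complex_of_real (C * pi) * W z)"
        using C by (simp add: norm_mult ac_simps)
    qed
  qed measurable
  have weyl: "weyl_mat f m n = (LINT z|lborel. F z * W z)" unfolding weyl_mat_def F_def W_def ..
  have "complex_of_real pi * weyl_mat f m n - complex_of_real pi * (LINT a|lborel. F a * husimi m n (fst a) (snd a))
     = (LINT z|lborel. W z * (complex_of_real pi * F z)) - (LINT z|lborel. W z * S z)"
  proof -
    have "complex_of_real pi * (LINT z|lborel. F z * W z) = (LINT z|lborel. W z * (complex_of_real pi * F z))"
      unfolding integral_mult_right_zero[symmetric] by (simp add: ac_simps)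
    then show ?thesis unfolding swap weyl by simp
  qed
  also have "\<dots> = (LINT z|lborel. W z * (complex_of_real pi * F z) - W z * S z)"
    by (rule Bochner_Integration.integral_diff[OF iWF iWS, symmetric])
  finally have diff: "complex_of_real pi * weyl_mat f m n - complex_of_real pi * (LINT a|lborel. F a * husimi m n (fst a) (snd a))
     = (LINT z|lborel. W z * (complex_of_real pi * F z) - W z * S z)" .
  have "p - q = r \<Longrightarrow> p = q + r" for p q r :: complex by (simp add: algebra_simps)
  note main = this[OF diff]
  let ?q = "\<lambda>a. (poisson_weight m (fst a) (snd a) + poisson_weight n (fst a) (snd a)) / 2"
  have iq: "integrable lborel ?q" by (intro integrable_divide_zero Bochner_Integration.integrable_add poisson_weight_integral)
  have t1: "cmod (LINT a|lborel. F a * husimi m n (fst a) (snd a)) \<le> C"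
  proof (cases "integrable lborel (\<lambda>a. F a * husimi m n (fst a) (snd a))")
    case True
    have "cmod (LINT a|lborel. F a * husimi m n (fst a) (snd a)) \<le> (LINT a|lborel. cmod (F a * husimi m n (fst a) (snd a)))"
      by (rule Bochner_Integration.integral_norm_bound)
    also have "\<dots> \<le> (LINT a|lborel. C * ?q a)"
    proof (rule integral_mono[OF integrable_norm[OF True] integrable_mult_right[OF iq]])
      show "cmod (F a * husimi m n (fst a) (snd a)) \<le> C * ?q a" for a
        unfolding norm_mult by (rule mult_mono[OF bF husimi_norm_le C norm_ge_zero])
    qed
    also have "\<dots> = C" using poisson_weight_integral by (simp add: Bochner_Integration.integral_add)
    finally show ?thesis .
  next
    case False
    then show ?thesis using C by (simp add: not_integrable_integral_eq)
  qed
  let ?J = "LINT z|lborel. 1 / (1 + (fst z)\<^sup>2 + (snd z)\<^sup>2)\<^sup>2"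
  have iW2: "integrable lborel (\<lambda>z. (cmod (W z))\<^sup>2)"
  proof (rule ccontr)
    assume "\<not> integrable lborel (\<lambda>z. (cmod (W z))\<^sup>2)"
    then have "(LINT z|lborel. (cmod (W z))\<^sup>2) = 0" by (rule not_integrable_integral_eq)
    then show False using wigner_L2[of m n] unfolding W_def by simp
  qed
  have t2: "cmod (LINT z|lborel. W z * (complex_of_real pi * F z) - W z * S z) \<le> C * smoothing_const / 4 * (1 / (2 * pi) + ?J)"
  proof -
    have "cmod (LINT z|lborel. W z * (complex_of_real pi * F z) - W z * S z) \<le> (LINT z|lborel. cmod (W z * (complex_of_real pi * F z) - W z * S z))"
      by (rule Bochner_Integration.integral_norm_bound)
    also have "\<dots> \<le> (LINT z|lborel. C * smoothing_const / 4 * ((cmod (W z))\<^sup>2 + 1 / (1 + (fst z)\<^sup>2 + (snd z)\<^sup>2)\<^sup>2))"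
    proof (rule integral_mono)
      show "integrable lborel (\<lambda>z. cmod (W z * (complex_of_real pi * F z) - W z * S z))"
        by (intro integrable_norm Bochner_Integration.integrable_diff iWF iWS)
      show "integrable lborel (\<lambda>z. C * smoothing_const / 4 * ((cmod (W z))\<^sup>2 + 1 / (1 + (fst z)\<^sup>2 + (snd z)\<^sup>2)\<^sup>2))"
        by (intro integrable_mult_right Bochner_Integration.integrable_add iW2 integrable_inverse_weight_sq)
      fix z :: "real \<times> real"
      define w where "w = 1 / (1 + (fst z)\<^sup>2 + (snd z)\<^sup>2)"
      have "S z = pint (\<lambda>a c. f a c * complex_of_real (exp (- ((a - fst z)\<^sup>2 + (c - snd z)\<^sup>2))))"
        unfolding S_def pint_def G_def F_def by (simp add: power2_commute mult.commute)
      then have "cmod (complex_of_real pi * F z - S z) \<le> C * smoothing_const / 2 * w"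
        using gauss_smoothing_defect[OF cf b sd, of "fst z" "snd z"] by (simp add: F_def w_def)
      then have "cmod (W z) * cmod (complex_of_real pi * F z - S z) \<le> cmod (W z) * (C * smoothing_const / 2 * w)"
        by (rule mult_left_mono) simp
      also have "\<dots> = C * smoothing_const / 2 * (cmod (W z) * w)" by simp
      \<comment> \<open>The arithmetic-geometric mean in place of Cauchy-Schwarz: only the squared
        norms of the Wigner function and of the inverse weight enter.\<close>
      also have "\<dots> \<le> C * smoothing_const / 2 * (((cmod (W z))\<^sup>2 + w\<^sup>2) / 2)"
        using C sc0 sum_squares_bound[of "cmod (W z)" w] by (intro mult_left_mono) auto
      finally show "cmod (W z * (complex_of_real pi * F z) - W z * S z) \<le> C * smoothing_const / 4 * ((cmod (W z))\<^sup>2 + 1 / (1 + (fst z)\<^sup>2 + (snd z)\<^sup>2)\<^sup>2)"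
        by (simp add: right_diff_distrib[symmetric] norm_mult w_def power_divide)
    qed
    also have "\<dots> = C * smoothing_const / 4 * ((LINT z|lborel. (cmod (W z))\<^sup>2) + ?J)"
      by (simp add: Bochner_Integration.integral_add iW2 integrable_inverse_weight_sq)
    also have "(LINT z|lborel. (cmod (W z))\<^sup>2) = 1 / (2 * pi)" unfolding W_def by (rule wigner_L2)
    finally show ?thesis .
  qed
  have "pi * cmod (weyl_mat f m n) = cmod (complex_of_real pi * weyl_mat f m n)" by (simp add: norm_mult)
  also have "\<dots> \<le> pi * C + C * smoothing_const / 4 * (1 / (2 * pi) + ?J)"
    unfolding main using t1 t2 by (intro order_trans[OF norm_triangle_ineq] add_mono) (auto simp: norm_mult)
  also have "\<dots> = pi * (weyl_const * C)" unfolding weyl_const_def by (simp add: field_simps)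
  finally show ?thesis by simp
qed

section \<open>Symbol classes and off-diagonal decay\<close>

text \<open>Symbols with \<open>M\<close> controlled derivatives and one constant for all of them;
  an order counts half powers of the weight, so each derivative lowers it by 1. The derivatives are
  quantified existentially, so membership is shown by exhibiting them, without computing iterated
  partial derivatives.\<close>

primrec symb :: "nat \<Rightarrow> real \<Rightarrow> real \<Rightarrow> (real \<Rightarrow> real \<Rightarrow> complex) \<Rightarrow> bool" where
  "symb 0 \<rho> C f \<longleftrightarrow> cplane f \<and> (\<forall>x y. cmod (f x y) \<le> C * (1 + x\<^sup>2 + y\<^sup>2) powr (\<rho> / 2))"
| "symb (Suc M) \<rho> C f \<longleftrightarrow> cplane f \<and> (\<forall>x y. cmod (f x y) \<le> C * (1 + x\<^sup>2 + y\<^sup>2) powr (\<rho> / 2)) \<and>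
     (\<exists>fx fy. (\<forall>x y. ((\<lambda>t. f t y) has_vector_derivative fx x y) (at x) \<and> ((\<lambda>t. f x t) has_vector_derivative fy x y) (at y)) \<and>
       symb M (\<rho> - 1) C fx \<and> symb M (\<rho> - 1) C fy)"

lemma symb_cplane: "symb M \<rho> C f \<Longrightarrow> cplane f" by (cases M) auto

lemma symb_bound: "symb M \<rho> C f \<Longrightarrow> cmod (f x y) \<le> C * (1 + x\<^sup>2 + y\<^sup>2) powr (\<rho> / 2)" by (cases M) auto

lemma symb_const_nonneg: assumes "symb M \<rho> C f" shows "C \<ge> 0"
  using order_trans[OF norm_ge_zero symb_bound[OF assms, of 0 0]] by simp

lemma symb_SucI:
  assumes "cplane f" "\<And>x y. cmod (f x y) \<le> C * (1 + x\<^sup>2 + y\<^sup>2) powr (\<rho> / 2)"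
    "\<And>x y. ((\<lambda>t. f t y) has_vector_derivative fx x y) (at x)" "\<And>x y. ((\<lambda>t. f x t) has_vector_derivative fy x y) (at y)"
    "symb M (\<rho> - 1) C fx" "symb M (\<rho> - 1) C fy"
  shows "symb (Suc M) \<rho> C f"
  unfolding symb.simps(2) using assms by blast

lemma symb_SucE:
  assumes "symb (Suc M) \<rho> C f"
  obtains fx fy where "\<And>x y. ((\<lambda>t. f t y) has_vector_derivative fx x y) (at x)" "\<And>x y. ((\<lambda>t. f x t) has_vector_derivative fy x y) (at y)"
    "symb M (\<rho> - 1) C fx" "symb M (\<rho> - 1) C fy"
  using assms unfolding symb.simps(2) by blast

lemma symb_Suc_D: "symb (Suc M) \<rho> C f \<Longrightarrow> symb M \<rho> C f"
proof (induction M arbitrary: \<rho> f)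
  case 0 then show ?case by simp
next
  case (Suc M)
  then obtain fx fy where f: "cplane f" "\<forall>x y. cmod (f x y) \<le> C * (1 + x\<^sup>2 + y\<^sup>2) powr (\<rho> / 2)"
    "\<forall>x y. ((\<lambda>t. f t y) has_vector_derivative fx x y) (at x) \<and> ((\<lambda>t. f x t) has_vector_derivative fy x y) (at y)"
    "symb (Suc M) (\<rho> - 1) C fx" "symb (Suc M) (\<rho> - 1) C fy" by (subst (asm) symb.simps(2)) blast
  show ?case unfolding symb.simps(2)[of M] using f(1-3) Suc.IH[OF f(4)] Suc.IH[OF f(5)] by blast
qed

lemma symb_mono:
  assumes "symb M \<rho> C f" "C \<le> D" "\<rho> \<le> \<sigma>" shows "symb M \<sigma> D f"
  using assms
proof (induction M arbitrary: \<rho> \<sigma> f)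
  case 0
  have "C * (1 + x\<^sup>2 + y\<^sup>2) powr (\<rho> / 2) \<le> D * (1 + x\<^sup>2 + y\<^sup>2) powr (\<sigma> / 2)" for x y :: real
    using 0 symb_const_nonneg[OF 0(1)] by (intro mult_mono powr_mono one_le_weight) auto
  then show ?case using 0 order_trans by (simp, blast)
next
  case (Suc M)
  have b: "C * (1 + x\<^sup>2 + y\<^sup>2) powr (\<rho> / 2) \<le> D * (1 + x\<^sup>2 + y\<^sup>2) powr (\<sigma> / 2)" for x y :: real
    using Suc.prems symb_const_nonneg[OF Suc.prems(1)] by (intro mult_mono powr_mono one_le_weight) auto
  obtain fx fy where f: "cplane f" "\<And>x y. cmod (f x y) \<le> C * (1 + x\<^sup>2 + y\<^sup>2) powr (\<rho> / 2)"
    "\<forall>x y. ((\<lambda>t. f t y) has_vector_derivative fx x y) (at x) \<and> ((\<lambda>t. f x t) has_vector_derivative fy x y) (at y)"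
    "symb M (\<rho> - 1) C fx" "symb M (\<rho> - 1) C fy" using Suc.prems(1) unfolding symb.simps(2) by blast
  have "symb M (\<sigma> - 1) D fx" "symb M (\<sigma> - 1) D fy" using Suc.IH[OF f(4)] Suc.IH[OF f(5)] Suc.prems by auto
  then show ?case unfolding symb.simps(2) using f(1,3) order_trans[OF f(2) b] by blast
qed

lemma symb_add:
  assumes "symb M \<rho> C f" "symb M \<rho> D g" shows "symb M \<rho> (C + D) (\<lambda>x y. f x y + g x y)"
  using assms
proof (induction M arbitrary: \<rho> f g)
  case 0
  then show ?case by (auto simp: distrib_right intro!: continuous_on_add order_trans[OF norm_triangle_ineq] add_mono)
next
  case (Suc M)
  obtain fx fy where f: "\<And>x y. ((\<lambda>t. f t y) has_vector_derivative fx x y) (at x)" "\<And>x y. ((\<lambda>t. f x t) has_vector_derivative fy x y) (at y)"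
    "symb M (\<rho> - 1) C fx" "symb M (\<rho> - 1) C fy" using Suc.prems(1) unfolding symb.simps(2) by blast
  obtain gx gy where g: "\<And>x y. ((\<lambda>t. g t y) has_vector_derivative gx x y) (at x)" "\<And>x y. ((\<lambda>t. g x t) has_vector_derivative gy x y) (at y)"
    "symb M (\<rho> - 1) D gx" "symb M (\<rho> - 1) D gy" using Suc.prems(2) unfolding symb.simps(2) by blast
  show ?case
  proof (rule symb_SucI[where fx = "\<lambda>x y. fx x y + gx x y" and fy = "\<lambda>x y. fy x y + gy x y"])
    show "cplane (\<lambda>x y. f x y + g x y)" by (intro continuous_on_add symb_cplane[OF Suc.prems(1)] symb_cplane[OF Suc.prems(2)])
    show "cmod (f x y + g x y) \<le> (C + D) * (1 + x\<^sup>2 + y\<^sup>2) powr (\<rho> / 2)" for x y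
      unfolding distrib_right by (intro order_trans[OF norm_triangle_ineq] add_mono symb_bound[OF Suc.prems(1)] symb_bound[OF Suc.prems(2)])
  qed (intro has_vector_derivative_add f g Suc.IH)+
qed

lemma symb_cmult:
  assumes "symb M \<rho> C f" shows "symb M \<rho> (cmod c * C) (\<lambda>x y. c * f x y)"
  using assms
proof (induction M arbitrary: \<rho> f)
  case 0
  then show ?case by (auto simp: norm_mult mult.assoc intro!: continuous_on_mult mult_left_mono)
next
  case (Suc M)
  obtain fx fy where f: "\<And>x y. ((\<lambda>t. f t y) has_vector_derivative fx x y) (at x)" "\<And>x y. ((\<lambda>t. f x t) has_vector_derivative fy x y) (at y)"
    "symb M (\<rho> - 1) C fx" "symb M (\<rho> - 1) C fy" using Suc.prems(1) unfolding symb.simps(2) by blast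
  show ?case
  proof (rule symb_SucI[where fx = "\<lambda>x y. c * fx x y" and fy = "\<lambda>x y. c * fy x y"])
    show "cplane (\<lambda>x y. c * f x y)" by (intro continuous_on_mult continuous_on_const symb_cplane[OF Suc.prems(1)])
    show "cmod (c * f x y) \<le> cmod c * C * (1 + x\<^sup>2 + y\<^sup>2) powr (\<rho> / 2)" for x y
      unfolding norm_mult mult.assoc by (intro mult_left_mono symb_bound[OF Suc.prems(1)]) simp
  qed (intro has_vector_derivative_mult_right f Suc.IH)+
qed

text \<open>By the Leibniz rule each derivative adds at most one undifferentiated term, so the
  constant grows linearly in \<open>M\<close>; the multiplier raises the order by one.\<close>

lemma symb_linear_mult:
  assumes "symb M \<rho> C f" and ab: "cmod a \<le> 1" "cmod b \<le> 1"
  shows "symb M (\<rho> + 1) (2 * (1 + real M) * C) (\<lambda>x y. (a * complex_of_real x + b * complex_of_real y) * f x y)"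
  using assms(1)
proof (induction M arbitrary: \<rho> f)
  let ?l = "\<lambda>x y. a * complex_of_real x + b * complex_of_real y"
  have cl: "cplane ?l" by (intro continuous_intros)
  have bl: "cmod (?l x y * z) \<le> 2 * C * (1 + x\<^sup>2 + y\<^sup>2) powr ((\<rho> + 1) / 2)" if z: "cmod z \<le> C * (1 + x\<^sup>2 + y\<^sup>2) powr (\<rho> / 2)" for x y z \<rho>
  proof -
    let ?w = "1 + x\<^sup>2 + y\<^sup>2"
    have w: "?w > 0" by (simp add: add_pos_nonneg)
    have "\<bar>x\<bar> \<le> sqrt ?w" "\<bar>y\<bar> \<le> sqrt ?w" by (simp_all add: real_le_rsqrt)
    moreover have "cmod (?l x y) \<le> 1 * \<bar>x\<bar> + 1 * \<bar>y\<bar>"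
      by (rule order_trans[OF norm_triangle_ineq], unfold norm_mult norm_of_real, intro add_mono mult_right_mono ab) auto
    ultimately have l: "cmod (?l x y) \<le> 2 * ?w powr (1/2)" using w by (simp add: powr_half_sqrt)
    have "cmod (?l x y * z) \<le> (2 * ?w powr (1/2)) * (C * ?w powr (\<rho> / 2))"
      unfolding norm_mult by (intro mult_mono l z) auto
    also have "\<dots> = 2 * C * (?w powr (1/2) * ?w powr (\<rho> / 2))" by simp
    also have "?w powr (1/2) * ?w powr (\<rho> / 2) = ?w powr ((\<rho> + 1) / 2)"
      unfolding powr_add[symmetric] by (simp add: add_divide_distrib add.commute)
    finally show ?thesis .
  qed
  {
    case 0
    then show ?case using bl by (simp add: continuous_on_mult cl)
  next
    case (Suc M)
    note C = symb_const_nonneg[OF Suc.prems]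
    obtain fx fy where f: "\<And>x y. ((\<lambda>t. f t y) has_vector_derivative fx x y) (at x)" "\<And>x y. ((\<lambda>t. f x t) has_vector_derivative fy x y) (at y)"
      "symb M (\<rho> - 1) C fx" "symb M (\<rho> - 1) C fy" using Suc.prems(1) unfolding symb.simps(2) by blast
    have s1: "symb M \<rho> (2 * (1 + real M) * C) (\<lambda>x y. ?l x y * fx x y)" using Suc.IH[OF f(3)] by simp
    have s2: "symb M \<rho> (2 * (1 + real M) * C) (\<lambda>x y. ?l x y * fy x y)" using Suc.IH[OF f(4)] by simp
    have s0: "symb M \<rho> (cmod c * C) (\<lambda>x y. c * f x y)" for c by (rule symb_cmult[OF symb_Suc_D[OF Suc.prems]])
    have dl: "(complex_of_real has_vector_derivative 1) (at t)" for t
    proof -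
      have "((\<lambda>x. x) has_vector_derivative (1::real)) (at t)" by (auto intro!: derivative_eq_intros)
      from bounded_linear.has_vector_derivative[OF bounded_linear_of_real this] show ?thesis by simp
    qed
    have Cle: "2 * (1 + real M) * C + cmod c * C \<le> 2 * (1 + real (Suc M)) * C" if "cmod c \<le> 1" for c
    proof -
      have "cmod c * C \<le> 1 * C" using that C by (intro mult_right_mono) auto
      then show ?thesis using C by (simp add: of_nat_Suc algebra_simps)
    qed
    show ?case
    proof (rule symb_SucI[where fx = "\<lambda>x y. ?l x y * fx x y + a * f x y" and fy = "\<lambda>x y. ?l x y * fy x y + b * f x y"])
      show "cplane (\<lambda>x y. ?l x y * f x y)" by (intro continuous_on_mult cl symb_cplane[OF Suc.prems(1)])
      show "cmod (?l x y * f x y) \<le> 2 * (1 + real (Suc M)) * C * (1 + x\<^sup>2 + y\<^sup>2) powr ((\<rho> + 1) / 2)" for x y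
      proof -
        have "cmod (?l x y * f x y) \<le> 2 * C * (1 + x\<^sup>2 + y\<^sup>2) powr ((\<rho> + 1) / 2)" by (rule bl[OF symb_bound[OF Suc.prems]])
        also have "\<dots> \<le> 2 * (1 + real (Suc M)) * C * (1 + x\<^sup>2 + y\<^sup>2) powr ((\<rho> + 1) / 2)"
          using C by (intro mult_right_mono) (auto simp: algebra_simps)
        finally show ?thesis .
      qed
      fix x y
      have "((\<lambda>t. ?l t y) has_vector_derivative a * 1 + 0) (at x)"
        by (intro has_vector_derivative_add has_vector_derivative_mult_right dl has_vector_derivative_const)
      then have "((\<lambda>t. ?l t y) has_vector_derivative a) (at x)" by simp
      then show "((\<lambda>t. ?l t y * f t y) has_vector_derivative ?l x y * fx x y + a * f x y) (at x)"
        by (intro has_vector_derivative_mult f)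
      have "((\<lambda>t. ?l x t) has_vector_derivative 0 + b * 1) (at y)"
        by (intro has_vector_derivative_add has_vector_derivative_mult_right dl has_vector_derivative_const)
      then have "((\<lambda>t. ?l x t) has_vector_derivative b) (at y)" by simp
      then show "((\<lambda>t. ?l x t * f x t) has_vector_derivative ?l x y * fy x y + b * f x y) (at y)"
        by (intro has_vector_derivative_mult f)
    next
      show "symb M (\<rho> + 1 - 1) (2 * (1 + real (Suc M)) * C) (\<lambda>x y. ?l x y * fx x y + a * f x y)"
        by (rule symb_mono[OF symb_add[OF s1 s0] Cle[OF ab(1)]]) simp
      show "symb M (\<rho> + 1 - 1) (2 * (1 + real (Suc M)) * C) (\<lambda>x y. ?l x y * fy x y + b * f x y)"
        by (rule symb_mono[OF symb_add[OF s2 s0] Cle[OF ab(2)]]) simp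
    qed
  }
qed

lemma symb_Complex_mult:
  assumes "symb M \<rho> C f"
  shows "symb M (\<rho> + 1) (2 * (1 + real M) * C) (\<lambda>x y. Complex x y * f x y)"
    and "symb M (\<rho> + 1) (2 * (1 + real M) * C) (\<lambda>x y. cnj (Complex x y) * f x y)"
proof -
  have "Complex x y = 1 * complex_of_real x + \<i> * complex_of_real y" "cnj (Complex x y) = 1 * complex_of_real x + (- \<i>) * complex_of_real y" for x y
    by (simp_all add: complex_eq_iff)
  then show "symb M (\<rho> + 1) (2 * (1 + real M) * C) (\<lambda>x y. Complex x y * f x y)"
    "symb M (\<rho> + 1) (2 * (1 + real M) * C) (\<lambda>x y. cnj (Complex x y) * f x y)"
    using symb_linear_mult[OF assms, of 1 \<i>] symb_linear_mult[OF assms, of 1 "- \<i>"] by (simp_all only: norm_one norm_ii norm_minus_cancel order_refl simp_thms)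
qed

lemma symb_poly_bdd: assumes "symb M \<rho> C f" "\<rho> \<le> 0" shows "poly_bdd f"
  unfolding poly_bdd_def
proof (intro conjI exI allI)
  show "cplane f" by (rule symb_cplane[OF assms(1)])
  show "cmod (f x y) \<le> C * (1 + x\<^sup>2 + y\<^sup>2) ^ 0" for x y
  proof -
    have "(1 + x\<^sup>2 + y\<^sup>2) powr (\<rho> / 2) \<le> (1 + x\<^sup>2 + y\<^sup>2) powr 0" using assms(2) by (intro powr_mono one_le_weight) auto
    also have "\<dots> \<le> 1" by simp
    finally have "C * (1 + x\<^sup>2 + y\<^sup>2) powr (\<rho> / 2) \<le> C * 1" using symb_const_nonneg[OF assms(1)] by (rule mult_left_mono)
    then show ?thesis using symb_bound[OF assms(1), of x y] by simp
  qed
qed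

section \<open>Ladder calculus on symbols: off-diagonal decay and the weighted commutator\<close>

lemma symb_wirt:
  assumes "symb (Suc M) \<rho> C f"
  obtains \<alpha> \<beta> where "wirt f \<alpha> \<beta>" "symb M (\<rho> - 1) (2 * C) \<alpha>" "symb M (\<rho> - 1) (2 * C) \<beta>"
proof -
  obtain fx fy where f: "\<And>x y. ((\<lambda>t. f t y) has_vector_derivative fx x y) (at x)" "\<And>x y. ((\<lambda>t. f x t) has_vector_derivative fy x y) (at y)"
    "symb M (\<rho> - 1) C fx" "symb M (\<rho> - 1) C fy" using assms unfolding symb.simps(2) by blast
  show ?thesis
  proof (rule that[of "\<lambda>x y. fx x y + \<i> * fy x y" "\<lambda>x y. fx x y + (- \<i>) * fy x y"])
    show "wirt f (\<lambda>x y. fx x y + \<i> * fy x y) (\<lambda>x y. fx x y + (- \<i>) * fy x y)"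
    proof -
      have e: "(a + \<i> * b + (a + (- \<i>) * b)) / 2 = a" "(a + \<i> * b - (a + (- \<i>) * b)) / (2 * \<i>) = b" for a b :: complex
        by (simp_all add: field_simps)
      show ?thesis unfolding wirt_def e using f by blast
    qed
    show "symb M (\<rho> - 1) (2 * C) (\<lambda>x y. fx x y + \<i> * fy x y)"
      using symb_add[OF f(3) symb_cmult[OF f(4), of \<i>]] by simp
    show "symb M (\<rho> - 1) (2 * C) (\<lambda>x y. fx x y + (- \<i>) * fy x y)"
      using symb_add[OF f(3) symb_cmult[OF f(4), of "- \<i>"]] by simp
  qed
qed

text \<open>The right side is
  \<open>-\<i>(x \<partial>\<^sub>\<xi> - \<xi> \<partial>\<^sub>x)\<close>, the generator of
  rotations of the phase plane, applied to the Wigner function. This is the action of the oscillator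
  flow, of which \<open>m - n\<close> is the weight.\<close>

lemma wigner_rot: "(of_nat m - of_nat n) * wigner m n x y = 1/2 * (Complex x y * wig\<beta> m n x y - cnj (Complex x y) * wig\<alpha> m n x y)"
proof -
  let ?W = "\<lambda>m n. wigner m n x y"
  define c d where "c = Complex x y" and "d = cnj (Complex x y)"
  have 1: "rt m * (2 * c * ?W (m - 1) n) = rt m * (rt n * ?W (m - 1) (n - 1) + rt m * ?W m n)"
    using wigner_z[of x y "m - 1" n] unfolding c_def by (cases m) simp_all
  have 2: "2 * c * ?W m (Suc n) = rt (Suc n) * ?W m n + rt (Suc m) * ?W (Suc m) (Suc n)"
    using wigner_z[of x y m "Suc n"] unfolding c_def by simp
  have 3: "rt n * (2 * d * ?W m (n - 1)) = rt n * (rt m * ?W (m - 1) (n - 1) + rt n * ?W m n)"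
    using wigner_zbar[of x y m "n - 1"] unfolding d_def by (cases n) simp_all
  have 4: "2 * d * ?W (Suc m) n = rt (Suc m) * ?W m n + rt (Suc n) * ?W (Suc m) (Suc n)"
    using wigner_zbar[of x y "Suc m" n] unfolding d_def by simp
  have "2 * (c * wig\<beta> m n x y - d * wig\<alpha> m n x y) = rt m * (2 * c * ?W (m - 1) n) - rt (Suc n) * (2 * c * ?W m (Suc n))
      - rt n * (2 * d * ?W m (n - 1)) + rt (Suc m) * (2 * d * ?W (Suc m) n)"
    unfolding wig\<alpha>_def wig\<beta>_def by (simp add: algebra_simps)
  also have "\<dots> = (rt m * rt m - rt (Suc n) * rt (Suc n) - rt n * rt n + rt (Suc m) * rt (Suc m)) * ?W m n"
    unfolding 1 2 3 4 by (simp add: algebra_simps)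
  also have "rt m * rt m - rt (Suc n) * rt (Suc n) - rt n * rt n + rt (Suc m) * rt (Suc m) = 4 * (of_nat m - of_nat n)"
    unfolding rt_sq by (simp add: of_nat_Suc algebra_simps)
  finally have "2 * (c * wig\<beta> m n x y - d * wig\<alpha> m n x y) = 4 * ((of_nat m - of_nat n) * ?W m n)" by (simp only: mult.assoc)
  moreover have "2 * p = 4 * q \<Longrightarrow> q = 1/2 * p" for p q :: complex by (simp add: field_simps)
  ultimately show ?thesis unfolding c_def d_def by blast
qed

text \<open>The commutator with the oscillator acts as the angular derivative of the symbol, which
  keeps order 0 and spends one derivative. In the integration by parts the two terms
  \<open>2 * f\<close> from the coordinate factors cancel.\<close>

lemma weyl_rot:
  assumes f: "symb (Suc M) 0 C f"
  obtains g where "symb M 0 (4 * (1 + real M) * C) g" "\<And>m n. (of_nat m - of_nat n) * weyl_mat f m n = weyl_mat g m n"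
proof -
  obtain \<alpha> \<beta> where w: "wirt f \<alpha> \<beta>" and sa: "symb M (0 - 1) (2 * C) \<alpha>" and sb: "symb M (0 - 1) (2 * C) \<beta>"
    using symb_wirt[OF f] by blast
  have pf: "poly_bdd f" "poly_bdd \<alpha>" "poly_bdd \<beta>" using symb_poly_bdd[OF f] symb_poly_bdd[OF sa] symb_poly_bdd[OF sb] by auto
  let ?z = "Complex" and ?zb = "\<lambda>x y. cnj (Complex x y)"
  let ?g = "\<lambda>x y. (1/2) * (?zb x y * \<alpha> x y + (-1) * (?z x y * \<beta> x y))"
  show ?thesis
  proof (rule that[of ?g])
    have "symb M (0 - 1 + 1) (2 * (1 + real M) * (2 * C) + cmod (-1) * (2 * (1 + real M) * (2 * C))) (\<lambda>x y. ?zb x y * \<alpha> x y + (-1) * (?z x y * \<beta> x y))"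
      by (intro symb_add symb_cmult symb_Complex_mult sa sb)
    from symb_cmult[OF this, of "1/2"] show "symb M 0 (4 * (1 + real M) * C) ?g"
      by (rule symb_mono) (simp_all add: algebra_simps)
    fix m n
    let ?W = "wigner m n"
    note g = gauss_poly_wigner gauss_poly_wig\<alpha> gauss_poly_wig\<beta>
    note gm = gauss_poly_mult
    have w1: "wirt (\<lambda>x y. ?z x y * f x y) (\<lambda>x y. ?z x y * \<alpha> x y + 0 * f x y) (\<lambda>x y. ?z x y * \<beta> x y + 2 * f x y)"
      by (rule wirt_mult[OF wirt_Complex w])
    have w2: "wirt (\<lambda>x y. ?zb x y * f x y) (\<lambda>x y. ?zb x y * \<alpha> x y + 2 * f x y) (\<lambda>x y. ?zb x y * \<beta> x y + 0 * f x y)"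
      by (rule wirt_mult[OF wirt_cnj_Complex w])
    have i1: "pint (\<lambda>x y. (?z x y * f x y) * wig\<beta> m n x y) = - pint (\<lambda>x y. (?z x y * \<beta> x y + 2 * f x y) * ?W x y)"
      by (rule pint_by_parts(2)[OF w1 _ _ _ wirt_wigner g]) (intro poly_bdd_add poly_bdd_mult poly_bdd_const poly_bdd_Complex pf)+
    have i2: "pint (\<lambda>x y. (?zb x y * f x y) * wig\<alpha> m n x y) = - pint (\<lambda>x y. (?zb x y * \<alpha> x y + 2 * f x y) * ?W x y)"
      by (rule pint_by_parts(1)[OF w2 _ _ _ wirt_wigner g]) (intro poly_bdd_add poly_bdd_mult poly_bdd_const poly_bdd_cnj_Complex pf)+
    have p1: "pint (\<lambda>x y. (?z x y * \<beta> x y + 2 * f x y) * ?W x y) = pint (\<lambda>x y. (?z x y * \<beta> x y) * ?W x y) + 2 * pint (\<lambda>x y. f x y * ?W x y)"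
      unfolding distrib_right mult.assoc[of 2] pint_cmult[symmetric]
      by (rule pint_add[OF gm[OF poly_bdd_mult[OF poly_bdd_Complex pf(3)] g(1)] gauss_poly_cmult[OF gm[OF pf(1) g(1)]]])
    have p2: "pint (\<lambda>x y. (?zb x y * \<alpha> x y + 2 * f x y) * ?W x y) = pint (\<lambda>x y. (?zb x y * \<alpha> x y) * ?W x y) + 2 * pint (\<lambda>x y. f x y * ?W x y)"
      unfolding distrib_right mult.assoc[of 2] pint_cmult[symmetric]
      by (rule pint_add[OF gm[OF poly_bdd_mult[OF poly_bdd_cnj_Complex pf(2)] g(1)] gauss_poly_cmult[OF gm[OF pf(1) g(1)]]])
    have "(of_nat m - of_nat n) * weyl_mat f m n = pint (\<lambda>x y. f x y * ((of_nat m - of_nat n) * ?W x y))"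
      unfolding weyl_mat_eq_pint pint_cmult[symmetric] by (simp only: mult.left_commute)
    also have "\<dots> = pint (\<lambda>x y. 1/2 * ((?z x y * f x y) * wig\<beta> m n x y - (?zb x y * f x y) * wig\<alpha> m n x y))"
      unfolding wigner_rot by (simp add: algebra_simps)
    also have "\<dots> = 1/2 * (pint (\<lambda>x y. (?z x y * f x y) * wig\<beta> m n x y) - pint (\<lambda>x y. (?zb x y * f x y) * wig\<alpha> m n x y))"
      unfolding pint_cmult
      by (subst pint_diff[OF gm[OF poly_bdd_mult[OF poly_bdd_Complex pf(1)] g(3)] gm[OF poly_bdd_mult[OF poly_bdd_cnj_Complex pf(1)] g(2)]]) (rule refl)
    also have "\<dots> = 1/2 * (pint (\<lambda>x y. (?zb x y * \<alpha> x y) * ?W x y) - pint (\<lambda>x y. (?z x y * \<beta> x y) * ?W x y))"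
      unfolding i1 i2 p1 p2 by simp
    also have "\<dots> = pint (\<lambda>x y. 1/2 * ((?zb x y * \<alpha> x y) * ?W x y - (?z x y * \<beta> x y) * ?W x y))"
      unfolding pint_cmult
      by (subst pint_diff[OF gm[OF poly_bdd_mult[OF poly_bdd_cnj_Complex pf(2)] g(1)] gm[OF poly_bdd_mult[OF poly_bdd_Complex pf(3)] g(1)]]) (rule refl)
    also have "\<dots> = weyl_mat ?g m n" unfolding weyl_mat_eq_pint by (simp add: algebra_simps)
    finally show "(of_nat m - of_nat n) * weyl_mat f m n = weyl_mat ?g m n" .
  qed
qed

declare symb.simps [simp del]

lemma symb_le: "symb M \<rho> C f \<Longrightarrow> N \<le> M \<Longrightarrow> symb N \<rho> C f"
proof (induction M)
  case 0 then show ?case by simp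
next
  case (Suc M) then show ?case using symb_Suc_D le_Suc_eq by metis
qed

lemma weyl_symb_bound:
  assumes s: "symb 2 0 C f" shows "cmod (weyl_mat f m n) \<le> weyl_const * C"
proof -
  have s': "symb (Suc (Suc 0)) 0 C f" using s by (simp only: numeral_2_eq_2)
  obtain fx fy where f: "\<And>x y. ((\<lambda>t. f t y) has_vector_derivative fx x y) (at x)" "\<And>x y. ((\<lambda>t. f x t) has_vector_derivative fy x y) (at y)"
    "symb (Suc 0) (0 - 1) C fx" "symb (Suc 0) (0 - 1) C fy" using symb_SucE[OF s'] by blast
  obtain fxx fxy where x: "\<And>x y. ((\<lambda>t. fx t y) has_vector_derivative fxx x y) (at x)" "\<And>x y. ((\<lambda>t. fx x t) has_vector_derivative fxy x y) (at y)"
    "symb 0 (0 - 1 - 1) C fxx" "symb 0 (0 - 1 - 1) C fxy" using symb_SucE[OF f(3)] by blast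
  obtain fyx fyy where y: "\<And>x y. ((\<lambda>t. fy t y) has_vector_derivative fyx x y) (at x)" "\<And>x y. ((\<lambda>t. fy x t) has_vector_derivative fyy x y) (at y)"
    "symb 0 (0 - 1 - 1) C fyx" "symb 0 (0 - 1 - 1) C fyy" using symb_SucE[OF f(4)] by blast
  have b: "cmod (g x y) \<le> C / (1 + x\<^sup>2 + y\<^sup>2)" if "symb 0 (0 - 1 - 1) C g" for g x y
  proof -
    have "(1 + x\<^sup>2 + y\<^sup>2) powr ((0 - 1 - 1) / 2) = 1 / (1 + x\<^sup>2 + y\<^sup>2)"
      using one_le_weight[of x y] by (simp add: powr_minus_divide)
    then show ?thesis using symb_bound[OF that, of x y] by simp
  qed
  show ?thesis
  proof (rule weyl_mat_bound[OF symb_cplane[OF s]])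
    show "cmod (f x y) \<le> C" for x y using symb_bound[OF s, of x y] one_le_weight[of x y] by simp
    show "cmod (2 * f x y - f (x + u) (y + v) - f (x - u) (y - v)) \<le> C * (4 * (u\<^sup>2 + v\<^sup>2) * (1 + u\<^sup>2 + v\<^sup>2)) / (1 + x\<^sup>2 + y\<^sup>2)" for x y u v
      by (rule second_difference_symbol[OF symb_cplane[OF f(4)] symb_cplane[OF x(4)] symb_cplane[OF y(4)] f(1,2) x(1,2) y(1,2) b[OF x(3)] b[OF x(4)] b[OF y(3)] b[OF y(4)]])
  qed
qed

text \<open>Each factor \<open>m - n\<close> is traded for one derivative of the symbol; the last
  two derivatives are those of \<open>weyl_symb_bound\<close>. The constant is common to all
  symbols, so smallness of \<open>C\<close> is inherited.\<close>

lemma weyl_decay_power: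
  "\<exists>\<kappa>\<ge>0. \<forall>f C m n. symb (K + 2) 0 C f \<longrightarrow> \<bar>real m - real n\<bar> ^ K * cmod (weyl_mat f m n) \<le> \<kappa> * C"
proof (induction K)
  case 0
  have "cmod (weyl_mat f m n) \<le> \<bar>weyl_const\<bar> * C" if "symb 2 0 C f" for f C m n
    by (rule order_trans[OF weyl_symb_bound[OF that]], intro mult_right_mono symb_const_nonneg[OF that]) simp
  then show ?case by (intro exI[of _ "\<bar>weyl_const\<bar>"]) (simp add: numeral_2_eq_2)
next
  case (Suc K)
  obtain \<kappa> where k0: "\<kappa> \<ge> 0 \<and> (\<forall>f C m n. symb (K + 2) 0 C f \<longrightarrow> \<bar>real m - real n\<bar> ^ K * cmod (weyl_mat f m n) \<le> \<kappa> * C)"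
    by (rule exE[OF Suc.IH])
  note k = k0[THEN conjunct1] k0[THEN conjunct2, rule_format]
  have "\<bar>real m - real n\<bar> ^ Suc K * cmod (weyl_mat f m n) \<le> (\<kappa> * (4 * (1 + real (K + 2)))) * C" if "symb (Suc K + 2) 0 C f" for f C m n
  proof -
    have "symb (Suc (K + 2)) 0 C f" using that by simp
    then obtain g where g: "symb (K + 2) 0 (4 * (1 + real (K + 2)) * C) g" "\<And>m n. (of_nat m - of_nat n) * weyl_mat f m n = weyl_mat g m n"
      using weyl_rot by blast
    have d: "\<bar>real m - real n\<bar> * cmod (weyl_mat f m n) = cmod (weyl_mat g m n)"
      unfolding g(2)[symmetric] norm_mult using norm_of_real[of "real m - real n", where 'a = complex] by simp
    have "\<bar>real m - real n\<bar> ^ Suc K * cmod (weyl_mat f m n) = \<bar>real m - real n\<bar> ^ K * cmod (weyl_mat g m n)"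
      unfolding d[symmetric] by simp
    also have "\<dots> \<le> \<kappa> * (4 * (1 + real (K + 2)) * C)" by (rule k(2)[OF g(1)])
    finally show ?thesis by (simp only: mult.assoc)
  qed
  then show ?case using k(1) by (intro exI[of _ "\<kappa> * (4 * (1 + real (K + 2)))"]) auto
qed

lemma weyl_decay:
  obtains \<kappa> where "\<kappa> \<ge> 0" "\<And>f C m n. symb (K + 2) 0 C f \<Longrightarrow> cmod (weyl_mat f m n) \<le> \<kappa> * C / (1 + \<bar>real m - real n\<bar>) ^ K"
proof -
  obtain p where p: "p \<ge> 0" "\<And>f C m n. symb (K + 2) 0 C f \<Longrightarrow> \<bar>real m - real n\<bar> ^ K * cmod (weyl_mat f m n) \<le> p * C"
    using weyl_decay_power[of K] by blast
  obtain q where q: "q \<ge> 0" "\<And>f C m n. symb (0 + 2) 0 C f \<Longrightarrow> \<bar>real m - real n\<bar> ^ 0 * cmod (weyl_mat f m n) \<le> q * C"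
    using weyl_decay_power[of 0] by blast
  show ?thesis
  proof (rule that[of "2 ^ K * (q + p)"])
    show "2 ^ K * (q + p) \<ge> 0" using p q by simp
    fix f C and m n :: nat assume s: "symb (K + 2) 0 C f"
    let ?d = "\<bar>real m - real n\<bar>" and ?w = "cmod (weyl_mat f m n)"
    \<comment> \<open>Near the diagonal the case \<open>K = 0\<close> is used, away from it the
      \<open>K\<close>-th power; the maximum is bounded by their sum.\<close>
    have "1 + d \<le> 2 * max 1 d" for d :: real by (simp add: max_def)
    then have "1 + ?d \<le> 2 * max 1 ?d" .
    then have "(1 + ?d) ^ K \<le> (2 * max 1 ?d) ^ K" by (intro power_mono) auto
    also have "\<dots> \<le> 2 ^ K * (1 + ?d ^ K)" unfolding power_mult_distrib by (intro mult_left_mono) (auto simp: max_def)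
    finally have "(1 + ?d) ^ K * ?w \<le> 2 ^ K * (1 + ?d ^ K) * ?w" by (intro mult_right_mono) auto
    also have "\<dots> = 2 ^ K * (?w + ?d ^ K * ?w)" by (simp add: algebra_simps)
    also have "\<dots> \<le> 2 ^ K * (q * C + p * C)"
      using q(2)[OF symb_le[OF s], of m n] p(2)[OF s, of m n] by (intro mult_left_mono add_mono) auto
    finally have "?w * (1 + ?d) ^ K \<le> 2 ^ K * (q + p) * C" by (simp only: mult.commute[of ?w] mult.assoc distrib_right)
    then show "?w \<le> 2 ^ K * (q + p) * C / (1 + ?d) ^ K" by (subst pos_le_divide_eq) auto
  qed
qed

text \<open>The difference in brackets is a commutator with the lowering operator, hence the matrix
  of a first derivative, of order -1. The factor \<open>rt (Suc m)\<close> is absorbed by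
  \<open>wigner_lower\<close> as a coordinate and one more derivative, which brings the order back
  to 0 after two derivatives in all.\<close>

lemma weyl_commutator:
  assumes s: "symb (Suc (Suc M)) 0 C f"
  obtains c where "symb M 0 ((4 * (2 + real M) + 2) * C) c"
    "\<And>m n. rt (Suc m) * (rt n * weyl_mat f m (n - 1) - rt (Suc m) * weyl_mat f (Suc m) n) = - weyl_mat c (Suc m) n"
proof -
  obtain b b' where w: "wirt f b b'" and sb: "symb (Suc M) (0 - 1) (2 * C) b" and sb': "symb (Suc M) (0 - 1) (2 * C) b'"
    using symb_wirt[OF s] by blast
  obtain a e where wb: "wirt b a e" and sa: "symb M (0 - 1 - 1) (2 * (2 * C)) a" and se: "symb M (0 - 1 - 1) (2 * (2 * C)) e"
    using symb_wirt[OF sb] by blast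
  have pb: "poly_bdd f" "poly_bdd b" "poly_bdd b'" "poly_bdd a" "poly_bdd e"
    using symb_poly_bdd[OF s] symb_poly_bdd[OF sb] symb_poly_bdd[OF sb'] symb_poly_bdd[OF sa] symb_poly_bdd[OF se] by auto
  let ?zb = "\<lambda>x y. cnj (Complex x y)"
  let ?c = "\<lambda>x y. ?zb x y * b x y + (- 1/2) * e x y"
  show ?thesis
  proof (rule that[of ?c])
    have C: "C \<ge> 0" by (rule symb_const_nonneg[OF s])
    have "symb M 0 (2 * (1 + real (Suc M)) * (2 * C)) (\<lambda>x y. ?zb x y * b x y)"
      using symb_Suc_D[OF symb_Complex_mult(2)[OF sb]] by simp
    moreover have "symb M 0 (2 * C) (\<lambda>x y. (- 1/2) * e x y)"
      by (rule symb_mono[OF symb_cmult[OF se]]) simp_all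
    ultimately have "symb M 0 (2 * (1 + real (Suc M)) * (2 * C) + 2 * C) ?c" by (rule symb_add)
    then show "symb M 0 ((4 * (2 + real M) + 2) * C) ?c" by (rule symb_mono) (simp_all add: of_nat_Suc algebra_simps)
    fix m n
    note g = gauss_poly_wigner gauss_poly_wig\<alpha> gauss_poly_wig\<beta>
    note gm = gauss_poly_mult
    let ?W = "wigner (Suc m) n"
    have fW: "gauss_poly (\<lambda>x y. k * (f x y * wigner i j x y))" for k i j by (rule gauss_poly_cmult[OF gm[OF pb(1) g(1)]])
    have "rt n * weyl_mat f m (n - 1) - rt (Suc m) * weyl_mat f (Suc m) n = pint (\<lambda>x y. f x y * wig\<alpha> m n x y)"
      unfolding weyl_mat_eq_pint pint_cmult[symmetric] wig\<alpha>_def pint_diff[OF fW fW, symmetric] by (simp add: algebra_simps)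
    also have "\<dots> = - pint (\<lambda>x y. b x y * wigner m n x y)"
      by (rule pint_by_parts(1)[OF w pb(1-3) wirt_wigner g])
    finally have 1: "rt n * weyl_mat f m (n - 1) - rt (Suc m) * weyl_mat f (Suc m) n = - pint (\<lambda>x y. b x y * wigner m n x y)" .
    have "rt (Suc m) * pint (\<lambda>x y. b x y * wigner m n x y) = pint (\<lambda>x y. b x y * (rt (Suc m) * wigner m n x y))"
      unfolding pint_cmult[symmetric] by (simp only: mult.left_commute)
    also have "\<dots> = pint (\<lambda>x y. (?zb x y * b x y) * ?W x y + 1/2 * (b x y * wig\<beta> (Suc m) n x y))"
      unfolding wigner_lower by (simp add: algebra_simps)
    also have "\<dots> = pint (\<lambda>x y. (?zb x y * b x y) * ?W x y) + 1/2 * pint (\<lambda>x y. b x y * wig\<beta> (Suc m) n x y)"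
      unfolding pint_cmult[symmetric]
      by (rule pint_add[OF gm[OF poly_bdd_mult[OF poly_bdd_cnj_Complex pb(2)] g(1)] gauss_poly_cmult[OF gm[OF pb(2) g(3)]]])
    also have "pint (\<lambda>x y. b x y * wig\<beta> (Suc m) n x y) = - pint (\<lambda>x y. e x y * ?W x y)"
      by (rule pint_by_parts(2)[OF wb pb(2,4,5) wirt_wigner g])
    also have "pint (\<lambda>x y. (?zb x y * b x y) * ?W x y) + 1/2 * (- pint (\<lambda>x y. e x y * ?W x y))
        = pint (\<lambda>x y. (?zb x y * b x y) * ?W x y) + pint (\<lambda>x y. (- 1/2) * (e x y * ?W x y))" unfolding pint_cmult by simp
    also have "\<dots> = pint (\<lambda>x y. (?zb x y * b x y) * ?W x y + (- 1/2) * (e x y * ?W x y))"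
      by (rule pint_add[OF gm[OF poly_bdd_mult[OF poly_bdd_cnj_Complex pb(2)] g(1)] gauss_poly_cmult[OF gm[OF pb(5) g(1)]], symmetric])
    also have "\<dots> = weyl_mat ?c (Suc m) n" unfolding weyl_mat_eq_pint by (simp only: distrib_right mult.assoc)
    finally show "rt (Suc m) * (rt n * weyl_mat f m (n - 1) - rt (Suc m) * weyl_mat f (Suc m) n) = - weyl_mat ?c (Suc m) n"
      unfolding 1 by simp
  qed
qed

text \<open>The geometric mean lies between its arguments. Needed because ladder operators carry
  square roots whereas \<open>wshift\<close> has integer-spaced weights.\<close>

lemma geometric_mean_distance:
  fixes p m :: real assumes "p \<ge> 0" "m \<ge> 0" shows "\<bar>m - sqrt (p * m)\<bar> \<le> \<bar>m - p\<bar>"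
proof (cases "p \<le> m")
  case True
  have "sqrt (p * p) \<le> sqrt (p * m)" "sqrt (p * m) \<le> sqrt (m * m)"
    unfolding real_sqrt_le_iff using True assms by (simp_all add: mult_left_mono mult_right_mono)
  then show ?thesis using assms True by simp
next
  case False
  have "sqrt (p * m) \<le> sqrt (p * p)" "sqrt (m * m) \<le> sqrt (p * m)"
    unfolding real_sqrt_le_iff using False assms by (simp_all add: mult_left_mono mult_right_mono)
  then show ?thesis using assms False by simp
qed

text \<open>The ladder commutator controls the expression in which the weight \<open>m + 1/2\<close>
  is replaced by \<open>sqrt ((n + 1) m)\<close>. The two differ by at most one plus the distance to
  the diagonal, which one more power of off-diagonal decay pays for. Six derivatives: two for
  \<open>weyl_commutator\<close>, then four for quadratic decay of the symbol it yields.\<close>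

lemma weighted_commutator_bound:
  obtains \<kappa> where "\<kappa> \<ge> 0" "\<And>f C n m. symb 6 0 C f \<Longrightarrow>
    cmod ((if m = 0 then 0 else weyl_mat f n (m - 1) * complex_of_real (real m + 1/2)) - complex_of_real (real n + 3/2) * weyl_mat f (Suc n) m)
      \<le> \<kappa> * C / (1 + \<bar>real n - real m\<bar>)\<^sup>2"
proof -
  obtain p where p: "p \<ge> 0" "\<And>f C m n. symb (2 + 2) 0 C f \<Longrightarrow> cmod (weyl_mat f m n) \<le> p * C / (1 + \<bar>real m - real n\<bar>) ^ 2"
    using weyl_decay[of 2] by blast
  obtain q where q: "q \<ge> 0" "\<And>f C m n. symb (3 + 2) 0 C f \<Longrightarrow> cmod (weyl_mat f m n) \<le> q * C / (1 + \<bar>real m - real n\<bar>) ^ 3"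
    using weyl_decay[of 3] by blast
  show ?thesis
  proof (rule that[of "4 * (26 * p + q + p)"])
    show "4 * (26 * p + q + p) \<ge> 0" using p q by simp
    fix f C n m assume s: "symb 6 0 C f"
    have C: "C \<ge> 0" by (rule symb_const_nonneg[OF s])
    have "symb (Suc (Suc 4)) 0 C f" using s by simp
    then obtain c where c: "symb 4 0 ((4 * (2 + real 4) + 2) * C) c"
      "\<And>m n. rt (Suc m) * (rt n * weyl_mat f m (n - 1) - rt (Suc m) * weyl_mat f (Suc m) n) = - weyl_mat c (Suc m) n"
      using weyl_commutator by blast
    let ?d = "\<bar>real (Suc n) - real m\<bar>" and ?D = "\<bar>real n - real m\<bar>"
    let ?w1 = "weyl_mat f n (m - 1)" and ?w2 = "weyl_mat f (Suc n) m"
    let ?s = "sqrt (real (Suc n) * real m)"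
    let ?L = "(if m = 0 then 0 else ?w1 * complex_of_real (real m + 1/2)) - complex_of_real (real n + 3/2) * ?w2"
    let ?R = "(if m = 0 then 0 else complex_of_real (real m + 1/2 - ?s) * ?w1)"
    have rr: "rt (Suc n) * rt m = 2 * complex_of_real ?s" proof -
      have "sqrt (2 * real (Suc n)) * sqrt (2 * real m) = sqrt (2 * 2) * ?s" unfolding real_sqrt_mult[symmetric] by (simp add: mult_ac)
      then show ?thesis unfolding of_real_mult[symmetric] by simp
    qed
    have "- weyl_mat c (Suc n) m = (rt (Suc n) * rt m) * ?w1 - (rt (Suc n) * rt (Suc n)) * ?w2"
      unfolding c(2)[symmetric] by (simp only: right_diff_distrib mult.assoc)
    also have "\<dots> = 2 * complex_of_real ?s * ?w1 - 2 * of_nat (Suc n) * ?w2" unfolding rr rt_sq ..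
    finally have E: "- weyl_mat c (Suc n) m = 2 * complex_of_real ?s * ?w1 - 2 * of_nat (Suc n) * ?w2" .
    \<comment> \<open>The exact ladder part, the error of replacing the geometric mean by
      \<open>m + 1/2\<close>, and the offset between \<open>n + 3/2\<close> and
      \<open>n + 1\<close>.\<close>
    have L: "?L = 1/2 * (- weyl_mat c (Suc n) m) + ?R - 1/2 * ?w2"
    proof -
      have "complex_of_real (real n + 3/2) = of_nat (Suc n) + 1/2" by (simp add: of_nat_Suc)
      then show ?thesis unfolding E by (cases "m = 0") (simp_all add: algebra_simps)
    qed
    have b1: "cmod (1/2 * (- weyl_mat c (Suc n) m)) \<le> 26 * p * C / (1 + ?d)\<^sup>2"
    proof -
      have "cmod (weyl_mat c (Suc n) m) \<le> p * ((4 * (2 + real 4) + 2) * C) / (1 + ?d)\<^sup>2" using p(2)[of _ c "Suc n" m] c(1) by simp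
      also have "\<dots> = 26 * p * C / (1 + ?d)\<^sup>2" by simp
      finally have "cmod (weyl_mat c (Suc n) m) \<le> 26 * p * C / (1 + ?d)\<^sup>2" .
      moreover have "cmod (1/2 * (- weyl_mat c (Suc n) m)) \<le> cmod (weyl_mat c (Suc n) m)" by (simp add: norm_mult norm_divide)
      ultimately show ?thesis by linarith
    qed
    have b3: "cmod (1/2 * ?w2) \<le> p * C / (1 + ?d)\<^sup>2"
    proof -
      have "symb (2 + 2) 0 C f" by (rule symb_le[OF s]) simp
      then have "cmod ?w2 \<le> p * C / (1 + ?d)\<^sup>2" using p(2) by blast
      moreover have "cmod (1/2 * ?w2) \<le> cmod ?w2" by (simp add: norm_mult norm_divide)
      ultimately show ?thesis by linarith
    qed
    have b2: "cmod ?R \<le> q * C / (1 + ?d)\<^sup>2"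
    proof (cases "m = 0")
      case True then show ?thesis using q(1) C by simp
    next
      case False
      have d: "\<bar>real n - real (m - 1)\<bar> = ?d" using False by (simp add: of_nat_diff of_nat_Suc)
      have "symb (3 + 2) 0 C f" by (rule symb_le[OF s]) simp
      then have w1: "cmod ?w1 \<le> q * C / (1 + ?d) ^ 3" using q(2)[of C f n "m - 1"] unfolding d by blast
      have "\<bar>real m - ?s\<bar> \<le> \<bar>real m - real (Suc n)\<bar>" by (rule geometric_mean_distance) auto
      then have "\<bar>real m + 1/2 - ?s\<bar> \<le> 1 + ?d" by linarith
      then have "cmod ?R \<le> (1 + ?d) * (q * C / (1 + ?d) ^ 3)" using False w1
        unfolding if_not_P[OF False] norm_mult norm_of_real by (intro mult_mono) auto
      also have "\<dots> = q * C / (1 + ?d)\<^sup>2" by (simp add: power3_eq_cube power2_eq_square)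
      finally show ?thesis .
    qed
    have "cmod ?L \<le> cmod (1/2 * (- weyl_mat c (Suc n) m)) + cmod ?R + cmod (1/2 * ?w2)"
      unfolding L by (intro order_trans[OF norm_triangle_ineq4] add_mono norm_triangle_ineq order_refl)
    also have "\<dots> \<le> 26 * p * C / (1 + ?d)\<^sup>2 + q * C / (1 + ?d)\<^sup>2 + p * C / (1 + ?d)\<^sup>2" by (intro add_mono b1 b2 b3)
    also have "\<dots> = (26 * p + q + p) * C / (1 + ?d)\<^sup>2" by (simp add: add_divide_distrib distrib_right)
    also have "\<dots> \<le> 4 * (26 * p + q + p) * C / (1 + ?D)\<^sup>2"
    proof -
      \<comment> \<open>The entries above decay in the distance from row \<open>Suc n\<close>;
        returning to row \<open>n\<close> at most doubles the weight, hence the factor 4.\<close>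
      have "1 + \<bar>a - b\<bar> \<le> 2 * (1 + \<bar>1 + a - b\<bar>)" for a b :: real
      proof -
        have "\<bar>a - b\<bar> \<le> \<bar>1 + a - b\<bar> + 1" using abs_triangle_ineq[of "1 + a - b" "-1"] by simp
        also have "\<dots> \<le> \<bar>1 + a - b\<bar> + 1 + \<bar>1 + a - b\<bar>" by simp
        finally show ?thesis by simp
      qed
      then have "1 + ?D \<le> 2 * (1 + ?d)" unfolding of_nat_Suc .
      then have "(1 + ?D)\<^sup>2 \<le> (2 * (1 + ?d))\<^sup>2" by (intro power_mono) auto
      then have "(1 + ?D)\<^sup>2 \<le> 4 * (1 + ?d)\<^sup>2" by (simp only: power_mult_distrib) simp
      then have "1 / (1 + ?d)\<^sup>2 \<le> 4 / (1 + ?D)\<^sup>2"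
        by (subst frac_le_eq) (auto simp: add_pos_nonneg zero_less_mult_iff divide_le_0_iff)
      then have "(26 * p + q + p) * C * (1 / (1 + ?d)\<^sup>2) \<le> (26 * p + q + p) * C * (4 / (1 + ?D)\<^sup>2)"
        using p q C by (intro mult_left_mono) auto
      then show ?thesis by (simp add: mult_ac)
    qed
    finally show "cmod ?L \<le> 4 * (26 * p + q + p) * C / (1 + ?D)\<^sup>2" .
  qed
qed

section \<open>Seminorms and time dependence of the given symbol\<close>

lemma weight_nonzero: "1 + x\<^sup>2 + (y::real)\<^sup>2 \<noteq> 0"
  using one_le_weight[of x y] by linarith

lemma pd_bdd_above:
  assumes "smooth_periodic_S0 w"
  obtains C where "\<And>t x y. cmod (pd 0 a b w t x y) * (1 + x\<^sup>2 + y\<^sup>2) powr (real (a + b) / 2) \<le> C"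
proof -
  obtain C where C: "\<And>t x y. cmod (pd 0 a b w t x y) \<le> C * (1 + x\<^sup>2 + y\<^sup>2) powr (- real (a + b) / 2)"
    using assms unfolding smooth_periodic_S0_def by blast
  show ?thesis
  proof (rule that[of C])
    fix t x y
    have p: "(1 + x\<^sup>2 + y\<^sup>2) powr (- real (a + b) / 2) * (1 + x\<^sup>2 + y\<^sup>2) powr (real (a + b) / 2) = 1"
      unfolding powr_add[symmetric] minus_divide_left[symmetric] using weight_nonzero[of x y] by simp
    have "cmod (pd 0 a b w t x y) * (1 + x\<^sup>2 + y\<^sup>2) powr (real (a + b) / 2)
        \<le> (C * (1 + x\<^sup>2 + y\<^sup>2) powr (- real (a + b) / 2)) * (1 + x\<^sup>2 + y\<^sup>2) powr (real (a + b) / 2)"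
      by (intro mult_right_mono C) simp
    then show "cmod (pd 0 a b w t x y) * (1 + x\<^sup>2 + y\<^sup>2) powr (real (a + b) / 2) \<le> C" unfolding mult.assoc p by simp
  qed
qed

lemma finite_pairs_sum_le: "finite {(a, b). a + b \<le> (j :: nat)}"
  by (rule finite_subset[of _ "{..j} \<times> {..j}"]) auto

text \<open>A real supremum is meaningful only for a set bounded above, which membership in the
  symbol class guarantees; nonnegativity then lets one summand be bounded by the whole sum.\<close>

lemma wp0_bound:
  assumes w: "smooth_periodic_S0 w" and ab: "a + b \<le> j"
  shows "cmod (pd 0 a b w t x y) \<le> wp0 j w t * (1 + x\<^sup>2 + y\<^sup>2) powr (- real (a + b) / 2)"
proof -
  define F where "F a b z = cmod (pd 0 a b w t (fst z) (snd z)) * (1 + (fst z)\<^sup>2 + (snd z)\<^sup>2) powr (real (a + b) / 2)" for a b and z :: "real \<times> real"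
  have bd: "bdd_above (range (F a b))" for a b
  proof -
    obtain C where "\<And>t x y. cmod (pd 0 a b w t x y) * (1 + x\<^sup>2 + y\<^sup>2) powr (real (a + b) / 2) \<le> C" using pd_bdd_above[OF w] by blast
    then show ?thesis unfolding F_def by (intro bdd_aboveI[of _ C]) auto
  qed
  have "F a b (x, y) \<le> (SUP z. F a b z)" by (rule cSUP_upper[OF _ bd]) simp
  also have "\<dots> \<le> (\<Sum>(a, b) \<in> {(a, b). a + b \<le> j}. SUP z. F a b z)"
  proof -
    have nn: "0 \<le> (SUP z. F a b z)" for a b
      by (rule order_trans[OF _ cSUP_upper[OF UNIV_I bd, where x = "(0,0)"]]) (simp add: F_def)
    show ?thesis
      using member_le_sum[of "(a, b)" "{(a, b). a + b \<le> j}" "\<lambda>(a, b). SUP z. F a b z"] ab nn finite_pairs_sum_le by auto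
  qed
  also have "\<dots> = wp0 j w t" unfolding wp0_def F_def ..
  finally have "cmod (pd 0 a b w t x y) * (1 + x\<^sup>2 + y\<^sup>2) powr (real (a + b) / 2) \<le> wp0 j w t" by (simp add: F_def)
  then have "cmod (pd 0 a b w t x y) * (1 + x\<^sup>2 + y\<^sup>2) powr (real (a + b) / 2) * (1 + x\<^sup>2 + y\<^sup>2) powr (- real (a + b) / 2)
      \<le> wp0 j w t * (1 + x\<^sup>2 + y\<^sup>2) powr (- real (a + b) / 2)" by (intro mult_right_mono) auto
  moreover have "(1 + x\<^sup>2 + y\<^sup>2) powr (real (a + b) / 2) * (1 + x\<^sup>2 + y\<^sup>2) powr (- real (a + b) / 2) = 1"
    unfolding powr_add[symmetric] minus_divide_left[symmetric] using weight_nonzero[of x y] by simp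
  ultimately show ?thesis unfolding mult.assoc by simp
qed

text \<open>Smallness is assumed for one seminorm, but off-diagonal decay of every order calls on
  all of them; these are bounded uniformly in time without being small.\<close>

lemma wp0_uniform_bound:
  assumes w: "smooth_periodic_S0 w" obtains C where "\<And>t. wp0 j w t \<le> C"
proof -
  have "\<exists>C. \<forall>t. (SUP z :: real \<times> real. cmod (pd 0 a b w t (fst z) (snd z)) * (1 + (fst z)\<^sup>2 + (snd z)\<^sup>2) powr (real (a + b) / 2)) \<le> C" for a b
  proof -
    obtain C where C: "\<And>t x y. cmod (pd 0 a b w t x y) * (1 + x\<^sup>2 + y\<^sup>2) powr (real (a + b) / 2) \<le> C" using pd_bdd_above[OF w] by blast
    show ?thesis by (intro exI[of _ C] allI cSUP_least C) simp
  qed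
  then have "\<forall>a b. \<exists>C. \<forall>t. (SUP z :: real \<times> real. cmod (pd 0 a b w t (fst z) (snd z)) * (1 + (fst z)\<^sup>2 + (snd z)\<^sup>2) powr (real (a + b) / 2)) \<le> C" by simp
  from this[unfolded choice_iff] obtain C
    where C: "\<forall>a b t. (SUP z :: real \<times> real. cmod (pd 0 a b w t (fst z) (snd z)) * (1 + (fst z)\<^sup>2 + (snd z)\<^sup>2) powr (real (a + b) / 2)) \<le> C a b"
    by (rule exE)
  show ?thesis
  proof (rule that)
    show "wp0 j w t \<le> (\<Sum>(a, b) \<in> {(a, b). a + b \<le> j}. C a b)" for t
      unfolding wp0_def using C by (intro sum_mono) auto
  qed
qed

lemma symb_pd:
  assumes w: "smooth_periodic_S0 w" and "a + b + M \<le> j"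
  shows "symb M (- real (a + b)) (wp0 j w t) (pd 0 a b w t)"
  using assms(2)
proof (induction M arbitrary: a b)
  have cont: "cplane (pd 0 a b w t)" for a b
  proof -
    have "continuous_on UNIV (\<lambda>(t, x, \<xi>). pd 0 a b w t x \<xi>)" using w unfolding smooth_periodic_S0_def smooth3_def by blast
    from continuous_on_compose2[OF this, of UNIV "\<lambda>z. (t, fst z, snd z)"] show ?thesis by (simp add: continuous_intros case_prod_beta)
  qed
  {
    case 0
    then show ?case using cont wp0_bound[OF w, of a b j t] by (simp add: symb.simps)
  next
    case (Suc M)
    have d: "((\<lambda>y. pd 0 a b w t y \<xi>) has_vector_derivative pd 0 (Suc a) b w t x \<xi>) (at x)"
      "((\<lambda>\<eta>. pd 0 a b w t x \<eta>) has_vector_derivative pd 0 a (Suc b) w t x \<xi>) (at \<xi>)" for x \<xi>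
      using w unfolding smooth_periodic_S0_def smooth3_def by blast+
    have e: "- real (Suc a + b) = - real (a + b) - 1" "- real (a + Suc b) = - real (a + b) - 1" by (simp_all add: of_nat_Suc)
    show ?case
    proof (rule symb_SucI[OF cont _ d])
      show "cmod (pd 0 a b w t x y) \<le> wp0 j w t * (1 + x\<^sup>2 + y\<^sup>2) powr (- real (a + b) / 2)" for x y
        by (rule wp0_bound[OF w]) (use Suc.prems in simp)
      show "symb M (- real (a + b) - 1) (wp0 j w t) (pd 0 (Suc a) b w t)" using Suc.IH[of "Suc a" b] Suc.prems unfolding e by simp
      show "symb M (- real (a + b) - 1) (wp0 j w t) (pd 0 a (Suc b) w t)" using Suc.IH[of a "Suc b"] Suc.prems unfolding e by simp
    qed
  }
qed

lemma symb_slice: assumes "smooth_periodic_S0 w" shows "symb M 0 (wp0 M w t) (w t)"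
  using symb_pd[OF assms, of 0 0 M M t] by (simp add: pd_def)

text \<open>Dominated convergence with a multiple of the Wigner function as majorant; the continuity
  feeds the Dyson series.\<close>

lemma continuous_weyl_mat:
  assumes w: "smooth_periodic_S0 w" shows "continuous_on UNIV (\<lambda>t. weyl_mat (w t) m n)"
proof -
  have "continuous_on UNIV (\<lambda>(t, x, \<xi>). pd 0 0 0 w t x \<xi>)" using w unfolding smooth_periodic_S0_def smooth3_def by blast
  then have c: "continuous_on UNIV (\<lambda>(t, x, \<xi>). w t x \<xi>)" by (simp add: pd_def)
  obtain C where C: "\<And>t. wp0 0 w t \<le> C" using wp0_uniform_bound[OF w] by blast
  have b: "cmod (w t x y) \<le> C" for t x y
    using symb_bound[OF symb_slice[OF w, of 0 t], of x y] C[of t] one_le_weight[of x y] by simp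
  have "(\<lambda>k. weyl_mat (w (s k)) m n) \<longlonglongrightarrow> weyl_mat (w t) m n" if s: "s \<longlonglongrightarrow> t" for s t
    unfolding weyl_mat_def
  proof (rule integral_dominated_convergence[where w = "\<lambda>z. C * cmod (wigner m n (fst z) (snd z))"])
    note iW = gauss_poly_integrable[OF gauss_poly_wigner[of m n]]
    have mw: "(\<lambda>z. w t (fst z) (snd z)) \<in> borel_measurable borel" for t by (rule cplane_measurable[OF symb_cplane[OF symb_slice[OF w]]])
    have mW: "(\<lambda>z. wigner m n (fst z) (snd z)) \<in> borel_measurable borel" using iW by auto
    show "(\<lambda>z. w t (fst z) (snd z) * wigner m n (fst z) (snd z)) \<in> borel_measurable lborel" using mw mW by (simp add: borel_measurable_times)
    show "(\<lambda>z. w (s k) (fst z) (snd z) * wigner m n (fst z) (snd z)) \<in> borel_measurable lborel" for k using mw mW by (simp add: borel_measurable_times)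
    show "integrable lborel (\<lambda>z. C * cmod (wigner m n (fst z) (snd z)))" using iW by auto
    show "AE z in lborel. (\<lambda>k. w (s k) (fst z) (snd z) * wigner m n (fst z) (snd z)) \<longlonglongrightarrow> w t (fst z) (snd z) * wigner m n (fst z) (snd z)"
    proof (intro AE_I2 tendsto_mult tendsto_const)
      fix z :: "real \<times> real"
      have "continuous_on UNIV (\<lambda>t. w t (fst z) (snd z))"
        using continuous_on_compose2[OF c, of UNIV "\<lambda>t. (t, fst z, snd z)"] by (simp add: continuous_intros case_prod_beta)
      then have "isCont (\<lambda>t. w t (fst z) (snd z)) t" by (simp add: continuous_on_eq_continuous_at)
      from isCont_tendsto_compose[OF this s] show "(\<lambda>k. w (s k) (fst z) (snd z)) \<longlonglongrightarrow> w t (fst z) (snd z)" .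
    qed
    show "AE z in lborel. cmod (w (s k) (fst z) (snd z) * wigner m n (fst z) (snd z)) \<le> C * cmod (wigner m n (fst z) (snd z))" for k
      unfolding norm_mult by (intro AE_I2 mult_right_mono b) auto
  qed
  then show ?thesis by (auto simp: continuous_on_eq_continuous_at continuous_at_sequentially o_def)
qed

section \<open>Hermite series\<close>

text \<open>A pointwise sum. For absolutely summable coefficients it converges almost everywhere, so
  the value taken where it diverges has no effect on any integral.\<close>

definition hseries :: "(nat \<Rightarrow> complex) \<Rightarrow> real \<Rightarrow> complex" where
  "hseries c x = (\<Sum>n. c n * complex_of_real (hfun n x))"

lemma hseries_measurable [measurable]: "hseries c \<in> borel_measurable borel"
  unfolding hseries_def[abs_def] by measurable

text \<open>Each squared Hermite function has integral 1, so the weighted series of squares has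
  integral equal to the sum of \<open>|c\<^sub>n|\<close> and is finite almost everywhere. Absolute
  convergence follows from \<open>|h| \<le> 1 + h\<^sup>2\<close>.\<close>

lemma AE_summable_hfun:
  assumes c: "summable (\<lambda>n. cmod (c n))"
  shows "AE x in lborel. summable (\<lambda>n. cmod (c n) * (hfun n x)\<^sup>2)"
    and "AE x in lborel. summable (\<lambda>n. cmod (c n) * \<bar>hfun n x\<bar>)"
proof -
  have 1: "(\<integral>\<^sup>+ x. ennreal (cmod (c n) * (hfun n x)\<^sup>2) \<partial>lborel) = ennreal (cmod (c n))" for n
  proof -
    have i: "integrable lborel (\<lambda>x. (hfun n x)\<^sup>2)" using integrable_hfun_product[of n n] by (simp add: power2_eq_square)
    have "(LINT x|lborel. cmod (c n) * (hfun n x)\<^sup>2) = cmod (c n)" using hfun_orthonormal[of n n] by (simp add: power2_eq_square)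
    moreover have "(\<integral>\<^sup>+ x. ennreal (cmod (c n) * (hfun n x)\<^sup>2) \<partial>lborel) = ennreal (LINT x|lborel. cmod (c n) * (hfun n x)\<^sup>2)"
      by (rule nn_integral_eq_integral) (use i in auto)
    ultimately show ?thesis by simp
  qed
  have "(\<integral>\<^sup>+ x. (\<Sum>n. ennreal (cmod (c n) * (hfun n x)\<^sup>2)) \<partial>lborel) = (\<Sum>n. ennreal (cmod (c n)))"
    by (subst nn_integral_suminf) (auto simp: 1)
  also have "\<dots> = ennreal (\<Sum>n. cmod (c n))" by (rule suminf_ennreal2) (use c in auto)
  finally have "(\<integral>\<^sup>+ x. (\<Sum>n. ennreal (cmod (c n) * (hfun n x)\<^sup>2)) \<partial>lborel) \<noteq> \<infinity>" by simp
  then have "AE x in lborel. (\<Sum>n. ennreal (cmod (c n) * (hfun n x)\<^sup>2)) \<noteq> \<infinity>"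
    by (intro nn_integral_PInf_AE) auto
  then show 2: "AE x in lborel. summable (\<lambda>n. cmod (c n) * (hfun n x)\<^sup>2)"
    by eventually_elim (rule summable_suminf_not_top, auto)
  show "AE x in lborel. summable (\<lambda>n. cmod (c n) * \<bar>hfun n x\<bar>)"
    using 2
  proof eventually_elim
    case s: (elim x)
    have le: "\<bar>h\<bar> \<le> 1 + h\<^sup>2" for h :: real using sum_squares_bound[of "\<bar>h\<bar>" 1] abs_ge_zero[of h] by simp
    have "norm (cmod (c n) * \<bar>hfun n x\<bar>) \<le> cmod (c n) + cmod (c n) * (hfun n x)\<^sup>2" for n
      using mult_left_mono[OF le[of "hfun n x"] norm_ge_zero[of "c n"]] by (simp add: algebra_simps)
    then show "summable (\<lambda>n. cmod (c n) * \<bar>hfun n x\<bar>)"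
      by (intro summable_comparison_test'[OF summable_add[OF c s], of 0]) auto
  qed
qed

lemma suminf_weighted_square_le:
  fixes a h :: "nat \<Rightarrow> real"
  assumes a: "\<And>n. a n \<ge> 0" "summable a" and s: "summable (\<lambda>n. a n * (h n)\<^sup>2)" "summable (\<lambda>n. a n * \<bar>h n\<bar>)"
  shows "(\<Sum>n. a n * \<bar>h n\<bar>)\<^sup>2 \<le> (\<Sum>n. a n) * (\<Sum>n. a n * (h n)\<^sup>2)"
proof -
  define S F G where "S = (\<Sum>n. a n)" and "F = (\<Sum>n. a n * \<bar>h n\<bar>)" and "G = (\<Sum>n. a n * (h n)\<^sup>2)"
  show ?thesis
  proof (cases "S = 0")
    case True
    then have "a n = 0" for n using suminf_eq_zero_iff[OF a(2,1)] unfolding S_def by auto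
    then show ?thesis by simp
  next
    case False
    then have S: "S > 0" using suminf_nonneg[OF a(2,1)] unfolding S_def by simp
    have "2 * S * F * (a n * \<bar>h n\<bar>) \<le> S\<^sup>2 * (a n * (h n)\<^sup>2) + F\<^sup>2 * a n" for n
    proof -
      have "2 * (S * \<bar>h n\<bar>) * F \<le> (S * \<bar>h n\<bar>)\<^sup>2 + F\<^sup>2" by (rule sum_squares_bound)
      from mult_left_mono[OF this a(1)[of n]] show ?thesis by (simp add: power_mult_distrib algebra_simps)
    qed
    then have "(\<Sum>n. 2 * S * F * (a n * \<bar>h n\<bar>)) \<le> (\<Sum>n. S\<^sup>2 * (a n * (h n)\<^sup>2) + F\<^sup>2 * a n)"
      by (rule suminf_le) (intro summable_add summable_mult s a)+
    also have "\<dots> = S\<^sup>2 * G + F\<^sup>2 * S" unfolding S_def G_def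
      by (subst suminf_add[symmetric]) (auto intro!: summable_mult s a simp: suminf_mult[OF s(1)] suminf_mult[OF a(2)])
    also have "(\<Sum>n. 2 * S * F * (a n * \<bar>h n\<bar>)) = 2 * S * F * F" unfolding F_def by (rule suminf_mult[OF s(2)])
    finally have "S * (F\<^sup>2) \<le> S * (S * G)" by (simp add: power2_eq_square algebra_simps)
    then show ?thesis using S unfolding S_def F_def G_def by simp
  qed
qed

lemma hseries_pointwise_bound:
  assumes c: "summable (\<lambda>n. cmod (c n))"
  shows "AE x in lborel. (cmod (hseries c x))\<^sup>2 \<le> (\<Sum>n. cmod (c n)) * (\<Sum>n. cmod (c n) * (hfun n x)\<^sup>2)"
  using AE_summable_hfun[OF c]
proof (eventually_elim)
  case (elim x)
  have "cmod (hseries c x) \<le> (\<Sum>n. cmod (c n) * \<bar>hfun n x\<bar>)"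
    unfolding hseries_def using summable_norm[of "\<lambda>n. c n * complex_of_real (hfun n x)"] elim(2) by (simp add: norm_mult)
  then have "(cmod (hseries c x))\<^sup>2 \<le> (\<Sum>n. cmod (c n) * \<bar>hfun n x\<bar>)\<^sup>2" by (rule power_mono) simp
  also have "\<dots> \<le> (\<Sum>n. cmod (c n)) * (\<Sum>n. cmod (c n) * (hfun n x)\<^sup>2)"
    by (rule suminf_weighted_square_le[OF _ c elim]) simp
  finally show ?case .
qed

lemma integrable_suminf_hfun_sq:
  assumes c: "summable (\<lambda>n. cmod (c n))"
  shows "integrable lborel (\<lambda>x. \<Sum>n. cmod (c n) * (hfun n x)\<^sup>2)"
    and "(LINT x|lborel. (\<Sum>n. cmod (c n) * (hfun n x)\<^sup>2)) = (\<Sum>n. cmod (c n))"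
proof -
  have i: "integrable lborel (\<lambda>x. cmod (c n) * (hfun n x)\<^sup>2)" for n using integrable_hfun_product[of n n] by (simp add: power2_eq_square)
  have v: "(LINT x|lborel. cmod (c n) * (hfun n x)\<^sup>2) = cmod (c n)" for n using hfun_orthonormal[of n n] by (simp add: power2_eq_square)
  have s: "AE x in lborel. summable (\<lambda>n. norm (cmod (c n) * (hfun n x)\<^sup>2))" using AE_summable_hfun(1)[OF c] by simp
  have t: "summable (\<lambda>n. LINT x|lborel. norm (cmod (c n) * (hfun n x)\<^sup>2))" using c by (simp only: real_norm_def abs_mult abs_norm_cancel abs_power2 v)
  show "integrable lborel (\<lambda>x. \<Sum>n. cmod (c n) * (hfun n x)\<^sup>2)" by (rule integrable_suminf[OF i s t])
  show "(LINT x|lborel. (\<Sum>n. cmod (c n) * (hfun n x)\<^sup>2)) = (\<Sum>n. cmod (c n))"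
    by (subst integral_suminf[OF i s t]) (simp only: v)
qed

text \<open>Cauchy-Schwarz with weights \<open>|c\<^sub>n|\<close> bounds the L2 norm by the l1 norm
  of the coefficients. For rapidly decreasing coefficients this replaces Parseval's identity and
  completeness.\<close>

lemma hseries_L2:
  assumes c: "summable (\<lambda>n. cmod (c n))"
  shows "is_L2 (hseries c)" and "(LINT x|lborel. (cmod (hseries c x))\<^sup>2) \<le> (\<Sum>n. cmod (c n))\<^sup>2"
proof -
  let ?g = "\<lambda>x. (\<Sum>n. cmod (c n)) * (\<Sum>n. cmod (c n) * (hfun n x)\<^sup>2)"
  have g: "integrable lborel ?g" using integrable_suminf_hfun_sq(1)[OF c] by simp
  have i: "integrable lborel (\<lambda>x. (cmod (hseries c x))\<^sup>2)"
    by (rule Bochner_Integration.integrable_bound[OF g]) (use hseries_pointwise_bound[OF c] in \<open>auto elim!: eventually_mono\<close>)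
  then show "is_L2 (hseries c)" unfolding is_L2_def by simp
  have "(LINT x|lborel. (cmod (hseries c x))\<^sup>2) \<le> (LINT x|lborel. ?g x)"
    by (rule integral_mono_AE[OF i g hseries_pointwise_bound[OF c]])
  also have "\<dots> = (\<Sum>n. cmod (c n))\<^sup>2" using integrable_suminf_hfun_sq(2)[OF c] by (simp add: power2_eq_square)
  finally show "(LINT x|lborel. (cmod (hseries c x))\<^sup>2) \<le> (\<Sum>n. cmod (c n))\<^sup>2" .
qed

lemma hseries_diff_L2:
  assumes c: "summable (\<lambda>n. cmod (c n))" and d: "summable (\<lambda>n. cmod (d n))"
  shows "(LINT x|lborel. (cmod (hseries c x - hseries d x))\<^sup>2) \<le> (\<Sum>n. cmod (c n - d n))\<^sup>2"
proof -
  have s: "summable (\<lambda>n. cmod (c n - d n))"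
    by (rule summable_comparison_test'[OF summable_add[OF c d], of 0]) (simp add: norm_triangle_ineq4)
  have "AE x in lborel. hseries c x - hseries d x = hseries (\<lambda>n. c n - d n) x"
    using AE_summable_hfun(2)[OF c] AE_summable_hfun(2)[OF d]
  proof eventually_elim
    case (elim x)
    have "summable (\<lambda>n. c n * complex_of_real (hfun n x))" "summable (\<lambda>n. d n * complex_of_real (hfun n x))"
      by (rule summable_norm_cancel, use elim in \<open>simp add: norm_mult\<close>)+
    then show ?case unfolding hseries_def left_diff_distrib by (rule suminf_diff)
  qed
  then have "(LINT x|lborel. (cmod (hseries c x - hseries d x))\<^sup>2) = (LINT x|lborel. (cmod (hseries (\<lambda>n. c n - d n) x))\<^sup>2)"
    by (intro integral_cong_AE) (auto elim!: eventually_mono)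
  then show ?thesis using hseries_L2(2)[OF s] by simp
qed

text \<open>Termwise integration against \<open>hfun k\<close>, justified since every product of two
  Hermite functions has L1 norm at most 1.\<close>

lemma hcoef_hseries:
  assumes c: "summable (\<lambda>n. cmod (c n))" shows "hcoef (hseries c) k = c k"
proof -
  let ?f = "\<lambda>n x. complex_of_real (hfun k x) * (c n * complex_of_real (hfun n x))"
  have ef: "?f n x = c n * complex_of_real (hfun k x * hfun n x)" for n x by simp
  have i: "integrable lborel (?f n)" for n
    unfolding ef using integrable_hfun_product[of k n] by (intro integrable_mult_right integrable_of_real)
  have v: "(LINT x|lborel. ?f n x) = (if n = k then c k else 0)" for n
    unfolding ef using hfun_orthonormal[of k n] by (auto simp del: of_real_mult)
  have s: "AE x in lborel. summable (\<lambda>n. norm (?f n x))"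
    using AE_summable_hfun(2)[OF c]
  proof eventually_elim
    case (elim x)
    then show ?case using summable_mult[OF elim, of "\<bar>hfun k x\<bar>"] by (simp add: norm_mult)
  qed
  have n: "(LINT x|lborel. norm (?f n x)) \<le> cmod (c n)" for n
  proof -
    have sq: "integrable lborel (\<lambda>x. (hfun j x)\<^sup>2)" "(LINT x|lborel. (hfun j x)\<^sup>2) = 1" for j
      using integrable_hfun_product[of j j] hfun_orthonormal[of j j] by (simp_all add: power2_eq_square)
    have "norm (?f n x) \<le> cmod (c n) * (((hfun k x)\<^sup>2 + (hfun n x)\<^sup>2) / 2)" for x
    proof -
      have "\<bar>hfun k x\<bar> * \<bar>hfun n x\<bar> \<le> ((hfun k x)\<^sup>2 + (hfun n x)\<^sup>2) / 2"
        using sum_squares_bound[of "\<bar>hfun k x\<bar>" "\<bar>hfun n x\<bar>"] by simp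
      from mult_left_mono[OF this norm_ge_zero[of "c n"]] show ?thesis unfolding ef norm_mult norm_of_real abs_mult .
    qed
    then have "(LINT x|lborel. norm (?f n x)) \<le> (LINT x|lborel. cmod (c n) * (((hfun k x)\<^sup>2 + (hfun n x)\<^sup>2) / 2))"
      by (intro integral_mono integrable_norm i integrable_mult_right integrable_divide_zero Bochner_Integration.integrable_add sq) auto
    also have "\<dots> = cmod (c n)" by (simp add: Bochner_Integration.integral_add sq)
    finally show ?thesis .
  qed
  have t: "summable (\<lambda>n. LINT x|lborel. norm (?f n x))"
    by (rule summable_comparison_test'[OF c, of 0]) (use n in \<open>simp add: integral_nonneg_AE\<close>)
  have "hcoef (hseries c) k = (LINT x|lborel. (\<Sum>n. ?f n x))"
    unfolding hcoef_def
  proof (rule integral_cong_AE)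
    show "AE x in lborel. complex_of_real (hfun k x) * hseries c x = (\<Sum>n. ?f n x)"
      using AE_summable_hfun(2)[OF c]
    proof eventually_elim
      case (elim x)
      have "summable (\<lambda>n. c n * complex_of_real (hfun n x))" by (rule summable_norm_cancel, use elim in \<open>simp add: norm_mult\<close>)
      then show ?case unfolding hseries_def by (rule suminf_mult[symmetric])
    qed
  qed measurable
  also have "\<dots> = (\<Sum>n. if n = k then c k else 0)" by (subst integral_suminf[OF i s t]) (simp only: v)
  also have "\<dots> = c k" using sums_single[of k "\<lambda>_. c k"] by (simp add: sums_iff)
  finally show ?thesis .
qed

section \<open>The transporter\<close>

text \<open>Entrywise continuity becomes l1 continuity by Tannery's theorem, rapid decay near
  \<open>t\<close> giving the majorant. Together with \<open>hseries_diff_L2\<close> this is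
  continuity in L2.\<close>

lemma tendsto_rapid_path_l1:
  assumes u: "rapid_path u" and c: "\<And>n. isCont (\<lambda>s. u s n) t"
  shows "((\<lambda>s. \<Sum>n. cmod (u s n - u t n)) \<longlongrightarrow> 0) (at t)"
proof -
  define T where "T = \<bar>t\<bar> + 1"
  obtain C where C: "\<And>s n. s \<in> {-T..T} \<Longrightarrow> cmod (u s n) \<le> C / real (Suc n) ^ 2"
    using u unfolding rapid_path_def rapid_on_def by blast
  have b: "cmod (u s n - u t n) \<le> 2 * C / real (Suc n) ^ 2" if "dist s t < 1" for s n
  proof -
    have "s \<in> {-T..T}" "t \<in> {-T..T}" using that unfolding T_def dist_real_def by auto
    then have "cmod (u s n) + cmod (u t n) \<le> C / real (Suc n) ^ 2 + C / real (Suc n) ^ 2" by (intro add_mono C)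
    then show ?thesis using norm_triangle_ineq4[of "u s n" "u t n"] by simp
  qed
  have ev: "eventually (\<lambda>s. dist s t < 1) (at t)" unfolding eventually_at by (intro exI[of _ 1]) auto
  have "((\<lambda>s. \<Sum>n. cmod (u s n - u t n)) \<longlongrightarrow> (\<Sum>n::nat. 0)) (at t)"
  proof (rule tannerys_theorem[THEN conjunct2, THEN conjunct2])
    show "((\<lambda>s. cmod (u s n - u t n)) \<longlongrightarrow> 0) (at t)" for n
    proof -
      have "((\<lambda>s. cmod (u s n - u t n)) \<longlongrightarrow> cmod (u t n - u t n)) (at t)"
        using c[of n] by (intro tendsto_intros) (simp add: isCont_def)
      then show ?thesis by simp
    qed
    show "eventually (\<lambda>(n, s). norm (cmod (u s n - u t n)) \<le> 2 * C / real (Suc n) ^ 2) (at_top \<times>\<^sub>F at t)"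
      unfolding eventually_prod_filter
      by (intro exI[of _ "\<lambda>_. True"] exI[of _ "\<lambda>s. dist s t < 1"]) (use ev b in auto)
    show "summable (\<lambda>n. 2 * C / real (Suc n) ^ 2)" by (rule summable_inverse_Suc_sq)
  qed simp
  then show ?thesis by simp
qed

lemma cis_periodic_difference: "cis ((t + 2 * pi) * (real n - real m)) = cis (t * (real n - real m))"
proof -
  have "cis (2 * pi * (real n - real m)) = 1" by (rule cis_multiple_2pi) simp
  then show ?thesis by (simp add: distrib_right cis_mult[symmetric])
qed

lemma transporter_solution:
  assumes w: "smooth_periodic_S0 w" and sa: "\<And>t. selfadjoint_mat (weyl_mat (w t))"
    and small: "\<And>t n m. cmod (weyl_mat (w t) n m) \<le> (1/10000) / (1 + \<bar>real n - real m\<bar>)\<^sup>2"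
    and comm: "\<And>t n m. cmod (wshift_comm (weyl_mat (w t)) n m) \<le> (1/10000) / (1 + \<bar>real n - real m\<bar>)\<^sup>2"
    and r: "r > 0"
  shows "\<exists>\<psi> C T. is_solution w r \<psi> \<and> C > 0 \<and> T > 0 \<and> (\<forall>t \<ge> T. Hr_norm r (\<psi> t) \<ge> C * sqrt (1 + t^2) powr r)"
proof -
  \<comment> \<open>Conjugation with the oscillator flow: the rotating frame turns \<open>V\<close>
    into the constant hopping matrix. Its phases have integer frequencies, which preserves the
    period.\<close>
  define A where "A t n m = cis (t * (real n - real m)) * weyl_mat (w t) n m" for t n m
  have nA: "cmod (A t n m) = cmod (weyl_mat (w t) n m)" for t n m unfolding A_def by (simp add: norm_mult)
  \<comment> \<open>\<open>wshift\<close> moves the index by one, so all terms of the commutator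
    share one phase and its modulus is that of the original matrix.\<close>
  have wA: "wshift_comm (A t) n m = cis (t * (real n + 1 - real m)) * wshift_comm (weyl_mat (w t)) n m" for t n m
  proof -
    have 1: "A t (Suc n) m = cis (t * (real n + 1 - real m)) * weyl_mat (w t) (Suc n) m"
      unfolding A_def by (simp add: of_nat_Suc add.commute)
    have 2: "A t n (m - 1) = cis (t * (real n + 1 - real m)) * weyl_mat (w t) n (m - 1)" if "m \<noteq> 0"
    proof -
      have "real n - real (m - 1) = real n + 1 - real m" using that by (simp add: of_nat_diff)
      then show ?thesis unfolding A_def by (simp only:)
    qed
    define k where "k = cis (t * (real n + 1 - real m))"
    have d: "k * a * p - q * (k * b) = k * (a * p - q * b)" for a b p q by (simp add: algebra_simps)
    show ?thesis
    proof (cases "m = 0")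
      case True
      then show ?thesis unfolding wshift_comm_def 1 k_def[symmetric] by simp
    next
      case False
      show ?thesis unfolding wshift_comm_def 1 2[OF False] if_not_P[OF False] k_def[symmetric] d ..
    qed
  qed
  interpret hopping_perturbation A "1/10000"
  proof
    show "offdiag_decay A" unfolding offdiag_decay_def
    proof
      fix K
      obtain \<kappa> where k: "\<kappa> \<ge> 0" "\<And>f C m n. symb (K + 2) 0 C f \<Longrightarrow> cmod (weyl_mat f m n) \<le> \<kappa> * C / (1 + \<bar>real m - real n\<bar>) ^ K"
        using weyl_decay[of K] by blast
      obtain D where D: "\<And>t. wp0 (K + 2) w t \<le> D" using wp0_uniform_bound[OF w] by blast
      have "cmod (A t n m) \<le> \<kappa> * D / (1 + \<bar>real n - real m\<bar>) ^ K" for t n m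
        unfolding nA by (rule k(2), rule symb_mono[OF symb_slice[OF w] D order_refl])
      then show "\<exists>C. \<forall>t n m. cmod (A t n m) \<le> C / (1 + \<bar>real n - real m\<bar>) ^ K" by blast
    qed
    show "A t m n = cnj (A t n m)" for t n m
    proof -
      have "weyl_mat (w t) m n = cnj (weyl_mat (w t) n m)" using sa[of t] unfolding selfadjoint_mat_def by blast
      moreover have "cis (t * (real m - real n)) = cnj (cis (t * (real n - real m)))" by (simp add: cis_cnj algebra_simps)
      ultimately show ?thesis unfolding A_def by simp
    qed
    show "A (t + 2 * pi) n m = A t n m" for t n m
    proof -
      have "w (t + 2 * pi) = w t" using w unfolding smooth_periodic_S0_def by (intro ext) blast
      then show ?thesis unfolding A_def cis_periodic_difference by simp
    qed
    show "cmod (A t n m) \<le> (1/10000) / (1 + \<bar>real n - real m\<bar>)\<^sup>2" for t n m unfolding nA by (rule small)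
    show "cmod (wshift_comm (A t) n m) \<le> (1/10000) / (1 + \<bar>real n - real m\<bar>)\<^sup>2" for t n m
      unfolding wA using comm[of t n m] by (simp add: norm_mult)
  qed simp
  have cB: "continuous_on UNIV (\<lambda>t. B t n m)" for n m
    unfolding B_def A_def by (intro continuous_intros continuous_weyl_mat[OF w] continuous_on_cis)
  obtain u0 where u0: "rapid u0" "nrm u0 = 1" "nrm (\<lambda>n. hop u0 n - 1/2 * u0 n) \<le> 1/100"
    using exists_wave_packet by blast
  obtain \<phi> where \<phi>: "rapid_path \<phi>" "\<phi> 0 = u0" "\<And>t n. ((\<lambda>s. \<phi> s n) has_vector_derivative - \<i> * mop (B t) (\<phi> t) n) (at t)"
    using solution_exists[OF B_decay cB u0(1)] by blast
  have sol: "solution \<phi>" unfolding solution_def using \<phi>(1,3) by blast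
  obtain c T where c: "c > 0" and T: "T \<ge> 1" and gr: "\<And>t. t \<ge> T \<Longrightarrow> c * t powr (2 * r) \<le> (\<Sum>n. (K0_eig n powr r)\<^sup>2 * (cmod (\<phi> t n))\<^sup>2)"
    using solution_growth[OF sol u0(2,3)[folded \<phi>(2)] r] by blast
  \<comment> \<open>Return from the rotating frame. Moduli are unchanged, hence so are decay and all
    weighted norms.\<close>
  define u where "u t n = cis (- t * K0_eig n) * \<phi> t n" for t n
  have nu: "cmod (u t n) = cmod (\<phi> t n)" for t n unfolding u_def by (simp add: norm_mult)
  have ru: "rapid_path u" using \<phi>(1) unfolding rapid_path_def rapid_on_def nu .
  note su = rapid_summable_norm[OF rapid_pathD[OF ru]]
  have mop: "(\<Sum>m. (V_mat t n m + weyl_mat (w t) n m) * u t m) = cis (- t * K0_eig n) * mop (B t) (\<phi> t) n" for t n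
  proof -
    obtain D where D: "D > 0" "\<And>t n m. cmod (B t n m) \<le> D" using offdiag_decay_bounded[OF B_decay] by blast
    have "(V_mat t n m + weyl_mat (w t) n m) * u t m = cis (- t * K0_eig n) * (B t n m * \<phi> t m)" for m
    proof -
      have 1: "cis (t * K0_eig m) * cis (- t * K0_eig m) = 1" by (simp add: cis_mult)
      have 2: "cis (- t * K0_eig m) = cis (- t * K0_eig n) * cis (t * (real n - real m))"
        unfolding cis_mult K0_eig_def by (simp add: algebra_simps)
      have "V_mat t n m * u t m = cis (- t * K0_eig n) * (SSadj_mat n m * (cis (t * K0_eig m) * cis (- t * K0_eig m)) * \<phi> t m)"
        unfolding V_mat_def u_def by (simp only: mult.assoc)
      moreover have "weyl_mat (w t) n m * u t m = cis (- t * K0_eig n) * (A t n m * \<phi> t m)"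
        unfolding u_def A_def 2 by (simp only: mult_ac)
      ultimately show ?thesis unfolding B_def 1 distrib_right distrib_left by simp
    qed
    moreover have "(\<lambda>m. B t n m * \<phi> t m) sums mop (B t) (\<phi> t) n" by (rule mop_sums[OF D(2) rapid_pathD[OF \<phi>(1)]])
    from sums_mult[OF this, of "cis (- t * K0_eig n)"] have "(\<Sum>m. cis (- t * K0_eig n) * (B t n m * \<phi> t m)) = cis (- t * K0_eig n) * mop (B t) (\<phi> t) n"
      by (rule sums_unique[symmetric])
    ultimately show ?thesis by simp
  qed
  have du: "((\<lambda>s. u s n) has_vector_derivative (- \<i>) * (complex_of_real (K0_eig n) * u t n + (\<Sum>m. (V_mat t n m + weyl_mat (w t) n m) * u t m))) (at t)" for t n
  proof -
    have "((\<lambda>s. cis (- s * K0_eig n)) has_vector_derivative \<i> * complex_of_real (- K0_eig n) * cis (- t * K0_eig n)) (at t)"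
      using has_vector_derivative_cis_mult[of "- K0_eig n" t] by (simp add: mult.commute)
    from has_vector_derivative_mult[OF this \<phi>(3)[of n t]]
    show ?thesis unfolding mop unfolding u_def by (rule has_vector_derivative_eq_rhs) (simp add: scaleR_conv_of_real algebra_simps)
  qed
  have hc: "hcoef (hseries (u t)) n = u t n" for t n by (rule hcoef_hseries[OF su])
  show ?thesis
  proof (intro exI conjI allI impI)
    show "is_solution w r (\<lambda>t. hseries (u t))"
      unfolding is_solution_def hc
    proof (intro conjI allI du)
      show "in_Hr r (hseries (u t))" for t
        unfolding in_Hr_def hc using hseries_L2(1)[OF su] summable_weighted[OF rapid_pathD[OF ru] r] by blast
      show "((\<lambda>s. LINT x|lborel. (cmod (hseries (u s) x - hseries (u t) x))\<^sup>2) \<longlongrightarrow> 0) (at t)" for t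
      proof (rule tendsto_sandwich[OF _ _ tendsto_const])
        show "\<forall>\<^sub>F s in at t. 0 \<le> (LINT x|lborel. (cmod (hseries (u s) x - hseries (u t) x))\<^sup>2)" by simp
        show "\<forall>\<^sub>F s in at t. (LINT x|lborel. (cmod (hseries (u s) x - hseries (u t) x))\<^sup>2) \<le> (\<Sum>n. cmod (u s n - u t n))\<^sup>2"
          by (intro always_eventually allI hseries_diff_L2 su)
        have "((\<lambda>s. \<Sum>n. cmod (u s n - u t n)) \<longlongrightarrow> 0) (at t)"
          by (rule tendsto_rapid_path_l1[OF ru has_vector_derivative_continuous[OF du]])
        from tendsto_power[OF this, of 2] show "((\<lambda>s. (\<Sum>n. cmod (u s n - u t n))\<^sup>2) \<longlongrightarrow> 0) (at t)" by simp
      qed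
    qed
    \<comment> \<open>The square root passes from the squared norm to the norm, and
      \<open>2 powr r\<close> accounts for \<open>sqrt (1 + t\<^sup>2) \<le> 2 * t\<close> at times
      beyond 1.\<close>
    show "sqrt c / 2 powr r > 0" using c by simp
    show "T > 0" using T by simp
    fix t assume t: "T \<le> t"
    then have t1: "t \<ge> 1" using T by simp
    have "sqrt (1 + t\<^sup>2) \<le> 2 * t"
    proof (rule real_le_lsqrt)
      have "1 \<le> t\<^sup>2" using t1 by simp
      then show "1 + t\<^sup>2 \<le> (2 * t)\<^sup>2" unfolding power_mult_distrib by simp
    qed (use t1 in auto)
    then have "sqrt (1 + t\<^sup>2) powr r \<le> (2 * t) powr r" using r by (intro powr_mono2) auto
    also have "\<dots> = 2 powr r * t powr r" using t1 by (simp add: powr_mult)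
    finally have "sqrt c / 2 powr r * sqrt (1 + t\<^sup>2) powr r \<le> sqrt c / 2 powr r * (2 powr r * t powr r)"
      using c by (intro mult_left_mono) auto
    also have "\<dots> = sqrt c * t powr r" by simp
    also have "\<dots> \<le> sqrt (\<Sum>n. (K0_eig n powr r)\<^sup>2 * (cmod (\<phi> t n))\<^sup>2)"
    proof (rule real_le_rsqrt)
      have "(t powr r)\<^sup>2 = t powr (2 * r)" unfolding power2_eq_square powr_add[symmetric] by simp
      then have "(sqrt c * t powr r)\<^sup>2 = c * t powr (2 * r)" using c by (simp add: power_mult_distrib)
      then show "(sqrt c * t powr r)\<^sup>2 \<le> (\<Sum>n. (K0_eig n powr r)\<^sup>2 * (cmod (\<phi> t n))\<^sup>2)" using gr[OF t] by simp
    qed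
    finally show "sqrt c / 2 powr r * sqrt (1 + t\<^sup>2) powr r \<le> Hr_norm r (hseries (u t))" unfolding Hr_norm_def hc nu .
  qed
qed

theorem mainTheorem15:
  shows "\<exists>\<epsilon>0 > 0. \<exists>M :: nat. \<forall>w :: tsymbol.
     smooth_periodic_S0 w \<and> (\<forall>t. selfadjoint_mat (weyl_mat (w t))) \<and> (\<forall>t. wp0 M w t \<le> \<epsilon>0)
     \<longrightarrow> (\<forall>r > 0. \<exists>\<psi> C T. is_solution w r \<psi> \<and> C > 0 \<and> T > 0 \<and>
            (\<forall>t \<ge> T. Hr_norm r (\<psi> t) \<ge> C * sqrt (1 + t^2) powr r))"
proof -
  obtain p where p: "p \<ge> 0" "\<And>f C m n. symb (2 + 2) 0 C f \<Longrightarrow> cmod (weyl_mat f m n) \<le> p * C / (1 + \<bar>real m - real n\<bar>) ^ 2"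
    using weyl_decay[of 2] by blast
  obtain q where q: "q \<ge> 0" "\<And>f C n m. symb 6 0 C f \<Longrightarrow> cmod (wshift_comm (weyl_mat f) n m) \<le> q * C / (1 + \<bar>real n - real m\<bar>)\<^sup>2"
    using weighted_commutator_bound unfolding wshift_comm_def[symmetric] by blast
  \<comment> \<open>\<open>p\<close> and \<open>q\<close> do not depend on the symbol, so one
    threshold brings both the entries and the commutator below 1/10000.\<close>
  define \<epsilon> where "\<epsilon> = 1 / (10000 * (1 + p + q))"
  have e: "\<epsilon> > 0" "p * \<epsilon> \<le> 1/10000" "q * \<epsilon> \<le> 1/10000" using p(1) q(1) unfolding \<epsilon>_def by (auto simp: divide_simps)
  show ?thesis
  \<comment> \<open>The seminorm index 6 is the number of derivatives consumed by the weighted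
    commutator; the entry bound takes only four of them.\<close>
  proof (rule exI[of _ \<epsilon>], rule conjI[OF e(1)], rule exI[of _ 6], intro allI impI, elim conjE)
    fix w :: tsymbol and r :: real
    assume w: "smooth_periodic_S0 w" and sa: "\<forall>t. selfadjoint_mat (weyl_mat (w t))" and b: "\<forall>t. wp0 6 w t \<le> \<epsilon>" and r: "r > 0"
    have s: "symb 6 0 \<epsilon> (w t)" for t by (rule symb_mono[OF symb_slice[OF w]]) (use b in auto)
    show "\<exists>\<psi> C T. is_solution w r \<psi> \<and> C > 0 \<and> T > 0 \<and> (\<forall>t \<ge> T. Hr_norm r (\<psi> t) \<ge> C * sqrt (1 + t^2) powr r)"
    proof (rule transporter_solution[OF w _ _ _ r])
      show "selfadjoint_mat (weyl_mat (w t))" for t using sa by blast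
      show "cmod (weyl_mat (w t) n m) \<le> (1/10000) / (1 + \<bar>real n - real m\<bar>)\<^sup>2" for t n m
      proof -
        have "symb (2 + 2) 0 \<epsilon> (w t)" by (rule symb_le[OF s]) simp
        from p(2)[OF this] show ?thesis by (rule order_trans) (intro divide_right_mono e zero_le_power2)
      qed
      show "cmod (wshift_comm (weyl_mat (w t)) n m) \<le> (1/10000) / (1 + \<bar>real n - real m\<bar>)\<^sup>2" for t n m
        using q(2)[OF s] by (rule order_trans) (intro divide_right_mono e zero_le_power2)
    qed
  qed
qed

end
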